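(* Let $\Psi_\hbar$ be the symplectic Lorentz map with angle $\theta_0$, where $\theta_0/2\pi$ is irrational. Let $C\subset TQ$ be a compact set and set $(q^k,v^k)=\Psi^k_\hbar(q,v)$ for $(q,v)\in TQ$. Let $|\cdot|_q$ denote the norm on $T_qQ$ provided by the metric tensor $g$. For each $N>0$ and $V_0>0$ there is a positive constant $V_1$ such that, for all sufficiently small $\hbar>0$ and every point $(q,v)\in C$ that is positively-contained in $C$ and satisfies $$|v-X_H(q)|_q<V_0\sqrt{\hbar},$$ one has $$|v^k-X_H(q^k)|_{q^k}\le V_1\sqrt{\hbar}\qquad\text{for all integers }k\in[0,k^*(\hbar,N)].$$ Here $k^*(\hbar,N)$ is an integer of order $\hbar^{-N}$, i.e. bounded above and below by positive constant multiples of $\hbar^{-N}$ as $\hbar\rightarrow0^+$.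
   Context: $Q\subset E$ is a connected open subset of a finite-dimensional real vector space $E$, so $TQ=Q\times E\ni(q,v)$. $Q$ carries an exact symplectic form $\omega=-\mathbf{d}\vartheta$, a smooth Hamiltonian $H:Q\rightarrow\mathbb{R}$, and an almost complex structure $\mathbb{J}:TQ\rightarrow TQ$ compatible with $\omega$, so that $g(v,w)=\omega(v,\mathbb{J}w)$ is a Riemannian metric; $\langle\cdot,\cdot\rangle=g(\cdot,\cdot)$. $X_H$ is the Hamiltonian vector field, $\iota_{X_H}\omega=\mathbf{d}H$, i.e. $X_H=-\mathbb{J}\nabla H$ with $\nabla$ the $g$-gradient. All data are $C^\infty$. Fix an angle $\theta_0\notin\{0,\pi\}$ (mod $2\pi$). In linear coordinates on $E$ let $\omega_{j\ell}$ be the components of $\omega$. For $x\in Q$, $\xi\in E$ set $$\Sigma(x,\xi)=-\hbar H(x)+\hbar^2\langle X_H(x),\xi\rangle-\tfrac{1}{12}\hbar^2\,\partial_k\omega_{j\ell}(x)X_H^k(x)X_H^j(x)\xi^\ell-\tfrac14\Bigl(\tfrac{\sin\theta_0}{1-\cos\theta_0}\Bigr)\langle\xi-\hbar X_H(x),\xi-\hbar X_H(x)\rangle,$$ with the metric evaluated at $x$, and $$S(q,\overline{q})=\int_q^{\overline{q}}\vartheta+\Sigma\Bigl(\tfrac{q+\overline{q}}2,\overline{q}-q\Bigr),$$ the integral being along the straight line segment from $q$ to $\overline{q}$. The symplectic Lorentz map $\Psi_\hbar:(q,v)\mapsto(\overline{q},\overline{v})$ is the mapping on $TQ$ defined by the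 implicit relations $$\vartheta_{\overline{q}}+\hbar^2\,g_{\overline{q}}(\overline{v},\cdot\,)=\partial_{\overline{q}}S(q,\overline{q}),\qquad \vartheta_q+\hbar^2\,g_q(v,\cdot\,)=-\partial_qS(q,\overline{q}),$$ where $\partial_q,\partial_{\overline{q}}$ denote differentials in the respective variables. It is known that these relations have a solution that is smooth in $(q,v,\hbar)$ on a neighborhood of $TQ\times\{0\}$ in $TQ\times\mathbb{R}$ with $\overline{q}=q$ at $\hbar=0$, that this solution is unique near $TQ\times\{0\}$, that $\Psi_0(q,v)=(q,X_H(q)+\exp(-\theta_0\mathbb{J}(q))[v-X_H(q)])$, and that $\Psi_\hbar$ preserves $\pi^*\omega-\hbar^2\mathbf{d}(g_q(v,dq))$ with $\pi:TQ\to Q$ the projection; $\Psi_\hbar$ denotes this solution. In particular, for compact $C\subset TQ$, $\Psi_\hbar$ is defined on $C$ for all sufficiently small $\hbar$. Given a compact set $C\subset TQ$ (and $\hbar$), a point $(q,v)$ is positively-contained in $C$ if $\Psi^k_\hbar(q,v)\in C$ for all non-negative integers $k$. *)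

theory Defs
  imports "HOL-Analysis.Analysis" "HOL-Library.Landau_Symbols"
begin

(* C^n and C^infinity on an open set of a finite-dimensional space.  On such a set, existence
   and continuity of all iterated directional derivatives of differentiable functions is the
   usual notion; the definitions are meant only for open S. *)

primrec Ck_on :: "nat \<Rightarrow> 'a::euclidean_space set \<Rightarrow> ('a \<Rightarrow> 'b::real_normed_vector) \<Rightarrow> bool" where
  "Ck_on 0 S f \<longleftrightarrow> continuous_on S f"
| "Ck_on (Suc n) S f \<longleftrightarrow>
     (\<forall>x\<in>S. f differentiable (at x)) \<and> (\<forall>w. Ck_on n S (\<lambda>x. frechet_derivative f (at x) w))"

definition smooth_on :: "'a::euclidean_space set \<Rightarrow> ('a \<Rightarrow> 'b::real_normed_vector) \<Rightarrow> bool" where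
  "smooth_on S f \<longleftrightarrow> (\<forall>n. Ck_on n S f)"

(* One-forms and endomorphism fields on Q are total functions on the ambient space, valued in
   linear maps; only their values on the open set Q matter. *)

definition ext_deriv ::
  "('a::euclidean_space \<Rightarrow> ('a \<Rightarrow>\<^sub>L real)) \<Rightarrow> 'a \<Rightarrow> 'a \<Rightarrow> 'a \<Rightarrow> real" where
  "ext_deriv \<theta> x u w = blinfun_apply (frechet_derivative \<theta> (at x) u) w
                     - blinfun_apply (frechet_derivative \<theta> (at x) w) u"

definition symp_form :: "('a::euclidean_space \<Rightarrow> ('a \<Rightarrow>\<^sub>L real)) \<Rightarrow> 'a \<Rightarrow> 'a \<Rightarrow> 'a \<Rightarrow> real" where
  "symp_form \<theta> x u w = - ext_deriv \<theta> x u w"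

(* Closedness of the two-form is automatic, as it is exact. *)
definition symplectic_on :: "'a::euclidean_space set \<Rightarrow> ('a \<Rightarrow> 'a \<Rightarrow> 'a \<Rightarrow> real) \<Rightarrow> bool" where
  "symplectic_on Q \<omega> \<longleftrightarrow> (\<forall>x\<in>Q. \<forall>u. (\<forall>w. \<omega> x u w = 0) \<longrightarrow> u = 0)"

definition almost_complex_on ::
  "'a::euclidean_space set \<Rightarrow> ('a \<Rightarrow> ('a \<Rightarrow>\<^sub>L 'a)) \<Rightarrow> bool" where
  "almost_complex_on Q J \<longleftrightarrow>
     smooth_on Q J \<and> (\<forall>x\<in>Q. \<forall>w. blinfun_apply (J x) (blinfun_apply (J x) w) = - w)"

definition compat_metric ::
  "('a::euclidean_space \<Rightarrow> ('a \<Rightarrow>\<^sub>L real)) \<Rightarrow> ('a \<Rightarrow> ('a \<Rightarrow>\<^sub>L 'a)) \<Rightarrow> 'a \<Rightarrow> 'a \<Rightarrow> 'a \<Rightarrow> real" where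
  "compat_metric \<theta> J x u w = symp_form \<theta> x u (blinfun_apply (J x) w)"

(* Bilinearity and smoothness of a metric obtained from smooth data are automatic. *)
definition riemannian_on :: "'a::euclidean_space set \<Rightarrow> ('a \<Rightarrow> 'a \<Rightarrow> 'a \<Rightarrow> real) \<Rightarrow> bool" where
  "riemannian_on Q g \<longleftrightarrow>
     (\<forall>x\<in>Q. (\<forall>u w. g x u w = g x w u) \<and> (\<forall>u. u \<noteq> 0 \<longrightarrow> g x u u > 0))"

definition metric_norm :: "('a::euclidean_space \<Rightarrow> 'a \<Rightarrow> 'a \<Rightarrow> real) \<Rightarrow> 'a \<Rightarrow> 'a \<Rightarrow> real" where
  "metric_norm g x w = sqrt (g x w w)"

definition ham_vec ::
  "('a::euclidean_space \<Rightarrow> ('a \<Rightarrow>\<^sub>L real)) \<Rightarrow> ('a \<Rightarrow> real) \<Rightarrow> 'a \<Rightarrow> 'a" where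
  "ham_vec \<theta> H x = (THE u. \<forall>w. symp_form \<theta> x u w = frechet_derivative H (at x) w)"

(* The third term of Sigma is written in the linear coordinates given by Basis; as a full
   contraction it does not depend on the choice of linear coordinates. *)
definition lorentz_Sigma ::
  "('a::euclidean_space \<Rightarrow> ('a \<Rightarrow>\<^sub>L real)) \<Rightarrow> ('a \<Rightarrow> ('a \<Rightarrow>\<^sub>L 'a)) \<Rightarrow> ('a \<Rightarrow> real) \<Rightarrow> real \<Rightarrow>
     real \<Rightarrow> 'a \<Rightarrow> 'a \<Rightarrow> real" where
  "lorentz_Sigma \<theta> J H \<theta>0 h x \<xi> =
     (let X = ham_vec \<theta> H x; g = compat_metric \<theta> J x in
       - h * H x + h\<^sup>2 * g X \<xi>
       - 1/12 * h\<^sup>2 *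
           (\<Sum>k\<in>Basis. \<Sum>j\<in>Basis. \<Sum>l\<in>Basis.
              frechet_derivative (\<lambda>y. symp_form \<theta> y j l) (at x) k * (X \<bullet> k) * (X \<bullet> j) * (\<xi> \<bullet> l))
       - 1/4 * (sin \<theta>0 / (1 - cos \<theta>0)) * g (\<xi> - h *\<^sub>R X) (\<xi> - h *\<^sub>R X))"

definition segment_integral :: "('a::euclidean_space \<Rightarrow> ('a \<Rightarrow>\<^sub>L real)) \<Rightarrow> 'a \<Rightarrow> 'a \<Rightarrow> real" where
  "segment_integral \<theta> q q' =
     integral {0..1} (\<lambda>t. blinfun_apply (\<theta> (q + t *\<^sub>R (q' - q))) (q' - q))"

(* Meaningful only if the closed segment from q to q' lies in the domain of the data. *)
definition lorentz_S ::
  "('a::euclidean_space \<Rightarrow> ('a \<Rightarrow>\<^sub>L real)) \<Rightarrow> ('a \<Rightarrow> ('a \<Rightarrow>\<^sub>L 'a)) \<Rightarrow> ('a \<Rightarrow> real) \<Rightarrow> real \<Rightarrow>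
     real \<Rightarrow> 'a \<Rightarrow> 'a \<Rightarrow> real" where
  "lorentz_S \<theta> J H \<theta>0 h q q' =
     segment_integral \<theta> q q' + lorentz_Sigma \<theta> J H \<theta>0 h ((1/2) *\<^sub>R (q + q')) (q' - q)"

definition lorentz_relations ::
  "'a::euclidean_space set \<Rightarrow> ('a \<Rightarrow> ('a \<Rightarrow>\<^sub>L real)) \<Rightarrow> ('a \<Rightarrow> ('a \<Rightarrow>\<^sub>L 'a)) \<Rightarrow> ('a \<Rightarrow> real) \<Rightarrow>
     real \<Rightarrow> real \<Rightarrow> 'a \<times> 'a \<Rightarrow> 'a \<times> 'a \<Rightarrow> bool" where
  "lorentz_relations Q \<theta> J H \<theta>0 h = (\<lambda>(q, v) (q', v').
     closed_segment q q' \<subseteq> Q \<and>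
     ((\<lambda>y. lorentz_S \<theta> J H \<theta>0 h q y) has_derivative
        (\<lambda>w. blinfun_apply (\<theta> q') w + h\<^sup>2 * compat_metric \<theta> J q' v' w)) (at q') \<and>
     ((\<lambda>y. lorentz_S \<theta> J H \<theta>0 h y q') has_derivative
        (\<lambda>w. - (blinfun_apply (\<theta> q) w + h\<^sup>2 * compat_metric \<theta> J q v w))) (at q))"

(* A smooth solution of the implicit relations on a neighbourhood U of TQ x {0} in TQ x R, lying
   over the identity at h = 0.  At h = 0 the relations leave the velocity component free; it is
   determined there by smoothness in h.  The germ of such a solution along TQ x {0} is unique,
   and values of Psi outside U are arbitrary. *)
definition symplectic_lorentz_map ::
  "'a::euclidean_space set \<Rightarrow> ('a \<Rightarrow> ('a \<Rightarrow>\<^sub>L real)) \<Rightarrow> ('a \<Rightarrow> ('a \<Rightarrow>\<^sub>L 'a)) \<Rightarrow> ('a \<Rightarrow> real) \<Rightarrow>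
     real \<Rightarrow> ('a \<times> 'a \<times> real) set \<Rightarrow> (real \<Rightarrow> 'a \<times> 'a \<Rightarrow> 'a \<times> 'a) \<Rightarrow> bool" where
  "symplectic_lorentz_map Q \<theta> J H \<theta>0 U \<Psi> \<longleftrightarrow>
     open U \<and> U \<subseteq> Q \<times> UNIV \<times> UNIV \<and> Q \<times> UNIV \<times> {0} \<subseteq> U \<and>
     smooth_on U (\<lambda>(q, v, h). \<Psi> h (q, v)) \<and>
     (\<forall>(q, v, h) \<in> U. lorentz_relations Q \<theta> J H \<theta>0 h (q, v) (\<Psi> h (q, v))) \<and>
     (\<forall>q\<in>Q. \<forall>v. fst (\<Psi> 0 (q, v)) = q)"

(* For compact C in TQ and small h, the set C x {h} lies in the domain of the Lorentz map, so that
   membership of all iterates in C includes that they are defined. *)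
definition positively_contained :: "('b \<Rightarrow> 'b) \<Rightarrow> 'b set \<Rightarrow> 'b \<Rightarrow> bool" where
  "positively_contained F C p \<longleftrightarrow> (\<forall>k. (F ^^ k) p \<in> C)"

end

theory Submission
  imports Defs "HOL-Computational_Algebra.Polynomial"
begin

text \<open>The positions \<open>q\<^sub>n\<close> of an orbit satisfy the discrete Euler--Lagrange equations
  \<open>\<partial>\<^sub>2S(q\<^sub>n, q\<^sub>n\<^sub>+\<^sub>1) + \<partial>\<^sub>1S(q\<^sub>n\<^sub>+\<^sub>1, q\<^sub>n\<^sub>+\<^sub>2) = 0\<close>, whose linearisation at a constant sequence rotates
  increments by \<open>\<theta>\<^sub>0\<close>.  As \<open>\<theta>\<^sub>0 / 2\<pi>\<close> is irrational, the successive orders in \<open>h\<close> can be solved, so that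
  on any fixed range of \<open>n\<close> the orbit is, up to \<open>O(h\<^sup>k)\<close>, a trigonometric polynomial in the phase \<open>n \<theta>\<^sub>0\<close>
  with coefficients polynomial in \<open>n\<close>.  Replacing the phase by \<open>n \<theta>\<^sub>0 + t\<close> gives a loop of approximate
  orbits, whose points are linear combinations of finitely many \<open>q\<^sub>n\<close> with coefficients depending on \<open>t\<close>
  only.  The loop integral of \<open>\<partial>\<^sub>2S(q\<^sub>0, q\<^sub>1) dq\<^sub>1\<close> changes by \<open>O(h\<^sup>k)\<close> per step, because
  \<open>\<partial>\<^sub>1S dq\<^sub>1 + \<partial>\<^sub>2S dq\<^sub>2\<close> is exact; and its leading term is \<open>- \<pi> h\<^sup>4 |v - X\<^sub>H|\<^sup>2\<close>.  Since \<open>k\<close> is arbitrary, this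
  controls \<open>|v - X\<^sub>H|\<close> up to \<open>O(\<surd>h)\<close> over \<open>O(h\<^sup>-\<^sup>N)\<close> steps.\<close>

section \<open>Trigonometric polynomials along an orbit\<close>

text \<open>No symmetry of the map is constructed. The loop through an orbit is a fixed linear
  combination of the orbit's own points, with weights depending only on the angle and on a degree.
  Hence the loop at index n + 1 is literally the loop at index n built from the shifted orbit, and
  one-step estimates of the action add up without approximate orbits having to be matched from step
  to step. The price is an order of quantifiers: the degree must not depend on the number of points,
  which is chosen after the degree. Terms polynomial in n are unavoidable, since q drifts along X_H;
  the loop varies the phase alone and freezes the index.

  The root of h in the conclusion is the accuracy of the leading term. The loop has size h^2 |v -
  X_H| and the action is quadratic in it, hence h^4; the error of this term is O(h^5). Conservation
  of the action to arbitrary order thus controls |v - X_H|^2 up to O(h). Irrationality enters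
  through non-vanishing divisors alone: each order involves finitely many frequencies, and no lower
  bound on the divisors is used.\<close>

text \<open>In \<open>F s \<phi>\<close>, the variable \<open>s\<close> stands for the index \<open>n\<close> along an orbit and \<open>\<phi>\<close> for the phase \<open>n \<alpha>\<close>.\<close>

inductive tp :: "nat \<Rightarrow> (real \<Rightarrow> real \<Rightarrow> complex) \<Rightarrow> bool" where
  mono: "j \<le> D \<Longrightarrow> \<bar>l\<bar> \<le> int D \<Longrightarrow> tp D (\<lambda>s \<phi>. c * of_real s ^ j * cis (of_int l * \<phi>))"
| add: "tp D F \<Longrightarrow> tp D G \<Longrightarrow> tp D (\<lambda>s \<phi>. F s \<phi> + G s \<phi>)"

lemma tp_const: "tp D (\<lambda>s \<phi>. c)"
  using tp.mono[of 0 D 0 c] by simp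

lemma tp_sum: "(\<And>i. i \<in> I \<Longrightarrow> tp D (F i)) \<Longrightarrow> tp D (\<lambda>s \<phi>. \<Sum>i\<in>I. F i s \<phi>)"
  by (induction I rule: infinite_finite_induct) (auto intro: tp_const tp.add)

lemma tp_mono: "tp D F \<Longrightarrow> D \<le> D' \<Longrightarrow> tp D' F"
  by (induction rule: tp.induct) (auto intro!: tp.intros)

lemma tp_mult_mono:
  assumes "tp D F" "j \<le> D'" "\<bar>l\<bar> \<le> int D'"
  shows "tp (D + D') (\<lambda>s \<phi>. (c * of_real s ^ j * cis (of_int l * \<phi>)) * F s \<phi>)"
  using assms
proof (induction rule: tp.induct)
  case (mono j0 D l0 c0)
  have "tp (D + D') (\<lambda>s \<phi>. (c * c0) * of_real s ^ (j + j0) * cis (of_int (l + l0) * \<phi>))"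
    by (rule tp.mono) (use mono in auto)
  moreover have "cis (of_int (l + l0) * \<phi>) = cis (of_int l * \<phi>) * cis (of_int l0 * \<phi>)" for \<phi>
    by (simp add: cis_mult distrib_right)
  ultimately show ?case
    by (simp only: power_add mult_ac)
next
  case (add D F G)
  then show ?case
    using tp.add by (simp add: distrib_left)
qed

lemma tp_mult: "tp D' G \<Longrightarrow> tp D F \<Longrightarrow> tp (D + D') (\<lambda>s \<phi>. G s \<phi> * F s \<phi>)"
proof (induction rule: tp.induct)
  case (mono j D' l c)
  then show ?case using tp_mult_mono by blast
next
  case (add D' F' G')
  then show ?case
    using tp.add by (simp add: distrib_right)
qed

lemma tp_cmult: "tp D F \<Longrightarrow> tp D (\<lambda>s \<phi>. c * F s \<phi>)"
  using tp_mult[OF tp_const[of 0 c], of D F] by simp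

lemma tp_diff: "tp D F \<Longrightarrow> tp D G \<Longrightarrow> tp D (\<lambda>s \<phi>. F s \<phi> - G s \<phi>)"
  using tp.add[OF _ tp_cmult[of D G "-1"], of F] by simp

lemma tp_cnj: "tp D F \<Longrightarrow> tp D (\<lambda>s \<phi>. cnj (F s \<phi>))"
proof (induction rule: tp.induct)
  case (mono j D l c)
  have "tp D (\<lambda>s \<phi>. cnj c * of_real s ^ j * cis (of_int (- l) * \<phi>))"
    by (rule tp.mono) (use mono in auto)
  then show ?case by (simp add: cis_cnj)
next
  case (add D F G)
  then show ?case using tp.add by simp
qed

lemma tp_Re: "tp D F \<Longrightarrow> tp D (\<lambda>s \<phi>. of_real (Re (F s \<phi>)))"
proof -
  assume F: "tp D F"
  have "(\<lambda>s \<phi>. complex_of_real (Re (F s \<phi>))) = (\<lambda>s \<phi>. (1/2) * (F s \<phi> + cnj (F s \<phi>)))"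
    by (simp add: complex_add_cnj fun_eq_iff)
  then show ?thesis using tp_cmult[OF tp.add[OF F tp_cnj[OF F]]] by metis
qed

lemma tp_shift: "tp D F \<Longrightarrow> tp D (\<lambda>s \<phi>. F (s + a) (\<phi> + \<alpha>))"
proof (induction rule: tp.induct)
  case (mono j D l c)
  have "tp D (\<lambda>s \<phi>. \<Sum>k\<le>j. (c * cis (of_int l * \<alpha>) * of_nat (j choose k) * of_real a ^ (j - k))
           * of_real s ^ k * cis (of_int l * \<phi>))"
    by (rule tp_sum, rule tp.mono) (use mono in auto)
  then show ?case
    by (simp add: binomial_ring sum_distrib_left sum_distrib_right distrib_left cis_mult[symmetric] mult_ac)
next
  case (add D F G)
  then show ?case using tp.add by simp
qed

definition nonres :: "real \<Rightarrow> bool" where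
  "nonres \<alpha> \<longleftrightarrow> (\<forall>l::int. l \<noteq> 0 \<longrightarrow> cis (of_int l * \<alpha>) \<noteq> 1)"

lemma nonres_irrational:
  assumes "\<alpha> / (2 * pi) \<notin> \<rat>" shows "nonres \<alpha>"
  unfolding nonres_def
proof (intro allI impI notI)
  fix l :: int assume l: "l \<noteq> 0" and "cis (of_int l * \<alpha>) = 1"
  then have "cos (of_int l * \<alpha>) = 1" by (metis cis.simps(1) one_complex.simps(1))
  then obtain n :: int where "of_int l * \<alpha> = of_int n * 2 * pi"
    using cos_one_2pi_int by blast
  then have "\<alpha> / (2 * pi) = of_int n / of_int l" using l by (simp add: field_simps)
  then show False using assms by (metis Rats_divide Rats_of_int)
qed

text \<open>The difference operator lowers the degree of a resonant monomial by one and keeps the degree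
  of a nonresonant one, so the equation is solved by descending induction on the degree.\<close>

lemma tp_difference_monom:
  assumes "nonres \<alpha>" "\<bar>l\<bar> \<le> int D" "j \<le> D"
  shows "\<exists>F. tp (Suc D) F \<and>
    (\<forall>s \<phi>. F (s + 1) (\<phi> + \<alpha>) - F s \<phi> = c * of_real s ^ j * cis (of_int l * \<phi>))"
  using assms(3)
proof (induction j arbitrary: c rule: less_induct)
  case (less j)
  define e where "e = (if l = 0 then 1 else (0::nat))"
  define z where "z = cis (of_int l * \<alpha>)"
  \<comment> \<open>The coefficient of s^j in (s + 1)^(j+e) z - s^(j+e): the leading one if l
    \<noteq> 0, and the binomial coefficient j + 1 if l = 0, where the leading powers
    cancel.\<close>
  define b where "b = (if l = 0 then of_nat (Suc j) else z - 1)"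
  define a where "a k = (if k = j + e then 0 else of_nat ((j + e) choose k) * z)" for k
  have "b \<noteq> 0" using assms(1) unfolding b_def z_def nonres_def
    by (auto simp del: of_nat_Suc)
  have *: "(of_real s + 1) ^ (j + e) * z - of_real s ^ (j + e) - b * of_real s ^ j
           = (\<Sum>k<j. a k * of_real s ^ k)" for s :: real
  proof -
    have "(of_real s + (1::complex)) ^ (j + e) = (\<Sum>k\<le>j+e. of_nat ((j + e) choose k) * of_real s ^ k)"
      by (subst binomial_ring) simp
    then show ?thesis
      by (cases "l = 0")
        (simp_all add: e_def b_def a_def z_def algebra_simps sum_distrib_left lessThan_Suc_atMost[symmetric])
  qed
  have "\<exists>F. tp (Suc D) F \<and> (\<forall>s \<phi>. F (s + 1) (\<phi> + \<alpha>) - F s \<phi> = d * of_real s ^ k * cis (of_int l * \<phi>))"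
    if "k < j" for k d
    using less that by auto
  then obtain F where F: "\<And>k d. k < j \<Longrightarrow> tp (Suc D) (F k d)"
      "\<And>k d s \<phi>. k < j \<Longrightarrow> F k d (s + 1) (\<phi> + \<alpha>) - F k d s \<phi> = d * of_real s ^ k * cis (of_int l * \<phi>)"
    by metis
  define G where "G s \<phi> = (c / b) * of_real s ^ (j + e) * cis (of_int l * \<phi>)
      - (\<Sum>k<j. F k (c / b * a k) s \<phi>)" for s \<phi>
  have "tp (Suc D) G" unfolding G_def
    by (intro tp_diff tp.mono tp_sum) (use assms(2) less F in \<open>auto simp: e_def\<close>)
  moreover have "G (s + 1) (\<phi> + \<alpha>) - G s \<phi> = c * of_real s ^ j * cis (of_int l * \<phi>)" for s \<phi>
  proof -
    have "cis (of_int l * (\<phi> + \<alpha>)) = cis (of_int l * \<phi>) * z"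
      by (simp add: z_def cis_mult distrib_left)
    then have "G (s + 1) (\<phi> + \<alpha>) - G s \<phi> =
        c / b * cis (of_int l * \<phi>) * ((of_real s + 1) ^ (j + e) * z - of_real s ^ (j + e))
        - (\<Sum>k<j. F k (c / b * a k) (s + 1) (\<phi> + \<alpha>) - F k (c / b * a k) s \<phi>)"
      by (simp add: G_def sum_subtractf algebra_simps)
    also have "(\<Sum>k<j. F k (c / b * a k) (s + 1) (\<phi> + \<alpha>) - F k (c / b * a k) s \<phi>)
        = c / b * cis (of_int l * \<phi>) * (\<Sum>k<j. a k * of_real s ^ k)"
      using F(2) by (simp add: sum_distrib_left mult_ac)
    finally have "G (s + 1) (\<phi> + \<alpha>) - G s \<phi> = c / b * cis (of_int l * \<phi>) * (b * of_real s ^ j)"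
      unfolding *[of s, symmetric] by (simp add: algebra_simps)
    then show ?thesis using \<open>b \<noteq> 0\<close> by simp
  qed
  ultimately show ?case by blast
qed

lemma tp_difference:
  assumes "tp D G" "nonres \<alpha>"
  shows "\<exists>F. tp (Suc D) F \<and> (\<forall>s \<phi>. F (s + 1) (\<phi> + \<alpha>) - F s \<phi> = G s \<phi>)"
  using assms
proof (induction rule: tp.induct)
  case (mono j D l c)
  then show ?case using tp_difference_monom by blast
next
  case (add D F G)
  then obtain F' G' where
    "tp (Suc D) F'" "\<And>s \<phi>. F' (s + 1) (\<phi> + \<alpha>) - F' s \<phi> = F s \<phi>"
    "tp (Suc D) G'" "\<And>s \<phi>. G' (s + 1) (\<phi> + \<alpha>) - G' s \<phi> = G s \<phi>" by blast
  then show ?case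
    by (intro exI[of _ "\<lambda>s \<phi>. F' s \<phi> + G' s \<phi>"]) (auto intro: tp.add simp: add_diff_add)
qed

section \<open>From finitely many orbit points to the whole circle of phases\<close>

text \<open>The sum is the value at z of the j-th iterate of the Euler operator on P, which sends a
  polynomial to x times its derivative. Each application costs at most one order of vanishing at z,
  so j + 1 orders suffice.\<close>

lemma sum_coeff_power_eq_0:
  fixes z :: complex
  assumes "[:- z, 1:] ^ Suc j dvd P"
  shows "(\<Sum>m\<le>degree P. coeff P m * of_nat m ^ j * z ^ m) = 0"
  using assms
proof (induction j arbitrary: P)
  case 0
  then have "poly P z = 0" by (simp add: poly_eq_0_iff_dvd)
  then show ?case by (simp add: poly_altdef)
next
  case (Suc j)
  define P' where "P' = pCons 0 (pderiv P)"
  obtain R where R: "P = [:- z, 1:] ^ Suc (Suc j) * R" using Suc.prems by (elim dvdE)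
  have "pderiv P = [:- z, 1:] ^ Suc j * (smult (of_nat (Suc (Suc j))) R + [:- z, 1:] * pderiv R)"
  proof -
    have "pderiv (A ^ Suc (Suc j) * R) = A ^ Suc j * (smult (of_nat (Suc (Suc j))) R + A * pderiv R)"
      if "pderiv A = 1" for A :: "complex poly"
      unfolding pderiv_mult pderiv_power_Suc that
      by (simp add: algebra_simps smult_add_left smult_add_right del: of_nat_Suc)
    from this[of "[:- z, 1:]"] show ?thesis unfolding R by (simp add: pderiv_pCons)
  qed
  then have "[:- z, 1:] ^ Suc j dvd P'" unfolding P'_def
    by (metis dvd_mult dvd_triv_left mult.commute mult_pCons_left pCons_0_0 add_0 smult_0_left mult_1 smult_1_left one_pCons)
  then have IH: "(\<Sum>m\<le>degree P'. coeff P' m * of_nat m ^ j * z ^ m) = 0" by (rule Suc.IH)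
  have c: "coeff P' m = of_nat m * coeff P m" for m
    by (cases m) (auto simp: P'_def coeff_pderiv)
  have "(\<Sum>m\<le>degree P. coeff P m * of_nat m ^ Suc j * z ^ m)
      = (\<Sum>m\<le>degree P. coeff P' m * of_nat m ^ j * z ^ m)"
    by (simp add: c mult_ac)
  also have "\<dots> = (\<Sum>m\<le>degree P'. coeff P' m * of_nat m ^ j * z ^ m)"
  proof (rule sum.mono_neutral_right)
    show "{..degree P'} \<subseteq> {..degree P}"
      using degree_pderiv[of P] pderiv_eq_0_iff[of P]
      by (cases "degree P") (auto simp: P'_def degree_pCons_eq_if)
    show "\<forall>m\<in>{..degree P} - {..degree P'}. coeff P' m * of_nat m ^ j * z ^ m = 0"
      by (auto simp: coeff_eq_0)
  qed auto
  finally show ?case using IH by simp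
qed

text \<open>If \<open>A\<close> is 1 at one node and 0 at the others, then \<open>1 - (1 - A ^ n) ^ n\<close> has these values
  to order \<open>n\<close>.\<close>

lemma hermite_idempotent:
  fixes Z :: "complex set"
  assumes "finite Z" "z \<in> Z"
  obtains P where "[:- z, 1:] ^ n dvd P - 1" "\<And>y. y \<in> Z - {z} \<Longrightarrow> [:- y, 1:] ^ n dvd P"
proof (cases "n = 0")
  case False
  \<comment> \<open>The Lagrange basis polynomial of the node z.\<close>
  define A where "A = (\<Prod>y\<in>Z - {z}. smult (inverse (z - y)) [:- y, 1:])"
  have "poly A z = 1" unfolding A_def poly_prod
  proof (rule prod.neutral, rule ballI)
    fix y assume "y \<in> Z - {z}"
    moreover have "poly [:- y, 1:] z = z - y" by simp
    ultimately show "poly (smult (inverse (z - y)) [:- y, 1:]) z = 1"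
      by (simp only: poly_smult left_inverse right_minus_eq Diff_iff insert_iff empty_iff) auto
  qed
  then have "poly (1 - A ^ n) z = 0" by simp
  then have 1: "[:- z, 1:] dvd 1 - A ^ n" by (simp only: poly_eq_0_iff_dvd)
  have 2: "[:- y, 1:] dvd A" if "y \<in> Z - {z}" for y
  proof -
    have "smult (inverse (z - y)) [:- y, 1:] dvd A"
      unfolding A_def using that assms(1) by (intro dvd_prodI) auto
    then show ?thesis by (rule dvd_trans[OF dvd_smult[OF dvd_refl]])
  qed
  show ?thesis
  proof (rule that[of "1 - (1 - A ^ n) ^ n"])
    show "[:- z, 1:] ^ n dvd 1 - (1 - A ^ n) ^ n - 1"
      using dvd_power_same[OF 1, of n] by simp
    fix y assume "y \<in> Z - {z}"
    then have "[:- y, 1:] ^ n dvd A ^ n" using 2 dvd_power_same by blast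
    moreover have "A ^ n dvd 1 - (1 - A ^ n) ^ n"
    proof -
      have "1 - (1 - A ^ n) ^ n = A ^ n * (\<Sum>i<n. (1 - A ^ n) ^ i)"
        using one_diff_power_eq[of "1 - A ^ n" n] by simp
      then show ?thesis by (metis dvd_triv_left)
    qed
    ultimately show "[:- y, 1:] ^ n dvd 1 - (1 - A ^ n) ^ n" by (rule dvd_trans)
  qed
qed (use that[of 1] in auto)

text \<open>The values of \<open>F\<close> at \<open>(n, n \<alpha>)\<close>, \<open>n \<le> L\<close>, determine those on the whole circle \<open>s = 0\<close>.\<close>

definition window :: "real \<Rightarrow> nat \<Rightarrow> nat \<Rightarrow> (nat \<Rightarrow> real \<Rightarrow> real) \<Rightarrow> (nat \<Rightarrow> real \<Rightarrow> real) \<Rightarrow> bool" where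
  "window \<alpha> D L c c' \<longleftrightarrow>
     (\<forall>m t. (c m has_real_derivative c' m t) (at t)) \<and> (\<forall>m. continuous_on UNIV (c' m)) \<and>
     (\<forall>m t. c m (t + 2 * pi) = c m t) \<and>
     (\<forall>F. tp D (\<lambda>s \<phi>. of_real (F s \<phi>)) \<longrightarrow>
        (\<forall>t. F 0 t = (\<Sum>m\<le>L. c m t * F (real m) (real m * \<alpha>))))"

text \<open>Along the indices n, the monomial s^j cis (l \<phi>) takes the values n^j z_l^n with z_l
  = cis (l \<alpha>), and by nonresonance the nodes z_l are distinct. A polynomial that is 1 to
  order D + 1 at z_l and 0 to that order at the other nodes has coefficients which, used as weights,
  extract the part of frequency l at s = 0. Multiplication by cis (l t) then puts it at phase
  t.\<close>

lemma window_exists: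
  assumes "nonres \<alpha>"
  shows "\<exists>L c c'. window \<alpha> D L c c'"
proof -
  define I where "I = {- int D..int D}"
  define z where "z l = cis (of_int l * \<alpha>)" for l :: int
  have inj: "z l \<noteq> z l'" if "l \<noteq> l'" for l l'
  proof
    assume "z l = z l'"
    moreover have "cis (of_int (l - l') * \<alpha>) = z l / z l'"
      by (simp add: z_def cis_divide left_diff_distrib)
    ultimately have "cis (of_int (l - l') * \<alpha>) = 1"
      by (simp add: z_def)
    then show False using assms that unfolding nonres_def by (metis right_minus_eq)
  qed
  have "\<exists>P. [:- z l, 1:] ^ Suc D dvd P - 1 \<and> (\<forall>k\<in>I - {l}. [:- z k, 1:] ^ Suc D dvd P)" if l: "l \<in> I" for l
  proof -
    obtain P where P: "[:- z l, 1:] ^ Suc D dvd P - 1"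
      "\<And>y. y \<in> z ` I - {z l} \<Longrightarrow> [:- y, 1:] ^ Suc D dvd P"
      by (rule hermite_idempotent[of "z ` I" "z l" "Suc D"]) (use l in \<open>auto simp: I_def\<close>)
    then show ?thesis using inj by (intro exI[of _ P] conjI ballI) auto
  qed
  then obtain P where P: "\<And>l. l \<in> I \<Longrightarrow> [:- z l, 1:] ^ Suc D dvd P l - 1"
      "\<And>l k. l \<in> I \<Longrightarrow> k \<in> I - {l} \<Longrightarrow> [:- z k, 1:] ^ Suc D dvd P l"
    by metis
  define L where "L = Max (insert 0 ((\<lambda>l. degree (P l)) ` I))"
  have fin: "finite I" by (simp add: I_def)
  have deg: "degree (P l) \<le> L" if "l \<in> I" for l
    unfolding L_def using that fin by (intro Max_ge) auto
  \<comment> \<open>The factor 0 ^ j is the value of s ^ j at s = 0: it is 1 for j = 0 and 0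
    otherwise.\<close>
  have P_sum: "(\<Sum>m\<le>L. coeff (P l) m * of_nat m ^ j * z k ^ m) = (if k = l then 0 ^ j else 0)"
    if "l \<in> I" "k \<in> I" "j \<le> D" for l k j
  proof -
    have ext: "(\<Sum>m\<le>L. coeff Q m * of_nat m ^ j * z k ^ m) = (\<Sum>m\<le>degree Q. coeff Q m * of_nat m ^ j * z k ^ m)"
      if "degree Q \<le> L" for Q
      by (rule sum.mono_neutral_right) (use that in \<open>auto simp: coeff_eq_0\<close>)
    have le: "[:- z k, 1:] ^ Suc j dvd [:- z k, 1:] ^ Suc D" using \<open>j \<le> D\<close> by (intro le_imp_power_dvd) auto
    show ?thesis
    proof (cases "k = l")
      case True
      have "degree (P l - 1) \<le> L" using deg[OF \<open>l \<in> I\<close>] by (intro degree_diff_le) auto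
      moreover have "[:- z k, 1:] ^ Suc j dvd P l - 1" using dvd_trans[OF le] P(1)[OF \<open>l \<in> I\<close>] True by simp
      ultimately have "(\<Sum>m\<le>L. coeff (P l - 1) m * of_nat m ^ j * z k ^ m) = 0"
        by (simp only: ext sum_coeff_power_eq_0)
      moreover have "(\<Sum>m\<le>L. coeff 1 m * of_nat m ^ j * z k ^ m) = 0 ^ j"
        using ext[of 1] by simp
      ultimately show ?thesis using True by (simp add: left_diff_distrib sum_subtractf)
    next
      case False
      then have "[:- z k, 1:] ^ Suc j dvd P l" using dvd_trans[OF le] P(2)[of l k] that by simp
      then show ?thesis using False by (simp only: ext deg[OF \<open>l \<in> I\<close>] sum_coeff_power_eq_0 if_False)
    qed
  qed
  define c where "c m t = (\<Sum>l\<in>I. coeff (P l) m * cis (of_int l * t))" for m t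
  define c' where "c' m t = (\<Sum>l\<in>I. coeff (P l) m * (\<i> * of_int l * cis (of_int l * t)))" for m t
  have rep: "F 0 t = (\<Sum>m\<le>L. c m t * F (real m) (real m * \<alpha>))" if "tp D' F" "D' \<le> D" for D' F t
    using that
  proof (induction rule: tp.induct)
    case (mono j D' k a)
    then have k: "k \<in> I" and j: "j \<le> D" by (auto simp: I_def)
    have "cis (of_int k * (real m * \<alpha>)) = z k ^ m" for m
      by (simp only: z_def Complex.DeMoivre mult_ac)
    then have "(\<Sum>m\<le>L. c m t * (a * of_real (real m) ^ j * cis (of_int k * (real m * \<alpha>))))
        = a * (\<Sum>m\<le>L. \<Sum>l\<in>I. cis (of_int l * t) * (coeff (P l) m * of_nat m ^ j * z k ^ m))"
      by (simp add: c_def sum_distrib_left sum_distrib_right mult_ac)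
    also have "\<dots> = a * (\<Sum>l\<in>I. cis (of_int l * t) * (\<Sum>m\<le>L. coeff (P l) m * of_nat m ^ j * z k ^ m))"
      by (subst sum.swap) (simp add: sum_distrib_left)
    also have "\<dots> = a * (\<Sum>l\<in>I. cis (of_int l * t) * (if k = l then 0 ^ j else 0))"
      using P_sum k j by (intro arg_cong[of _ _ "\<lambda>x. a * x"] sum.cong) auto
    also have "\<dots> = a * 0 ^ j * cis (of_int k * t)"
      using k fin by (simp add: if_distrib[of "\<lambda>x. _ * x"] sum.delta cong: if_cong)
    finally show ?case by simp
  next
    case (add D' F G)
    then show ?case by (simp add: distrib_left sum.distrib)
  qed
  have der: "(c m has_vector_derivative c' m t) (at t)" for m t
  proof -
    have "((\<lambda>t. cis (of_int l * t)) has_vector_derivative \<i> * of_int l * cis (of_int l * t)) (at t)" for l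
      using exp_scaleR_has_vector_derivative_left[of "\<i> * of_int l" t]
      by (simp add: cis_conv_exp scaleR_conv_of_real mult_ac)
    then show ?thesis unfolding c_def[abs_def] c'_def
      by (intro has_vector_derivative_sum has_vector_derivative_mult_right)
  qed
  \<comment> \<open>A real F is reproduced already by the real parts of the complex weights.\<close>
  have "window \<alpha> D L (\<lambda>m t. Re (c m t)) (\<lambda>m t. Re (c' m t))"
    unfolding window_def
  proof (intro conjI allI impI)
    show "((\<lambda>t. Re (c m t)) has_real_derivative Re (c' m t)) (at t)" for m t
      using bounded_linear.has_vector_derivative[OF bounded_linear_Re der]
      by (simp add: has_real_derivative_iff_has_vector_derivative)
    show "continuous_on UNIV (\<lambda>t. Re (c' m t))" for m
      unfolding c'_def by (intro continuous_intros)
    show "Re (c m (t + 2 * pi)) = Re (c m t)" for m t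
    proof -
      have "cis (of_int l * (t + 2 * pi)) = cis (of_int l * t) * cis (2 * pi * of_int l)" for l
        by (simp add: distrib_left cis_mult mult_ac)
      then have "cis (of_int l * (t + 2 * pi)) = cis (of_int l * t)" for l
        by (simp add: cis_multiple_2pi)
      then show ?thesis by (simp add: c_def)
    qed
    fix F :: "real \<Rightarrow> real \<Rightarrow> real" and t
    assume "tp D (\<lambda>s \<phi>. of_real (F s \<phi>))"
    from arg_cong[OF rep[OF this order_refl, of t], of Re]
    show "F 0 t = (\<Sum>m\<le>L. Re (c m t) * F (real m) (real m * \<alpha>))" by simp
  qed
  then show ?thesis by blast
qed

section \<open>Vector-valued trigonometric polynomials\<close>

definition vtp :: "nat \<Rightarrow> (real \<Rightarrow> real \<Rightarrow> 'b::euclidean_space) \<Rightarrow> bool" where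
  "vtp D F \<longleftrightarrow> (\<forall>u\<in>Basis. tp D (\<lambda>s \<phi>. of_real (F s \<phi> \<bullet> u)))"

lemma vtp_real: "vtp D (F :: real \<Rightarrow> real \<Rightarrow> real) \<longleftrightarrow> tp D (\<lambda>s \<phi>. of_real (F s \<phi>))"
  by (simp add: vtp_def)

lemma vtp_const: "vtp D (\<lambda>s \<phi>. c)"
  by (simp add: vtp_def tp_const)

lemma vtp_add: "vtp D F \<Longrightarrow> vtp D G \<Longrightarrow> vtp D (\<lambda>s \<phi>. F s \<phi> + G s \<phi>)"
  unfolding vtp_def by (simp add: inner_left_distrib tp.add)

lemma vtp_diff: "vtp D F \<Longrightarrow> vtp D G \<Longrightarrow> vtp D (\<lambda>s \<phi>. F s \<phi> - G s \<phi>)"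
  unfolding vtp_def by (simp add: inner_diff_left tp_diff)

lemma vtp_sum: "(\<And>i. i \<in> I \<Longrightarrow> vtp D (F i)) \<Longrightarrow> vtp D (\<lambda>s \<phi>. \<Sum>i\<in>I. F i s \<phi>)"
  by (induction I rule: infinite_finite_induct) (simp_all add: vtp_const vtp_add)

lemma vtp_mono: "vtp D F \<Longrightarrow> D \<le> D' \<Longrightarrow> vtp D' F"
  unfolding vtp_def by (blast intro: tp_mono)

lemma vtp_shift: "vtp D F \<Longrightarrow> vtp D (\<lambda>s \<phi>. F (s + a) (\<phi> + \<beta>))"
  unfolding vtp_def using tp_shift by fastforce

lemma vtp_scaleR: "vtp D' f \<Longrightarrow> vtp D F \<Longrightarrow> vtp (D + D') (\<lambda>s \<phi>. f s \<phi> *\<^sub>R F s \<phi>)"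
  unfolding vtp_real unfolding vtp_def by (simp add: tp_mult)

lemma vtp_scaleR_const: "vtp D F \<Longrightarrow> vtp D (\<lambda>s \<phi>. c *\<^sub>R F s \<phi>)"
  using vtp_scaleR[OF vtp_const[of 0 c], of D F] by simp

lemma vtp_linear:
  assumes "bounded_linear A" "vtp D F" shows "vtp D (\<lambda>s \<phi>. A (F s \<phi>))"
  unfolding vtp_def
proof
  fix u :: 'b assume "u \<in> Basis"
  have A: "A x \<bullet> u = (\<Sum>b\<in>Basis. (A b \<bullet> u) * (x \<bullet> b))" for x
  proof -
    have "A x = A (\<Sum>b\<in>Basis. (x \<bullet> b) *\<^sub>R b)" by (simp add: euclidean_representation)
    also have "\<dots> = (\<Sum>b\<in>Basis. (x \<bullet> b) *\<^sub>R A b)"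
      using assms(1) by (simp add: linear_sum linear_scale bounded_linear.linear)
    finally show ?thesis by (simp add: inner_sum_left mult.commute)
  qed
  have "(\<lambda>s \<phi>. complex_of_real (A (F s \<phi>) \<bullet> u))
      = (\<lambda>s \<phi>. \<Sum>b\<in>Basis. of_real (A b \<bullet> u) * of_real (F s \<phi> \<bullet> b))"
    by (intro ext, subst A) simp
  then show "tp D (\<lambda>s \<phi>. of_real (A (F s \<phi>) \<bullet> u))"
    using assms(2) unfolding vtp_def by (simp add: tp_sum tp_cmult)
qed

lemma vtp_inner: "vtp D F \<Longrightarrow> vtp D (\<lambda>s \<phi>. F s \<phi> \<bullet> b)"
  by (rule vtp_linear[OF bounded_linear_inner_left])

lemma vtp_Pair: "vtp D F \<Longrightarrow> vtp D G \<Longrightarrow> vtp D (\<lambda>s \<phi>. (F s \<phi>, G s \<phi>))"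
  unfolding vtp_def Basis_prod_def by auto

lemma vtp_cos: "vtp 1 (\<lambda>s \<phi>. cos \<phi>)" and vtp_sin: "vtp 1 (\<lambda>s \<phi>. sin \<phi>)"
proof -
  have 1: "tp 1 (\<lambda>s \<phi>. cis \<phi>)" using tp.mono[of 0 1 1 1] by simp
  show "vtp 1 (\<lambda>s \<phi>. cos \<phi>)" using tp_Re[OF 1] by (simp add: vtp_real)
  show "vtp 1 (\<lambda>s \<phi>. sin \<phi>)" using tp_Re[OF tp_cmult[OF 1, of "-\<i>"]] by (simp add: vtp_real)
qed

lemma vtp_s: "vtp 1 (\<lambda>s \<phi>. s)"
  using tp.mono[of 1 1 0 1] by (simp add: vtp_real)

lemma vtp_difference:
  fixes G :: "real \<Rightarrow> real \<Rightarrow> 'b::euclidean_space"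
  assumes "vtp D G" "nonres \<alpha>"
  shows "\<exists>F. vtp (Suc D) F \<and> (\<forall>s \<phi>. F (s + 1) (\<phi> + \<alpha>) - F s \<phi> = G s \<phi>)"
proof -
  have "\<exists>f. tp (Suc D) f \<and> (\<forall>s \<phi>. f (s + 1) (\<phi> + \<alpha>) - f s \<phi> = of_real (G s \<phi> \<bullet> u))" if "u \<in> Basis" for u
    using tp_difference assms that unfolding vtp_def by blast
  then obtain f where f: "\<And>u. u \<in> Basis \<Longrightarrow> tp (Suc D) (f u)"
      "\<And>u s \<phi>. u \<in> Basis \<Longrightarrow> f u (s + 1) (\<phi> + \<alpha>) - f u s \<phi> = of_real (G s \<phi> \<bullet> u)" by metis
  define F where "F s \<phi> = (\<Sum>u\<in>Basis. Re (f u s \<phi>) *\<^sub>R u)" for s \<phi>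
  have Fu: "F s \<phi> \<bullet> u = Re (f u s \<phi>)" if "u \<in> Basis" for s \<phi> u
    using that by (simp add: F_def)
  show ?thesis
  proof (intro exI conjI allI)
    show "vtp (Suc D) F" unfolding vtp_def using f(1) by (simp add: Fu tp_Re)
    show "F (s + 1) (\<phi> + \<alpha>) - F s \<phi> = G s \<phi>" for s \<phi>
    proof (rule euclidean_eqI)
      fix u :: 'b assume u: "u \<in> Basis"
      from arg_cong[OF f(2)[OF u], of Re s \<phi>]
      show "(F (s + 1) (\<phi> + \<alpha>) - F s \<phi>) \<bullet> u = G s \<phi> \<bullet> u"
        by (simp add: inner_diff_left Fu[OF u])
    qed
  qed
qed

lemma windowD:
  assumes "window \<alpha> D L c c'" "tp D (\<lambda>s \<phi>. of_real (F s \<phi>))"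
  shows "F 0 t = (\<Sum>m\<le>L. c m t * F (real m) (real m * \<alpha>))"
  using assms unfolding window_def by blast

lemma window_vtp:
  assumes "window \<alpha> D L c c'" "vtp D F"
  shows "F 0 t = (\<Sum>m\<le>L. c m t *\<^sub>R F (real m) (real m * \<alpha>))"
proof (rule euclidean_eqI)
  fix u :: 'a assume "u \<in> Basis"
  then have "tp D (\<lambda>s \<phi>. of_real (F s \<phi> \<bullet> u))" using assms(2) by (simp add: vtp_def)
  from windowD[OF assms(1) this, of t]
  show "F 0 t \<bullet> u = (\<Sum>m\<le>L. c m t *\<^sub>R F (real m) (real m * \<alpha>)) \<bullet> u"
    by (simp add: inner_sum_left)
qed

text \<open>Trigonometric polynomials are invariant under the translation by (i, i \<alpha>), so the
  same weights serve at every index i.\<close>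

lemma window_shift:
  assumes "window \<alpha> D L c c'" "vtp D F"
  shows "F (real i) (t + real i * \<alpha>) = (\<Sum>m\<le>L. c m t *\<^sub>R F (real (i + m)) (real (i + m) * \<alpha>))"
  using window_vtp[OF assms(1) vtp_shift[OF assms(2), of "real i" "real i * \<alpha>"], of t]
  by (simp add: algebra_simps)

lemma window_sum1:
  assumes "window \<alpha> D L c c'"
  shows "(\<Sum>m\<le>L. c m t) = 1"
  using window_vtp[OF assms vtp_const[of D "1::real"]] by simp

lemma window_bounded:
  assumes "window \<alpha> D L c c'"
  obtains M where "M \<ge> 0" "\<And>m t. m \<le> L \<Longrightarrow> t \<in> {0..2*pi} \<Longrightarrow> \<bar>c m t\<bar> \<le> M \<and> \<bar>c' m t\<bar> \<le> M"
proof -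
  have "\<exists>M. \<forall>t\<in>{0..2*pi}. \<bar>c m t\<bar> \<le> M \<and> \<bar>c' m t\<bar> \<le> M" for m
  proof -
    have "continuous_on {0..2*pi} (c m)"
      using assms unfolding window_def by (intro continuous_at_imp_continuous_on ballI) (blast intro: DERIV_isCont)
    moreover have "continuous_on {0..2*pi} (c' m)"
      using assms unfolding window_def by (blast intro: continuous_on_subset)
    ultimately have "bounded (c m ` {0..2*pi} \<union> c' m ` {0..2*pi})"
      by (simp add: compact_imp_bounded compact_continuous_image)
    then show ?thesis unfolding bounded_iff real_norm_def by blast
  qed
  then obtain M where M: "\<And>m t. t \<in> {0..2*pi} \<Longrightarrow> \<bar>c m t\<bar> \<le> M m \<and> \<bar>c' m t\<bar> \<le> M m" by metis
  have "M m \<le> (\<Sum>m\<le>L. \<bar>M m\<bar>)" if "m \<le> L" for m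
    using that by (intro order_trans[OF abs_ge_self member_le_sum[of m "{..L}" "\<lambda>m. \<bar>M m\<bar>"]]) auto
  then have "\<bar>c m t\<bar> \<le> (\<Sum>m\<le>L. \<bar>M m\<bar>) \<and> \<bar>c' m t\<bar> \<le> (\<Sum>m\<le>L. \<bar>M m\<bar>)"
    if "m \<le> L" "t \<in> {0..2*pi}" for m t
    using M[OF that(2), of m] that(1) by (meson order_trans)
  then show ?thesis by (intro that[of "\<Sum>m\<le>L. \<bar>M m\<bar>"]) (auto intro: sum_nonneg)
qed

section \<open>Smooth maps\<close>

lemma Ck_on_cong:
  assumes "open S" "\<And>x. x \<in> S \<Longrightarrow> f x = g x" "Ck_on n S f"
  shows "Ck_on n S g"
  using assms(2,3)
proof (induction n arbitrary: f g)
  case 0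
  then show ?case using continuous_on_cong[of S S f g] by simp
next
  case (Suc n)
  have der: "(g has_derivative frechet_derivative f (at x)) (at x)" if "x \<in> S" for x
  proof -
    have "(f has_derivative frechet_derivative f (at x)) (at x)"
      using Suc.prems(2) that by (simp add: frechet_derivative_works)
    then show ?thesis
      by (rule has_derivative_transform_within_open[OF _ \<open>open S\<close> that]) (use Suc.prems(1) in auto)
  qed
  have eq: "frechet_derivative f (at x) = frechet_derivative g (at x)" if "x \<in> S" for x
    using frechet_derivative_at[OF der[OF that]] .
  have "Ck_on n S (\<lambda>x. frechet_derivative g (at x) w)" for w
  proof (rule Suc.IH)
    show "Ck_on n S (\<lambda>x. frechet_derivative f (at x) w)" using Suc.prems(2) by simp
    show "frechet_derivative f (at x) w = frechet_derivative g (at x) w" if "x \<in> S" for x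
      by (simp only: eq[OF that])
  qed
  moreover have "g differentiable (at x)" if "x \<in> S" for x
    using der[OF that] by (rule differentiableI)
  ultimately show ?case by simp
qed

lemma Ck_on_SucI:
  assumes "open S" "\<And>x. x \<in> S \<Longrightarrow> (f has_derivative f' x) (at x)" "\<And>w. Ck_on n S (\<lambda>x. f' x w)"
  shows "Ck_on (Suc n) S f"
proof -
  have "f' x = frechet_derivative f (at x)" if "x \<in> S" for x
    using assms(2)[OF that] by (rule frechet_derivative_at)
  then have "Ck_on n S (\<lambda>x. frechet_derivative f (at x) w)" for w
    by (intro Ck_on_cong[OF \<open>open S\<close> _ assms(3)[of w]]) simp
  then show ?thesis using assms(2) by (auto intro: differentiableI)
qed

lemma Ck_on_Suc_has_derivative:
  "Ck_on (Suc n) S f \<Longrightarrow> x \<in> S \<Longrightarrow> (f has_derivative frechet_derivative f (at x)) (at x)"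
  by (simp add: frechet_derivative_works)

lemma Ck_on_Suc_imp: "Ck_on (Suc n) S f \<Longrightarrow> Ck_on n S f"
proof (induction n arbitrary: f)
  case 0
  then have "\<forall>x\<in>S. f differentiable (at x)" by simp
  then show ?case
    by (auto intro!: continuous_at_imp_continuous_on differentiable_imp_continuous_within)
qed auto

lemma Ck_on_imp_continuous_on: "Ck_on n S f \<Longrightarrow> continuous_on S f"
  by (induction n) (use Ck_on_Suc_imp in auto)

lemma Ck_on_const: "open S \<Longrightarrow> Ck_on n S (\<lambda>x. c)"
  by (induction n arbitrary: c) (auto intro: Ck_on_SucI has_derivative_const)

lemma Ck_on_bounded_linear_comp:
  assumes "open S" "bounded_linear A" "Ck_on n S f"
  shows "Ck_on n S (\<lambda>x. A (f x))"
  using assms(3)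
proof (induction n arbitrary: f)
  case 0
  then show ?case using assms(2) by (simp add: bounded_linear.continuous_on)
next
  case (Suc n)
  show ?case
    by (rule Ck_on_SucI[OF assms(1), of _ "\<lambda>x w. A (frechet_derivative f (at x) w)"])
      (use Suc in \<open>auto intro!: bounded_linear.has_derivative[OF assms(2)] Ck_on_Suc_has_derivative[OF Suc.prems]\<close>)
qed

lemma Ck_on_linear:
  assumes "open S" "bounded_linear A" shows "Ck_on n S A"
proof (cases n)
  case 0
  then show ?thesis using assms(2) by (simp add: linear_continuous_on)
next
  case (Suc m)
  show ?thesis unfolding Suc
    by (rule Ck_on_SucI[OF assms(1) bounded_linear_imp_has_derivative[OF assms(2)] Ck_on_const[OF assms(1)]])
qed

lemma Ck_on_add:
  assumes "open S" "Ck_on n S f" "Ck_on n S g"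
  shows "Ck_on n S (\<lambda>x. f x + g x)"
  using assms(2,3)
proof (induction n arbitrary: f g)
  case (Suc n)
  show ?case
    by (rule Ck_on_SucI[OF assms(1), of _ "\<lambda>x w. frechet_derivative f (at x) w + frechet_derivative g (at x) w"])
      (use Suc in \<open>auto intro!: has_derivative_add Ck_on_Suc_has_derivative[OF Suc.prems(1)]
         Ck_on_Suc_has_derivative[OF Suc.prems(2)]\<close>)
qed (auto intro: continuous_on_add)

lemma Ck_on_sum:
  assumes "open S" "\<And>i. i \<in> I \<Longrightarrow> Ck_on n S (f i)"
  shows "Ck_on n S (\<lambda>x. \<Sum>i\<in>I. f i x)"
  using assms(2) by (induction I rule: infinite_finite_induct) (auto intro: Ck_on_add Ck_on_const assms(1))

lemma Ck_on_bilinear: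
  assumes "open S" "bounded_bilinear p" "Ck_on n S f" "Ck_on n S g"
  shows "Ck_on n S (\<lambda>x. p (f x) (g x))"
  using assms(3,4)
proof (induction n arbitrary: f g)
  case 0
  then show ?case using bounded_bilinear.continuous_on[OF assms(2)] by simp
next
  case (Suc n)
  have "Ck_on n S f" "Ck_on n S g" using Suc.prems Ck_on_Suc_imp by blast+
  then show ?case
    by (intro Ck_on_SucI[OF assms(1), of _ "\<lambda>x w. p (f x) (frechet_derivative g (at x) w) + p (frechet_derivative f (at x) w) (g x)"]
       Ck_on_add assms(1))
      (use Suc in \<open>auto intro!: bounded_bilinear.FDERIV[OF assms(2)] Ck_on_Suc_has_derivative[OF Suc.prems(1)]
         Ck_on_Suc_has_derivative[OF Suc.prems(2)]\<close>)
qed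

lemma linear_euclidean_expand:
  assumes "linear A"
  shows "A x = (\<Sum>b\<in>Basis. (x \<bullet> b) *\<^sub>R A b)"
proof -
  have "A x = A (\<Sum>b\<in>Basis. (x \<bullet> b) *\<^sub>R b)" by (simp add: euclidean_representation)
  also have "\<dots> = (\<Sum>b\<in>Basis. (x \<bullet> b) *\<^sub>R A b)"
    using assms by (simp add: linear_sum linear_scale)
  finally show ?thesis .
qed

text \<open>In the chain rule the outer derivative is taken in a direction that varies with x.
  Expanding this direction in \<open>Basis\<close> leaves the fixed directions b, to which the
  induction hypothesis applies.\<close>

lemma Ck_on_compose:
  assumes "open S" "open T" "\<And>x. x \<in> S \<Longrightarrow> g x \<in> T" "Ck_on n T f" "Ck_on n S g"
  shows "Ck_on n S (\<lambda>x. f (g x))"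
  using assms(4,5)
proof (induction n arbitrary: f)
  case 0
  then show ?case using assms(3) by (auto intro: continuous_on_compose2)
next
  case (Suc n)
  have der: "((\<lambda>x. f (g x)) has_derivative
      (\<lambda>w. \<Sum>b\<in>Basis. (frechet_derivative g (at x) w \<bullet> b) *\<^sub>R frechet_derivative f (at (g x)) b)) (at x)"
    if "x \<in> S" for x
  proof -
    have f: "(f has_derivative frechet_derivative f (at (g x))) (at (g x))"
      using Ck_on_Suc_has_derivative Suc.prems(1) assms(3) that by blast
    have "((\<lambda>x. f (g x)) has_derivative (\<lambda>w. frechet_derivative f (at (g x)) (frechet_derivative g (at x) w))) (at x)"
      using has_derivative_compose[OF Ck_on_Suc_has_derivative[OF Suc.prems(2) that] f] .
    then show ?thesis
      by (rule has_derivative_eq_rhs) (rule ext, rule linear_euclidean_expand[OF has_derivative_linear[OF f]])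
  qed
  have g: "Ck_on n S g" using Suc.prems(2) Ck_on_Suc_imp by blast
  show ?case
  proof (rule Ck_on_SucI[OF assms(1) der])
    fix w
    show "Ck_on n S (\<lambda>x. \<Sum>b\<in>Basis. (frechet_derivative g (at x) w \<bullet> b) *\<^sub>R frechet_derivative f (at (g x)) b)"
      using Suc.prems g
      by (intro Ck_on_sum[OF assms(1)] Ck_on_bilinear[OF assms(1) bounded_bilinear_scaleR] Suc.IH
            Ck_on_bounded_linear_comp[OF assms(1) bounded_linear_inner_left]) auto
  qed
qed

lemma smooth_on_continuous: "smooth_on S f \<Longrightarrow> continuous_on S f"
  unfolding smooth_on_def using Ck_on_imp_continuous_on by blast

lemma smooth_on_has_derivative:
  "smooth_on S f \<Longrightarrow> x \<in> S \<Longrightarrow> (f has_derivative frechet_derivative f (at x)) (at x)"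
  unfolding smooth_on_def using Ck_on_Suc_has_derivative by blast

lemma smooth_on_deriv: "smooth_on S f \<Longrightarrow> smooth_on S (\<lambda>x. frechet_derivative f (at x) w)"
  unfolding smooth_on_def by (metis Ck_on.simps(2))

lemma smooth_on_const: "open S \<Longrightarrow> smooth_on S (\<lambda>x. c)"
  and smooth_on_linear: "open S \<Longrightarrow> bounded_linear A \<Longrightarrow> smooth_on S A"
  and smooth_on_linear_comp: "open S \<Longrightarrow> bounded_linear B \<Longrightarrow> smooth_on S f \<Longrightarrow> smooth_on S (\<lambda>x. B (f x))"
  and smooth_on_add: "open S \<Longrightarrow> smooth_on S f \<Longrightarrow> smooth_on S g \<Longrightarrow> smooth_on S (\<lambda>x. f x + g x)"
  and smooth_on_sum: "open S \<Longrightarrow> (\<And>i. i \<in> I \<Longrightarrow> smooth_on S (h i)) \<Longrightarrow> smooth_on S (\<lambda>x. \<Sum>i\<in>I. h i x)"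
  and smooth_on_bilinear: "open S \<Longrightarrow> bounded_bilinear p \<Longrightarrow> smooth_on S u \<Longrightarrow> smooth_on S v \<Longrightarrow> smooth_on S (\<lambda>x. p (u x) (v x))"
  unfolding smooth_on_def
  by (auto intro: Ck_on_const Ck_on_linear Ck_on_bounded_linear_comp Ck_on_add Ck_on_sum Ck_on_bilinear)

lemma smooth_on_diff:
  "open S \<Longrightarrow> smooth_on S f \<Longrightarrow> smooth_on S g \<Longrightarrow> smooth_on S (\<lambda>x. f x - g x)"
  using smooth_on_add[OF _ _ smooth_on_linear_comp[OF _ bounded_linear_minus[OF bounded_linear_ident]], of S f g]
  by simp

lemmas smooth_on_scaleR = smooth_on_bilinear[OF _ bounded_bilinear_scaleR]
lemmas smooth_on_mult = smooth_on_bilinear[OF _ bounded_bilinear_mult]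
lemmas smooth_on_inner = smooth_on_bilinear[OF _ bounded_bilinear_inner]
lemmas smooth_on_blinfun_apply = smooth_on_bilinear[OF _ bounded_bilinear_blinfun_apply]
lemmas smooth_on_blinfun_compose = smooth_on_bilinear[OF _ bounded_bilinear_blinfun_compose]

lemma smooth_on_power: "open S \<Longrightarrow> smooth_on S f \<Longrightarrow> smooth_on S (\<lambda>x. (f x :: real) ^ n)"
  by (induction n) (auto intro: smooth_on_const smooth_on_mult)

lemma smooth_on_compose:
  assumes "open S" "open T" "\<And>x. x \<in> S \<Longrightarrow> g x \<in> T" "smooth_on T f" "smooth_on S g"
  shows "smooth_on S (\<lambda>x. f (g x))"
  using assms unfolding smooth_on_def by (auto intro: Ck_on_compose)

text \<open>The derivative as a bounded linear map, assembled from directional derivatives. In this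
  form it is a total function, and its smoothness reduces to that of finitely many directional
  derivatives.\<close>

definition total_deriv :: "('a::euclidean_space \<Rightarrow> 'b::real_normed_vector) \<Rightarrow> 'a \<Rightarrow> ('a \<Rightarrow>\<^sub>L 'b)" where
  "total_deriv f x = (\<Sum>b\<in>Basis. blinfun_scaleR_left (frechet_derivative f (at x) b) o\<^sub>L blinfun_inner_left b)"

lemma total_deriv_apply:
  assumes "f differentiable (at x)"
  shows "blinfun_apply (total_deriv f x) = frechet_derivative f (at x)"
proof
  fix w
  have "blinfun_apply (total_deriv f x) w = (\<Sum>b\<in>Basis. (w \<bullet> b) *\<^sub>R frechet_derivative f (at x) b)"
    by (simp add: total_deriv_def blinfun.sum_left)
  also have "\<dots> = frechet_derivative f (at x) w"
    by (rule linear_euclidean_expand[OF linear_frechet_derivative[OF assms], symmetric])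
  finally show "blinfun_apply (total_deriv f x) w = frechet_derivative f (at x) w" .
qed

lemma smooth_on_total_deriv_apply:
  "smooth_on S f \<Longrightarrow> x \<in> S \<Longrightarrow> blinfun_apply (total_deriv f x) = frechet_derivative f (at x)"
  using smooth_on_has_derivative by (intro total_deriv_apply) (auto intro: differentiableI)

lemma smooth_on_total_deriv: "open S \<Longrightarrow> smooth_on S f \<Longrightarrow> smooth_on S (total_deriv f)"
  unfolding total_deriv_def[abs_def]
  by (intro smooth_on_sum smooth_on_blinfun_compose smooth_on_const
        smooth_on_linear_comp[OF _ bounded_linear_blinfun_scaleR_left] smooth_on_deriv)

lemma has_derivative_total_deriv:
  "smooth_on S f \<Longrightarrow> x \<in> S \<Longrightarrow> (f has_derivative total_deriv f x) (at x)"
  using smooth_on_has_derivative smooth_on_total_deriv_apply by metis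

text \<open>A product rule in which one factor is merely continuous: the other factor vanishes at x
  and is therefore O(|y - x|), so replacing g y by g x costs o(|y - x|).\<close>

lemma has_derivative_bilinear_vanishing:
  assumes "bounded_bilinear p" "(f has_derivative f') (at x)" "f x = 0" "isCont g x"
  shows "((\<lambda>y. p (f y) (g y)) has_derivative (\<lambda>w. p (f' w) (g x))) (at x)"
proof -
  interpret p: bounded_bilinear p by fact
  obtain K where K: "K > 0" "\<And>a b. norm (p a b) \<le> norm a * norm b * K" using p.pos_bounded by blast
  have bl: "bounded_linear f'" using assms(2) by (rule has_derivative_bounded_linear)
  obtain M where M: "\<And>w. norm (f' w) \<le> norm w * M"
    using bounded_linear.bounded[OF bl] by blast
  define e where "e y = norm (f y - f x - f' (y - x)) / norm (y - x)" for y
  have e: "(e \<longlongrightarrow> 0) (at x)" using assms(2) unfolding e_def has_derivative_iff_norm by blast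
  have g: "((\<lambda>y. norm (g y - g x)) \<longlongrightarrow> 0) (at x)"
    using assms(4) by (simp add: isCont_def LIM_zero tendsto_norm_zero)
  have "((\<lambda>y. p (f y) (g y - g x)) has_derivative (\<lambda>w. 0)) (at x)"
    unfolding has_derivative_iff_norm
  proof (intro conjI)
    show "((\<lambda>y. norm (p (f y) (g y - g x) - p (f x) (g x - g x) - 0) / norm (y - x)) \<longlongrightarrow> 0) (at x)"
    proof (rule tendsto_sandwich[of "\<lambda>_. 0" _ _ "\<lambda>y. (e y + M) * norm (g y - g x) * K"])
      have "norm (p (f y) (g y - g x)) / norm (y - x) \<le> (e y + M) * norm (g y - g x) * K" if "y \<noteq> x" for y
      proof -
        have "norm (f y) \<le> norm (f y - f' (y - x)) + norm (f' (y - x))"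
          using norm_triangle_ineq[of "f y - f' (y - x)" "f' (y - x)"] by simp
        also have "\<dots> \<le> (e y + M) * norm (y - x)"
          using M[of "y - x"] that assms(3) by (simp add: e_def algebra_simps)
        finally have "norm (f y) \<le> (e y + M) * norm (y - x)" .
        then have "norm (f y) * norm (g y - g x) * K \<le> (e y + M) * norm (y - x) * norm (g y - g x) * K"
          using K(1) by (intro mult_right_mono) auto
        then have "norm (p (f y) (g y - g x)) \<le> (e y + M) * norm (g y - g x) * K * norm (y - x)"
          using K(2)[of "f y" "g y - g x"] by (simp add: mult_ac)
        then show ?thesis using that by (simp add: divide_le_eq)
      qed
      then show "\<forall>\<^sub>F y in at x. norm (p (f y) (g y - g x) - p (f x) (g x - g x) - 0) / norm (y - x)
          \<le> (e y + M) * norm (g y - g x) * K"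
        using assms(3) by (auto simp: eventually_at_filter p.zero_left)
      show "((\<lambda>y. (e y + M) * norm (g y - g x) * K) \<longlongrightarrow> 0) (at x)"
        using tendsto_mult[OF tendsto_mult[OF tendsto_add[OF e tendsto_const[of M]] g] tendsto_const[of K]] by simp
    qed auto
  qed auto
  moreover have "((\<lambda>y. p (f y) (g x)) has_derivative (\<lambda>w. p (f' w) (g x))) (at x)"
    by (rule bounded_linear.has_derivative[OF p.bounded_linear_left assms(2)])
  ultimately have "((\<lambda>y. p (f y) (g y - g x) + p (f y) (g x)) has_derivative (\<lambda>w. 0 + p (f' w) (g x))) (at x)"
    by (rule has_derivative_add)
  then show ?thesis by (simp add: p.diff_right)
qed

section \<open>Linear systems with smooth coefficients\<close>

text \<open>X is known only as a solution of B X = \<beta>. With a left inverse G of B x the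
  equation reads X y = G (\<beta> y - (B y - B x) (X y)), where B y - B x tends to 0. This gives
  continuity of X first, and then differentiability through
  \<open>has_derivative_bilinear_vanishing\<close>.\<close>

lemma solve_differentiable:
  fixes B :: "'a::euclidean_space \<Rightarrow> 'b::euclidean_space \<Rightarrow>\<^sub>L 'b"
  assumes "open S" "x \<in> S" "\<And>y. y \<in> S \<Longrightarrow> blinfun_apply (B y) (X y) = \<beta> y"
    and inj: "\<And>u. blinfun_apply (B x) u = 0 \<Longrightarrow> u = 0"
  shows "isCont B x \<Longrightarrow> isCont \<beta> x \<Longrightarrow> isCont X x"
    and "B differentiable (at x) \<Longrightarrow> \<beta> differentiable (at x) \<Longrightarrow> X differentiable (at x)"
proof -
  have lin: "linear (blinfun_apply (B x))" by (rule bounded_linear.linear) (rule blinfun.bounded_linear_right)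
  have "inj (blinfun_apply (B x))" using inj linear_injective_0[OF lin] by blast
  then obtain G where G: "linear G" "G \<circ> blinfun_apply (B x) = id"
    using linear_injective_left_inverse[OF lin] by blast
  have GB: "G (blinfun_apply (B x) u) = u" for u using G(2) by (metis comp_apply id_apply)
  have bG: "bounded_linear G" using G(1) by (rule linear_conv_bounded_linear[THEN iffD1])
  obtain K where K: "K > 0" "\<And>u. norm (G u) \<le> norm u * K" using bounded_linear.pos_bounded[OF bG] by blast
  have Xy: "X y = G (\<beta> y - blinfun_apply (B y - B x) (X y))" if "y \<in> S" for y
    using assms(3)[OF that] GB[of "X y"] by (simp add: blinfun.diff_left)
  have ev: "\<forall>\<^sub>F y in at x. y \<in> S" using assms(1,2) by (simp add: eventually_at_in_open')
  have cont: "isCont X x" if B: "isCont B x" and b: "isCont \<beta> x"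
  proof -
    have tB: "((\<lambda>y. norm (B y - B x)) \<longlongrightarrow> 0) (at x)" using B by (simp add: isCont_def LIM_zero tendsto_norm_zero)
    have tb: "((\<lambda>y. norm (\<beta> y - \<beta> x)) \<longlongrightarrow> 0) (at x)" using b by (simp add: isCont_def LIM_zero tendsto_norm_zero)
    \<comment> \<open>With this bound the error term containing X y - X x is at most half of the
      left-hand side and can be absorbed there.\<close>
    have "\<forall>\<^sub>F y in at x. norm (B y - B x) < 1 / (2 * K)" using tB K(1) by (intro order_tendstoD) auto
    with ev have "\<forall>\<^sub>F y in at x. norm (X y - X x) \<le> 2 * K * (norm (\<beta> y - \<beta> x) + norm (B y - B x) * norm (X x))"
    proof eventually_elim
      case (elim y)
      have "X y - X x = G (\<beta> y - \<beta> x - blinfun_apply (B y - B x) (X y))"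
        using Xy[OF elim(1)] Xy[OF assms(2)] by (simp add: linear_diff[OF G(1)])
      then have "norm (X y - X x) \<le> norm (\<beta> y - \<beta> x - blinfun_apply (B y - B x) (X y)) * K"
        using K(2) by metis
      also have "\<dots> \<le> (norm (\<beta> y - \<beta> x) + norm (B y - B x) * norm (X y)) * K"
        using K(1) by (intro mult_right_mono order_trans[OF norm_triangle_ineq4] add_left_mono norm_blinfun) auto
      also have "\<dots> \<le> (norm (\<beta> y - \<beta> x) + norm (B y - B x) * (norm (X y - X x) + norm (X x))) * K"
        using K(1) norm_triangle_ineq[of "X y - X x" "X x"] by (intro mult_right_mono add_left_mono mult_left_mono) auto
      also have "\<dots> = K * (norm (\<beta> y - \<beta> x) + norm (B y - B x) * norm (X x)) + K * norm (B y - B x) * norm (X y - X x)"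
        by (simp add: algebra_simps)
      also have "K * norm (B y - B x) * norm (X y - X x) \<le> 1 / 2 * norm (X y - X x)"
        using elim(2) K(1) by (intro mult_right_mono) (auto simp: field_simps)
      finally show ?case by simp
    qed
    moreover have "((\<lambda>y. 2 * K * (norm (\<beta> y - \<beta> x) + norm (B y - B x) * norm (X x))) \<longlongrightarrow> 0) (at x)"
      using tendsto_mult[OF tendsto_const[of "2 * K"] tendsto_add[OF tb tendsto_mult[OF tB tendsto_const[of "norm (X x)"]]]]
      by simp
    ultimately have "((\<lambda>y. X y - X x) \<longlongrightarrow> 0) (at x)" by (rule Lim_null_comparison)
    then show ?thesis by (simp add: isCont_def LIM_zero_iff)
  qed
  then show "isCont B x \<Longrightarrow> isCont \<beta> x \<Longrightarrow> isCont X x" .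
  assume B: "B differentiable (at x)" and b: "\<beta> differentiable (at x)"
  obtain B' b' where B': "(B has_derivative B') (at x)" and b': "(\<beta> has_derivative b') (at x)"
    using B b unfolding differentiable_def by blast
  have X: "isCont X x"
    using cont B' b' by (blast intro: has_derivative_continuous)
  have "((\<lambda>y. B y - B x) has_derivative (\<lambda>w. B' w - 0)) (at x)"
    by (intro has_derivative_diff B' has_derivative_const)
  then have "((\<lambda>y. blinfun_apply (B y - B x) (X y)) has_derivative (\<lambda>w. blinfun_apply (B' w - 0) (X x))) (at x)"
    by (rule has_derivative_bilinear_vanishing[OF bounded_bilinear_blinfun_apply _ _ X]) simp
  then have "((\<lambda>y. G (\<beta> y - blinfun_apply (B y - B x) (X y))) has_derivative
      (\<lambda>w. G (b' w - blinfun_apply (B' w - 0) (X x)))) (at x)"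
    by (intro bounded_linear.has_derivative[OF bG] has_derivative_diff b')
  then have "(X has_derivative (\<lambda>w. G (b' w - blinfun_apply (B' w - 0) (X x)))) (at x)"
    by (rule has_derivative_transform_within_open[OF _ assms(1,2)]) (use Xy in simp)
  then show "X differentiable (at x)" by (rule differentiableI)
qed

text \<open>Differentiating B X = \<beta> in the direction w gives a system for the derivative of X
  with the same B and a new right-hand side, in which X itself occurs with one derivative less.
  Hence the induction runs over all right-hand sides.\<close>

lemma Ck_on_solve:
  fixes B :: "'a::euclidean_space \<Rightarrow> 'b::euclidean_space \<Rightarrow>\<^sub>L 'b"
  assumes "open S" "smooth_on S B" "\<And>x u. x \<in> S \<Longrightarrow> blinfun_apply (B x) u = 0 \<Longrightarrow> u = 0"
    and "Ck_on n S \<beta>" "\<And>x. x \<in> S \<Longrightarrow> blinfun_apply (B x) (X x) = \<beta> x"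
  shows "Ck_on n S X"
  using assms(4,5)
proof (induction n arbitrary: \<beta> X)
  case 0
  have "isCont X x" if x: "x \<in> S" for x
  proof (rule solve_differentiable(1)[OF assms(1) x 0(2) assms(3)[OF x]])
    show "isCont B x" "isCont \<beta> x"
      using 0(1) smooth_on_continuous[OF assms(2)] x assms(1) continuous_on_eq_continuous_at by auto
  qed
  then show ?case by (simp add: continuous_at_imp_continuous_on)
next
  case (Suc n)
  have X': "(X has_derivative frechet_derivative X (at x)) (at x)" if x: "x \<in> S" for x
  proof -
    have "X differentiable (at x)"
      by (rule solve_differentiable(2)[OF assms(1) x Suc.prems(2) assms(3)[OF x]])
        (use smooth_on_has_derivative[OF assms(2) x] Ck_on_Suc_has_derivative[OF Suc.prems(1) x] in
          \<open>auto intro: differentiableI\<close>)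
    then show ?thesis by (simp add: frechet_derivative_works)
  qed
  have X: "Ck_on n S X" using Suc.IH[OF Ck_on_Suc_imp[OF Suc.prems(1)]] Suc.prems(2) by blast
  show ?case
  proof (rule Ck_on_SucI[OF assms(1) X'])
    fix w
    show "Ck_on n S (\<lambda>x. frechet_derivative X (at x) w)"
    proof (rule Suc.IH)
      have 1: "Ck_on n S (\<lambda>x. frechet_derivative B (at x) w)"
        using assms(2) unfolding smooth_on_def by (metis Ck_on.simps(2))
      have 2: "Ck_on n S (\<lambda>x. frechet_derivative \<beta> (at x) w)"
        using Suc.prems(1) by simp
      show "Ck_on n S (\<lambda>x. frechet_derivative \<beta> (at x) w + - blinfun_apply (frechet_derivative B (at x) w) (X x))"
        by (intro Ck_on_add assms(1) 2 Ck_on_bounded_linear_comp[OF assms(1) bounded_linear_minus[OF bounded_linear_ident]]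
              Ck_on_bilinear[OF assms(1) bounded_bilinear_blinfun_apply] 1 X)
      fix x assume x: "x \<in> S"
      have "((\<lambda>x. blinfun_apply (B x) (X x)) has_derivative
          (\<lambda>w. blinfun_apply (B x) (frechet_derivative X (at x) w) + blinfun_apply (frechet_derivative B (at x) w) (X x))) (at x)"
        by (rule bounded_bilinear.FDERIV[OF bounded_bilinear_blinfun_apply smooth_on_has_derivative[OF assms(2) x] X'[OF x]])
      then have "(\<beta> has_derivative
          (\<lambda>w. blinfun_apply (B x) (frechet_derivative X (at x) w) + blinfun_apply (frechet_derivative B (at x) w) (X x))) (at x)"
        by (rule has_derivative_transform_within_open[OF _ assms(1) x]) (use Suc.prems(2) in simp)
      from fun_cong[OF frechet_derivative_at[OF this], of w]
      show "blinfun_apply (B x) (frechet_derivative X (at x) w)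
          = frechet_derivative \<beta> (at x) w + - blinfun_apply (frechet_derivative B (at x) w) (X x)"
        by (simp add: algebra_simps)
    qed
  qed
qed

lemma smooth_on_solve:
  fixes B :: "'a::euclidean_space \<Rightarrow> 'b::euclidean_space \<Rightarrow>\<^sub>L 'b"
  assumes "open S" "smooth_on S B" "\<And>x u. x \<in> S \<Longrightarrow> blinfun_apply (B x) u = 0 \<Longrightarrow> u = 0"
    and "smooth_on S \<beta>" "\<And>x. x \<in> S \<Longrightarrow> blinfun_apply (B x) (X x) = \<beta> x"
  shows "smooth_on S X"
proof -
  have "Ck_on n S X" for n
    by (rule Ck_on_solve[OF assms(1-3) _ assms(5)]) (use assms(4) in \<open>auto simp: smooth_on_def\<close>)
  then show ?thesis by (simp add: smooth_on_def)
qed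

section \<open>Weighted integrals along segments\<close>

definition ray_dom :: "'a::euclidean_space set \<Rightarrow> ('a \<times> 'a) set" where
  "ray_dom Q = {(x, y). \<forall>t\<in>{0..1}. x + t *\<^sub>R y \<in> Q}"

lemma open_ray_dom:
  assumes "open Q" shows "open (ray_dom Q)"
  unfolding open_dist
proof
  fix z assume "z \<in> ray_dom Q"
  then obtain x y where z: "z = (x, y)" "\<forall>t\<in>{0..1}. x + t *\<^sub>R y \<in> Q" by (auto simp: ray_dom_def)
  have "compact ((\<lambda>t. x + t *\<^sub>R y) ` {0..1})"
    by (intro compact_continuous_image continuous_intros compact_Icc)
  then obtain e where e: "e > 0" "(\<Union>w\<in>(\<lambda>t. x + t *\<^sub>R y) ` {0..1}. cball w e) \<subseteq> Q"
    by (rule compact_subset_open_imp_cball_epsilon_subset[OF _ assms]) (use z in auto)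
  have "z' \<in> ray_dom Q" if "dist z' z < e / 2" for z'
  proof -
    obtain x' y' where z': "z' = (x', y')" by (cases z')
    have d: "dist x' x < e / 2" "dist y' y < e / 2"
      using that dist_fst_le[of z' z] dist_snd_le[of z' z] by (auto simp: z z')
    have "x' + t *\<^sub>R y' \<in> Q" if t: "t \<in> {0..1}" for t
    proof -
      have "dist (x' + t *\<^sub>R y') (x + t *\<^sub>R y) \<le> dist x' x + \<bar>t\<bar> * dist y' y"
        using norm_triangle_ineq[of "x' - x" "t *\<^sub>R (y' - y)"]
        unfolding dist_norm norm_scaleR[symmetric] by (simp add: scaleR_diff_right add_diff_add)
      also have "\<dots> \<le> dist x' x + 1 * dist y' y"
        using t by (intro add_left_mono mult_right_mono) auto
      finally have "x' + t *\<^sub>R y' \<in> cball (x + t *\<^sub>R y) e"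
        using d by (simp add: dist_commute)
      then show ?thesis using e(2) t by blast
    qed
    then show ?thesis by (simp add: ray_dom_def z')
  qed
  then show "\<exists>e>0. \<forall>z'. dist z' z < e \<longrightarrow> z' \<in> ray_dom Q" using e(1) by (intro exI[of _ "e / 2"]) auto
qed

text \<open>The weight t^i makes the family closed under differentiation: varying the direction of
  the ray produces a factor t and raises i by one, varying the base point leaves i
  unchanged.\<close>

definition ray_int :: "nat \<Rightarrow> ('a::euclidean_space \<Rightarrow> 'b::banach) \<Rightarrow> 'a \<times> 'a \<Rightarrow> 'b" where
  "ray_int i f z = integral {0..1} (\<lambda>t. t ^ i *\<^sub>R f (fst z + t *\<^sub>R snd z))"

lemma ray_continuous:
  fixes f :: "'a::euclidean_space \<Rightarrow> 'b::banach"
  assumes "continuous_on Q f" "z \<in> ray_dom Q"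
  shows "continuous_on {0..1} (\<lambda>t. f (fst z + t *\<^sub>R snd z))"
  by (rule continuous_on_compose2[OF assms(1)]) (use assms(2) in \<open>auto simp: ray_dom_def intro!: continuous_intros\<close>)

lemma ray_int_integrable:
  fixes f :: "'a::euclidean_space \<Rightarrow> 'b::banach"
  assumes "continuous_on Q f" "z \<in> ray_dom Q"
  shows "(\<lambda>t. t ^ i *\<^sub>R f (fst z + t *\<^sub>R snd z)) integrable_on {0..1}"
  by (intro integrable_continuous_real continuous_intros ray_continuous[OF assms])

lemma ray_int_has_derivative:
  fixes f :: "'a::euclidean_space \<Rightarrow> 'b::banach"
  assumes "open Q" "smooth_on Q f" "z \<in> ray_dom Q"
  shows "(ray_int i f has_derivative
    (\<lambda>w. \<Sum>b\<in>Basis. (fst w \<bullet> b) *\<^sub>R ray_int i (\<lambda>y. frechet_derivative f (at y) b) z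
                 + (snd w \<bullet> b) *\<^sub>R ray_int (Suc i) (\<lambda>y. frechet_derivative f (at y) b) z)) (at z)"
proof -
  obtain e where e: "e > 0" "ball z e \<subseteq> ray_dom Q"
    using open_ray_dom[OF assms(1)] assms(3) open_contains_ball by blast
  \<comment> \<open>Differentiation under the integral sign is carried out on a convex
    neighbourhood, hence on a ball.\<close>
  define U where "U = ball z e"
  have U: "\<And>z. z \<in> U \<Longrightarrow> z \<in> ray_dom Q" "z \<in> U" "open U" "convex U" using e by (auto simp: U_def)
  define fx where "fx z t = t ^ i *\<^sub>R (total_deriv f (fst z + t *\<^sub>R snd z) o\<^sub>L (fst_blinfun + t *\<^sub>R snd_blinfun))"
    for z :: "'a \<times> 'a" and t :: real
  have Q: "fst z + t *\<^sub>R snd z \<in> Q" if "z \<in> U" "t \<in> {0..1}" for z t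
    using U(1)[OF that(1)] that(2) by (auto simp: ray_dom_def)
  have fx_apply: "blinfun_apply (fx z t) w = t ^ i *\<^sub>R frechet_derivative f (at (fst z + t *\<^sub>R snd z)) (fst w + t *\<^sub>R snd w)"
    if "z \<in> U" "t \<in> {0..1}" for z t w
    using smooth_on_total_deriv_apply[OF assms(2) Q[OF that]]
    by (simp add: fx_def blinfun.scaleR_left blinfun.add_left fst_blinfun.rep_eq snd_blinfun.rep_eq)
  have 1: "((\<lambda>z. integral (cbox 0 1) (\<lambda>t. t ^ i *\<^sub>R f (fst z + t *\<^sub>R snd z))) has_derivative
      integral (cbox 0 1) (fx z)) (at z within U)"
  proof (rule leibniz_rule)
    fix y :: "'a \<times> 'a" and t :: real assume y: "y \<in> U" "t \<in> cbox 0 1"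
    then have t: "t \<in> {0..1}" by simp
    have "((\<lambda>z. fst z + t *\<^sub>R snd z) has_derivative (\<lambda>w. fst w + t *\<^sub>R snd w)) (at y within U)"
      by (auto intro!: derivative_eq_intros)
    from has_derivative_compose[OF this smooth_on_has_derivative[OF assms(2) Q[OF y(1) t]]]
    have "((\<lambda>z. t ^ i *\<^sub>R f (fst z + t *\<^sub>R snd z)) has_derivative
       (\<lambda>w. t ^ i *\<^sub>R frechet_derivative f (at (fst y + t *\<^sub>R snd y)) (fst w + t *\<^sub>R snd w))) (at y within U)"
      by (rule has_derivative_scaleR_right)
    then show "((\<lambda>z. t ^ i *\<^sub>R f (fst z + t *\<^sub>R snd z)) has_derivative blinfun_apply (fx y t)) (at y within U)"
      by (rule has_derivative_eq_rhs) (rule ext, rule fx_apply[OF y(1) t, symmetric])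
  next
    fix y assume "y \<in> U"
    then show "(\<lambda>t. t ^ i *\<^sub>R f (fst y + t *\<^sub>R snd y)) integrable_on cbox 0 1"
      using ray_int_integrable[OF smooth_on_continuous[OF assms(2)] U(1)] by simp
  next
    have "continuous_on (U \<times> cbox 0 1) (\<lambda>x. total_deriv f (fst (fst x) + snd x *\<^sub>R snd (fst x)))"
      by (rule continuous_on_compose2[OF smooth_on_continuous[OF smooth_on_total_deriv[OF assms(1,2)]]])
        (use Q in \<open>auto intro!: continuous_intros\<close>)
    then show "continuous_on (U \<times> cbox 0 1) (\<lambda>(x, t). fx x t)"
      unfolding fx_def case_prod_beta
      by (intro continuous_intros bounded_bilinear.continuous_on[OF bounded_bilinear_blinfun_compose])
  qed (use U in auto)
  have int: "fx z integrable_on {0..1}"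
    unfolding fx_def
    by (intro integrable_continuous_real continuous_intros bounded_bilinear.continuous_on[OF bounded_bilinear_blinfun_compose]
         ray_continuous[OF smooth_on_continuous[OF smooth_on_total_deriv[OF assms(1,2)]] assms(3)])
  have D: "(\<lambda>t. t ^ j *\<^sub>R frechet_derivative f (at (fst z + t *\<^sub>R snd z)) b) integrable_on {0..1}" for j b
    by (rule ray_int_integrable[OF smooth_on_continuous[OF smooth_on_deriv[OF assms(2)]] assms(3)])
  have 2: "blinfun_apply (integral (cbox 0 1) (fx z)) w =
      (\<Sum>b\<in>Basis. (fst w \<bullet> b) *\<^sub>R ray_int i (\<lambda>y. frechet_derivative f (at y) b) z
                 + (snd w \<bullet> b) *\<^sub>R ray_int (Suc i) (\<lambda>y. frechet_derivative f (at y) b) z)" for w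
  proof -
    have "blinfun_apply (integral {0..1} (fx z)) w = integral {0..1} (\<lambda>t. blinfun_apply (fx z t) w)"
      using integral_linear[OF int, of "\<lambda>T. blinfun_apply T w"] by (simp add: o_def bounded_linear_apply_blinfun)
    also have "\<dots> = integral {0..1} (\<lambda>t. \<Sum>b\<in>Basis. (fst w \<bullet> b) *\<^sub>R t ^ i *\<^sub>R frechet_derivative f (at (fst z + t *\<^sub>R snd z)) b
        + (snd w \<bullet> b) *\<^sub>R t ^ Suc i *\<^sub>R frechet_derivative f (at (fst z + t *\<^sub>R snd z)) b)"
    proof (rule integral_cong)
      fix t :: real assume t: "t \<in> {0..1}"
      have lin: "linear (frechet_derivative f (at (fst z + t *\<^sub>R snd z)))"
        using smooth_on_has_derivative[OF assms(2) Q[OF U(2) t]] has_derivative_linear by blast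
      show "blinfun_apply (fx z t) w = (\<Sum>b\<in>Basis. (fst w \<bullet> b) *\<^sub>R t ^ i *\<^sub>R frechet_derivative f (at (fst z + t *\<^sub>R snd z)) b
        + (snd w \<bullet> b) *\<^sub>R t ^ Suc i *\<^sub>R frechet_derivative f (at (fst z + t *\<^sub>R snd z)) b)"
        unfolding fx_apply[OF U(2) t]
        by (subst linear_euclidean_expand[OF lin]) (simp add: scaleR_sum_right inner_add_left algebra_simps)
    qed
    also have "\<dots> = (\<Sum>b\<in>Basis. (fst w \<bullet> b) *\<^sub>R ray_int i (\<lambda>y. frechet_derivative f (at y) b) z
                 + (snd w \<bullet> b) *\<^sub>R ray_int (Suc i) (\<lambda>y. frechet_derivative f (at y) b) z)"
      unfolding ray_int_def
      by (intro integral_unique has_integral_sum has_integral_add has_integral_cmul integrable_integral D finite_Basis)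
    finally show ?thesis by simp
  qed
  have "(at z within U) = at z" using U(2,3) by (rule at_within_open)
  then have "(ray_int i f has_derivative blinfun_apply (integral (cbox 0 1) (fx z))) (at z)"
    using 1 by (simp add: ray_int_def[abs_def])
  then show ?thesis by (rule has_derivative_eq_rhs) (rule ext, rule 2)
qed

lemma smooth_on_ray_int:
  fixes f :: "'a::euclidean_space \<Rightarrow> 'b::banach"
  assumes "open Q" "smooth_on Q f"
  shows "smooth_on (ray_dom Q) (ray_int i f)"
proof -
  note o = open_ray_dom[OF assms(1)]
  have "Ck_on n (ray_dom Q) (ray_int i f)" for n
    using assms(2)
  proof (induction n arbitrary: i f)
    case 0
    then show ?case
      using has_derivative_continuous[OF ray_int_has_derivative[OF assms(1) 0]]
      by (simp add: continuous_at_imp_continuous_on)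
  next
    case (Suc n)
    show ?case
      by (rule Ck_on_SucI[OF o ray_int_has_derivative[OF assms(1) Suc.prems]])
        (auto intro!: Ck_on_sum[OF o] Ck_on_add[OF o] Suc.IH smooth_on_deriv[OF Suc.prems]
           Ck_on_bounded_linear_comp[OF o bounded_linear_scaleR_right])
  qed
  then show ?thesis by (simp add: smooth_on_def)
qed

section \<open>Taylor expansion\<close>

text \<open>The i-th derivative of f at x with all arguments equal to p, without the factor 1 / i!.
  The expansion in \<open>Basis\<close> makes it visibly a polynomial of degree i in the coordinates
  of p, into which trigonometric polynomials can be inserted.\<close>

primrec taylor_term :: "nat \<Rightarrow> ('a::euclidean_space \<Rightarrow> 'b::real_normed_vector) \<Rightarrow> 'a \<Rightarrow> 'a \<Rightarrow> 'b" where
  "taylor_term 0 f x p = f x"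
| "taylor_term (Suc i) f x p =
     (\<Sum>b\<in>Basis. (p \<bullet> b) *\<^sub>R taylor_term i (\<lambda>y. frechet_derivative f (at y) b) x p)"

lemma smooth_on_bounded:
  assumes "smooth_on Q f" "compact K" "K \<subseteq> Q"
  obtains C where "C \<ge> 0" "\<And>x. x \<in> K \<Longrightarrow> norm (f x) \<le> C"
proof -
  have "bounded (f ` K)"
    using assms by (meson compact_continuous_image compact_imp_bounded continuous_on_subset smooth_on_continuous)
  then obtain C where "\<And>x. x \<in> K \<Longrightarrow> norm (f x) \<le> C" unfolding bounded_iff by blast
  then show ?thesis by (intro that[of "max C 0"]) (auto simp: le_max_iff_disj)
qed

lemma taylor_term_bound:
  fixes f :: "'a::euclidean_space \<Rightarrow> 'b::real_normed_vector"
  assumes "smooth_on Q f" "compact K" "K \<subseteq> Q"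
  shows "\<exists>C\<ge>0. \<forall>x\<in>K. \<forall>p. norm (taylor_term i f x p) \<le> C * norm p ^ i"
  using assms(1)
proof (induction i arbitrary: f)
  case 0
  then obtain C where "C \<ge> 0" "\<And>x. x \<in> K \<Longrightarrow> norm (f x) \<le> C"
    using smooth_on_bounded assms by blast
  then show ?case by auto
next
  case (Suc i)
  then have "\<exists>C\<ge>0. \<forall>x\<in>K. \<forall>p. norm (taylor_term i (\<lambda>y. frechet_derivative f (at y) b) x p) \<le> C * norm p ^ i" for b
    using smooth_on_deriv by blast
  then obtain C where C: "\<And>b. C b \<ge> 0"
    "\<And>b x p. x \<in> K \<Longrightarrow> norm (taylor_term i (\<lambda>y. frechet_derivative f (at y) b) x p) \<le> C b * norm p ^ i"
    by metis
  show ?case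
  proof (intro exI[of _ "\<Sum>b\<in>Basis. C b"] conjI ballI allI)
    show "(\<Sum>b\<in>Basis. C b) \<ge> 0" using C(1) by (intro sum_nonneg)
    fix x p assume x: "x \<in> K"
    have "norm (taylor_term (Suc i) f x p) \<le> (\<Sum>b\<in>Basis. norm p * (C b * norm p ^ i))"
      unfolding taylor_term.simps
      by (rule sum_norm_le) (auto intro!: mult_mono C(2)[OF x] Basis_le_norm)
    then show "norm (taylor_term (Suc i) f x p) \<le> (\<Sum>b\<in>Basis. C b) * norm p ^ Suc i"
      by (simp add: sum_distrib_left sum_distrib_right mult_ac)
  qed
qed

text \<open>A homogeneous polynomial of degree i + 1 has a Lipschitz constant of order r^i on the
  ball of radius r. For i \<ge> 1 this power of r is the gain recorded in
  \<open>taylor_approx\<close>.\<close>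

lemma taylor_term_lipschitz:
  fixes f :: "'a::euclidean_space \<Rightarrow> 'b::real_normed_vector"
  assumes "smooth_on Q f" "compact K" "K \<subseteq> Q"
  shows "\<exists>C\<ge>0. \<forall>x\<in>K. \<forall>p p' r. norm p \<le> r \<longrightarrow> norm p' \<le> r \<longrightarrow>
    norm (taylor_term (Suc i) f x p - taylor_term (Suc i) f x p') \<le> C * r ^ i * norm (p - p')"
  using assms(1)
proof (induction i arbitrary: f)
  case 0
  have "\<exists>C\<ge>0. \<forall>x\<in>K. norm (frechet_derivative f (at x) b) \<le> C" for b
    using smooth_on_bounded[OF smooth_on_deriv[OF 0] assms(2,3)] by metis
  then obtain C where C: "\<And>b. C b \<ge> 0" "\<And>b x. x \<in> K \<Longrightarrow> norm (frechet_derivative f (at x) b) \<le> C b"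
    by metis
  show ?case
  proof (intro exI[of _ "\<Sum>b\<in>Basis. C b"] conjI ballI allI impI)
    show "(\<Sum>b\<in>Basis. C b) \<ge> 0" using C(1) by (intro sum_nonneg)
    fix x p p' :: 'a and r :: real assume x: "x \<in> K"
    have "taylor_term (Suc 0) f x p - taylor_term (Suc 0) f x p'
        = (\<Sum>b\<in>Basis. ((p - p') \<bullet> b) *\<^sub>R frechet_derivative f (at x) b)"
      by (simp add: sum_subtractf[symmetric] inner_diff_left scaleR_left_diff_distrib)
    moreover have "norm (\<Sum>b\<in>Basis. ((p - p') \<bullet> b) *\<^sub>R frechet_derivative f (at x) b)
        \<le> (\<Sum>b\<in>Basis. norm (p - p') * C b)"
      by (rule sum_norm_le) (auto intro!: mult_mono C(2)[OF x] Basis_le_norm)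
    ultimately show "norm (taylor_term (Suc 0) f x p - taylor_term (Suc 0) f x p')
        \<le> (\<Sum>b\<in>Basis. C b) * r ^ 0 * norm (p - p')"
      by (simp add: sum_distrib_left sum_distrib_right mult_ac)
  qed
next
  case (Suc i)
  let ?D = "\<lambda>(b::'a) y. frechet_derivative f (at y) b"
  have "\<exists>C\<ge>0. \<forall>x\<in>K. \<forall>p p' r. norm p \<le> r \<longrightarrow> norm p' \<le> r \<longrightarrow>
    norm (taylor_term (Suc i) (?D b) x p - taylor_term (Suc i) (?D b) x p') \<le> C * r ^ i * norm (p - p')" for b
    using Suc.IH[OF smooth_on_deriv[OF Suc.prems]] .
  then obtain C where C: "\<And>b. C b \<ge> 0"
    "\<And>b x p p' r. x \<in> K \<Longrightarrow> norm p \<le> r \<Longrightarrow> norm p' \<le> r \<Longrightarrow>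
      norm (taylor_term (Suc i) (?D b) x p - taylor_term (Suc i) (?D b) x p') \<le> C b * r ^ i * norm (p - p')"
    by metis
  have "\<exists>C\<ge>0. \<forall>x\<in>K. \<forall>p. norm (taylor_term (Suc i) (?D b) x p) \<le> C * norm p ^ Suc i" for b
    by (rule taylor_term_bound[OF smooth_on_deriv[OF Suc.prems] assms(2,3)])
  then obtain C' where C': "\<And>b. C' b \<ge> 0"
    "\<And>b x p. x \<in> K \<Longrightarrow> norm (taylor_term (Suc i) (?D b) x p) \<le> C' b * norm p ^ Suc i"
    by metis
  show ?case
  proof (intro exI[of _ "\<Sum>b\<in>Basis. C b + C' b"] conjI ballI allI impI)
    show "(\<Sum>b\<in>Basis. C b + C' b) \<ge> 0" using C(1) C'(1) by (intro sum_nonneg add_nonneg_nonneg)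
    fix x p p' :: 'a and r :: real assume x: "x \<in> K" and p: "norm p \<le> r" "norm p' \<le> r"
    then have r: "r \<ge> 0" using norm_ge_zero order_trans by blast
    let ?T = "\<lambda>b (p::'a). taylor_term (Suc i) (?D b) x p"
    have "taylor_term (Suc (Suc i)) f x p - taylor_term (Suc (Suc i)) f x p'
        = (\<Sum>b\<in>Basis. ((p - p') \<bullet> b) *\<^sub>R ?T b p + (p' \<bullet> b) *\<^sub>R (?T b p - ?T b p'))"
      unfolding taylor_term.simps(2)[of "Suc i" f] sum_subtractf[symmetric]
      by (intro sum.cong refl) (simp add: inner_diff_left algebra_simps del: taylor_term.simps)
    moreover have "norm (\<Sum>b\<in>Basis. ((p - p') \<bullet> b) *\<^sub>R ?T b p + (p' \<bullet> b) *\<^sub>R (?T b p - ?T b p'))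
        \<le> (\<Sum>b\<in>Basis. (C b + C' b) * r ^ Suc i * norm (p - p'))"
    proof (rule sum_norm_le)
      fix b :: 'a assume b: "b \<in> Basis"
      have "norm (((p - p') \<bullet> b) *\<^sub>R ?T b p) \<le> norm (p - p') * (C' b * r ^ Suc i)"
        unfolding norm_scaleR
        by (intro mult_mono order_trans[OF C'(2)[OF x]] mult_left_mono power_mono Basis_le_norm b C'(1) p r)
           (auto intro!: C'(1) r mult_nonneg_nonneg)
      moreover have "norm ((p' \<bullet> b) *\<^sub>R (?T b p - ?T b p')) \<le> r * (C b * r ^ i * norm (p - p'))"
        unfolding norm_scaleR real_norm_def
        by (intro mult_mono C(2) x p r) (auto intro!: order_trans[OF Basis_le_norm[OF b] p(2)])
      ultimately show "norm (((p - p') \<bullet> b) *\<^sub>R ?T b p + (p' \<bullet> b) *\<^sub>R (?T b p - ?T b p'))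
          \<le> (C b + C' b) * r ^ Suc i * norm (p - p')"
        by (intro order_trans[OF norm_triangle_ineq]) (simp add: algebra_simps del: taylor_term.simps)
    qed
    ultimately show "norm (taylor_term (Suc (Suc i)) f x p - taylor_term (Suc (Suc i)) f x p')
        \<le> (\<Sum>b\<in>Basis. C b + C' b) * r ^ Suc i * norm (p - p')"
      by (simp only: sum_distrib_right)
  qed
qed

text \<open>The t-derivative of the remainder of order k + 1 is a combination of the remainders of
  order k of the directional derivatives, with the coordinates of p as coefficients. Keeping t as a
  variable lets the mean value inequality close the induction.\<close>

lemma taylor_remainder_ray:
  fixes f :: "'a::euclidean_space \<Rightarrow> 'b::real_normed_vector"
  assumes "smooth_on Q f" "open Q" "compact K" "K \<subseteq> Q"
  shows "\<exists>C\<ge>0. \<forall>x p. (\<forall>t\<in>{0..1}. x + t *\<^sub>R p \<in> K) \<longrightarrow>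
    (\<forall>t\<in>{0..1}. norm (f (x + t *\<^sub>R p) - (\<Sum>i<k. (t ^ i / fact i) *\<^sub>R taylor_term i f x p)) \<le> C * norm p ^ k)"
  using assms(1)
proof (induction k arbitrary: f)
  case 0
  then obtain C where "C \<ge> 0" "\<And>x. x \<in> K \<Longrightarrow> norm (f x) \<le> C"
    using smooth_on_bounded assms by blast
  then show ?case by auto
next
  case (Suc k)
  let ?D = "\<lambda>(b::'a) y. frechet_derivative f (at y) b"
  define R where "R k f x p t = f (x + t *\<^sub>R p) - (\<Sum>i<k. (t ^ i / fact i) *\<^sub>R taylor_term i f x p)"
    for k and f :: "'a \<Rightarrow> 'b" and x p t
  have "\<exists>C\<ge>0. \<forall>x p. (\<forall>t\<in>{0..1}. x + t *\<^sub>R p \<in> K) \<longrightarrow> (\<forall>t\<in>{0..1}. norm (R k (?D b) x p t) \<le> C * norm p ^ k)" for b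
    using Suc.IH[OF smooth_on_deriv[OF Suc.prems]] unfolding R_def .
  then obtain C where C: "\<And>b. C b \<ge> 0"
    "\<And>b x p t. \<forall>t\<in>{0..1}. x + t *\<^sub>R p \<in> K \<Longrightarrow> t \<in> {0..1} \<Longrightarrow> norm (R k (?D b) x p t) \<le> C b * norm p ^ k"
    by metis
  have "norm (R (Suc k) f x p t) \<le> (\<Sum>b\<in>Basis. C b) * norm p ^ Suc k"
    if K: "\<forall>t\<in>{0..1}. x + t *\<^sub>R p \<in> K" and t: "t \<in> {0..1}" for x p t
  proof -
    define R' where "R' s = (\<Sum>b\<in>Basis. (p \<bullet> b) *\<^sub>R R k (?D b) x p s)" for s
    have der: "(R (Suc k) f x p has_vector_derivative R' s) (at s within {0..1})" if "s \<in> {0..1}" for s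
    proof -
      have xs: "x + s *\<^sub>R p \<in> Q" using K that assms(4) by blast
      note f' = smooth_on_has_derivative[OF Suc.prems xs]
      have "((\<lambda>s. x + s *\<^sub>R p) has_derivative (\<lambda>h. h *\<^sub>R p)) (at s within {0..1})"
        by (auto intro!: derivative_eq_intros)
      from has_derivative_compose[OF this f']
      have 1: "((\<lambda>s. f (x + s *\<^sub>R p)) has_vector_derivative frechet_derivative f (at (x + s *\<^sub>R p)) p) (at s within {0..1})"
        unfolding has_vector_derivative_def
        by (rule has_derivative_eq_rhs) (simp add: linear_scale[OF has_derivative_linear[OF f']])
      have 2: "((\<lambda>s. (s ^ Suc i / fact (Suc i)) *\<^sub>R c) has_vector_derivative (s ^ i / fact i) *\<^sub>R c) (at s within {0..1})"
        for i and c :: 'b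
      proof -
        have "((\<lambda>s. s ^ Suc i / fact (Suc i)) has_field_derivative s ^ i / fact i) (at s within {0..1})"
          using DERIV_cdivide[OF DERIV_pow[of "Suc i" s "{0..1}"], of "fact (Suc i)"]
          by (simp add: fact_Suc del: of_nat_Suc)
        then show ?thesis
          using has_vector_derivative_scaleR[OF _ has_vector_derivative_const, of _ _ s "{0..1}" c] by fastforce
      qed
      have 3: "R (Suc k) f x p = (\<lambda>s. f (x + s *\<^sub>R p) - (f x + (\<Sum>i<k. (s ^ Suc i / fact (Suc i)) *\<^sub>R taylor_term (Suc i) f x p)))"
        by (simp add: R_def fun_eq_iff sum.lessThan_Suc_shift del: sum.lessThan_Suc taylor_term.simps(2))
      have "(R (Suc k) f x p has_vector_derivative frechet_derivative f (at (x + s *\<^sub>R p)) p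
            - (0 + (\<Sum>i<k. (s ^ i / fact i) *\<^sub>R taylor_term (Suc i) f x p))) (at s within {0..1})"
        unfolding 3
        by (intro has_vector_derivative_diff has_vector_derivative_add has_vector_derivative_sum
              has_vector_derivative_const 1 2)
      moreover have "frechet_derivative f (at (x + s *\<^sub>R p)) p = (\<Sum>b\<in>Basis. (p \<bullet> b) *\<^sub>R ?D b (x + s *\<^sub>R p))"
        by (rule linear_euclidean_expand[OF has_derivative_linear[OF f']])
      moreover have "(\<Sum>i<k. (s ^ i / fact i) *\<^sub>R taylor_term (Suc i) f x p)
          = (\<Sum>b\<in>Basis. (p \<bullet> b) *\<^sub>R (\<Sum>i<k. (s ^ i / fact i) *\<^sub>R taylor_term i (?D b) x p))"
        unfolding taylor_term.simps scaleR_sum_right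
        by (subst sum.swap) (simp add: mult.commute)
      ultimately show ?thesis
        unfolding R'_def R_def by (simp add: scaleR_right_diff_distrib sum_subtractf)
    qed
    have bound: "norm (R' s) \<le> (\<Sum>b\<in>Basis. C b) * norm p ^ Suc k" if "s \<in> {0..1}" for s
    proof -
      have "norm (R' s) \<le> (\<Sum>b\<in>Basis. norm p * (C b * norm p ^ k))"
        unfolding R'_def
        by (rule sum_norm_le) (auto intro!: mult_mono C(2) K that Basis_le_norm)
      then show ?thesis by (simp add: sum_distrib_left sum_distrib_right mult_ac)
    qed
    have "norm (R (Suc k) f x p t - R (Suc k) f x p 0) \<le> (\<Sum>b\<in>Basis. C b) * norm p ^ Suc k * norm (t - 0)"
    proof (rule differentiable_bound[of "{0..1}" _ "\<lambda>s h. h *\<^sub>R R' s"])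
      show "(R (Suc k) f x p has_derivative (\<lambda>h. h *\<^sub>R R' s)) (at s within {0..1})" if "s \<in> {0..1}" for s
        using der[OF that] unfolding has_vector_derivative_def .
      show "onorm (\<lambda>h. h *\<^sub>R R' s) \<le> (\<Sum>b\<in>Basis. C b) * norm p ^ Suc k" if "s \<in> {0..1}" for s
        using bound[OF that] onorm_scaleR_left[of "\<lambda>h::real. h" "R' s"] by (simp add: onorm_id bounded_linear_ident)
    qed (use t in auto)
    moreover have "R (Suc k) f x p 0 = 0"
      by (simp add: R_def sum.lessThan_Suc_shift del: sum.lessThan_Suc)
    moreover have "(\<Sum>b\<in>Basis. C b) * norm p ^ Suc k * norm (t - 0) \<le> (\<Sum>b\<in>Basis. C b) * norm p ^ Suc k * 1"
      using t C(1) by (intro mult_left_mono) (auto intro!: mult_nonneg_nonneg sum_nonneg)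
    ultimately show ?thesis by simp
  qed
  then show ?case
    using C(1) unfolding R_def by (intro exI[of _ "\<Sum>b\<in>Basis. C b"] conjI) (auto intro: sum_nonneg)
qed

lemma taylor_remainder:
  fixes f :: "'a::euclidean_space \<Rightarrow> 'b::real_normed_vector"
  assumes "smooth_on Q f" "open Q" "compact K" "K \<subseteq> Q"
  shows "\<exists>C\<ge>0. \<forall>x p. (\<forall>t\<in>{0..1}. x + t *\<^sub>R p \<in> K) \<longrightarrow>
    norm (f (x + p) - (\<Sum>i<k. (1 / fact i) *\<^sub>R taylor_term i f x p)) \<le> C * norm p ^ k"
proof -
  from taylor_remainder_ray[OF assms, of k] obtain C where "C \<ge> 0"
    and C: "\<And>x p t. \<forall>t\<in>{0..1}. x + t *\<^sub>R p \<in> K \<Longrightarrow> t \<in> {0..1} \<Longrightarrow>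
      norm (f (x + t *\<^sub>R p) - (\<Sum>i<k. (t ^ i / fact i) *\<^sub>R taylor_term i f x p)) \<le> C * norm p ^ k"
    by blast
  then show ?thesis using C[of _ _ 1] by (intro exI[of _ C]) auto
qed

lemma compact_neighbourhood:
  fixes K :: "'a::euclidean_space set"
  assumes "compact K" "open Q" "K \<subseteq> Q"
  obtains r K' where "r > 0" "compact K'" "K' \<subseteq> Q" "\<And>x y. x \<in> K \<Longrightarrow> norm (y - x) \<le> r \<Longrightarrow> y \<in> K'"
proof -
  obtain r where r: "r > 0" "(\<Union>x\<in>K. cball x r) \<subseteq> Q"
    using compact_subset_open_imp_cball_epsilon_subset[OF assms] by blast
  have "compact (\<Union>x\<in>K. \<Union>y\<in>cball 0 r. {x + y})"
    by (rule compact_sums'[OF assms(1) compact_cball])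
  moreover have "(\<Union>x\<in>K. \<Union>y\<in>cball 0 r. {x + y}) = (\<Union>x\<in>K. cball x r)"
  proof -
    have "y \<in> cball x r \<longleftrightarrow> (\<exists>z\<in>cball 0 r. y = x + z)" for x y :: 'a
      by (rule iffI, intro bexI[of _ "y - x"]) (auto simp: dist_norm norm_minus_commute)
    then show ?thesis by blast
  qed
  ultimately have "compact (\<Union>x\<in>K. cball x r)" by simp
  moreover have "y \<in> (\<Union>x\<in>K. cball x r)" if "x \<in> K" "norm (y - x) \<le> r" for x y
    using that by (intro UN_I[of x]) (auto simp: dist_norm norm_minus_commute)
  ultimately show ?thesis using r by (intro that[of r "\<Union>x\<in>K. cball x r"]) auto
qed

text \<open>The multiplication of degrees is the source of the factor k in
  \<open>orbit_trig_polynomial_step\<close> and of \<open>Suc k\<close> in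
  \<open>window_defect\<close>.\<close>

lemma vtp_taylor_term:
  fixes f :: "'a::euclidean_space \<Rightarrow> 'b::euclidean_space"
  assumes "vtp D F"
  shows "vtp (i * D) (\<lambda>s \<phi>. taylor_term i f x (F s \<phi>))"
proof (induction i arbitrary: f)
  case 0
  show ?case by (simp add: vtp_const)
next
  case (Suc i)
  show ?case unfolding taylor_term.simps
    using vtp_scaleR[OF vtp_inner[OF assms] Suc.IH] by (intro vtp_sum) (simp add: add.commute)
qed

lemma taylor_term_1:
  "smooth_on Q f \<Longrightarrow> x \<in> Q \<Longrightarrow> taylor_term (Suc 0) f x p = frechet_derivative f (at x) p"
  using linear_euclidean_expand[OF has_derivative_linear[OF smooth_on_has_derivative], of Q f x p] by simp

text \<open>The approximation \<open>Z\<close> of the argument \<open>\<zeta>\<close> enters only the terms of order at least 2 in the second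
  estimate; hence an error of \<open>Z\<close> is improved by the factor \<open>\<rho>\<close>.\<close>

lemma taylor_approx:
  fixes f :: "'a::euclidean_space \<Rightarrow> 'b::real_normed_vector"
  assumes "smooth_on Q f" "open Q" "compact K" "K \<subseteq> Q"
  shows "\<exists>C r. C \<ge> 0 \<and> 0 < r \<and> r \<le> 1 \<and> (\<forall>x\<in>K. \<forall>\<zeta> Z \<rho>. norm \<zeta> \<le> \<rho> \<longrightarrow> norm Z \<le> \<rho> \<longrightarrow> \<rho> \<le> r \<longrightarrow>
     x + \<zeta> \<in> Q \<and>
     norm (f (x + \<zeta>) - (\<Sum>i<k. (1 / fact i) *\<^sub>R taylor_term i f x Z)) \<le> C * (\<rho> ^ k + norm (\<zeta> - Z)) \<and>
     norm (f (x + \<zeta>) - (\<Sum>i<k. (1 / fact i) *\<^sub>R taylor_term i f x (if i < 2 then \<zeta> else Z)))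
       \<le> C * (\<rho> ^ k + \<rho> * norm (\<zeta> - Z)))"
proof -
  obtain r K' where K': "r > 0" "compact K'" "K' \<subseteq> Q" "\<And>x y. x \<in> K \<Longrightarrow> norm (y - x) \<le> r \<Longrightarrow> y \<in> K'"
    using compact_neighbourhood[OF assms(3,2,4)] by blast
  obtain C1 where C1: "C1 \<ge> 0" "\<And>x p. \<forall>t\<in>{0..1}. x + t *\<^sub>R p \<in> K' \<Longrightarrow>
    norm (f (x + p) - (\<Sum>i<k. (1 / fact i) *\<^sub>R taylor_term i f x p)) \<le> C1 * norm p ^ k"
    using taylor_remainder[OF assms(1,2) K'(2,3), of k] by blast
  have "\<exists>C\<ge>0. \<forall>x\<in>K. \<forall>p p' r. norm p \<le> r \<longrightarrow> norm p' \<le> r \<longrightarrow>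
    norm (taylor_term (Suc i) f x p - taylor_term (Suc i) f x p') \<le> C * r ^ i * norm (p - p')" for i
    by (rule taylor_term_lipschitz[OF assms(1,3,4)])
  then obtain C2 where C2: "\<And>i. C2 i \<ge> 0" "\<And>i x p p' r. x \<in> K \<Longrightarrow> norm p \<le> r \<Longrightarrow> norm p' \<le> r \<Longrightarrow>
    norm (taylor_term (Suc i) f x p - taylor_term (Suc i) f x p') \<le> C2 i * r ^ i * norm (p - p')"
    by metis
  \<comment> \<open>For i = 0 the index i - 1 is 0; the term of order 0 does not depend on its
    argument, so any nonnegative constant serves for it.\<close>
  define C where "C = C1 + (\<Sum>i<k. C2 (i - 1))"
  have C: "C1 \<le> C" "(\<Sum>i<k. C2 (i - 1)) \<le> C" "C \<ge> 0"
    using C1(1) C2(1) by (auto simp: C_def sum_nonneg)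
  show ?thesis
  proof (rule exI[of _ C], rule exI[of _ "min r 1"], intro conjI ballI allI impI)
    fix x \<zeta> Z :: 'a and \<rho> :: real assume x: "x \<in> K" and \<zeta>: "norm \<zeta> \<le> \<rho>" and Z: "norm Z \<le> \<rho>" and \<rho>: "\<rho> \<le> min r 1"
    have \<rho>0: "\<rho> \<ge> 0" using \<zeta> norm_ge_zero order_trans by blast
    have ray: "x + t *\<^sub>R \<zeta> \<in> K'" if "t \<in> {0..1}" for t
    proof (rule K'(4)[OF x])
      have "norm (t *\<^sub>R \<zeta>) \<le> 1 * norm \<zeta>" unfolding norm_scaleR by (rule mult_right_mono) (use that in auto)
      then show "norm (x + t *\<^sub>R \<zeta> - x) \<le> r" using \<zeta> \<rho> by simp
    qed
    then show "x + \<zeta> \<in> Q" using ray[of 1] K'(3) by auto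
    have "norm (f (x + \<zeta>) - (\<Sum>i<k. (1 / fact i) *\<^sub>R taylor_term i f x \<zeta>)) \<le> C1 * norm \<zeta> ^ k"
      using C1(2) ray by blast
    also have "\<dots> \<le> C1 * \<rho> ^ k"
      by (intro mult_left_mono power_mono \<zeta> C1(1)) auto
    finally have 1: "norm (f (x + \<zeta>) - (\<Sum>i<k. (1 / fact i) *\<^sub>R taylor_term i f x \<zeta>)) \<le> C1 * \<rho> ^ k" .
    have diff: "norm ((1 / fact i) *\<^sub>R taylor_term i f x \<zeta> - (1 / fact i) *\<^sub>R taylor_term i f x Z)
        \<le> C2 (i - 1) * (\<rho> ^ (i - 1) * norm (\<zeta> - Z))" for i
    proof (cases i)
      case 0
      then show ?thesis using C2(1) \<rho>0 by (simp add: mult_nonneg_nonneg)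
    next
      case (Suc j)
      have "norm ((1 / fact i) *\<^sub>R taylor_term i f x \<zeta> - (1 / fact i) *\<^sub>R taylor_term i f x Z)
          = (1 / fact i) * norm (taylor_term i f x \<zeta> - taylor_term i f x Z)"
        by (simp add: scaleR_diff_right[symmetric] del: scaleR_diff_right)
      also have "\<dots> \<le> 1 * (C2 j * \<rho> ^ j * norm (\<zeta> - Z))"
        unfolding Suc by (intro mult_mono C2(2) x \<zeta> Z) (auto simp: divide_le_eq fact_ge_1 simp del: fact_Suc)
      finally show ?thesis by (simp add: Suc mult.assoc)
    qed
    have step: "norm (f (x + \<zeta>) - (\<Sum>i<k. (1 / fact i) *\<^sub>R taylor_term i f x (W i)))
        \<le> C * (\<rho> ^ k + d)"
      if W: "\<And>i. i < k \<Longrightarrow> norm ((1 / fact i) *\<^sub>R taylor_term i f x \<zeta> - (1 / fact i) *\<^sub>R taylor_term i f x (W i)) \<le> C2 (i - 1) * d"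
        and d: "d \<ge> 0" for W d
    proof -
      have "norm ((\<Sum>i<k. (1 / fact i) *\<^sub>R taylor_term i f x \<zeta>) - (\<Sum>i<k. (1 / fact i) *\<^sub>R taylor_term i f x (W i)))
          \<le> (\<Sum>i<k. C2 (i - 1) * d)"
        unfolding sum_subtractf[symmetric] by (rule sum_norm_le) (use W in auto)
      then have "norm (f (x + \<zeta>) - (\<Sum>i<k. (1 / fact i) *\<^sub>R taylor_term i f x (W i))) \<le> C1 * \<rho> ^ k + (\<Sum>i<k. C2 (i - 1)) * d"
        using norm_triangle_mono[OF 1] by (fastforce simp: sum_distrib_right)
      also have "\<dots> \<le> C * \<rho> ^ k + C * d"
        using C d \<rho>0 by (intro add_mono mult_right_mono) auto
      finally show ?thesis by (simp add: distrib_left)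
    qed
    show "norm (f (x + \<zeta>) - (\<Sum>i<k. (1 / fact i) *\<^sub>R taylor_term i f x Z)) \<le> C * (\<rho> ^ k + norm (\<zeta> - Z))"
    proof (rule step)
      fix i
      have "C2 (i - 1) * (\<rho> ^ (i - 1) * norm (\<zeta> - Z)) \<le> C2 (i - 1) * (1 * norm (\<zeta> - Z))"
        using \<rho>0 \<rho> C2(1) by (intro mult_left_mono mult_right_mono power_le_one) auto
      then show "norm ((1 / fact i) *\<^sub>R taylor_term i f x \<zeta> - (1 / fact i) *\<^sub>R taylor_term i f x Z) \<le> C2 (i - 1) * norm (\<zeta> - Z)"
        using diff[of i] by simp
    qed simp
    show "norm (f (x + \<zeta>) - (\<Sum>i<k. (1 / fact i) *\<^sub>R taylor_term i f x (if i < 2 then \<zeta> else Z)))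
       \<le> C * (\<rho> ^ k + \<rho> * norm (\<zeta> - Z))"
    proof (rule step)
      fix i
      show "norm ((1 / fact i) *\<^sub>R taylor_term i f x \<zeta> - (1 / fact i) *\<^sub>R taylor_term i f x (if i < 2 then \<zeta> else Z))
          \<le> C2 (i - 1) * (\<rho> * norm (\<zeta> - Z))"
      proof (cases "i < 2")
        case True
        then show ?thesis using C2(1) \<rho>0 by simp
      next
        case False
        then have "\<rho> ^ (i - 1) \<le> \<rho> ^ 1" using \<rho>0 \<rho> by (intro power_decreasing) auto
        then have "C2 (i - 1) * (\<rho> ^ (i - 1) * norm (\<zeta> - Z)) \<le> C2 (i - 1) * (\<rho> * norm (\<zeta> - Z))"
          using C2(1) by (intro mult_left_mono mult_right_mono) auto
        then show ?thesis using diff[of i] False by simp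
      qed
    qed (use \<rho>0 in simp)
  qed (use C K' in auto)
qed

section \<open>Rotating recurrences\<close>

text \<open>For a complex structure j this is exp (- \<phi> j), the rotation that the Lorentz map
  performs on velocities at h = 0.\<close>

definition rot :: "('a::real_vector \<Rightarrow> 'a) \<Rightarrow> real \<Rightarrow> 'a \<Rightarrow> 'a" where
  "rot j \<phi> v = cos \<phi> *\<^sub>R v - sin \<phi> *\<^sub>R j v"

lemma rot_0: "rot j 0 v = v"
  by (simp add: rot_def)

lemma rot_rot:
  assumes "linear j" "\<And>v. j (j v) = - v"
  shows "rot j \<phi> (rot j \<psi> v) = rot j (\<phi> + \<psi>) v"
  using assms(2)[of v]
  by (simp add: rot_def linear_diff[OF assms(1)] linear_scale[OF assms(1)] cos_add sin_add algebra_simps)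

lemma rot_add: "linear j \<Longrightarrow> rot j \<phi> (v + w) = rot j \<phi> v + rot j \<phi> w"
  by (simp add: rot_def linear_add algebra_simps)

lemma rot_diff: "linear j \<Longrightarrow> rot j \<phi> (v - w) = rot j \<phi> v - rot j \<phi> w"
  by (simp add: rot_def linear_diff algebra_simps)

lemma norm_rot_le:
  assumes "\<And>v. norm (j v) \<le> c * norm v" "c \<ge> 0"
  shows "norm (rot j \<phi> v) \<le> (1 + c) * norm v"
proof -
  have "norm (rot j \<phi> v) \<le> \<bar>cos \<phi>\<bar> * norm v + \<bar>sin \<phi>\<bar> * norm (j v)"
    unfolding rot_def by (intro order_trans[OF norm_triangle_ineq4]) simp
  also have "\<dots> \<le> 1 * norm v + 1 * (c * norm v)"
    using assms by (intro add_mono mult_mono) auto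
  finally show ?thesis by (simp add: distrib_right)
qed

lemma vtp_rot:
  assumes "vtp D F" "bounded_linear j"
  shows "vtp (Suc D) (\<lambda>s \<phi>. rot j (\<phi> + a) (F s \<phi>))"
    and "vtp (Suc D) (\<lambda>s \<phi>. rot j (- (\<phi> + a)) (F s \<phi>))"
proof -
  note c = vtp_shift[OF vtp_cos, of a] and s = vtp_shift[OF vtp_sin, of a]
  have 1: "vtp (Suc D) (\<lambda>s \<phi>. cos (\<phi> + a) *\<^sub>R F s \<phi>)" using vtp_scaleR[OF c assms(1)] by simp
  have 2: "vtp (Suc D) (\<lambda>s \<phi>. sin (\<phi> + a) *\<^sub>R j (F s \<phi>))"
    using vtp_scaleR[OF s vtp_linear[OF assms(2,1)]] by simp
  have m: "cos (- (\<phi> + a)) = cos (\<phi> + a)" "sin (- (\<phi> + a)) = - sin (\<phi> + a)" for \<phi>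
    by (rule cos_minus sin_minus)+
  show "vtp (Suc D) (\<lambda>s \<phi>. rot j (\<phi> + a) (F s \<phi>))"
    unfolding rot_def by (rule vtp_diff[OF 1 2])
  show "vtp (Suc D) (\<lambda>s \<phi>. rot j (- (\<phi> + a)) (F s \<phi>))"
    using vtp_add[OF 1 2] unfolding rot_def m by simp
qed

text \<open>Variation of constants: in the rotating frame, rot (- \<phi>) F satisfies a plain
  difference equation with right-hand side rot (- (\<phi> + \<alpha>)) G. The degree rises by one
  for each of the two changes of frame and by one for the difference equation; a constant added in
  the rotating frame adjusts the initial value.\<close>

lemma rotating_recurrence:
  fixes j :: "'a::euclidean_space \<Rightarrow> 'a"
  assumes "vtp D G" "nonres \<alpha>" "bounded_linear j" "\<And>v. j (j v) = - v"
  shows "\<exists>F. vtp (D + 3) F \<and> F 0 0 = v \<and> (\<forall>s \<phi>. F (s + 1) (\<phi> + \<alpha>) = rot j \<alpha> (F s \<phi>) + G s \<phi>)"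
proof -
  have lin: "linear j" using assms(3) by (rule bounded_linear.linear)
  note rr = rot_rot[OF lin assms(4)]
  obtain e where e: "vtp (Suc (Suc D)) e"
    "\<And>s \<phi>. e (s + 1) (\<phi> + \<alpha>) - e s \<phi> = rot j (- (\<phi> + \<alpha>)) (G s \<phi>)"
    using vtp_difference[OF vtp_rot(2)[OF assms(1,3)] assms(2)] by blast
  define F where "F s \<phi> = rot j (\<phi> + 0) (e s \<phi> - e 0 0 + v)" for s \<phi>
  show ?thesis
  proof (intro exI conjI allI)
    have "vtp (Suc (Suc D)) (\<lambda>s \<phi>. e s \<phi> - e 0 0 + v)"
      by (intro vtp_add vtp_diff vtp_const e)
    from vtp_rot(1)[OF this assms(3), of 0] show "vtp (D + 3) F"
      by (simp add: F_def[abs_def] numeral_3_eq_3)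
    show "F 0 0 = v" by (simp add: F_def rot_0)
    fix s \<phi>
    have "F (s + 1) (\<phi> + \<alpha>) = rot j (\<alpha> + \<phi>) ((e s \<phi> - e 0 0 + v) + rot j (- (\<phi> + \<alpha>)) (G s \<phi>))"
      using e(2)[of s \<phi>] by (simp add: F_def algebra_simps)
    also have "\<dots> = rot j \<alpha> (F s \<phi>) + G s \<phi>"
      unfolding rot_add[OF lin] F_def rr by (simp add: rot_0 add.commute)
    finally show "F (s + 1) (\<phi> + \<alpha>) = rot j \<alpha> (F s \<phi>) + G s \<phi>" .
  qed
qed

text \<open>A discrete Gronwall inequality. The horizon L is fixed while h tends to 0, so the factor
  \<rho> ^ L is only a constant.\<close>

lemma linear_recurrence_error:
  assumes "\<And>n. n < L \<Longrightarrow> norm (\<Delta> (Suc n)) \<le> \<rho> * norm (\<Delta> n) + \<epsilon>" "\<Delta> 0 = 0" "\<rho> \<ge> 1" "\<epsilon> \<ge> 0" "n \<le> L"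
  shows "norm (\<Delta> n) \<le> real L * \<rho> ^ L * \<epsilon>"
proof -
  have "norm (\<Delta> n) \<le> real n * \<rho> ^ n * \<epsilon>" using assms(5)
  proof (induction n)
    case (Suc n)
    have "1 \<le> \<rho> ^ Suc n" using assms(3) by (rule one_le_power)
    then have "1 * \<epsilon> \<le> \<rho> ^ Suc n * \<epsilon>" using assms(4) by (rule mult_right_mono)
    moreover have "norm (\<Delta> (Suc n)) \<le> \<rho> * (real n * \<rho> ^ n * \<epsilon>) + \<epsilon>"
      using assms(1)[of n] Suc assms(3) by (intro order_trans[OF assms(1)] add_right_mono mult_left_mono) auto
    ultimately show ?case by (simp add: algebra_simps)
  qed (use assms(2) in simp)
  also have "\<dots> \<le> real L * \<rho> ^ L * \<epsilon>"
    using assms(3-5) by (intro mult_right_mono mult_mono power_increasing) auto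
  finally show ?thesis .
qed

lemma norm_Pair_le: "norm (a, b) \<le> norm a + norm b"
  using norm_fst_le norm_snd_le sqrt_sum_squares_le_sum[of "norm a" "norm b"] by (simp add: norm_Pair)

lemma norm_quadruple_le:
  fixes a1 :: "'b::real_normed_vector" and a2 :: "'c::real_normed_vector"
    and a3 :: "'d::real_normed_vector" and a4 :: "'e::real_normed_vector"
  shows "norm (a1, a2, a3, a4) \<le> norm a1 + norm a2 + norm a3 + norm a4"
  using norm_Pair_le[of a1 "(a2, a3, a4)"] norm_Pair_le[of a2 "(a3, a4)"] norm_Pair_le[of a3 a4] by linarith

lemma window_sum0:
  assumes "window \<alpha> D L c c'"
  shows "(\<Sum>m\<le>L. c' m t) = 0"
proof -
  have "((\<lambda>t. \<Sum>m\<le>L. c m t) has_real_derivative (\<Sum>m\<le>L. c' m t)) (at t)"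
    using assms unfolding window_def by (intro DERIV_sum) blast
  then have "((\<lambda>t. 1) has_real_derivative (\<Sum>m\<le>L. c' m t)) (at t)"
    by (simp only: window_sum1[OF assms])
  then show ?thesis by (rule DERIV_unique[OF _ DERIV_const])
qed

lemma window_mono: "window \<alpha> D L c c' \<Longrightarrow> D' \<le> D \<Longrightarrow> window \<alpha> D' L c c'"
  unfolding window_def using tp_mono by blast

text \<open>With the coefficients of a window, \<open>t \<mapsto> avg c L q i t\<close> is a loop that replaces the phase \<open>i \<alpha>\<close> of \<open>q i\<close>
  by \<open>i \<alpha> + t\<close>, and \<open>c\<close> replaced by \<open>c'\<close> gives its velocity.\<close>

definition avg :: "(nat \<Rightarrow> real \<Rightarrow> real) \<Rightarrow> nat \<Rightarrow> (nat \<Rightarrow> 'a::real_vector) \<Rightarrow> nat \<Rightarrow> real \<Rightarrow> 'a" where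
  "avg c L q i t = (\<Sum>m\<le>L. c m t *\<^sub>R q (i + m))"

text \<open>Shifting the orbit and advancing the index are the same operation; this compatibility is
  what lets one-step defects telescope.\<close>

lemma avg_shift: "avg c L (\<lambda>n. q (Suc n)) i t = avg c L q (Suc i) t"
  by (simp add: avg_def)

lemma norm_avg_le:
  fixes v :: "nat \<Rightarrow> 'b::real_normed_vector"
  assumes "\<And>m. m \<le> L \<Longrightarrow> \<bar>c m\<bar> \<le> M" "\<And>m. m \<le> L \<Longrightarrow> norm (v m) \<le> B" "M \<ge> 0"
  shows "norm (\<Sum>m\<le>L. c m *\<^sub>R v m) \<le> real (Suc L) * M * B"
proof -
  have "norm (\<Sum>m\<le>L. c m *\<^sub>R v m) \<le> (\<Sum>m\<le>L. M * B)"
    by (rule sum_norm_le) (use assms in \<open>auto intro!: mult_mono\<close>)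
  then show ?thesis by (simp add: mult.assoc)
qed

lemma avg_has_vector_derivative:
  fixes q :: "nat \<Rightarrow> 'a::real_normed_vector"
  assumes "window \<alpha> D L c c'"
  shows "(avg c L q i has_vector_derivative avg c' L q i t) (at t within X)"
proof -
  have "((\<lambda>t. c m t *\<^sub>R v) has_vector_derivative c' m t *\<^sub>R v) (at t within X)" for m and v :: 'a
  proof -
    have "(c m has_real_derivative c' m t) (at t within X)"
      using assms unfolding window_def by (blast intro: has_field_derivative_at_within)
    then show ?thesis
      by (auto intro!: derivative_eq_intros simp: has_real_derivative_iff_has_vector_derivative)
  qed
  then show ?thesis unfolding avg_def[abs_def] by (intro has_vector_derivative_sum)
qed

lemma avg_continuous:
  fixes q :: "nat \<Rightarrow> 'a::real_normed_vector"
  assumes "window \<alpha> D L c c'"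
  shows "continuous_on X (avg c L q i)" "continuous_on X (avg c' L q i)"
proof -
  show "continuous_on X (avg c L q i)"
    using avg_has_vector_derivative[OF assms]
    by (intro continuous_on_vector_derivative[of X _ "avg c' L q i"]) blast
  have "continuous_on X (c' m)" for m
    using assms unfolding window_def by (blast intro: continuous_on_subset)
  then show "continuous_on X (avg c' L q i)"
    unfolding avg_def[abs_def] by (intro continuous_intros)
qed

text \<open>Linearised at the diagonal, \<open>f\<close> becomes after multiplication by \<open>A\<close> a recurrence that rotates the
  increments by the angle \<open>\<alpha>\<close>.\<close>

locale discrete_orbits =
  fixes f :: "'a::euclidean_space \<times> 'a \<times> 'a \<times> real \<Rightarrow> 'a"
    and \<Omega> :: "('a \<times> 'a \<times> 'a \<times> real) set"
    and K :: "'a set"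
    and j :: "'a \<Rightarrow> 'a \<Rightarrow> 'a"
    and \<alpha> :: real
    and A :: "'a \<Rightarrow> 'a \<Rightarrow> 'a"
    and b :: "'a \<Rightarrow> 'a"
    and orb :: "real \<Rightarrow> (nat \<Rightarrow> 'a) \<Rightarrow> bool"
    and C0 Cj CA :: real
  assumes f_smooth: "smooth_on \<Omega> f" and \<Omega>_open: "open \<Omega>"
    and K_compact: "compact K" and K_\<Omega>: "\<And>x. x \<in> K \<Longrightarrow> (x, x, x, 0) \<in> \<Omega>"
    and f_diag: "\<And>x. x \<in> K \<Longrightarrow> f (x, x, x, 0) = 0"
    and f_linear: "\<And>x p0 p1 p2 h. x \<in> K \<Longrightarrow>
      A x (frechet_derivative f (at (x, x, x, 0)) (p0, p1, p2, h)) = p2 - p1 - rot (j x) \<alpha> (p1 - p0) - h *\<^sub>R b x"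
    and A_linear: "\<And>x. x \<in> K \<Longrightarrow> bounded_linear (A x)"
    and A_bound: "\<And>x v. x \<in> K \<Longrightarrow> norm (A x v) \<le> CA * norm v" "CA \<ge> 0"
    and j_linear: "\<And>x. x \<in> K \<Longrightarrow> bounded_linear (j x)"
    and j_bound: "\<And>x v. x \<in> K \<Longrightarrow> norm (j x v) \<le> Cj * norm v" "Cj \<ge> 0"
    and j_j: "\<And>x v. x \<in> K \<Longrightarrow> j x (j x v) = - v"
    and nonres: "nonres \<alpha>"
    and orb_h: "\<And>h q. orb h q \<Longrightarrow> h > 0"
    and orb_K: "\<And>h q n. orb h q \<Longrightarrow> q n \<in> K"
    and orb_step: "\<And>h q n. orb h q \<Longrightarrow> norm (q (Suc n) - q n) \<le> C0 * h"
    and orb_f: "\<And>h q n. orb h q \<Longrightarrow> f (q n, q (Suc n), q (Suc (Suc n)), h) = 0"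
    and C0_nonneg: "C0 \<ge> 0"
begin

lemma orb_dist: "orb h q \<Longrightarrow> norm (q n - q 0) \<le> real n * C0 * h"
proof (induction n)
  case (Suc n)
  have "norm (q (Suc n) - q 0) \<le> norm (q (Suc n) - q n) + norm (q n - q 0)"
    using norm_triangle_ineq[of "q (Suc n) - q n" "q n - q 0"] by simp
  also have "\<dots> \<le> C0 * h + real n * C0 * h" using orb_step Suc by (intro add_mono) auto
  finally show ?case by (simp add: algebra_simps)
qed simp

abbreviation diag :: "'a \<Rightarrow> 'a \<times> 'a \<times> 'a \<times> real" where
  "diag x \<equiv> (x, x, x, 0)"

lemma diag_K: "compact (diag ` K)" "diag ` K \<subseteq> \<Omega>"
  using K_\<Omega> by (auto intro!: compact_continuous_image continuous_intros K_compact)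

definition triple :: "(real \<Rightarrow> real \<Rightarrow> 'a) \<Rightarrow> real \<Rightarrow> real \<Rightarrow> real \<Rightarrow> 'a \<times> 'a \<times> 'a \<times> real" where
  "triple F h s \<phi> = (F s \<phi>, F (s + 1) (\<phi> + \<alpha>), F (s + 2) (\<phi> + 2 * \<alpha>), h)"

lemma vtp_triple: "vtp D F \<Longrightarrow> vtp D (triple F h)"
  unfolding triple_def[abs_def] by (rule vtp_Pair[OF _ vtp_Pair[OF vtp_shift vtp_Pair[OF vtp_shift vtp_const]]])

definition displacement :: "(nat \<Rightarrow> 'a) \<Rightarrow> real \<Rightarrow> nat \<Rightarrow> 'a \<times> 'a \<times> 'a \<times> real" where
  "displacement q h n = (q n - q 0, q (Suc n) - q 0, q (Suc (Suc n)) - q 0, h)"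

lemma f_displacement: "orb h q \<Longrightarrow> f (diag (q 0) + displacement q h n) = 0"
  using orb_f by (simp add: displacement_def)

text \<open>No bound on the coefficients of F is available. Its size at the relevant indices is
  inherited from the orbit, which moves by O(h) per step; this explains the two summands of
  \<open>Cq\<close>. The indices reach L + 2 because f at n reads the points n, n + 1 and n +
  2.\<close>

lemma displacement_bounds:
  assumes "k \<ge> 1" and orb: "orb h q" and "h < 1" and "Ce \<ge> 0"
    and F: "\<And>n. n \<le> L + 2 \<Longrightarrow> norm (q n - q 0 - F (real n) (real n * \<alpha>)) \<le> Ce * h ^ k"
  defines "Cq \<equiv> real (L + 2) * C0 + Ce"
  shows "n \<le> L + 2 \<Longrightarrow> norm (F (real n) (real n * \<alpha>)) \<le> Cq * h"
    and "n \<le> L + 2 \<Longrightarrow> norm (q n - q 0) \<le> Cq * h"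
    and "n \<le> L \<Longrightarrow> norm (displacement q h n) \<le> (3 * Cq + 1) * h"
    and "n \<le> L \<Longrightarrow> norm (triple F h (real n) (real n * \<alpha>)) \<le> (3 * Cq + 1) * h"
    and "n \<le> L \<Longrightarrow> norm (displacement q h n - triple F h (real n) (real n * \<alpha>)) \<le> 3 * Ce * h ^ k"
proof -
  have h: "h > 0" "h < 1" using orb_h[OF orb] assms(3) by auto
  have Ce: "Ce \<ge> 0" by fact
  have hk: "h ^ k \<le> h" using h assms(1) power_decreasing[of 1 k h] by simp
  have Fn: "norm (F (real n) (real n * \<alpha>)) \<le> Cq * h" if "n \<le> L + 2" for n
  proof -
    have "norm (F (real n) (real n * \<alpha>)) \<le> norm (q n - q 0) + norm (q n - q 0 - F (real n) (real n * \<alpha>))"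
      using norm_triangle_ineq4[of "q n - q 0" "q n - q 0 - F (real n) (real n * \<alpha>)"] by simp
    also have "\<dots> \<le> real n * C0 * h + Ce * h ^ k"
      using orb_dist[OF orb, of n] F[OF that] by simp
    also have "\<dots> \<le> real (L + 2) * C0 * h + Ce * h"
      using that hk Ce C0_nonneg h by (intro add_mono mult_right_mono mult_left_mono) auto
    finally show ?thesis by (simp add: Cq_def algebra_simps)
  qed
  have qn: "norm (q n - q 0) \<le> Cq * h" if "n \<le> L + 2" for n
  proof -
    have "norm (q n - q 0) \<le> real n * C0 * h" by (rule orb_dist[OF orb])
    also have "\<dots> \<le> Cq * h" unfolding Cq_def
      using that Ce C0_nonneg h by (intro mult_right_mono order_trans[OF mult_right_mono[of "real n" "real (L + 2)" C0]]) auto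
    finally show ?thesis .
  qed
  have \<zeta>_bound: "norm (displacement q h n) \<le> (3 * Cq + 1) * h" if "n \<le> L" for n
    using norm_quadruple_le[of "q n - q 0" "q (Suc n) - q 0" "q (Suc (Suc n)) - q 0" h] qn[of n] qn[of "Suc n"] qn[of "Suc (Suc n)"] that h
    unfolding displacement_def by (simp add: algebra_simps)
  have shift: "(real n + 1) * \<alpha> = real n * \<alpha> + \<alpha>" "real (Suc n) = real n + 1" for n
    by (simp_all add: algebra_simps)
  have shift2: "(real n + 2) * \<alpha> = real n * \<alpha> + 2 * \<alpha>" "real (Suc (Suc n)) = real n + 2" for n
    by (simp_all add: algebra_simps)
  have Z_bound: "norm (triple F h (real n) (real n * \<alpha>)) \<le> (3 * Cq + 1) * h" if "n \<le> L" for n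
  proof -
    have "norm (F (real n) (real n * \<alpha>)) \<le> Cq * h"
      "norm (F (real n + 1) (real n * \<alpha> + \<alpha>)) \<le> Cq * h"
      "norm (F (real n + 2) (real n * \<alpha> + 2 * \<alpha>)) \<le> Cq * h"
      using Fn[of n] Fn[of "Suc n", unfolded shift[of n]] Fn[of "Suc (Suc n)", unfolded shift2[of n]] that by auto
    moreover have "(3 * Cq + 1) * h = 3 * (Cq * h) + h" by (simp add: algebra_simps)
    ultimately show ?thesis
      using norm_quadruple_le[of "F (real n) (real n * \<alpha>)" "F (real n + 1) (real n * \<alpha> + \<alpha>)" "F (real n + 2) (real n * \<alpha> + 2 * \<alpha>)" h]
        h unfolding triple_def by simp
  qed
  have \<zeta>Z: "norm (displacement q h n - triple F h (real n) (real n * \<alpha>)) \<le> 3 * Ce * h ^ k" if "n \<le> L" for n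
  proof -
    have "norm (q n - q 0 - F (real n) (real n * \<alpha>)) \<le> Ce * h ^ k"
      "norm (q (Suc n) - q 0 - F (real n + 1) (real n * \<alpha> + \<alpha>)) \<le> Ce * h ^ k"
      "norm (q (Suc (Suc n)) - q 0 - F (real n + 2) (real n * \<alpha> + 2 * \<alpha>)) \<le> Ce * h ^ k"
      using F[of n] F[of "Suc n", unfolded shift[of n]] F[of "Suc (Suc n)", unfolded shift2[of n]] that
      by auto
    then show ?thesis
      using norm_quadruple_le[of "q n - q 0 - F (real n) (real n * \<alpha>)" "q (Suc n) - q 0 - F (real n + 1) (real n * \<alpha> + \<alpha>)"
        "q (Suc (Suc n)) - q 0 - F (real n + 2) (real n * \<alpha> + 2 * \<alpha>)" "0::real"]
      unfolding triple_def displacement_def by (simp add: mult.assoc)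
  qed

  show "n \<le> L + 2 \<Longrightarrow> norm (F (real n) (real n * \<alpha>)) \<le> Cq * h" by (rule Fn)
  show "n \<le> L + 2 \<Longrightarrow> norm (q n - q 0) \<le> Cq * h" by (rule qn)
  show "n \<le> L \<Longrightarrow> norm (displacement q h n) \<le> (3 * Cq + 1) * h" by (rule \<zeta>_bound)
  show "n \<le> L \<Longrightarrow> norm (triple F h (real n) (real n * \<alpha>)) \<le> (3 * Cq + 1) * h" by (rule Z_bound)
  show "n \<le> L \<Longrightarrow> norm (displacement q h n - triple F h (real n) (real n * \<alpha>)) \<le> 3 * Ce * h ^ k" by (rule \<zeta>Z)
qed

text \<open>Bootstrapping in h. The linear part of f at the diagonal is evaluated on the true orbit,
  and only the terms of order at least 2 on its approximation, where one more power of h is gained.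
  After multiplication by \<open>A\<close> the increments satisfy, up to this error, a rotating
  recurrence whose forcing is a trigonometric polynomial. Its exact solution is then summed. In the
  degree, k D comes from the products in the Taylor terms, 3 from the recurrence and 1 from the
  summation.\<close>

lemma orbit_trig_polynomial_step:
  assumes "k \<ge> 1" and IH: "\<And>L. \<exists>C h0. C \<ge> 0 \<and> h0 > 0 \<and> (\<forall>h q. orb h q \<longrightarrow> h < h0 \<longrightarrow>
    (\<exists>F. vtp D F \<and> (\<forall>n\<le>L. norm (q n - q 0 - F (real n) (real n * \<alpha>)) \<le> C * h ^ k)))"
  shows "\<exists>C h0. C \<ge> 0 \<and> h0 > 0 \<and> (\<forall>h q. orb h q \<longrightarrow> h < h0 \<longrightarrow>
    (\<exists>F. vtp (k * D + 4) F \<and> (\<forall>n\<le>L. norm (q n - q 0 - F (real n) (real n * \<alpha>)) \<le> C * h ^ Suc k)))"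
proof -
  obtain C1 h1 where C1: "C1 \<ge> 0" "h1 > 0" "\<And>h q. orb h q \<Longrightarrow> h < h1 \<Longrightarrow>
    (\<exists>F. vtp D F \<and> (\<forall>n\<le>L + 2. norm (q n - q 0 - F (real n) (real n * \<alpha>)) \<le> C1 * h ^ k))"
    using IH[of "L + 2"] by blast
  obtain C2 r where C2: "C2 \<ge> 0" "r > 0" "r \<le> 1"
    "\<And>x \<zeta> Z \<rho>. x \<in> diag ` K \<Longrightarrow> norm \<zeta> \<le> \<rho> \<Longrightarrow> norm Z \<le> \<rho> \<Longrightarrow> \<rho> \<le> r \<Longrightarrow>
     norm (f (x + \<zeta>) - (\<Sum>i<Suc k. (1 / fact i) *\<^sub>R taylor_term i f x (if i < 2 then \<zeta> else Z)))
       \<le> C2 * (\<rho> ^ Suc k + \<rho> * norm (\<zeta> - Z))"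
    using taylor_approx[OF f_smooth \<Omega>_open diag_K, of "Suc k"] by blast
  define C3 where "C3 = 3 * (real (L + 2) * C0 + C1) + 1"
  define C4 where "C4 = CA * (C2 * (C3 ^ Suc k + C3 * (3 * C1)))"
  define C5 where "C5 = real L * (1 + Cj) ^ L * C4"
  have C3: "C3 > 0" using C0_nonneg C1(1) by (auto simp: C3_def intro!: add_nonneg_pos mult_nonneg_nonneg)
  have C4: "C4 \<ge> 0" using C3 C2(1) A_bound(2) C1(1) by (auto simp: C4_def intro!: mult_nonneg_nonneg add_nonneg_nonneg)
  have C5: "C5 \<ge> 0" using C4 j_bound(2) by (auto simp: C5_def)
  show ?thesis
  \<comment> \<open>The first witness has the shape delivered by
    \<open>linear_recurrence_error\<close>, with growth factor 1 because increments are merely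
    summed.\<close>
  proof (rule exI[of _ "real L * 1 ^ L * C5"], rule exI[of _ "min (min h1 1) (r / C3)"], intro conjI allI impI)
    show "0 \<le> real L * 1 ^ L * C5" using C5 by simp
    show "0 < min (min h1 1) (r / C3)" using C1 C2 C3 by simp
    fix h q assume orb: "orb h q" and h_small: "h < min (min h1 1) (r / C3)"
    then have h: "h > 0" "h < 1" "h < h1" "C3 * h < r"
      using orb_h[OF orb] C3 by (auto simp: field_simps)
    obtain F where F: "vtp D F" "\<And>n. n \<le> L + 2 \<Longrightarrow> norm (q n - q 0 - F (real n) (real n * \<alpha>)) \<le> C1 * h ^ k"
      using C1(3)[OF orb h(3)] by blast
    define x where "x = q 0"
    have x: "x \<in> K" unfolding x_def by (rule orb_K[OF orb])
    define Z where "Z = triple F h"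
    have Z: "vtp D Z" unfolding Z_def by (rule vtp_triple[OF F(1)])
    define \<zeta> where "\<zeta> n = displacement q h n" for n
    note bounds = displacement_bounds[where F = F and q = q and h = h and k = k and L = L and Ce = C1, OF assms(1) orb h(2) C1(1) F(2), folded Z_def \<zeta>_def]
    have \<zeta>_bound: "norm (\<zeta> n) \<le> C3 * h" "norm (Z (real n) (real n * \<alpha>)) \<le> C3 * h"
      and \<zeta>Z: "norm (\<zeta> n - Z (real n) (real n * \<alpha>)) \<le> 3 * C1 * h ^ k" if "n \<le> L" for n
      using bounds(3-5)[of n] that by (auto simp: C3_def)
    have shift: "(real n + 1) * \<alpha> = real n * \<alpha> + \<alpha>" "real (Suc n) = real n + 1" for n
      by (simp_all add: algebra_simps)
    define N where "N s \<phi> = (\<Sum>i\<in>{2..<Suc k}. (1 / fact i) *\<^sub>R taylor_term i f (diag x) (Z s \<phi>))" for s \<phi>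
    have N: "vtp (k * D) N" unfolding N_def[abs_def]
    proof (intro vtp_sum vtp_scaleR_const)
      fix i assume "i \<in> {2..<Suc k}"
      then show "vtp (k * D) (\<lambda>s \<phi>. taylor_term i f (diag x) (Z s \<phi>))"
        by (intro vtp_mono[OF vtp_taylor_term[OF Z]] mult_right_mono) auto
    qed
    define G where "G s \<phi> = h *\<^sub>R b x - A x (N s \<phi>)" for s \<phi>
    have G: "vtp (k * D) G" unfolding G_def[abs_def]
      by (intro vtp_diff vtp_const vtp_linear[OF A_linear[OF x] N])
    define \<delta> where "\<delta> n = q (Suc n) - q n" for n
    have \<delta>: "norm (\<delta> (Suc n) - rot (j x) \<alpha> (\<delta> n) - G (real n) (real n * \<alpha>)) \<le> C4 * h ^ Suc k" if n: "n \<le> L" for n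
    proof -
      let ?Z = "Z (real n) (real n * \<alpha>)"
      have f0: "f (diag x + \<zeta> n) = 0" unfolding x_def \<zeta>_def by (rule f_displacement[OF orb])
      have "norm (f (diag x + \<zeta> n) - (\<Sum>i<Suc k. (1 / fact i) *\<^sub>R taylor_term i f (diag x) (if i < 2 then \<zeta> n else ?Z)))
          \<le> C2 * ((C3 * h) ^ Suc k + C3 * h * norm (\<zeta> n - ?Z))"
        by (rule C2(4)) (use x \<zeta>_bound[OF n]  h in auto)
      also have "\<dots> \<le> C2 * ((C3 * h) ^ Suc k + C3 * h * (3 * C1 * h ^ k))"
        using C2(1) C3 h(1) \<zeta>Z[OF n] by (intro mult_left_mono add_left_mono) auto
      also have "\<dots> = C2 * (C3 ^ Suc k + C3 * (3 * C1)) * h ^ Suc k"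
        by (simp add: power_mult_distrib algebra_simps)
      finally have 1: "norm (f (diag x + \<zeta> n) - (\<Sum>i<Suc k. (1 / fact i) *\<^sub>R taylor_term i f (diag x) (if i < 2 then \<zeta> n else ?Z)))
          \<le> C2 * (C3 ^ Suc k + C3 * (3 * C1)) * h ^ Suc k" .
      have 2: "(\<Sum>i<Suc k. (1 / fact i) *\<^sub>R taylor_term i f (diag x) (if i < 2 then \<zeta> n else ?Z))
          = frechet_derivative f (at (diag x)) (\<zeta> n) + N (real n) (real n * \<alpha>)"
      proof -
        have s: "{..<Suc k} = {0, 1} \<union> {2..<Suc k}" using assms(1) by auto
        show ?thesis unfolding s
          by (subst sum.union_disjoint)
             (auto simp: N_def f_diag[OF x] taylor_term_1[OF f_smooth K_\<Omega>[OF x]] simp del: taylor_term.simps(2))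
      qed
      have lin: "A x (frechet_derivative f (at (diag x)) (\<zeta> n) + N (real n) (real n * \<alpha>))
          = \<delta> (Suc n) - rot (j x) \<alpha> (\<delta> n) - G (real n) (real n * \<alpha>)"
        unfolding linear_add[OF bounded_linear.linear[OF A_linear[OF x]]] \<zeta>_def displacement_def f_linear[OF x]
        by (simp add: \<delta>_def G_def)
      have "norm (\<delta> (Suc n) - rot (j x) \<alpha> (\<delta> n) - G (real n) (real n * \<alpha>))
          \<le> CA * norm (frechet_derivative f (at (diag x)) (\<zeta> n) + N (real n) (real n * \<alpha>))"
        unfolding lin[symmetric] by (rule A_bound(1)[OF x])
      also have "\<dots> \<le> CA * (C2 * (C3 ^ Suc k + C3 * (3 * C1)) * h ^ Suc k)"
        using 1 unfolding 2 f0 diff_0 norm_minus_cancel by (intro mult_left_mono A_bound(2))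
      finally show ?thesis by (simp add: C4_def mult_ac)
    qed
    \<comment> \<open>The model increments start at the true first increment, so their error
      recurrence starts at 0.\<close>
    obtain d where d: "vtp (k * D + 3) d" "d 0 0 = \<delta> 0"
      "\<And>s \<phi>. d (s + 1) (\<phi> + \<alpha>) = rot (j x) \<alpha> (d s \<phi>) + G s \<phi>"
      using rotating_recurrence[OF G nonres j_linear[OF x] j_j[OF x]] by blast
    have d_err: "norm (\<delta> n - d (real n) (real n * \<alpha>)) \<le> C5 * h ^ Suc k" if "n \<le> L" for n
    proof -
      have "norm (\<delta> n - d (real n) (real n * \<alpha>)) \<le> real L * (1 + Cj) ^ L * (C4 * h ^ Suc k)"
      proof (rule linear_recurrence_error[of L "\<lambda>n. \<delta> n - d (real n) (real n * \<alpha>)", OF _ _ _ _ that])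
        fix n assume n: "n < L"
        have "\<delta> (Suc n) - d (real (Suc n)) (real (Suc n) * \<alpha>)
          = rot (j x) \<alpha> (\<delta> n - d (real n) (real n * \<alpha>)) + (\<delta> (Suc n) - rot (j x) \<alpha> (\<delta> n) - G (real n) (real n * \<alpha>))"
          unfolding shift d(3) rot_diff[OF bounded_linear.linear[OF j_linear[OF x]]] by simp
        then show "norm (\<delta> (Suc n) - d (real (Suc n)) (real (Suc n) * \<alpha>))
          \<le> (1 + Cj) * norm (\<delta> n - d (real n) (real n * \<alpha>)) + C4 * h ^ Suc k"
          using \<delta>[of n] n
          by (metis add_mono less_imp_le norm_rot_le[OF j_bound(1)[OF x] j_bound(2)] norm_triangle_mono)
      qed (use d(2) j_bound(2) C4 h in auto)
      then show ?thesis by (simp add: C5_def mult_ac)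
    qed
    obtain E where E: "vtp (Suc (k * D + 3)) E" "\<And>s \<phi>. E (s + 1) (\<phi> + \<alpha>) - E s \<phi> = d s \<phi>"
      using vtp_difference[OF d(1) nonres] by blast
    show "\<exists>F. vtp (k * D + 4) F \<and> (\<forall>n\<le>L. norm (q n - q 0 - F (real n) (real n * \<alpha>)) \<le> real L * 1 ^ L * C5 * h ^ Suc k)"
    proof (rule exI[of _ "\<lambda>s \<phi>. E s \<phi> - E 0 0"], intro conjI allI impI)
      show "vtp (k * D + 4) (\<lambda>s \<phi>. E s \<phi> - E 0 0)"
        using E(1) by (intro vtp_diff vtp_const) (simp add: eval_nat_numeral)
      fix n assume n: "n \<le> L"
      have "norm (q n - q 0 - (E (real n) (real n * \<alpha>) - E 0 0)) \<le> real L * 1 ^ L * (C5 * h ^ Suc k)"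
      proof (rule linear_recurrence_error[of L "\<lambda>n. q n - q 0 - (E (real n) (real n * \<alpha>) - E 0 0)", OF _ _ _ _ n])
        fix n assume n: "n < L"
        have "q (Suc n) - q 0 - (E (real (Suc n)) (real (Suc n) * \<alpha>) - E 0 0)
          = (q n - q 0 - (E (real n) (real n * \<alpha>) - E 0 0)) + (\<delta> n - d (real n) (real n * \<alpha>))"
          unfolding shift E(2)[symmetric] \<delta>_def by simp
        then show "norm (q (Suc n) - q 0 - (E (real (Suc n)) (real (Suc n) * \<alpha>) - E 0 0))
          \<le> 1 * norm (q n - q 0 - (E (real n) (real n * \<alpha>) - E 0 0)) + C5 * h ^ Suc k"
          using d_err[of n] n by (metis less_imp_le mult_1 norm_triangle_mono order_refl)
      qed (use C5 h in auto)
      then show "norm (q n - q 0 - (E (real n) (real n * \<alpha>) - E 0 0)) \<le> real L * 1 ^ L * C5 * h ^ Suc k"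
        by (simp add: mult.assoc)
    qed
  qed
qed

text \<open>D is chosen before L because a window for degree D dictates its own length. The first
  order is achieved by the zero polynomial, since the orbit moves by O(h) per step.\<close>

lemma orbit_trig_polynomial:
  "\<exists>D. \<forall>L. \<exists>C h0. C \<ge> 0 \<and> h0 > 0 \<and> (\<forall>h q. orb h q \<longrightarrow> h < h0 \<longrightarrow>
    (\<exists>F. vtp D F \<and> (\<forall>n\<le>L. norm (q n - q 0 - F (real n) (real n * \<alpha>)) \<le> C * h ^ Suc k)))"
proof (induction k)
  case 0
  show ?case
  proof (rule exI[of _ 0], rule allI, rule_tac x = "real L * C0" in exI, rule_tac x = 1 in exI, intro conjI allI impI)
    fix L h q assume orb: "orb h q"
    have "norm (q n - q 0) \<le> real L * C0 * h" if "n \<le> L" for n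
    proof -
      have "norm (q n - q 0) \<le> real n * (C0 * h)" using orb_dist[OF orb, of n] by (simp add: mult.assoc)
      also have "\<dots> \<le> real L * (C0 * h)" using that C0_nonneg orb_h[OF orb] by (intro mult_right_mono) auto
      finally show ?thesis by (simp add: mult.assoc)
    qed
    then show "\<exists>F. vtp 0 F \<and> (\<forall>n\<le>L. norm (q n - q 0 - F (real n) (real n * \<alpha>)) \<le> real L * C0 * h ^ Suc 0)"
      by (intro exI[of _ "\<lambda>s \<phi>. 0"]) (simp add: vtp_const)
  qed (use C0_nonneg in auto)
next
  case (Suc k)
  then obtain D where D: "\<And>L. \<exists>C h0. C \<ge> 0 \<and> h0 > 0 \<and> (\<forall>h q. orb h q \<longrightarrow> h < h0 \<longrightarrow>
    (\<exists>F. vtp D F \<and> (\<forall>n\<le>L. norm (q n - q 0 - F (real n) (real n * \<alpha>)) \<le> C * h ^ Suc k)))" by blast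
  have "1 \<le> Suc k" by simp
  show ?case by (rule exI, rule allI, rule orbit_trig_polynomial_step[OF \<open>1 \<le> Suc k\<close> D])
qed

text \<open>Averaging does not commute with the nonlinear f, but it reproduces trigonometric
  polynomials exactly. The Taylor polynomial of f along the approximate orbit is one, and it is
  O(h^(k+1)) at the orbit points because f vanishes there; the window carries this smallness to
  every phase t. The averaged points differ from the approximation at phase t by O(h^(k+1)) as well,
  so f is small on them too.\<close>

lemma window_defect:
  "\<exists>D. \<forall>L c c'. window \<alpha> D L c c' \<longrightarrow> (\<exists>C h0. C \<ge> 0 \<and> h0 > 0 \<and> (\<forall>h q. orb h q \<longrightarrow> h < h0 \<longrightarrow>
    (\<forall>t\<in>{0..2*pi}. norm (f (avg c L q 0 t, avg c L q 1 t, avg c L q 2 t, h)) \<le> C * h ^ Suc k)))"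
proof -
  obtain D where D: "\<And>L. \<exists>C h0. C \<ge> 0 \<and> h0 > 0 \<and> (\<forall>h q. orb h q \<longrightarrow> h < h0 \<longrightarrow>
    (\<exists>F. vtp D F \<and> (\<forall>n\<le>L. norm (q n - q 0 - F (real n) (real n * \<alpha>)) \<le> C * h ^ Suc k)))"
    using orbit_trig_polynomial[of k] by blast
  have "\<exists>C h0. C \<ge> 0 \<and> h0 > 0 \<and> (\<forall>h q. orb h q \<longrightarrow> h < h0 \<longrightarrow>
    (\<forall>t\<in>{0..2*pi}. norm (f (avg c L q 0 t, avg c L q 1 t, avg c L q 2 t, h)) \<le> C * h ^ Suc k))"
    if win: "window \<alpha> (Suc k * D) L c c'" for L c c'
  proof -
    obtain M where M: "M \<ge> 0" "\<And>m t. m \<le> L \<Longrightarrow> t \<in> {0..2*pi} \<Longrightarrow> \<bar>c m t\<bar> \<le> M \<and> \<bar>c' m t\<bar> \<le> M"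
      using window_bounded[OF win] by blast
    obtain C1 h1 where C1: "C1 \<ge> 0" "h1 > 0" "\<And>h q. orb h q \<Longrightarrow> h < h1 \<Longrightarrow>
      (\<exists>F. vtp D F \<and> (\<forall>n\<le>L + 2. norm (q n - q 0 - F (real n) (real n * \<alpha>)) \<le> C1 * h ^ Suc k))"
      using D[of "L + 2"] by blast
    obtain C2 r where C2: "C2 \<ge> 0" "r > 0" "r \<le> 1"
      "\<And>x \<zeta> Z \<rho>. x \<in> diag ` K \<Longrightarrow> norm \<zeta> \<le> \<rho> \<Longrightarrow> norm Z \<le> \<rho> \<Longrightarrow> \<rho> \<le> r \<Longrightarrow>
       norm (f (x + \<zeta>) - (\<Sum>i<Suc k. (1 / fact i) *\<^sub>R taylor_term i f x Z)) \<le> C2 * (\<rho> ^ Suc k + norm (\<zeta> - Z))"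
      using taylor_approx[OF f_smooth \<Omega>_open diag_K, of "Suc k"] by blast
    define Cq where "Cq = real (L + 2) * C0 + C1"
    define W where "W = real (Suc L) * M"
    define C3 where "C3 = 3 * Cq + 1"
    define C4 where "C4 = 3 * (W * Cq) + 1"
    define C5 where "C5 = C2 * (C3 ^ Suc k + 3 * C1)"
    define C6 where "C6 = C2 * (C4 ^ Suc k + 3 * (W * C1))"
    have Cq: "Cq \<ge> 0" using C0_nonneg C1(1) by (auto simp: Cq_def)
    have W: "W \<ge> 0" using M(1) by (simp add: W_def)
    have C34: "C3 > 0" "C4 > 0" using Cq W by (auto simp: C3_def C4_def intro!: add_nonneg_pos)
    have C56: "C5 \<ge> 0" "C6 \<ge> 0" using C2(1) C34 C1(1) W by (auto simp: C5_def C6_def intro!: mult_nonneg_nonneg add_nonneg_nonneg)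
    show ?thesis
    proof (rule exI[of _ "W * C5 + C6"], rule exI[of _ "min (min h1 1) (min (r / C3) (r / C4))"], intro conjI allI impI ballI)
      show "0 \<le> W * C5 + C6" using C56 W by simp
      show "0 < min (min h1 1) (min (r / C3) (r / C4))" using C1 C2 C34 by simp
      fix h q and t :: real
      assume orb: "orb h q" and h_small: "h < min (min h1 1) (min (r / C3) (r / C4))" and t: "t \<in> {0..2*pi}"
      then have h: "h > 0" "h < 1" "h < h1" "C3 * h < r" "C4 * h < r"
        using orb_h[OF orb] C34 by (auto simp: field_simps)
      obtain F where F: "vtp D F" "\<And>n. n \<le> L + 2 \<Longrightarrow> norm (q n - q 0 - F (real n) (real n * \<alpha>)) \<le> C1 * h ^ Suc k"
        using C1(3)[OF orb h(3)] by blast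
      have "1 \<le> Suc k" by simp
      note bounds = displacement_bounds[where F = F and q = q and h = h and k = "Suc k" and L = L and Ce = C1, OF this orb h(2) C1(1) F(2), folded Cq_def C3_def]
      have q0: "q 0 \<in> K" by (rule orb_K[OF orb])
      define Z where "Z = triple F h"
      have Z: "vtp D Z" unfolding Z_def by (rule vtp_triple[OF F(1)])
      define P where "P s \<phi> = (\<Sum>i<Suc k. (1 / fact i) *\<^sub>R taylor_term i f (diag (q 0)) (Z s \<phi>))" for s \<phi>
      have "vtp (Suc k * D) P" unfolding P_def[abs_def]
      proof (intro vtp_sum vtp_scaleR_const)
        fix i assume "i \<in> {..<Suc k}"
        then show "vtp (Suc k * D) (\<lambda>s \<phi>. taylor_term i f (diag (q 0)) (Z s \<phi>))"
          by (intro vtp_mono[OF vtp_taylor_term[OF Z]] mult_right_mono) auto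
      qed
      from window_vtp[OF win this] have P0: "P 0 t = (\<Sum>m\<le>L. c m t *\<^sub>R P (real m) (real m * \<alpha>))" .
      have Pm: "norm (P (real m) (real m * \<alpha>)) \<le> C5 * h ^ Suc k" if m: "m \<le> L" for m
      proof -
        have "norm (f (diag (q 0) + displacement q h m) - P (real m) (real m * \<alpha>))
            \<le> C2 * ((C3 * h) ^ Suc k + norm (displacement q h m - Z (real m) (real m * \<alpha>)))"
          unfolding P_def by (rule C2(4)) (use q0 bounds(3,4)[OF _ m] h Z_def in auto)
        also have "\<dots> \<le> C2 * ((C3 * h) ^ Suc k + 3 * C1 * h ^ Suc k)"
          unfolding Z_def by (intro mult_left_mono add_left_mono bounds(5) m C2(1))
        also have "\<dots> = C5 * h ^ Suc k" by (simp add: C5_def power_mult_distrib algebra_simps)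
        finally show ?thesis unfolding f_displacement[OF orb] by simp
      qed
      have P0_bound: "norm (P 0 t) \<le> W * (C5 * h ^ Suc k)"
        unfolding P0 W_def by (rule norm_avg_le) (use M t Pm in auto)
      have F0: "F (real i) (t + real i * \<alpha>) = (\<Sum>m\<le>L. c m t *\<^sub>R F (real (i + m)) (real (i + m) * \<alpha>))" for i
        by (rule window_shift[OF win]) (rule vtp_mono[OF F(1)], simp)
      have avg_q0: "avg c L q i t - q 0 = (\<Sum>m\<le>L. c m t *\<^sub>R (q (i + m) - q 0))" for i
        by (simp add: avg_def scaleR_diff_right sum_subtractf scaleR_sum_left[symmetric] window_sum1[OF win])
      have x_bound: "norm (avg c L q i t - q 0) \<le> W * (Cq * h)" if "i \<le> 2" for i
        unfolding avg_q0 W_def by (rule norm_avg_le) (use M t bounds(2) that in auto)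
      have F_bound: "norm (F (real i) (t + real i * \<alpha>)) \<le> W * (Cq * h)" if "i \<le> 2" for i
      proof -
        have "norm (F (real (i + m)) (real (i + m) * \<alpha>)) \<le> Cq * h" if "m \<le> L" for m
          by (rule bounds(1)) (use that \<open>i \<le> 2\<close> in auto)
        then show ?thesis unfolding F0 W_def by (rule norm_avg_le[rotated]) (use M t in auto)
      qed
      have xF: "norm (avg c L q i t - q 0 - F (real i) (t + real i * \<alpha>)) \<le> W * (C1 * h ^ Suc k)" if "i \<le> 2" for i
      proof -
        have "avg c L q i t - q 0 - F (real i) (t + real i * \<alpha>)
            = (\<Sum>m\<le>L. c m t *\<^sub>R (q (i + m) - q 0 - F (real (i + m)) (real (i + m) * \<alpha>)))"
          unfolding avg_q0 F0 by (simp add: scaleR_diff_right sum_subtractf)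
        also have "norm \<dots> \<le> W * (C1 * h ^ Suc k)"
        proof -
          have "norm (q (i + m) - q 0 - F (real (i + m)) (real (i + m) * \<alpha>)) \<le> C1 * h ^ Suc k" if "m \<le> L" for m
            by (rule F(2)) (use that \<open>i \<le> 2\<close> in auto)
          then show ?thesis unfolding W_def by (rule norm_avg_le[rotated]) (use M t in auto)
        qed
        finally show ?thesis .
      qed
      define \<xi> where "\<xi> = (avg c L q 0 t - q 0, avg c L q 1 t - q 0, avg c L q 2 t - q 0, h)"
      have Z0: "Z 0 t = (F (real 0) (t + real 0 * \<alpha>), F (real 1) (t + real 1 * \<alpha>), F (real 2) (t + real 2 * \<alpha>), h)"
        by (simp add: Z_def triple_def)
      have C4h: "C4 * h = 3 * (W * (Cq * h)) + h" by (simp add: C4_def algebra_simps)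
      have \<xi>: "norm \<xi> \<le> C4 * h"
        unfolding \<xi>_def using x_bound[of 0] x_bound[of 1] x_bound[of 2] h(1) C4h
        by (intro order_trans[OF norm_quadruple_le]) auto
      have Z0b: "norm (Z 0 t) \<le> C4 * h"
        unfolding Z0 using F_bound[of 0] F_bound[of 1] F_bound[of 2] h(1) C4h
        by (intro order_trans[OF norm_quadruple_le]) auto
      have \<xi>Z: "norm (\<xi> - Z 0 t) \<le> 3 * (W * (C1 * h ^ Suc k))"
      proof -
        have "norm (\<xi> - Z 0 t) \<le> norm (avg c L q 0 t - q 0 - F (real 0) (t + real 0 * \<alpha>))
          + norm (avg c L q 1 t - q 0 - F (real 1) (t + real 1 * \<alpha>))
          + norm (avg c L q 2 t - q 0 - F (real 2) (t + real 2 * \<alpha>)) + norm (h - h)"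
          unfolding Z0 \<xi>_def diff_Pair by (rule norm_quadruple_le)
        moreover have "norm (h - h) = 0" by simp
        ultimately show ?thesis using xF[OF zero_le] xF[OF one_le_numeral] xF[OF order_refl] by linarith
      qed
      have "diag (q 0) + \<xi> = (avg c L q 0 t, avg c L q 1 t, avg c L q 2 t, h)" by (simp add: \<xi>_def)
      moreover have "norm (f (diag (q 0) + \<xi>) - P 0 t) \<le> C2 * ((C4 * h) ^ Suc k + norm (\<xi> - Z 0 t))"
        unfolding P_def by (rule C2(4)) (use q0 \<xi> Z0b h in auto)
      moreover have "\<dots> \<le> C2 * ((C4 * h) ^ Suc k + 3 * (W * (C1 * h ^ Suc k)))"
        by (intro mult_left_mono add_left_mono \<xi>Z C2(1))
      moreover have "\<dots> = C6 * h ^ Suc k" by (simp add: C6_def power_mult_distrib algebra_simps)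
      ultimately have "norm (f (avg c L q 0 t, avg c L q 1 t, avg c L q 2 t, h) - P 0 t) \<le> C6 * h ^ Suc k"
        by simp
      then have "norm (f (avg c L q 0 t, avg c L q 1 t, avg c L q 2 t, h)) \<le> C6 * h ^ Suc k + norm (P 0 t)"
        using norm_triangle_ineq2[of "f (avg c L q 0 t, avg c L q 1 t, avg c L q 2 t, h)" "P 0 t"] by linarith
      then show "norm (f (avg c L q 0 t, avg c L q 1 t, avg c L q 2 t, h)) \<le> (W * C5 + C6) * h ^ Suc k"
        using P0_bound by (simp add: distrib_right mult.assoc)
    qed
  qed
  then show ?thesis by blast
qed

end

section \<open>The approximately conserved action\<close>

locale variational_orbits = discrete_orbits f \<Omega> K j \<alpha> A b orb C0 Cj CA
  for f :: "'a::euclidean_space \<times> 'a \<times> 'a \<times> real \<Rightarrow> 'a" and \<Omega> K j \<alpha> A b orb C0 Cj CA +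
  fixes S :: "'a \<times> 'a \<times> real \<Rightarrow> real" and s1 s2 :: "'a \<times> 'a \<times> real \<Rightarrow> 'a"
    and s3 :: "'a \<times> 'a \<times> real \<Rightarrow> real" and \<Omega>S :: "('a \<times> 'a \<times> real) set"
  assumes \<Omega>S_open: "open \<Omega>S" and K_\<Omega>S: "\<And>x. x \<in> K \<Longrightarrow> (x, x, 0) \<in> \<Omega>S"
    and S_deriv: "\<And>P. P \<in> \<Omega>S \<Longrightarrow>
      (S has_derivative (\<lambda>w. s1 P \<bullet> fst w + s2 P \<bullet> fst (snd w) + s3 P * snd (snd w))) (at P)"
    and s1_smooth: "smooth_on \<Omega>S s1" and s2_smooth: "smooth_on \<Omega>S s2"
    and f_eq: "\<And>x y z h. f (x, y, z, h) = s2 (x, y, h) + s1 (y, z, h)"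
begin

text \<open>The weights sum to 1 and their derivatives to 0, so q 0 may be subtracted from every
  point. The remaining combination is O(h), as the orbit moves by O(h) per step.\<close>

lemma window_close:
  assumes win: "window \<alpha> D L c c'"
  shows "\<exists>C h0. C \<ge> 0 \<and> h0 > 0 \<and> (\<forall>h q. orb h q \<longrightarrow> h < h0 \<longrightarrow> (\<forall>t\<in>{0..2*pi}. \<forall>i\<le>2.
    norm (avg c L q i t - q 0) \<le> C * h \<and> norm (avg c' L q i t) \<le> C * h \<and>
    (avg c L q 0 t, avg c L q 1 t, h) \<in> \<Omega>S \<and> (avg c L q 1 t, avg c L q 2 t, h) \<in> \<Omega>S))"
proof -
  obtain M where M: "M \<ge> 0" "\<And>m t. m \<le> L \<Longrightarrow> t \<in> {0..2*pi} \<Longrightarrow> \<bar>c m t\<bar> \<le> M \<and> \<bar>c' m t\<bar> \<le> M"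
    using window_bounded[OF win] by blast
  have "compact ((\<lambda>x. (x, x, 0 :: real)) ` K)"
    by (intro compact_continuous_image continuous_intros K_compact)
  moreover have "(\<lambda>x. (x, x, 0 :: real)) ` K \<subseteq> \<Omega>S" using K_\<Omega>S by auto
  ultimately obtain r where r: "r > 0" "(\<Union>P\<in>(\<lambda>x. (x, x, 0)) ` K. cball P r) \<subseteq> \<Omega>S"
    using compact_subset_open_imp_cball_epsilon_subset[OF _ \<Omega>S_open] by blast
  define C where "C = real (Suc L) * M * (real (L + 2) * C0)"
  have C: "C \<ge> 0" using M(1) C0_nonneg by (simp add: C_def)
  show ?thesis
  proof (rule exI[of _ C], rule exI[of _ "r / (2 * C + 1)"], intro conjI allI impI ballI)
    show "0 < r / (2 * C + 1)" using r(1) C by simp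
    fix h q t i assume orb: "orb h q" and h_small: "h < r / (2 * C + 1)" and t: "t \<in> {0..2*pi}" and i: "i \<le> (2::nat)"
    have h: "h > 0" "2 * (C * h) + h < r" using orb_h[OF orb] h_small C by (auto simp: field_simps)
    have dist: "norm (q (i + m) - q 0) \<le> real (L + 2) * C0 * h" if "m \<le> L" "i \<le> 2" for m i
      using orb_dist[OF orb, of "i + m"]
      by (rule order_trans) (use that h(1) C0_nonneg in \<open>intro mult_right_mono, auto\<close>)
    have Ch: "C * h = real (Suc L) * M * (real (L + 2) * C0 * h)" by (simp add: C_def)
    have avg_q0: "avg c L q i t - q 0 = (\<Sum>m\<le>L. c m t *\<^sub>R (q (i + m) - q 0))" for i
      by (simp add: avg_def scaleR_diff_right sum_subtractf scaleR_sum_left[symmetric] window_sum1[OF win])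
    have avg'_q0: "avg c' L q i t = (\<Sum>m\<le>L. c' m t *\<^sub>R (q (i + m) - q 0))"
      by (simp add: avg_def scaleR_diff_right sum_subtractf scaleR_sum_left[symmetric] window_sum0[OF win])
    have 1: "norm (avg c L q i t - q 0) \<le> C * h" if "i \<le> 2" for i
      unfolding avg_q0 Ch
      by (rule norm_avg_le[OF _ dist]) (use M t that in auto)
    then show "norm (avg c L q i t - q 0) \<le> C * h" using i by blast
    show "norm (avg c' L q i t) \<le> C * h"
      unfolding avg'_q0 Ch
      by (rule norm_avg_le[OF _ dist]) (use M t i in auto)
    have 2: "(avg c L q i t, avg c L q k t, h) \<in> \<Omega>S" if "i \<le> 2" "k \<le> 2" for i k
    proof -
      have "norm ((avg c L q i t, avg c L q k t, h) - (q 0, q 0, 0)) \<le> norm (avg c L q i t - q 0) + (norm (avg c L q k t - q 0) + norm h)"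
        unfolding diff_Pair by (intro order_trans[OF norm_Pair_le] add_mono) (auto intro: order_trans[OF norm_Pair_le])
      moreover have "norm h = h" using h by simp
      ultimately have "(avg c L q i t, avg c L q k t, h) \<in> cball (q 0, q 0, 0) r"
        using 1[OF that(1)] 1[OF that(2)] h
        by (subst mem_cball, subst dist_commute, subst dist_norm) linarith
      then show ?thesis using r(2) orb_K[OF orb, of 0] by blast
    qed
    show "(avg c L q 0 t, avg c L q 1 t, h) \<in> \<Omega>S" "(avg c L q 1 t, avg c L q 2 t, h) \<in> \<Omega>S"
      using 2 by auto
  qed (use C in auto)
qed

definition action :: "(nat \<Rightarrow> real \<Rightarrow> real) \<Rightarrow> (nat \<Rightarrow> real \<Rightarrow> real) \<Rightarrow> nat \<Rightarrow> real \<Rightarrow> (nat \<Rightarrow> 'a) \<Rightarrow> real" where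
  "action c c' L h q = integral {0..2*pi} (\<lambda>t. s2 (avg c L q 0 t, avg c L q 1 t, h) \<bullet> avg c' L q 1 t)"

text \<open>Stokes for the one-form \<open>dS\<close> on the loop shifted by one step; the Euler--Lagrange defect \<open>f\<close> is what
  remains.\<close>

lemma action_step:
  "\<exists>D. \<forall>L c c'. window \<alpha> D L c c' \<longrightarrow> (\<exists>C h0. C \<ge> 0 \<and> h0 > 0 \<and> (\<forall>h q. orb h q \<longrightarrow> h < h0 \<longrightarrow>
    \<bar>action c c' L h (\<lambda>n. q (Suc n)) - action c c' L h q\<bar> \<le> C * h ^ Suc k))"
proof -
  obtain D where D: "\<And>L c c'. window \<alpha> D L c c' \<Longrightarrow> (\<exists>C h0. C \<ge> 0 \<and> h0 > 0 \<and> (\<forall>h q. orb h q \<longrightarrow> h < h0 \<longrightarrow>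
    (\<forall>t\<in>{0..2*pi}. norm (f (avg c L q 0 t, avg c L q 1 t, avg c L q 2 t, h)) \<le> C * h ^ Suc k)))"
    using window_defect[of k] by blast
  have "\<exists>C h0. C \<ge> 0 \<and> h0 > 0 \<and> (\<forall>h q. orb h q \<longrightarrow> h < h0 \<longrightarrow>
    \<bar>action c c' L h (\<lambda>n. q (Suc n)) - action c c' L h q\<bar> \<le> C * h ^ Suc k)"
    if win: "window \<alpha> D L c c'" for L c c'
  proof -
    obtain C1 h1 where C1: "C1 \<ge> 0" "h1 > 0" "\<And>h q t. orb h q \<Longrightarrow> h < h1 \<Longrightarrow> t \<in> {0..2*pi} \<Longrightarrow>
      norm (f (avg c L q 0 t, avg c L q 1 t, avg c L q 2 t, h)) \<le> C1 * h ^ Suc k"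
      using D[OF win] by blast
    obtain C2 h2 where C2: "C2 \<ge> 0" "h2 > 0" "\<And>h q t i. orb h q \<Longrightarrow> h < h2 \<Longrightarrow> t \<in> {0..2*pi} \<Longrightarrow> i \<le> (2::nat) \<Longrightarrow>
      norm (avg c L q i t - q 0) \<le> C2 * h \<and> norm (avg c' L q i t) \<le> C2 * h \<and>
      (avg c L q 0 t, avg c L q 1 t, h) \<in> \<Omega>S \<and> (avg c L q 1 t, avg c L q 2 t, h) \<in> \<Omega>S"
      using window_close[OF win] by blast
    show ?thesis
    proof (rule exI[of _ "C1 * C2 * (2 * pi)"], rule exI[of _ "min 1 (min h1 h2)"], intro conjI allI impI)
      fix h q assume orb: "orb h q" and "h < min 1 (min h1 h2)"
      then have h: "h > 0" "h < 1" "h < h1" "h < h2" using orb_h[OF orb] by auto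
      define x where "x i t = avg c L q i t" for i t
      define x' where "x' i t = avg c' L q i t" for i t
      have dom: "(x 0 t, x 1 t, h) \<in> \<Omega>S" "(x 1 t, x 2 t, h) \<in> \<Omega>S" if "t \<in> {0..2*pi}" for t
        using C2(3)[OF orb h(4) that, of 0] unfolding x_def by auto
      note xc = avg_continuous[OF win, of "{0..2*pi}" q, folded x_def[abs_def] x'_def[abs_def]]
      have x_cont: "continuous_on {0..2*pi} (\<lambda>t. x i t)" "continuous_on {0..2*pi} (\<lambda>t. x' i t)" for i
        using xc[of i] by (simp_all add: x_def[abs_def] x'_def[abs_def])
      have P01: "continuous_on {0..2*pi} (\<lambda>t. s2 (x 0 t, x 1 t, h))"
        by (rule continuous_on_compose2[OF smooth_on_continuous[OF s2_smooth]])
          (use dom in \<open>auto intro!: continuous_intros x_cont\<close>)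
      have P12: "continuous_on {0..2*pi} (\<lambda>t. s2 (x 1 t, x 2 t, h))" "continuous_on {0..2*pi} (\<lambda>t. s1 (x 1 t, x 2 t, h))"
        by (rule continuous_on_compose2[OF smooth_on_continuous[OF s2_smooth]]
            continuous_on_compose2[OF smooth_on_continuous[OF s1_smooth]],
          use dom in \<open>auto intro!: continuous_intros x_cont\<close>)+
      have "((\<lambda>t. s1 (x 1 t, x 2 t, h) \<bullet> x' 1 t + s2 (x 1 t, x 2 t, h) \<bullet> x' 2 t) has_integral
          (S (x 1 (2*pi), x 2 (2*pi), h) - S (x 1 0, x 2 0, h))) {0..2*pi}"
      proof (rule fundamental_theorem_of_calculus)
        fix t assume t: "t \<in> {0..2*pi}"
        have xd: "(x i has_vector_derivative x' i t) (at t within {0..2*pi})" for i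
          using avg_has_vector_derivative[OF win] by (simp add: x_def[abs_def] x'_def)
        have "((\<lambda>t. (x 1 t, x 2 t, h)) has_derivative (\<lambda>s. (s *\<^sub>R x' 1 t, s *\<^sub>R x' 2 t, 0))) (at t within {0..2*pi})"
          using xd unfolding has_vector_derivative_def by (intro has_derivative_Pair has_derivative_const) auto
        from has_derivative_compose[OF this S_deriv[OF dom(2)[OF t]]]
        show "((\<lambda>t. S (x 1 t, x 2 t, h)) has_vector_derivative s1 (x 1 t, x 2 t, h) \<bullet> x' 1 t + s2 (x 1 t, x 2 t, h) \<bullet> x' 2 t)
          (at t within {0..2*pi})"
          unfolding has_vector_derivative_def by (simp add: distrib_left)
      qed simp
      moreover have "x i (2 * pi) = x i 0" for i
      proof -
        have "c m (0 + 2 * pi) = c m 0" for m using win unfolding window_def by blast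
        then show ?thesis by (simp add: x_def avg_def)
      qed
      ultimately have exact: "integral {0..2*pi} (\<lambda>t. s1 (x 1 t, x 2 t, h) \<bullet> x' 1 t + s2 (x 1 t, x 2 t, h) \<bullet> x' 2 t) = 0"
        by (simp add: integral_unique)
      \<comment> \<open>The vanishing integral of dS is subtracted: its second term cancels the
        action of the shifted loop, and its first term completes \<open>s2\<close> to the defect
        f.\<close>
      have "action c c' L h (\<lambda>n. q (Suc n)) - action c c' L h q
          = integral {0..2*pi} (\<lambda>t. s2 (x 1 t, x 2 t, h) \<bullet> x' 2 t) - integral {0..2*pi} (\<lambda>t. s2 (x 0 t, x 1 t, h) \<bullet> x' 1 t)
            - integral {0..2*pi} (\<lambda>t. s1 (x 1 t, x 2 t, h) \<bullet> x' 1 t + s2 (x 1 t, x 2 t, h) \<bullet> x' 2 t)"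
        unfolding exact by (simp add: action_def avg_shift x_def x'_def numeral_2_eq_2)
      also have "\<dots> = integral {0..2*pi} (\<lambda>t. s2 (x 1 t, x 2 t, h) \<bullet> x' 2 t - s2 (x 0 t, x 1 t, h) \<bullet> x' 1 t
            - (s1 (x 1 t, x 2 t, h) \<bullet> x' 1 t + s2 (x 1 t, x 2 t, h) \<bullet> x' 2 t))"
        by (subst integral_diff[symmetric],
            (intro integrable_continuous_real continuous_intros P01 P12 x_cont)+)+ simp
      also have "\<dots> = integral {0..2*pi} (\<lambda>t. - (f (x 0 t, x 1 t, x 2 t, h) \<bullet> x' 1 t))"
        by (rule integral_cong) (simp add: f_eq inner_add_left)
      finally have eq: "action c c' L h (\<lambda>n. q (Suc n)) - action c c' L h q
          = integral {0..2*pi} (\<lambda>t. - (f (x 0 t, x 1 t, x 2 t, h) \<bullet> x' 1 t))" .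
      have "norm (integral {0..2*pi} (\<lambda>t. - (f (x 0 t, x 1 t, x 2 t, h) \<bullet> x' 1 t))) \<le> (C1 * h ^ Suc k * C2) * (2 * pi - 0)"
      proof (rule integral_bound)
        show "continuous_on {0..2*pi} (\<lambda>t. - (f (x 0 t, x 1 t, x 2 t, h) \<bullet> x' 1 t))"
          unfolding f_eq by (intro continuous_intros P01 P12 x_cont)
        fix t assume t: "t \<in> {0..2*pi}"
        have "norm (x' 1 t) \<le> C2 * h" using C2(3)[OF orb h(4) t, of 1] by (simp add: x'_def)
        also have "\<dots> \<le> C2 * 1" using C2(1) h by (intro mult_left_mono) auto
        finally have "norm (f (x 0 t, x 1 t, x 2 t, h)) * norm (x' 1 t) \<le> (C1 * h ^ Suc k) * C2"
          using C1(3)[OF orb h(3) t] C1(1) h(1) by (intro mult_mono) (auto simp: x_def)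
        then show "norm (- (f (x 0 t, x 1 t, x 2 t, h) \<bullet> x' 1 t)) \<le> C1 * h ^ Suc k * C2"
          using Cauchy_Schwarz_ineq2[of "f (x 0 t, x 1 t, x 2 t, h)" "x' 1 t"] by simp
      qed simp
      then show "\<bar>action c c' L h (\<lambda>n. q (Suc n)) - action c c' L h q\<bar> \<le> C1 * C2 * (2 * pi) * h ^ Suc k"
        unfolding eq by (simp add: mult_ac)
    qed (use C1 C2 in auto)
  qed
  then show ?thesis by blast
qed

end

lemma blinfun_linear: "linear (blinfun_apply A)"
  by (rule bounded_linear.linear[OF blinfun.bounded_linear_right])

definition rank_one :: "'a::euclidean_space \<Rightarrow> 'b::real_normed_vector \<Rightarrow> 'a \<Rightarrow>\<^sub>L 'b" where
  "rank_one u v = blinfun_scaleR_left v o\<^sub>L blinfun_inner_left u"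

lemma rank_one_apply: "blinfun_apply (rank_one u v) x = (x \<bullet> u) *\<^sub>R v"
  by (simp add: rank_one_def)

section \<open>The generating function of the Lorentz map\<close>

locale lorentz =
  fixes Q :: "'a::euclidean_space set"
    and \<theta> :: "'a \<Rightarrow> ('a \<Rightarrow>\<^sub>L real)"
    and J :: "'a \<Rightarrow> ('a \<Rightarrow>\<^sub>L 'a)"
    and H :: "'a \<Rightarrow> real"
    and \<theta>0 :: real
  assumes open_Q: "open Q" and \<theta>_smooth: "smooth_on Q \<theta>"
    and symplectic: "symplectic_on Q (symp_form \<theta>)"
    and H_smooth: "smooth_on Q H"
    and almost_complex: "almost_complex_on Q J"
    and riemannian: "riemannian_on Q (compat_metric \<theta> J)"
    and nonresonant: "nonres \<theta>0"
begin

abbreviation om where "om \<equiv> symp_form \<theta>"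

text \<open>The fields \<open>thv\<close>, \<open>B\<close>, \<open>G\<close> and \<open>gH\<close> represent the one-form, \<open>\<omega>\<close>, \<open>g\<close> and \<open>dH\<close> by means of the inner product of
  the ambient space.\<close>

definition thv :: "'a \<Rightarrow> 'a" where "thv x = (\<Sum>u\<in>Basis. \<theta> x u *\<^sub>R u)"

lemma thv_inner: "thv x \<bullet> w = \<theta> x w"
proof -
  have "thv x \<bullet> w = (\<Sum>u\<in>Basis. (w \<bullet> u) *\<^sub>R \<theta> x u)"
    by (simp add: thv_def inner_sum_left inner_commute[of w] mult.commute)
  also have "\<dots> = \<theta> x w" by (rule linear_euclidean_expand[OF blinfun_linear, symmetric])
  finally show ?thesis .
qed

lemma thv_smooth: "smooth_on Q thv"
  unfolding thv_def[abs_def]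
  by (intro smooth_on_sum smooth_on_scaleR smooth_on_blinfun_apply smooth_on_const open_Q \<theta>_smooth)

definition T :: "'a \<Rightarrow> ('a \<Rightarrow>\<^sub>L 'a)" where "T = total_deriv thv"

lemma T_derivative: "x \<in> Q \<Longrightarrow> (thv has_derivative T x) (at x)"
  unfolding T_def by (rule has_derivative_total_deriv[OF thv_smooth])

lemma T_smooth: "smooth_on Q T"
  unfolding T_def by (rule smooth_on_total_deriv[OF open_Q thv_smooth])

lemma T_inner:
  assumes "x \<in> Q" shows "T x u \<bullet> w = frechet_derivative \<theta> (at x) u w"
proof -
  have "((\<lambda>x. \<theta> x w) has_derivative (\<lambda>u. frechet_derivative \<theta> (at x) u w)) (at x)"
    by (rule bounded_linear.has_derivative[OF bounded_linear_apply_blinfun smooth_on_has_derivative[OF \<theta>_smooth assms]])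
  moreover have "((\<lambda>x. thv x \<bullet> w) has_derivative (\<lambda>u. T x u \<bullet> w)) (at x)"
    by (rule bounded_linear.has_derivative[OF bounded_linear_inner_left T_derivative[OF assms]])
  ultimately show ?thesis
    unfolding thv_inner by (metis has_derivative_unique)
qed

lemma om_T: "x \<in> Q \<Longrightarrow> om x u w = T x w \<bullet> u - T x u \<bullet> w"
  by (simp add: symp_form_def ext_deriv_def T_inner)

definition B :: "'a \<Rightarrow> ('a \<Rightarrow>\<^sub>L 'a)" where
  "B x = (\<Sum>u\<in>Basis. \<Sum>w\<in>Basis. om x u w *\<^sub>R rank_one u w)"

lemma B_inner:
  assumes "x \<in> Q" shows "B x u \<bullet> w = om x u w"
proof -
  have "linear (\<lambda>u. om x u w)" for w
    unfolding om_T[OF assms] by (intro linearI) (simp_all add: blinfun.add_right blinfun.scaleR_right inner_add_left inner_add_right algebra_simps)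
  note 1 = linear_euclidean_expand[OF this]
  have "linear (\<lambda>w. om x u w)" for u
    unfolding om_T[OF assms] by (intro linearI) (simp_all add: blinfun.add_right blinfun.scaleR_right inner_add_left inner_add_right algebra_simps)
  note 2 = linear_euclidean_expand[OF this]
  have "om x u w = (\<Sum>a\<in>Basis. (u \<bullet> a) *\<^sub>R (\<Sum>b\<in>Basis. (w \<bullet> b) *\<^sub>R om x a b))"
    by (subst 1, subst 2) (rule refl)
  also have "\<dots> = B x u \<bullet> w"
    by (simp add: B_def blinfun.sum_left blinfun.scaleR_left rank_one_apply inner_sum_left sum_distrib_left
        inner_commute[of w] mult_ac)
  finally show ?thesis by simp
qed

lemma om_smooth: "smooth_on Q (\<lambda>x. om x u w)"
  unfolding symp_form_def ext_deriv_def
  by (intro smooth_on_linear_comp[OF _ bounded_linear_minus[OF bounded_linear_ident]] smooth_on_diff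
      smooth_on_blinfun_apply smooth_on_deriv smooth_on_const open_Q \<theta>_smooth)

lemma B_smooth: "smooth_on Q B"
  unfolding B_def[abs_def]
  by (intro smooth_on_sum smooth_on_scaleR om_smooth smooth_on_const open_Q)

lemma B_T: "x \<in> Q \<Longrightarrow> B x u \<bullet> w = T x w \<bullet> u - T x u \<bullet> w"
  by (simp add: B_inner om_T)

lemma B_antisym: "x \<in> Q \<Longrightarrow> B x u \<bullet> w = - (B x w \<bullet> u)"
  by (simp add: B_T)

lemma B_inj: "x \<in> Q \<Longrightarrow> B x u = 0 \<Longrightarrow> u = 0"
  using symplectic B_inner unfolding symplectic_on_def by (metis inner_zero_left)

lemma J_smooth: "smooth_on Q J" and J_J: "x \<in> Q \<Longrightarrow> J x (J x w) = - w"
  using almost_complex by (auto simp: almost_complex_on_def)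

definition G :: "'a \<Rightarrow> ('a \<Rightarrow>\<^sub>L 'a)" where "G x = - (B x o\<^sub>L J x)"

lemma G_smooth: "smooth_on Q G"
  unfolding G_def[abs_def]
  by (intro smooth_on_linear_comp[OF _ bounded_linear_minus[OF bounded_linear_ident]]
      smooth_on_blinfun_compose open_Q B_smooth J_smooth)

lemma G_apply: "G x u = - B x (J x u)"
  by (simp add: G_def blinfun.minus_left)

text \<open>By symmetry of the metric, g(u, w) = g(w, u) = B w . J u, and antisymmetry of B moves J
  u into its argument. This avoids the adjoint of J and explains the minus sign in
  \<open>G\<close>.\<close>

lemma G_inner:
  assumes "x \<in> Q" shows "G x u \<bullet> w = compat_metric \<theta> J x u w"
proof -
  have "compat_metric \<theta> J x u w = compat_metric \<theta> J x w u"
    using riemannian assms by (auto simp: riemannian_on_def)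
  also have "\<dots> = B x w \<bullet> J x u" by (simp add: compat_metric_def B_inner[OF assms])
  also have "\<dots> = G x u \<bullet> w" using B_antisym[OF assms, of w "J x u"] by (simp add: G_apply)
  finally show ?thesis by simp
qed

lemma G_sym: "x \<in> Q \<Longrightarrow> G x u \<bullet> w = G x w \<bullet> u"
  using riemannian by (simp add: G_inner riemannian_on_def)

lemma G_pos: "x \<in> Q \<Longrightarrow> u \<noteq> 0 \<Longrightarrow> G x u \<bullet> u > 0"
  using riemannian by (simp add: G_inner riemannian_on_def)

lemma G_nonneg: "x \<in> Q \<Longrightarrow> G x u \<bullet> u \<ge> 0"
  using G_pos[of x u] by (cases "u = 0") (auto simp: less_imp_le)

lemma B_G: "x \<in> Q \<Longrightarrow> B x u = G x (J x u)"
  by (simp add: G_apply J_J blinfun.minus_right)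

lemma G_J: "x \<in> Q \<Longrightarrow> G x (J x u) \<bullet> J x w = G x u \<bullet> w"
  using B_antisym[of x u "J x w"] by (simp add: B_G[symmetric] G_apply[of x w] G_sym[of x u w])

lemma G_inj: "x \<in> Q \<Longrightarrow> G x u = 0 \<Longrightarrow> u = 0"
  using G_pos[of x u] by (metis inner_zero_left less_irrefl)

definition gH :: "'a \<Rightarrow> 'a" where "gH x = (\<Sum>u\<in>Basis. frechet_derivative H (at x) u *\<^sub>R u)"

lemma gH_inner:
  assumes "x \<in> Q" shows "gH x \<bullet> w = frechet_derivative H (at x) w"
proof -
  have "gH x \<bullet> w = (\<Sum>u\<in>Basis. (w \<bullet> u) *\<^sub>R frechet_derivative H (at x) u)"
    by (simp add: gH_def inner_sum_left inner_commute[of w] mult.commute)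
  also have "\<dots> = frechet_derivative H (at x) w"
    by (rule linear_euclidean_expand[OF has_derivative_linear[OF smooth_on_has_derivative[OF H_smooth assms]], symmetric])
  finally show ?thesis .
qed

lemma gH_smooth: "smooth_on Q gH"
  unfolding gH_def[abs_def]
  by (intro smooth_on_sum smooth_on_scaleR smooth_on_deriv smooth_on_const open_Q H_smooth)

abbreviation X :: "'a \<Rightarrow> 'a" where "X \<equiv> ham_vec \<theta> H"

lemma B_X:
  assumes "x \<in> Q" shows "B x (X x) = gH x"
proof -
  have iff: "(\<forall>w. om x u w = frechet_derivative H (at x) w) \<longleftrightarrow> B x u = gH x" for u
    unfolding B_inner[OF assms, symmetric] gH_inner[OF assms, symmetric] by (rule vector_eq_rdot)
  have "inj (blinfun_apply (B x))"
    using B_inj[OF assms] by (subst linear_injective_0[OF blinfun_linear]) blast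
  then have "surj (blinfun_apply (B x))" by (intro linear_injective_imp_surjective[OF blinfun_linear]) simp_all
  then obtain u where u: "B x u = gH x" by (metis surjD)
  have "B x (THE u. B x u = gH x) = gH x"
  proof (rule theI[where P = "\<lambda>u. B x u = gH x", OF u])
    fix u' assume "B x u' = gH x"
    then show "u' = u" using u \<open>inj (blinfun_apply (B x))\<close> by (metis injD)
  qed
  then show ?thesis unfolding ham_vec_def iff .
qed

text \<open>\<open>ham_vec\<close> is a definite description, so its smoothness is obtained from the
  nondegenerate linear system that characterises it.\<close>

lemma X_smooth: "smooth_on Q X"
  by (rule smooth_on_solve[OF open_Q B_smooth B_inj gH_smooth B_X])

definition Ginv :: "'a \<Rightarrow> ('a \<Rightarrow>\<^sub>L 'a)" where
  "Ginv x = (\<Sum>w\<in>Basis. rank_one w (THE u. G x u = w))"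

lemma G_the:
  assumes "x \<in> Q" shows "G x (THE u. G x u = w) = w"
proof -
  have inj: "inj (blinfun_apply (G x))"
    using G_inj[OF assms] by (subst linear_injective_0[OF blinfun_linear]) blast
  then have "surj (blinfun_apply (G x))" by (intro linear_injective_imp_surjective[OF blinfun_linear]) simp_all
  then obtain u where u: "G x u = w" by (metis surjD)
  show ?thesis by (rule theI[where P = "\<lambda>u. G x u = w", OF u]) (use u inj in \<open>metis injD\<close>)
qed

lemma rank_one_linear: "bounded_linear (rank_one w)"
  unfolding rank_one_def[abs_def]
  by (intro bounded_linear_compose[OF bounded_bilinear.bounded_linear_left[OF bounded_bilinear_blinfun_compose]
        bounded_linear_blinfun_scaleR_left])

lemma Ginv_smooth: "smooth_on Q Ginv"
  unfolding Ginv_def[abs_def]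
  by (intro smooth_on_sum open_Q smooth_on_linear_comp[OF open_Q rank_one_linear]
      smooth_on_solve[OF open_Q G_smooth G_inj smooth_on_const[OF open_Q] G_the])

lemma G_Ginv: "x \<in> Q \<Longrightarrow> G x (Ginv x v) = v"
  by (simp add: Ginv_def blinfun.sum_left blinfun.sum_right rank_one_apply blinfun.scaleR_right G_the
      euclidean_representation)

lemma Ginv_G: "x \<in> Q \<Longrightarrow> Ginv x (G x u) = u"
  using G_inj[of x "Ginv x (G x u) - u"] by (simp add: blinfun.diff_right G_Ginv)

text \<open>The derivative of \<omega> along X_H, contracted with X_H in the first slot: the
  covector behind the third term of \<Sigma>, freed from coordinates.\<close>

definition cc :: "'a \<Rightarrow> 'a" where "cc x = blinfun_apply (blinfun_apply (total_deriv B x) (X x)) (X x)"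

lemma total_deriv_B_smooth: "smooth_on Q (total_deriv B)"
  by (rule smooth_on_total_deriv[OF open_Q B_smooth])

lemma cc_smooth: "smooth_on Q cc"
  unfolding cc_def[abs_def]
  by (intro smooth_on_blinfun_apply total_deriv_B_smooth X_smooth open_Q)

lemma cc_inner:
  assumes x: "x \<in> Q"
  shows "(\<Sum>k\<in>Basis. \<Sum>j\<in>Basis. \<Sum>l\<in>Basis.
      frechet_derivative (\<lambda>y. om y j l) (at x) k * (X x \<bullet> k) * (X x \<bullet> j) * (\<xi> \<bullet> l)) = cc x \<bullet> \<xi>"
proof -
  have D: "frechet_derivative (\<lambda>y. om y j l) (at x) k = total_deriv B x k j \<bullet> l" for j l k
  proof -
    have "((\<lambda>y. B y j \<bullet> l) has_derivative (\<lambda>k. total_deriv B x k j \<bullet> l)) (at x)"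
      by (intro bounded_linear.has_derivative[OF bounded_linear_inner_left]
          bounded_linear.has_derivative[OF bounded_linear_apply_blinfun] has_derivative_total_deriv[OF B_smooth x])
    then have "((\<lambda>y. om y j l) has_derivative (\<lambda>k. total_deriv B x k j \<bullet> l)) (at x)"
      by (rule has_derivative_transform_within_open[OF _ open_Q x]) (simp add: B_inner)
    from frechet_derivative_at[OF this] show ?thesis by metis
  qed
  let ?A = "\<lambda>k j. blinfun_apply (blinfun_apply (total_deriv B x) k) j"
  have "cc x = (\<Sum>k\<in>Basis. (X x \<bullet> k) *\<^sub>R ?A k (X x))"
    unfolding cc_def by (subst linear_euclidean_expand[OF blinfun_linear, of "total_deriv B x"])
      (simp add: blinfun.sum_left blinfun.scaleR_left)
  also have "\<dots> = (\<Sum>k\<in>Basis. (X x \<bullet> k) *\<^sub>R (\<Sum>j\<in>Basis. (X x \<bullet> j) *\<^sub>R ?A k j))"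
    by (rule sum.cong[OF refl], subst linear_euclidean_expand[OF blinfun_linear]) (rule refl)
  finally have cc: "cc x = (\<Sum>k\<in>Basis. (X x \<bullet> k) *\<^sub>R (\<Sum>j\<in>Basis. (X x \<bullet> j) *\<^sub>R ?A k j))" .
  have "?A k j \<bullet> \<xi> = (\<Sum>l\<in>Basis. (?A k j \<bullet> l) * (\<xi> \<bullet> l))" for k j
    by (rule euclidean_inner)
  then show ?thesis
    unfolding cc D by (simp add: inner_sum_left sum_distrib_left mult_ac)
qed

text \<open>This is cot (\<theta>0 / 2).\<close>

definition \<kappa> :: real where "\<kappa> = sin \<theta>0 / (1 - cos \<theta>0)"

text \<open>\<open>\<Sigma>\<close> is \<open>sg\<close>, and \<open>sgx\<close>, \<open>sg\<xi>\<close>, \<open>sgh\<close> are its partial gradients.\<close>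

definition al :: "'a \<Rightarrow> 'a" where "al x = G x (X x) - (1/12) *\<^sub>R cc x"

lemma al_smooth: "smooth_on Q al"
  unfolding al_def[abs_def]
  by (intro smooth_on_diff smooth_on_blinfun_apply smooth_on_linear_comp[OF _ bounded_linear_scaleR_right]
      G_smooth X_smooth cc_smooth open_Q)

definition sg :: "'a \<times> 'a \<times> real \<Rightarrow> real" where
  "sg = (\<lambda>(x, \<xi>, h). - h * H x + h\<^sup>2 * (al x \<bullet> \<xi>) - \<kappa> / 4 * (G x (\<xi> - h *\<^sub>R X x) \<bullet> (\<xi> - h *\<^sub>R X x)))"

lemma lorentz_Sigma_eq:
  assumes "x \<in> Q" shows "lorentz_Sigma \<theta> J H \<theta>0 h x \<xi> = sg (x, \<xi>, h)"
  unfolding lorentz_Sigma_def Let_def cc_inner[OF assms] G_inner[OF assms, symmetric] sg_def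
  by (simp add: al_def \<kappa>_def inner_diff_left algebra_simps)

definition sgx :: "'a \<times> 'a \<times> real \<Rightarrow> 'a" where
  "sgx = (\<lambda>(x, \<xi>, h). \<Sum>u\<in>Basis. (- h * (gH x \<bullet> u) + h\<^sup>2 * (total_deriv al x u \<bullet> \<xi>)
     - \<kappa> / 4 * (total_deriv G x u (\<xi> - h *\<^sub>R X x) \<bullet> (\<xi> - h *\<^sub>R X x))
     + \<kappa> / 2 * h * (G x (\<xi> - h *\<^sub>R X x) \<bullet> total_deriv X x u)) *\<^sub>R u)"

definition sg\<xi> :: "'a \<times> 'a \<times> real \<Rightarrow> 'a" where
  "sg\<xi> = (\<lambda>(x, \<xi>, h). h\<^sup>2 *\<^sub>R al x - (\<kappa> / 2) *\<^sub>R G x (\<xi> - h *\<^sub>R X x))"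

definition sgh :: "'a \<times> 'a \<times> real \<Rightarrow> real" where
  "sgh = (\<lambda>(x, \<xi>, h). - H x + 2 * h * (al x \<bullet> \<xi>) + \<kappa> / 2 * (G x (\<xi> - h *\<^sub>R X x) \<bullet> X x))"

lemma sgx_inner:
  "sgx (x, \<xi>, h) \<bullet> w = - h * (gH x \<bullet> w) + h\<^sup>2 * (total_deriv al x w \<bullet> \<xi>)
     - \<kappa> / 4 * (total_deriv G x w (\<xi> - h *\<^sub>R X x) \<bullet> (\<xi> - h *\<^sub>R X x))
     + \<kappa> / 2 * h * (G x (\<xi> - h *\<^sub>R X x) \<bullet> total_deriv X x w)" (is "_ = ?L w")
proof -
  have "linear ?L"
    by (intro linearI) (simp_all add: blinfun.add_right blinfun.scaleR_right blinfun.add_left blinfun.scaleR_left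
        inner_add_left inner_add_right algebra_simps)
  have "sgx (x, \<xi>, h) \<bullet> w = (\<Sum>u\<in>Basis. (w \<bullet> u) *\<^sub>R ?L u)"
    unfolding sgx_def prod.case inner_sum_left inner_scaleR_left
    by (rule sum.cong[OF refl]) (simp add: inner_commute[of w] mult.commute)
  also have "\<dots> = ?L w" by (rule linear_euclidean_expand[OF \<open>linear ?L\<close>, symmetric])
  finally show ?thesis .
qed

lemma sg_has_derivative:
  assumes "x \<in> Q"
  shows "(sg has_derivative (\<lambda>w. sgx (x, \<xi>, h) \<bullet> fst w + sg\<xi> (x, \<xi>, h) \<bullet> fst (snd w) + sgh (x, \<xi>, h) * snd (snd w)))
    (at (x, \<xi>, h))"
proof -
  let ?P = "(x, \<xi>, h)"
  have f: "(fst has_derivative fst) (at ?P)" by (rule has_derivative_fst[OF has_derivative_ident])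
  have xi: "((\<lambda>P. fst (snd P)) has_derivative (\<lambda>w. fst (snd w))) (at ?P)"
    by (intro has_derivative_fst has_derivative_snd has_derivative_ident)
  have hh: "((\<lambda>P. snd (snd P)) has_derivative (\<lambda>w. snd (snd w))) (at ?P)"
    by (intro has_derivative_snd has_derivative_ident)
  have comp: "((\<lambda>P. F (fst P)) has_derivative (\<lambda>w. total_deriv F x (fst w))) (at ?P)" if "smooth_on Q F" for F :: "'a \<Rightarrow> 'b::real_normed_vector"
    using has_derivative_compose[OF f, of F "total_deriv F x"] has_derivative_total_deriv[OF that assms] by simp
  have Hd: "((\<lambda>P. H (fst P)) has_derivative (\<lambda>w. gH x \<bullet> fst w)) (at ?P)"
    using comp[OF H_smooth] by (simp add: gH_inner[OF assms] smooth_on_total_deriv_apply[OF H_smooth assms])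
  have d: "((\<lambda>P. fst (snd P) - snd (snd P) *\<^sub>R X (fst P)) has_derivative
      (\<lambda>w. fst (snd w) - (h *\<^sub>R total_deriv X x (fst w) + snd (snd w) *\<^sub>R X x))) (at ?P)"
    using has_derivative_diff[OF xi has_derivative_scaleR[OF hh comp[OF X_smooth]]] by simp
  have Gd: "((\<lambda>P. G (fst P) (fst (snd P) - snd (snd P) *\<^sub>R X (fst P))) has_derivative
      (\<lambda>w. G x (fst (snd w) - (h *\<^sub>R total_deriv X x (fst w) + snd (snd w) *\<^sub>R X x)) + total_deriv G x (fst w) (\<xi> - h *\<^sub>R X x))) (at ?P)"
    using bounded_bilinear.FDERIV[OF bounded_bilinear_blinfun_apply comp[OF G_smooth] d] by simp
  note Gdd = bounded_bilinear.FDERIV[OF bounded_bilinear_inner Gd d]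
  note ax = bounded_bilinear.FDERIV[OF bounded_bilinear_inner comp[OF al_smooth] xi]
  have h2: "((\<lambda>P. (snd (snd P))\<^sup>2) has_derivative (\<lambda>w. 2 * h * snd (snd w))) (at ?P)"
    using has_derivative_power[OF hh, of 2] by (simp add: mult_ac)
  have "((\<lambda>P. - snd (snd P) * H (fst P) + (snd (snd P))\<^sup>2 * (al (fst P) \<bullet> fst (snd P))
      - \<kappa> / 4 * (G (fst P) (fst (snd P) - snd (snd P) *\<^sub>R X (fst P)) \<bullet> (fst (snd P) - snd (snd P) *\<^sub>R X (fst P)))) has_derivative
     (\<lambda>w. (- h * (gH x \<bullet> fst w) + (- snd (snd w)) * H x) + (h\<^sup>2 * (al x \<bullet> fst (snd w) + total_deriv al x (fst w) \<bullet> \<xi>)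
        + 2 * h * snd (snd w) * (al x \<bullet> \<xi>))
      - \<kappa> / 4 * (G x (\<xi> - h *\<^sub>R X x) \<bullet> (fst (snd w) - (h *\<^sub>R total_deriv X x (fst w) + snd (snd w) *\<^sub>R X x))
         + (G x (fst (snd w) - (h *\<^sub>R total_deriv X x (fst w) + snd (snd w) *\<^sub>R X x)) + total_deriv G x (fst w) (\<xi> - h *\<^sub>R X x)) \<bullet> (\<xi> - h *\<^sub>R X x)))) (at ?P)"
    using has_derivative_diff[OF has_derivative_add[OF has_derivative_mult[OF has_derivative_minus[OF hh] Hd]
        has_derivative_mult[OF h2 ax]] has_derivative_mult_right[OF Gdd, of "\<kappa> / 4"]]
    by simp
  then show ?thesis
    unfolding sg_def case_prod_beta
  proof (rule has_derivative_eq_rhs, intro ext)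
    fix w :: "'a \<times> 'a \<times> real"
    have s: "G x (fst (snd w) - (h *\<^sub>R total_deriv X x (fst w) + snd (snd w) *\<^sub>R X x)) \<bullet> (\<xi> - h *\<^sub>R X x)
       = G x (\<xi> - h *\<^sub>R X x) \<bullet> (fst (snd w) - (h *\<^sub>R total_deriv X x (fst w) + snd (snd w) *\<^sub>R X x))"
      by (rule G_sym[OF assms])
    show "- h * (gH x \<bullet> fst w) + - snd (snd w) * H x + (h\<^sup>2 * (al x \<bullet> fst (snd w) + total_deriv al x (fst w) \<bullet> \<xi>)
        + 2 * h * snd (snd w) * (al x \<bullet> \<xi>))
      - \<kappa> / 4 * (G x (\<xi> - h *\<^sub>R X x) \<bullet> (fst (snd w) - (h *\<^sub>R total_deriv X x (fst w) + snd (snd w) *\<^sub>R X x))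
         + (G x (fst (snd w) - (h *\<^sub>R total_deriv X x (fst w) + snd (snd w) *\<^sub>R X x)) + total_deriv G x (fst w) (\<xi> - h *\<^sub>R X x)) \<bullet> (\<xi> - h *\<^sub>R X x))
      = sgx (x, \<xi>, h) \<bullet> fst w + sg\<xi> (x, \<xi>, h) \<bullet> fst (snd w) + sgh (x, \<xi>, h) * snd (snd w)"
      unfolding sgx_inner sg\<xi>_def sgh_def prod.case inner_add_left s
      by (simp add: inner_diff_left inner_diff_right inner_add_right algebra_simps)
  qed
qed

end

section \<open>Evaluation of segment integrals\<close>

lemma smooth_on_linear_precomp:
  assumes "open S" "open T" "bounded_linear g" "\<And>x. x \<in> S \<Longrightarrow> g x \<in> T" "smooth_on T f"
  shows "smooth_on S (\<lambda>x. f (g x))"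
  by (rule smooth_on_compose[OF assms(1,2,4,5) smooth_on_linear[OF assms(1,3)]])

lemma ray_int_blinfun_apply:
  fixes F :: "'a::euclidean_space \<Rightarrow> 'c::real_normed_vector \<Rightarrow>\<^sub>L 'b::banach"
  assumes "continuous_on Q F" "z \<in> ray_dom Q"
  shows "blinfun_apply (ray_int i F z) u = ray_int i (\<lambda>y. blinfun_apply (F y) u) z"
  using integral_linear[OF ray_int_integrable[OF assms, of i], of "\<lambda>A. blinfun_apply A u"]
  by (simp add: ray_int_def o_def bounded_linear_apply_blinfun blinfun.scaleR_left)

lemma ray_int_inner:
  fixes f :: "'a::euclidean_space \<Rightarrow> 'b::euclidean_space"
  assumes "continuous_on Q f" "z \<in> ray_dom Q"
  shows "ray_int i f z \<bullet> u = ray_int i (\<lambda>y. f y \<bullet> u) z"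
  using integral_linear[OF ray_int_integrable[OF assms, of i] bounded_linear_inner_left, of u]
  by (simp add: ray_int_def o_def)

lemma ray_int_cong:
  assumes "\<And>y. y \<in> Q \<Longrightarrow> f y = g y" "z \<in> ray_dom Q"
  shows "ray_int i f z = ray_int i g z"
  unfolding ray_int_def using assms by (intro integral_cong) (auto simp: ray_dom_def)

lemma ray_int_has_derivative_total_deriv:
  fixes f :: "'a::euclidean_space \<Rightarrow> 'b::banach"
  assumes "open Q" "smooth_on Q f" "z \<in> ray_dom Q"
  shows "(ray_int i f has_derivative
    (\<lambda>w. ray_int i (total_deriv f) z (fst w) + ray_int (Suc i) (total_deriv f) z (snd w))) (at z)"
proof (rule has_derivative_eq_rhs[OF ray_int_has_derivative[OF assms]], rule ext)
  fix w :: "'a \<times> 'a"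
  note c = smooth_on_continuous[OF smooth_on_total_deriv[OF assms(1,2)]]
  have *: "ray_int j (\<lambda>y. frechet_derivative f (at y) b) z = ray_int j (total_deriv f) z b" for j b
    unfolding ray_int_blinfun_apply[OF c assms(3)]
    by (rule ray_int_cong[OF _ assms(3)]) (simp add: smooth_on_total_deriv_apply[OF assms(2)])
  show "(\<Sum>b\<in>Basis. (fst w \<bullet> b) *\<^sub>R ray_int i (\<lambda>y. frechet_derivative f (at y) b) z
                 + (snd w \<bullet> b) *\<^sub>R ray_int (Suc i) (\<lambda>y. frechet_derivative f (at y) b) z)
      = ray_int i (total_deriv f) z (fst w) + ray_int (Suc i) (total_deriv f) z (snd w)"
    unfolding * sum.distrib linear_euclidean_expand[OF blinfun_linear, symmetric] ..
qed

lemma ray_int_at_0: "ray_int i f (x, 0) = (1 / real (Suc i)) *\<^sub>R f x"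
proof -
  have "((\<lambda>t. t ^ i *\<^sub>R f x) has_integral (1 / real (Suc i)) *\<^sub>R f x) {0..1}"
  proof (rule has_integral_scaleR_left)
    have "((\<lambda>t. t ^ i) has_integral (1 ^ Suc i / real (Suc i) - 0 ^ Suc i / real (Suc i))) {0..1::real}"
    proof (rule fundamental_theorem_of_calculus)
      fix t :: real
      show "((\<lambda>t. t ^ Suc i / real (Suc i)) has_vector_derivative t ^ i) (at t within {0..1})"
        using DERIV_cdivide[OF DERIV_pow[of "Suc i" t "{0..1}"], of "real (Suc i)"]
        by (simp add: has_real_derivative_iff_has_vector_derivative[symmetric] del: of_nat_Suc)
    qed simp
    then show "((\<lambda>t. t ^ i) has_integral 1 / real (Suc i)) {0..1::real}" by simp
  qed
  then show ?thesis by (simp add: ray_int_def integral_unique)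
qed

text \<open>Both equations come from the fundamental theorem of calculus, applied to f (x + t \<xi>)
  and to t f (x + t \<xi>) on the unit interval.\<close>

lemma ray_int_total_deriv_direction:
  fixes f :: "'a::euclidean_space \<Rightarrow> 'b::banach"
  assumes "open Q" "smooth_on Q f" "(x, \<xi>) \<in> ray_dom Q"
  shows "ray_int 0 (total_deriv f) (x, \<xi>) \<xi> = f (x + \<xi>) - f x"
    and "ray_int 1 (total_deriv f) (x, \<xi>) \<xi> = f (x + \<xi>) - ray_int 0 f (x, \<xi>)"
proof -
  note c = smooth_on_continuous[OF smooth_on_total_deriv[OF assms(1,2)]]
  have der: "((\<lambda>t. f (x + t *\<^sub>R \<xi>)) has_vector_derivative total_deriv f (x + t *\<^sub>R \<xi>) \<xi>) (at t within {0..1})"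
    if "t \<in> {0..1}" for t
  proof -
    have "x + t *\<^sub>R \<xi> \<in> Q" using assms(3) that by (auto simp: ray_dom_def)
    note f' = has_derivative_total_deriv[OF assms(2) this]
    have "((\<lambda>t. x + t *\<^sub>R \<xi>) has_derivative (\<lambda>s. s *\<^sub>R \<xi>)) (at t within {0..1})"
      by (auto intro!: derivative_eq_intros)
    from has_derivative_compose[OF this f'] show ?thesis
      unfolding has_vector_derivative_def by (simp add: blinfun.scaleR_right)
  qed
  have "((\<lambda>t. total_deriv f (x + t *\<^sub>R \<xi>) \<xi>) has_integral (f (x + 1 *\<^sub>R \<xi>) - f (x + 0 *\<^sub>R \<xi>))) {0..1}"
    by (rule fundamental_theorem_of_calculus) (use der in auto)
  then show "ray_int 0 (total_deriv f) (x, \<xi>) \<xi> = f (x + \<xi>) - f x"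
    unfolding ray_int_blinfun_apply[OF c assms(3)] by (simp add: ray_int_def integral_unique)
  have "((\<lambda>t. t *\<^sub>R total_deriv f (x + t *\<^sub>R \<xi>) \<xi> + 1 *\<^sub>R f (x + t *\<^sub>R \<xi>)) has_integral
      (1 *\<^sub>R f (x + 1 *\<^sub>R \<xi>) - 0 *\<^sub>R f (x + 0 *\<^sub>R \<xi>))) {0..1}"
    by (rule fundamental_theorem_of_calculus[OF _ has_vector_derivative_scaleR[OF DERIV_ident der]]) auto
  then have "integral {0..1} (\<lambda>t. t *\<^sub>R total_deriv f (x + t *\<^sub>R \<xi>) \<xi> + f (x + t *\<^sub>R \<xi>)) = f (x + \<xi>)"
    by (simp add: integral_unique)
  moreover have "integral {0..1} (\<lambda>t. t *\<^sub>R total_deriv f (x + t *\<^sub>R \<xi>) \<xi> + f (x + t *\<^sub>R \<xi>))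
      = ray_int 1 (\<lambda>y. total_deriv f y \<xi>) (x, \<xi>) + ray_int 0 f (x, \<xi>)"
    using integral_add[OF ray_int_integrable[OF _ assms(3), of "\<lambda>y. total_deriv f y \<xi>" 1]
        ray_int_integrable[OF smooth_on_continuous[OF assms(2)] assms(3), of 0]] c
    by (simp add: ray_int_def bounded_linear.continuous_on[OF bounded_linear_apply_blinfun])
  ultimately show "ray_int 1 (total_deriv f) (x, \<xi>) \<xi> = f (x + \<xi>) - ray_int 0 f (x, \<xi>)"
    unfolding ray_int_blinfun_apply[OF c assms(3)] by (simp add: eq_diff_eq)
qed

section \<open>Gradients of the generating function\<close>

context lorentz
begin

definition \<Omega>S :: "('a \<times> 'a \<times> real) set" where
  "\<Omega>S = {P. (fst P, fst (snd P) - fst P) \<in> ray_dom Q}"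

lemma \<Omega>S_maps:
  "bounded_linear (\<lambda>P::'a \<times> 'a \<times> real. (fst P, fst (snd P) - fst P))"
  "bounded_linear (\<lambda>P::'a \<times> 'a \<times> real. fst (snd P) - fst P)"
  "bounded_linear (\<lambda>P::'a \<times> 'a \<times> real. fst (snd P))"
  "bounded_linear (\<lambda>P::'a \<times> 'a \<times> real. fst P)"
  "bounded_linear (\<lambda>P::'a \<times> 'a \<times> real. ((1/2) *\<^sub>R (fst P + fst (snd P)), fst (snd P) - fst P, snd (snd P)))"
  by (intro bounded_linear_Pair bounded_linear_sub bounded_linear_add bounded_linear_const_scaleR
      bounded_linear_compose[OF bounded_linear_fst bounded_linear_snd] bounded_linear_fst
      bounded_linear_compose[OF bounded_linear_snd bounded_linear_snd])+

lemma open_\<Omega>S: "open \<Omega>S"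
proof -
  have "\<Omega>S = (\<lambda>P. (fst P, fst (snd P) - fst P)) -` ray_dom Q" by (auto simp: \<Omega>S_def)
  then show ?thesis
    using open_vimage[OF open_ray_dom[OF open_Q] linear_continuous_on[OF \<Omega>S_maps(1)]] by simp
qed

lemma \<Omega>S_iff: "(a, b, h) \<in> \<Omega>S \<longleftrightarrow> closed_segment a b \<subseteq> Q"
proof -
  have "a + t *\<^sub>R (b - a) = (1 - t) *\<^sub>R a + t *\<^sub>R b" for t by (simp add: algebra_simps)
  then have "closed_segment a b = (\<lambda>t. a + t *\<^sub>R (b - a)) ` {0..1}"
    by (simp add: closed_segment_image_interval)
  then show ?thesis by (auto simp: \<Omega>S_def ray_dom_def)
qed

lemma \<Omega>S_points: "P \<in> \<Omega>S \<Longrightarrow> fst P \<in> Q" "P \<in> \<Omega>S \<Longrightarrow> fst (snd P) \<in> Q"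
  "P \<in> \<Omega>S \<Longrightarrow> (1/2) *\<^sub>R (fst P + fst (snd P)) \<in> Q"
proof -
  assume "P \<in> \<Omega>S"
  then have P: "fst P + t *\<^sub>R (fst (snd P) - fst P) \<in> Q" if "t \<in> {0..1}" for t
    using that by (auto simp: \<Omega>S_def ray_dom_def)
  show "fst P \<in> Q" "fst (snd P) \<in> Q" using P[of 0] P[of 1] by auto
  have "fst P + (1/2) *\<^sub>R (fst (snd P) - fst P) = (1/2) *\<^sub>R (fst P + fst (snd P))"
    by (simp add: algebra_simps flip: scaleR_left_distrib)
  then show "(1/2) *\<^sub>R (fst P + fst (snd P)) \<in> Q" using P[of "1/2"] by simp
qed

definition mid :: "'a \<times> 'a \<times> real \<Rightarrow> 'a \<times> 'a \<times> real" where
  "mid P = ((1/2) *\<^sub>R (fst P + fst (snd P)), fst (snd P) - fst P, snd (snd P))"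

definition S :: "'a \<times> 'a \<times> real \<Rightarrow> real" where
  "S P = lorentz_S \<theta> J H \<theta>0 (snd (snd P)) (fst P) (fst (snd P))"

text \<open>Moving an endpoint of the segment changes the integral of the one-form by its value at
  that endpoint and by the flux of \<omega> through the triangle swept. The flux carries the weight
  1 - t for the initial endpoint and t for the final one. In the contribution of \<Sigma>, the
  factor 1/2 comes from the midpoint, and the sign of \<open>sg\<xi>\<close> from the difference of
  the endpoints.\<close>

definition s1 :: "'a \<times> 'a \<times> real \<Rightarrow> 'a" where
  "s1 P = - thv (fst P) + (ray_int 0 B (fst P, fst (snd P) - fst P) - ray_int 1 B (fst P, fst (snd P) - fst P)) (fst (snd P) - fst P)
     + (1/2) *\<^sub>R sgx (mid P) - sg\<xi> (mid P)"

definition s2 :: "'a \<times> 'a \<times> real \<Rightarrow> 'a" where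
  "s2 P = thv (fst (snd P)) + ray_int 1 B (fst P, fst (snd P) - fst P) (fst (snd P) - fst P)
     + (1/2) *\<^sub>R sgx (mid P) + sg\<xi> (mid P)"

lemma segment_integral_eq:
  assumes "(a, b - a) \<in> ray_dom Q"
  shows "segment_integral \<theta> a b = ray_int 0 thv (a, b - a) \<bullet> (b - a)"
  unfolding ray_int_inner[OF smooth_on_continuous[OF thv_smooth] assms]
  by (simp add: segment_integral_def ray_int_def thv_inner)

lemma ray_int_B:
  assumes "z \<in> ray_dom Q"
  shows "ray_int i B z u \<bullet> w = ray_int i T z w \<bullet> u - ray_int i T z u \<bullet> w"
proof -
  note cB = smooth_on_continuous[OF B_smooth] and cT = smooth_on_continuous[OF T_smooth]
  have c: "continuous_on Q (\<lambda>y. blinfun_apply (F y) u)" if "continuous_on Q F" for F :: "'a \<Rightarrow> 'a \<Rightarrow>\<^sub>L 'a" and u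
    by (rule bounded_linear.continuous_on[OF bounded_linear_apply_blinfun that])
  have ap: "ray_int i F z u \<bullet> w = ray_int i (\<lambda>y. F y u \<bullet> w) z" if "continuous_on Q F" for F :: "'a \<Rightarrow> 'a \<Rightarrow>\<^sub>L 'a" and u w
    unfolding ray_int_blinfun_apply[OF that assms] by (rule ray_int_inner[OF c[OF that] assms])
  have "ray_int i (\<lambda>y. B y u \<bullet> w) z = ray_int i (\<lambda>y. T y w \<bullet> u - T y u \<bullet> w) z"
    by (rule ray_int_cong[OF _ assms]) (rule B_T)
  also have "\<dots> = ray_int i (\<lambda>y. T y w \<bullet> u) z - ray_int i (\<lambda>y. T y u \<bullet> w) z"
    unfolding ray_int_def scaleR_diff_right
    by (intro integral_diff ray_int_integrable[OF _ assms] continuous_intros c cT)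
  finally show ?thesis unfolding ap[OF cB] ap[OF cT] .
qed

lemma mid_in: "P \<in> \<Omega>S \<Longrightarrow> fst (mid P) \<in> Q"
  by (simp add: mid_def \<Omega>S_points)

lemma S_has_derivative:
  assumes P: "P \<in> \<Omega>S"
  shows "(S has_derivative (\<lambda>w. s1 P \<bullet> fst w + s2 P \<bullet> fst (snd w) + sgh (mid P) * snd (snd w))) (at P)"
proof -
  define a where "a = fst P"
  define \<xi> where "\<xi> = fst (snd P) - fst P"
  have z: "(a, \<xi>) \<in> ray_dom Q" using P by (simp add: \<Omega>S_def a_def \<xi>_def)
  have b: "fst (snd P) = a + \<xi>" by (simp add: a_def \<xi>_def)
  have I: "((\<lambda>P. ray_int 0 thv (fst P, fst (snd P) - fst P)) has_derivative
      (\<lambda>w. ray_int 0 T (a, \<xi>) (fst w) + ray_int 1 T (a, \<xi>) (fst (snd w) - fst w))) (at P)"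
    using has_derivative_compose[OF bounded_linear_imp_has_derivative[OF \<Omega>S_maps(1)],
        of "ray_int 0 thv" "\<lambda>w. ray_int 0 T (a, \<xi>) (fst w) + ray_int 1 T (a, \<xi>) (snd w)" P]
      ray_int_has_derivative_total_deriv[OF open_Q thv_smooth z, of 0]
    by (simp add: T_def a_def \<xi>_def)
  note II = bounded_bilinear.FDERIV[OF bounded_bilinear_inner I bounded_linear_imp_has_derivative[OF \<Omega>S_maps(2)]]
  have sgP: "((\<lambda>P. sg (mid P)) has_derivative (\<lambda>w. sgx (mid P) \<bullet> fst (mid w) + sg\<xi> (mid P) \<bullet> fst (snd (mid w)) + sgh (mid P) * snd (snd (mid w)))) (at P)"
    using has_derivative_compose[OF bounded_linear_imp_has_derivative[OF \<Omega>S_maps(5)], folded mid_def,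
        OF sg_has_derivative[OF mid_in[OF P], of "fst (snd (mid P))" "snd (snd (mid P))", simplified]] .
  have "((\<lambda>P. ray_int 0 thv (fst P, fst (snd P) - fst P) \<bullet> (fst (snd P) - fst P) + sg (mid P)) has_derivative
     (\<lambda>w. s1 P \<bullet> fst w + s2 P \<bullet> fst (snd w) + sgh (mid P) * snd (snd w))) (at P)"
  proof (rule has_derivative_eq_rhs[OF has_derivative_add[OF II sgP]], rule ext)
    fix w :: "'a \<times> 'a \<times> real"
    \<comment> \<open>Exchanging the two arguments of \<open>T\<close> costs a \<open>B\<close>;
      with \<xi> as direction the integral of \<open>T\<close> is then evaluated exactly. The same
      is done in \<open>e1\<close> with weight t.\<close>
    have e0: "ray_int 0 T (a, \<xi>) u \<bullet> \<xi> = ray_int 0 B (a, \<xi>) \<xi> \<bullet> u + (thv (a + \<xi>) - thv a) \<bullet> u" for u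
      using ray_int_B[OF z, of 0 \<xi> u] ray_int_total_deriv_direction(1)[OF open_Q thv_smooth z] by (simp add: T_def)
    have e1: "ray_int 1 T (a, \<xi>) u \<bullet> \<xi> = ray_int 1 B (a, \<xi>) \<xi> \<bullet> u + (thv (a + \<xi>) - ray_int 0 thv (a, \<xi>)) \<bullet> u" for u
      using ray_int_B[OF z, of 1 \<xi> u] ray_int_total_deriv_direction(2)[OF open_Q thv_smooth z] by (simp add: T_def)
    show "ray_int 0 thv (fst P, fst (snd P) - fst P) \<bullet> (fst (snd w) - fst w) +
          (ray_int 0 T (a, \<xi>) (fst w) + ray_int 1 T (a, \<xi>) (fst (snd w) - fst w)) \<bullet> (fst (snd P) - fst P) +
          (sgx (mid P) \<bullet> fst (mid w) + sg\<xi> (mid P) \<bullet> fst (snd (mid w)) + sgh (mid P) * snd (snd (mid w)))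
        = s1 P \<bullet> fst w + s2 P \<bullet> fst (snd w) + sgh (mid P) * snd (snd w)"
      unfolding s1_def s2_def
      unfolding \<xi>_def[symmetric]
      unfolding a_def[symmetric] b inner_add_left e0 e1
      by (simp add: mid_def inner_diff_left inner_diff_right inner_add_left inner_add_right blinfun.diff_left algebra_simps)
  qed
  then show ?thesis
  proof (rule has_derivative_transform_within_open[OF _ open_\<Omega>S P])
    fix P assume P: "P \<in> \<Omega>S"
    show "ray_int 0 thv (fst P, fst (snd P) - fst P) \<bullet> (fst (snd P) - fst P) + sg (mid P) = S P"
      using P lorentz_Sigma_eq[OF mid_in[OF P]]
      by (simp add: S_def lorentz_S_def \<Omega>S_def segment_integral_eq mid_def)
  qed
qed

lemma sg_smooth:
  "smooth_on (Q \<times> UNIV) (sgx :: 'a \<times> 'a \<times> real \<Rightarrow> 'a)" "smooth_on (Q \<times> UNIV) (sg\<xi> :: 'a \<times> 'a \<times> real \<Rightarrow> 'a)"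
proof -
  have o: "open (Q \<times> (UNIV :: ('a \<times> real) set))" by (intro open_Times open_Q open_UNIV)
  have comp: "smooth_on (Q \<times> UNIV) (\<lambda>P::'a \<times> 'a \<times> real. F (fst P))" if "smooth_on Q F" for F :: "'a \<Rightarrow> 'b::real_normed_vector"
    by (rule smooth_on_linear_precomp[OF o open_Q bounded_linear_fst _ that]) auto
  have xi: "smooth_on (Q \<times> UNIV) (\<lambda>P::'a \<times> 'a \<times> real. fst (snd P))"
    by (rule smooth_on_linear[OF o bounded_linear_compose[OF bounded_linear_fst bounded_linear_snd]])
  have h: "smooth_on (Q \<times> UNIV) (\<lambda>P::'a \<times> 'a \<times> real. snd (snd P))"
    by (rule smooth_on_linear[OF o bounded_linear_compose[OF bounded_linear_snd bounded_linear_snd]])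
  have d: "smooth_on (Q \<times> UNIV) (\<lambda>P::'a \<times> 'a \<times> real. fst (snd P) - snd (snd P) *\<^sub>R X (fst P))"
    by (intro smooth_on_diff smooth_on_scaleR o xi h comp X_smooth)
  show "smooth_on (Q \<times> UNIV) (sgx :: 'a \<times> 'a \<times> real \<Rightarrow> 'a)"
    unfolding sgx_def case_prod_beta
    by (intro smooth_on_sum smooth_on_scaleR smooth_on_add smooth_on_diff smooth_on_mult smooth_on_inner smooth_on_power
        smooth_on_blinfun_apply smooth_on_const o xi h d comp[OF gH_smooth] comp[OF G_smooth]
        comp[OF smooth_on_total_deriv[OF open_Q al_smooth]] comp[OF smooth_on_total_deriv[OF open_Q G_smooth]]
        comp[OF smooth_on_total_deriv[OF open_Q X_smooth]] smooth_on_linear_comp[OF o bounded_linear_minus[OF bounded_linear_ident] h])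
  show "smooth_on (Q \<times> UNIV) (sg\<xi> :: 'a \<times> 'a \<times> real \<Rightarrow> 'a)"
    unfolding sg\<xi>_def case_prod_beta
    by (intro smooth_on_scaleR smooth_on_diff smooth_on_power smooth_on_blinfun_apply smooth_on_const o h d
        comp[OF al_smooth] comp[OF G_smooth])
qed

lemma s_smooth: "smooth_on \<Omega>S s1" "smooth_on \<Omega>S s2"
proof -
  note o = open_\<Omega>S
  have oT: "open (Q \<times> (UNIV :: ('a \<times> real) set))" by (intro open_Times open_Q open_UNIV)
  have t1: "smooth_on \<Omega>S (\<lambda>P. thv (fst P))"
    by (rule smooth_on_linear_precomp[OF o open_Q \<Omega>S_maps(4) _ thv_smooth]) (rule \<Omega>S_points)
  have t2: "smooth_on \<Omega>S (\<lambda>P. thv (fst (snd P)))"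
    by (rule smooth_on_linear_precomp[OF o open_Q \<Omega>S_maps(3) _ thv_smooth]) (rule \<Omega>S_points)
  have r: "smooth_on \<Omega>S (\<lambda>P. ray_int i B (fst P, fst (snd P) - fst P))" for i
    by (rule smooth_on_linear_precomp[OF o open_ray_dom[OF open_Q] \<Omega>S_maps(1) _ smooth_on_ray_int[OF open_Q B_smooth]])
      (simp add: \<Omega>S_def)
  have d: "smooth_on \<Omega>S (\<lambda>P. fst (snd P) - fst P)" by (rule smooth_on_linear[OF o \<Omega>S_maps(2)])
  have m: "smooth_on \<Omega>S (\<lambda>P. F (mid P))" if "smooth_on (Q \<times> UNIV) F" for F :: "'a \<times> 'a \<times> real \<Rightarrow> 'a"
    unfolding mid_def
    by (rule smooth_on_linear_precomp[OF o oT \<Omega>S_maps(5) _ that]) (simp add: \<Omega>S_points)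
  show "smooth_on \<Omega>S s1"
    unfolding s1_def[abs_def]
    by (intro smooth_on_add smooth_on_diff smooth_on_scaleR smooth_on_const smooth_on_blinfun_apply o t1 r d m sg_smooth
        smooth_on_linear_comp[OF o bounded_linear_minus[OF bounded_linear_ident]])
  show "smooth_on \<Omega>S s2"
    unfolding s2_def[abs_def]
    by (intro smooth_on_add smooth_on_diff smooth_on_scaleR smooth_on_const smooth_on_blinfun_apply o t2 r d m sg_smooth)
qed


section \<open>Linearisation at the diagonal\<close>

lemma sg\<xi>_diag:
  assumes x: "x \<in> Q"
  shows "(sg\<xi> has_derivative (\<lambda>w. - (\<kappa> / 2) *\<^sub>R G x (fst (snd w) - snd (snd w) *\<^sub>R X x))) (at (x, 0, 0))"
proof -
  let ?P = "(x, 0 :: 'a, 0 :: real)"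
  have f: "(fst has_derivative fst) (at ?P)" by (rule has_derivative_fst[OF has_derivative_ident])
  have xi: "((\<lambda>P. fst (snd P)) has_derivative (\<lambda>w. fst (snd w))) (at ?P)"
    by (intro has_derivative_fst has_derivative_snd has_derivative_ident)
  have hh: "((\<lambda>P. snd (snd P)) has_derivative (\<lambda>w. snd (snd w))) (at ?P)"
    by (intro has_derivative_snd has_derivative_ident)
  have comp: "((\<lambda>P. F (fst P)) has_derivative (\<lambda>w. total_deriv F x (fst w))) (at ?P)" if "smooth_on Q F" for F :: "'a \<Rightarrow> 'b::real_normed_vector"
    using has_derivative_compose[OF f, of F "total_deriv F x"] has_derivative_total_deriv[OF that x] by simp
  have d: "((\<lambda>P. fst (snd P) - snd (snd P) *\<^sub>R X (fst P)) has_derivative (\<lambda>w. fst (snd w) - snd (snd w) *\<^sub>R X x)) (at ?P)"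
    using has_derivative_diff[OF xi has_derivative_scaleR[OF hh comp[OF X_smooth]]] by simp
  have Gd: "((\<lambda>P. G (fst P) (fst (snd P) - snd (snd P) *\<^sub>R X (fst P))) has_derivative
      (\<lambda>w. G x (fst (snd w) - snd (snd w) *\<^sub>R X x))) (at ?P)"
    using bounded_bilinear.FDERIV[OF bounded_bilinear_blinfun_apply comp[OF G_smooth] d] by simp
  have h2: "((\<lambda>P. (snd (snd P))\<^sup>2) has_derivative (\<lambda>w. 0)) (at ?P)"
    using has_derivative_power[OF hh, of 2] by simp
  have "((\<lambda>P. (snd (snd P))\<^sup>2 *\<^sub>R al (fst P) - (\<kappa> / 2) *\<^sub>R G (fst P) (fst (snd P) - snd (snd P) *\<^sub>R X (fst P)))
      has_derivative (\<lambda>w. - (\<kappa> / 2) *\<^sub>R G x (fst (snd w) - snd (snd w) *\<^sub>R X x))) (at ?P)"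
    using has_derivative_diff[OF has_derivative_scaleR[OF h2 comp[OF al_smooth]] has_derivative_scaleR_right[OF Gd, of "\<kappa> / 2"]]
    by simp
  then show ?thesis unfolding sg\<xi>_def case_prod_beta .
qed

text \<open>Every term of \<open>sgx\<close> except - h gH has a product of two factors that vanish
  at (x, 0, 0), since \<xi> - h X vanishes there; such terms have derivative 0.\<close>

lemma sgx_diag:
  assumes x: "x \<in> Q"
  shows "(sgx has_derivative (\<lambda>w. - snd (snd w) *\<^sub>R gH x)) (at (x, 0, 0))"
proof -
  let ?P = "(x, 0 :: 'a, 0 :: real)"
  have f: "(fst has_derivative fst) (at ?P)" by (rule has_derivative_fst[OF has_derivative_ident])
  have xi: "((\<lambda>P. fst (snd P)) has_derivative (\<lambda>w. fst (snd w))) (at ?P)"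
    by (intro has_derivative_fst has_derivative_snd has_derivative_ident)
  have hh: "((\<lambda>P. snd (snd P)) has_derivative (\<lambda>w. snd (snd w))) (at ?P)"
    by (intro has_derivative_snd has_derivative_ident)
  have comp: "((\<lambda>P. F (fst P)) has_derivative (\<lambda>w. total_deriv F x (fst w))) (at ?P)" if "smooth_on Q F" for F :: "'a \<Rightarrow> 'b::real_normed_vector"
    using has_derivative_compose[OF f, of F "total_deriv F x"] has_derivative_total_deriv[OF that x] by simp
  have d: "((\<lambda>P. fst (snd P) - snd (snd P) *\<^sub>R X (fst P)) has_derivative (\<lambda>w. fst (snd w) - snd (snd w) *\<^sub>R X x)) (at ?P)"
    using has_derivative_diff[OF xi has_derivative_scaleR[OF hh comp[OF X_smooth]]] by simp
  have Gd: "((\<lambda>P. G (fst P) (fst (snd P) - snd (snd P) *\<^sub>R X (fst P))) has_derivative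
      (\<lambda>w. G x (fst (snd w) - snd (snd w) *\<^sub>R X x))) (at ?P)"
    using bounded_bilinear.FDERIV[OF bounded_bilinear_blinfun_apply comp[OF G_smooth] d] by simp
  have h2: "((\<lambda>P. (snd (snd P))\<^sup>2) has_derivative (\<lambda>w. 0)) (at ?P)"
    using has_derivative_power[OF hh, of 2] by simp
  have col: "((\<lambda>P. total_deriv F (fst P) u) has_derivative (\<lambda>w. total_deriv (total_deriv F) x (fst w) u)) (at ?P)"
    if "smooth_on Q F" for F :: "'a \<Rightarrow> 'b::real_normed_vector" and u
    by (rule bounded_linear.has_derivative[OF bounded_linear_apply_blinfun comp[OF smooth_on_total_deriv[OF open_Q that]]])
  have t1: "((\<lambda>P. - snd (snd P) * (gH (fst P) \<bullet> u)) has_derivative (\<lambda>w. - snd (snd w) * (gH x \<bullet> u))) (at ?P)" for u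
    using has_derivative_mult[OF has_derivative_minus[OF hh] bounded_linear.has_derivative[OF bounded_linear_inner_left comp[OF gH_smooth]]]
    by simp
  have t2: "((\<lambda>P. (snd (snd P))\<^sup>2 * (total_deriv al (fst P) u \<bullet> fst (snd P))) has_derivative (\<lambda>w. 0)) (at ?P)" for u
    using has_derivative_mult[OF h2 bounded_bilinear.FDERIV[OF bounded_bilinear_inner col[OF al_smooth, of u] xi]] by simp
  have t3: "((\<lambda>P. \<kappa> / 4 * (total_deriv G (fst P) u (fst (snd P) - snd (snd P) *\<^sub>R X (fst P)) \<bullet> (fst (snd P) - snd (snd P) *\<^sub>R X (fst P))))
      has_derivative (\<lambda>w. 0)) (at ?P)" for u
    using has_derivative_mult_right[OF bounded_bilinear.FDERIV[OF bounded_bilinear_inner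
        bounded_bilinear.FDERIV[OF bounded_bilinear_blinfun_apply col[OF G_smooth, of u] d] d], of "\<kappa> / 4"] by simp
  have t4: "((\<lambda>P. \<kappa> / 2 * snd (snd P) * (G (fst P) (fst (snd P) - snd (snd P) *\<^sub>R X (fst P)) \<bullet> total_deriv X (fst P) u))
      has_derivative (\<lambda>w. 0)) (at ?P)" for u
    using has_derivative_mult[OF has_derivative_mult_right[OF hh, of "\<kappa> / 2"]
        bounded_bilinear.FDERIV[OF bounded_bilinear_inner Gd col[OF X_smooth, of u]]] by simp
  have "((\<lambda>P. \<Sum>u\<in>Basis. (- snd (snd P) * (gH (fst P) \<bullet> u) + (snd (snd P))\<^sup>2 * (total_deriv al (fst P) u \<bullet> fst (snd P))
     - \<kappa> / 4 * (total_deriv G (fst P) u (fst (snd P) - snd (snd P) *\<^sub>R X (fst P)) \<bullet> (fst (snd P) - snd (snd P) *\<^sub>R X (fst P)))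
     + \<kappa> / 2 * snd (snd P) * (G (fst P) (fst (snd P) - snd (snd P) *\<^sub>R X (fst P)) \<bullet> total_deriv X (fst P) u)) *\<^sub>R u)
      has_derivative (\<lambda>w. \<Sum>u\<in>Basis. (- snd (snd w) * (gH x \<bullet> u) + 0 - 0 + 0) *\<^sub>R u)) (at ?P)"
    by (intro has_derivative_sum has_derivative_scaleR_left has_derivative_add has_derivative_diff t1 t2 t3 t4)
  moreover have "(\<Sum>u\<in>Basis. (- k * (gH x \<bullet> u) + 0 - 0 + 0) *\<^sub>R u) = - k *\<^sub>R gH x" for k
  proof -
    have "(\<Sum>u\<in>Basis. (- k * (gH x \<bullet> u) + 0 - 0 + 0) *\<^sub>R u) = - k *\<^sub>R (\<Sum>u\<in>Basis. (gH x \<bullet> u) *\<^sub>R u)"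
      by (simp add: scaleR_sum_right sum_negf)
    then show ?thesis by (simp add: euclidean_representation)
  qed
  ultimately show ?thesis unfolding sgx_def case_prod_beta by simp
qed

lemma diag_\<Omega>S: "x \<in> Q \<Longrightarrow> (x, x, 0) \<in> \<Omega>S"
  by (simp add: \<Omega>S_iff)

lemma s_diag:
  assumes x: "x \<in> Q"
  shows "(s1 has_derivative (\<lambda>w. - T x (fst w) + (1/2) *\<^sub>R B x (fst (snd w) - fst w)
        - (snd (snd w) / 2) *\<^sub>R gH x + (\<kappa> / 2) *\<^sub>R G x (fst (snd w) - fst w - snd (snd w) *\<^sub>R X x))) (at (x, x, 0))"
    and "(s2 has_derivative (\<lambda>w. T x (fst (snd w)) + (1/2) *\<^sub>R B x (fst (snd w) - fst w)
        - (snd (snd w) / 2) *\<^sub>R gH x - (\<kappa> / 2) *\<^sub>R G x (fst (snd w) - fst w - snd (snd w) *\<^sub>R X x))) (at (x, x, 0))"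
proof -
  let ?P = "(x, x, 0 :: real)"
  note P = diag_\<Omega>S[OF x]
  note f = bounded_linear_imp_has_derivative[OF \<Omega>S_maps(4), of "at ?P"]
    and f2 = bounded_linear_imp_has_derivative[OF \<Omega>S_maps(3), of "at ?P"]
    and d = bounded_linear_imp_has_derivative[OF \<Omega>S_maps(2), of "at ?P"]
    and m = bounded_linear_imp_has_derivative[OF \<Omega>S_maps(5), of "at ?P"]
  have t1: "((\<lambda>P. thv (fst P)) has_derivative (\<lambda>w. T x (fst w))) (at ?P)"
    using has_derivative_compose[OF f, of thv "T x"] T_derivative[OF x] by simp
  have t2: "((\<lambda>P. thv (fst (snd P))) has_derivative (\<lambda>w. T x (fst (snd w)))) (at ?P)"
    using has_derivative_compose[OF f2, of thv "T x"] T_derivative[OF x] by simp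
  \<comment> \<open>The value of this derivative is immaterial: in the product rule it is applied to
    q' - q, which is 0 on the diagonal.\<close>
  have r: "\<exists>r'. ((\<lambda>P. ray_int i B (fst P, fst (snd P) - fst P)) has_derivative r') (at ?P)" for i
  proof -
    have "smooth_on \<Omega>S (\<lambda>P. ray_int i B (fst P, fst (snd P) - fst P))"
      by (rule smooth_on_linear_precomp[OF open_\<Omega>S open_ray_dom[OF open_Q] \<Omega>S_maps(1) _ smooth_on_ray_int[OF open_Q B_smooth]])
        (simp add: \<Omega>S_def)
    from smooth_on_has_derivative[OF this P] show ?thesis by blast
  qed
  obtain r0 r1 where r0: "((\<lambda>P. ray_int 0 B (fst P, fst (snd P) - fst P)) has_derivative r0) (at ?P)"
    and r1: "((\<lambda>P. ray_int 1 B (fst P, fst (snd P) - fst P)) has_derivative r1) (at ?P)" using r by blast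
  have i0: "ray_int 0 B (x, 0) = B x" and i1: "ray_int 1 B (x, 0) = (1/2) *\<^sub>R B x"
    by (simp_all add: ray_int_at_0)
  have R1: "((\<lambda>P. ray_int 1 B (fst P, fst (snd P) - fst P) (fst (snd P) - fst P)) has_derivative
      (\<lambda>w. (1/2) *\<^sub>R B x (fst (snd w) - fst w))) (at ?P)"
    using bounded_bilinear.FDERIV[OF bounded_bilinear_blinfun_apply r1 d] i1 by (simp add: blinfun.scaleR_left)
  have R2: "((\<lambda>P. (ray_int 0 B (fst P, fst (snd P) - fst P) - ray_int 1 B (fst P, fst (snd P) - fst P)) (fst (snd P) - fst P)) has_derivative
      (\<lambda>w. (1/2) *\<^sub>R B x (fst (snd w) - fst w))) (at ?P)"
  proof (rule has_derivative_eq_rhs[OF bounded_bilinear.FDERIV[OF bounded_bilinear_blinfun_apply has_derivative_diff[OF r0 r1] d]], rule ext)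
    fix w :: "'a \<times> 'a \<times> real"
    have "B x v - (1/2) *\<^sub>R B x v = (1/2) *\<^sub>R B x v" for v
      by (simp add: algebra_simps flip: scaleR_left_distrib)
    then show "(ray_int 0 B (fst ?P, fst (snd ?P) - fst ?P) - ray_int 1 B (fst ?P, fst (snd ?P) - fst ?P)) (fst (snd w) - fst w) +
         (r0 w - r1 w) (fst (snd ?P) - fst ?P) = (1/2) *\<^sub>R B x (fst (snd w) - fst w)"
      using i0 i1 by (simp add: blinfun.diff_left blinfun.scaleR_left)
  qed
  have mP: "((1/2) *\<^sub>R (x + x), x - x, 0) = (x, 0 :: 'a, 0 :: real)"
    by (simp flip: scaleR_left_distrib add: scaleR_right_distrib)
  have mx: "((\<lambda>P. sgx (mid P)) has_derivative (\<lambda>w. - snd (snd w) *\<^sub>R gH x)) (at ?P)"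
    using has_derivative_compose[OF m, of sgx "\<lambda>w. - snd (snd w) *\<^sub>R gH x"] sgx_diag[OF x] mP by (simp add: mid_def)
  have mxi: "((\<lambda>P. sg\<xi> (mid P)) has_derivative (\<lambda>w. - (\<kappa> / 2) *\<^sub>R G x (fst (snd w) - fst w - snd (snd w) *\<^sub>R X x))) (at ?P)"
    using has_derivative_compose[OF m, of sg\<xi> "\<lambda>w. - (\<kappa> / 2) *\<^sub>R G x (fst (snd w) - snd (snd w) *\<^sub>R X x)"] sg\<xi>_diag[OF x] mP by (simp add: mid_def)
  show "(s1 has_derivative (\<lambda>w. - T x (fst w) + (1/2) *\<^sub>R B x (fst (snd w) - fst w)
        - (snd (snd w) / 2) *\<^sub>R gH x + (\<kappa> / 2) *\<^sub>R G x (fst (snd w) - fst w - snd (snd w) *\<^sub>R X x))) (at ?P)"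
    unfolding s1_def[abs_def]
    by (rule has_derivative_eq_rhs[OF has_derivative_diff[OF has_derivative_add[OF has_derivative_add[OF has_derivative_minus[OF t1] R2]
        has_derivative_scaleR_right[OF mx]] mxi]]) (simp add: fun_eq_iff)
  show "(s2 has_derivative (\<lambda>w. T x (fst (snd w)) + (1/2) *\<^sub>R B x (fst (snd w) - fst w)
        - (snd (snd w) / 2) *\<^sub>R gH x - (\<kappa> / 2) *\<^sub>R G x (fst (snd w) - fst w - snd (snd w) *\<^sub>R X x))) (at ?P)"
    unfolding s2_def[abs_def]
    by (rule has_derivative_eq_rhs[OF has_derivative_add[OF has_derivative_add[OF has_derivative_add[OF t2 R1]
        has_derivative_scaleR_right[OF mx]] mxi]]) (simp add: fun_eq_iff)
qed

definition \<Omega> :: "('a \<times> 'a \<times> 'a \<times> real) set" where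
  "\<Omega> = {P. (fst P, fst (snd P), snd (snd (snd P))) \<in> \<Omega>S \<and> (fst (snd P), fst (snd (snd P)), snd (snd (snd P))) \<in> \<Omega>S}"

definition f :: "'a \<times> 'a \<times> 'a \<times> real \<Rightarrow> 'a" where
  "f P = s2 (fst P, fst (snd P), snd (snd (snd P))) + s1 (fst (snd P), fst (snd (snd P)), snd (snd (snd P)))"

lemma \<Omega>_maps:
  "bounded_linear (\<lambda>P::'a \<times> 'a \<times> 'a \<times> real. (fst P, fst (snd P), snd (snd (snd P))))"
  "bounded_linear (\<lambda>P::'a \<times> 'a \<times> 'a \<times> real. (fst (snd P), fst (snd (snd P)), snd (snd (snd P))))"
  by (intro bounded_linear_Pair bounded_linear_fst
      bounded_linear_compose[OF bounded_linear_fst bounded_linear_snd]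
      bounded_linear_compose[OF bounded_linear_fst bounded_linear_compose[OF bounded_linear_snd bounded_linear_snd]]
      bounded_linear_compose[OF bounded_linear_snd bounded_linear_compose[OF bounded_linear_snd bounded_linear_snd]])+

lemma open_\<Omega>: "open \<Omega>"
proof -
  have "\<Omega> = (\<lambda>P. (fst P, fst (snd P), snd (snd (snd P)))) -` \<Omega>S \<inter> (\<lambda>P. (fst (snd P), fst (snd (snd P)), snd (snd (snd P)))) -` \<Omega>S"
    by (auto simp: \<Omega>_def)
  then show ?thesis
    using open_vimage[OF open_\<Omega>S linear_continuous_on[OF \<Omega>_maps(1)]] open_vimage[OF open_\<Omega>S linear_continuous_on[OF \<Omega>_maps(2)]]
    by (simp add: open_Int)
qed

lemma f_smooth: "smooth_on \<Omega> f"
  unfolding f_def[abs_def]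
  by (intro smooth_on_add open_\<Omega> smooth_on_linear_precomp[OF open_\<Omega> open_\<Omega>S \<Omega>_maps(1) _ s_smooth(2)]
      smooth_on_linear_precomp[OF open_\<Omega> open_\<Omega>S \<Omega>_maps(2) _ s_smooth(1)]) (auto simp: \<Omega>_def)

lemma diag_\<Omega>: "x \<in> Q \<Longrightarrow> (x, x, x, 0) \<in> \<Omega>"
  by (simp add: \<Omega>_def diag_\<Omega>S)

lemma f_diag: "x \<in> Q \<Longrightarrow> f (x, x, x, 0) = 0"
proof -
  assume x: "x \<in> Q"
  have "mid (x, x, 0) = (x, 0, 0)" by (simp add: mid_def scaleR_right_distrib flip: scaleR_left_distrib)
  moreover have "sg\<xi> (x, 0, 0) = 0" by (simp add: sg\<xi>_def)
  moreover have "sgx (x, 0, 0) = 0" by (simp add: sgx_def)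
  ultimately show ?thesis by (simp add: f_def s1_def s2_def)
qed

text \<open>Equals 2 (\<kappa> + J)^-1 G^-1, because (\<kappa> + J)^-1 = (\<kappa> - J) /
  (\<kappa>^2 + 1). It inverts G (\<kappa> + J) / 2, the coefficient of the later increment in the
  linearised f.\<close>

definition A :: "'a \<Rightarrow> 'a \<Rightarrow> 'a" where
  "A x v = (2 / (\<kappa>\<^sup>2 + 1)) *\<^sub>R (\<kappa> *\<^sub>R Ginv x v - J x (Ginv x v))"

definition bv :: "'a \<Rightarrow> 'a" where
  "bv x = (2 / (\<kappa>\<^sup>2 + 1)) *\<^sub>R (\<kappa> *\<^sub>R J x (X x) + X x)"

lemma cos_ne: "cos \<theta>0 \<noteq> 1"
proof
  assume 1: "cos \<theta>0 = 1"
  then have "sin \<theta>0 = 0" using sin_cos_squared_add[of \<theta>0] by simp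
  with 1 have "cis (of_int 1 * \<theta>0) = 1" by (simp add: complex_eq_iff)
  then show False using nonresonant unfolding nonres_def by (metis one_neq_zero)
qed

lemma \<kappa>_trig: "cos \<theta>0 * (\<kappa>\<^sup>2 + 1) = \<kappa>\<^sup>2 - 1" "sin \<theta>0 * (\<kappa>\<^sup>2 + 1) = 2 * \<kappa>"
  "\<kappa> * sin \<theta>0 = 1 + cos \<theta>0" "\<kappa> * (1 - cos \<theta>0) = sin \<theta>0"
proof -
  have c: "1 - cos \<theta>0 \<noteq> 0" using cos_ne by simp
  show k1: "\<kappa> * (1 - cos \<theta>0) = sin \<theta>0" using c by (simp add: \<kappa>_def)
  have s: "(sin \<theta>0)\<^sup>2 = (1 - cos \<theta>0) * (1 + cos \<theta>0)"
    using sin_cos_squared_add[of \<theta>0] by (simp add: algebra_simps power2_eq_square)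
  have "(1 - cos \<theta>0) * (\<kappa> * sin \<theta>0) = (\<kappa> * (1 - cos \<theta>0)) * sin \<theta>0" by (simp only: mult_ac)
  then have "(1 - cos \<theta>0) * (\<kappa> * sin \<theta>0) = (sin \<theta>0)\<^sup>2" by (simp add: k1 power2_eq_square)
  then show k2: "\<kappa> * sin \<theta>0 = 1 + cos \<theta>0" using s c by simp
  have "\<kappa>\<^sup>2 * (1 - cos \<theta>0) = 1 + cos \<theta>0" using k1 k2 by (simp add: power2_eq_square mult.assoc)
  then have k3: "\<kappa>\<^sup>2 - \<kappa>\<^sup>2 * cos \<theta>0 = 1 + cos \<theta>0" by (simp add: right_diff_distrib)
  then show "cos \<theta>0 * (\<kappa>\<^sup>2 + 1) = \<kappa>\<^sup>2 - 1" by (simp add: algebra_simps)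
  have "\<kappa>\<^sup>2 * sin \<theta>0 = \<kappa> * (1 + cos \<theta>0)" using k2 by (simp add: power2_eq_square mult.assoc)
  then show "sin \<theta>0 * (\<kappa>\<^sup>2 + 1) = 2 * \<kappa>" using k1 by (simp add: algebra_simps)
qed

text \<open>The later and the earlier increment enter with the coefficients G (J + \<kappa>) / 2 and
  G (J - \<kappa>) / 2; the terms with \<open>T\<close> cancel. The recurrence is therefore governed
  by the Cayley transform (\<kappa> - J) (\<kappa> + J)^-1. For \<kappa> = cot (\<theta>0 / 2) this
  is the rotation by \<theta>0, which explains the coefficient of the last term of \<Sigma>.\<close>

lemma f_linear:
  assumes x: "x \<in> Q"
  shows "A x (frechet_derivative f (at (x, x, x, 0)) (p0, p1, p2, h)) = p2 - p1 - rot (J x) \<theta>0 (p1 - p0) - h *\<^sub>R bv x"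
proof -
  let ?P = "(x, x, x, 0 :: real)"
  have 1: "((\<lambda>P. s2 (fst P, fst (snd P), snd (snd (snd P)))) has_derivative
     (\<lambda>w. T x (fst (snd w)) + (1/2) *\<^sub>R B x (fst (snd w) - fst w) - (snd (snd (snd w)) / 2) *\<^sub>R gH x
        - (\<kappa> / 2) *\<^sub>R G x (fst (snd w) - fst w - snd (snd (snd w)) *\<^sub>R X x))) (at ?P)"
    using has_derivative_compose[OF bounded_linear_imp_has_derivative[OF \<Omega>_maps(1), of "at ?P"], of s2] s_diag(2)[OF x] by fastforce
  have 2: "((\<lambda>P. s1 (fst (snd P), fst (snd (snd P)), snd (snd (snd P)))) has_derivative
     (\<lambda>w. - T x (fst (snd w)) + (1/2) *\<^sub>R B x (fst (snd (snd w)) - fst (snd w)) - (snd (snd (snd w)) / 2) *\<^sub>R gH x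
        + (\<kappa> / 2) *\<^sub>R G x (fst (snd (snd w)) - fst (snd w) - snd (snd (snd w)) *\<^sub>R X x))) (at ?P)"
    using has_derivative_compose[OF bounded_linear_imp_has_derivative[OF \<Omega>_maps(2), of "at ?P"], of s1] s_diag(1)[OF x] by fastforce
  from has_derivative_add[OF 1 2]
  have D: "frechet_derivative f (at ?P) = (\<lambda>w. (T x (fst (snd w)) + (1/2) *\<^sub>R B x (fst (snd w) - fst w) - (snd (snd (snd w)) / 2) *\<^sub>R gH x
        - (\<kappa> / 2) *\<^sub>R G x (fst (snd w) - fst w - snd (snd (snd w)) *\<^sub>R X x))
      + (- T x (fst (snd w)) + (1/2) *\<^sub>R B x (fst (snd (snd w)) - fst (snd w)) - (snd (snd (snd w)) / 2) *\<^sub>R gH x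
        + (\<kappa> / 2) *\<^sub>R G x (fst (snd (snd w)) - fst (snd w) - snd (snd (snd w)) *\<^sub>R X x)))"
    unfolding f_def[abs_def, symmetric] by (rule frechet_derivative_at[symmetric])
  define d1 d2 where "d1 = p1 - p0" and "d2 = p2 - p1"
  define v where "v = (1/2) *\<^sub>R (J x d1 + J x d2 - \<kappa> *\<^sub>R d1 + \<kappa> *\<^sub>R d2 - (2 * h) *\<^sub>R J x (X x))"
  have "frechet_derivative f (at ?P) (p0, p1, p2, h) = G x v"
    unfolding D v_def B_X[OF x, symmetric] B_G[OF x] d1_def[symmetric] d2_def[symmetric] fst_conv snd_conv
    by (simp add: blinfun.scaleR_right blinfun.add_right blinfun.diff_right algebra_simps)
      (simp flip: scaleR_left_distrib)
  then have "A x (frechet_derivative f (at ?P) (p0, p1, p2, h)) = (2 / (\<kappa>\<^sup>2 + 1)) *\<^sub>R (\<kappa> *\<^sub>R v - J x v)"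
    by (simp add: A_def Ginv_G[OF x])
  also have "\<kappa> *\<^sub>R v - J x v = (1/2) *\<^sub>R ((\<kappa>\<^sup>2 + 1) *\<^sub>R d2 - ((\<kappa>\<^sup>2 - 1) *\<^sub>R d1 - (2 * \<kappa>) *\<^sub>R J x d1) - (2 * h) *\<^sub>R (\<kappa> *\<^sub>R J x (X x) + X x))"
    unfolding v_def
    by (simp add: blinfun.scaleR_right blinfun.add_right blinfun.diff_right J_J[OF x] algebra_simps power2_eq_square)
      (simp flip: scaleR_left_distrib)
  also have "\<dots> = ((\<kappa>\<^sup>2 + 1) / 2) *\<^sub>R (d2 - rot (J x) \<theta>0 d1 - h *\<^sub>R bv x)"
  proof -
    have n: "\<kappa>\<^sup>2 + 1 \<noteq> 0" by (metis add_nonneg_eq_0_iff zero_le_one zero_le_power2 zero_neq_one)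
    have 1: "(\<kappa>\<^sup>2 + 1) *\<^sub>R rot (J x) \<theta>0 d1 = (\<kappa>\<^sup>2 - 1) *\<^sub>R d1 - (2 * \<kappa>) *\<^sub>R J x d1"
      unfolding rot_def scaleR_diff_right scaleR_scaleR \<kappa>_trig[symmetric] by (simp add: mult.commute)
    have 2: "(\<kappa>\<^sup>2 + 1) *\<^sub>R (h *\<^sub>R bv x) = (2 * h) *\<^sub>R (\<kappa> *\<^sub>R J x (X x) + X x)"
      using n by (simp add: bv_def mult.commute)
    have "((\<kappa>\<^sup>2 + 1) / 2) *\<^sub>R (d2 - rot (J x) \<theta>0 d1 - h *\<^sub>R bv x)
        = (1/2) *\<^sub>R ((\<kappa>\<^sup>2 + 1) *\<^sub>R (d2 - rot (J x) \<theta>0 d1 - h *\<^sub>R bv x))"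
      by simp
    then show ?thesis unfolding scaleR_diff_right[of "\<kappa>\<^sup>2 + 1"] 1 2 by simp
  qed
  also have "(2 / (\<kappa>\<^sup>2 + 1)) *\<^sub>R \<dots> = d2 - rot (J x) \<theta>0 d1 - h *\<^sub>R bv x"
  proof -
    have n: "\<kappa>\<^sup>2 + 1 \<noteq> 0" by (metis add_nonneg_eq_0_iff zero_le_one zero_le_power2 zero_neq_one)
    have "(2 / N) *\<^sub>R ((N / 2) *\<^sub>R y) = y" if "N \<noteq> 0" for N and y :: 'a
      using that by simp
    from this[OF n] show ?thesis .
  qed
  finally show ?thesis by (simp add: d1_def d2_def)
qed

end

section \<open>Uniform estimates in the small parameter\<close>

locale small_parameter =
  fixes F :: "'i filter" and h :: "'i \<Rightarrow> real"
  assumes small: "\<And>r. r > 0 \<Longrightarrow> \<forall>\<^sub>F i in F. 0 < h i \<and> h i < r"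
begin

text \<open>A Landau symbol for families depending on more than h: whatever else the index carries,
  the constant is uniform in it.\<close>

definition bO :: "nat \<Rightarrow> ('i \<Rightarrow> 'b::real_normed_vector) \<Rightarrow> bool" where
  "bO n f \<longleftrightarrow> (\<exists>C\<ge>0. \<forall>\<^sub>F i in F. norm (f i) \<le> C * h i ^ n)"

lemma bO_I:
  assumes "\<forall>\<^sub>F i in F. norm (f i) \<le> C * h i ^ n" shows "bO n f"
proof -
  have "\<forall>\<^sub>F i in F. norm (f i) \<le> max C 0 * h i ^ n"
    using assms small[OF zero_less_one]
  proof eventually_elim
    case (elim i)
    then have "C * h i ^ n \<le> max C 0 * h i ^ n" by (intro mult_right_mono) auto
    then show ?case using elim by linarith
  qed
  then show ?thesis unfolding bO_def by (intro exI[of _ "max C 0"]) simp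
qed

lemma bO_E:
  assumes "bO n f"
  obtains C where "C \<ge> 0" "\<forall>\<^sub>F i in F. norm (f i) \<le> C * h i ^ n"
  using assms unfolding bO_def by blast

lemma bO_le:
  assumes "\<forall>\<^sub>F i in F. norm (f i) \<le> K * norm (g i)" "bO n g" shows "bO n f"
proof -
  obtain C where C: "C \<ge> 0" "\<forall>\<^sub>F i in F. norm (g i) \<le> C * h i ^ n" using assms(2) by (rule bO_E)
  have "\<forall>\<^sub>F i in F. norm (f i) \<le> (max K 0 * C) * h i ^ n"
    using assms(1) C(2)
  proof eventually_elim
    case (elim i)
    have "K * norm (g i) \<le> max K 0 * (C * h i ^ n)" using elim(2) by (intro mult_mono) auto
    then show ?case using elim(1) by (simp add: mult.assoc)
  qed
  then show ?thesis by (rule bO_I)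
qed

lemma bO_cong: "\<forall>\<^sub>F i in F. f i = g i \<Longrightarrow> bO n f \<Longrightarrow> bO n g"
  by (rule bO_le[of _ 1 f]) (auto elim: eventually_mono)

lemma bO_mono:
  assumes "bO m f" "n \<le> m" shows "bO n f"
proof -
  obtain C where C: "C \<ge> 0" "\<forall>\<^sub>F i in F. norm (f i) \<le> C * h i ^ m" using assms(1) by (rule bO_E)
  have "\<forall>\<^sub>F i in F. norm (f i) \<le> C * h i ^ n"
    using C(2) small[OF zero_less_one]
  proof eventually_elim
    case (elim i)
    then have "C * h i ^ m \<le> C * h i ^ n" using C(1) assms(2) by (intro mult_left_mono power_decreasing) auto
    then show ?case using elim by linarith
  qed
  then show ?thesis by (rule bO_I)
qed

lemma bO_add:
  assumes "bO n f" "bO n g" shows "bO n (\<lambda>i. f i + g i)"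
proof -
  obtain C where C: "\<forall>\<^sub>F i in F. norm (f i) \<le> C * h i ^ n" using assms(1) by (rule bO_E)
  obtain D where D: "\<forall>\<^sub>F i in F. norm (g i) \<le> D * h i ^ n" using assms(2) by (rule bO_E)
  from C D have "\<forall>\<^sub>F i in F. norm (f i + g i) \<le> (C + D) * h i ^ n"
    by eventually_elim (auto simp: distrib_right intro: norm_triangle_mono)
  then show ?thesis by (rule bO_I)
qed

lemma bO_linear:
  assumes "bounded_linear A" "bO n f" shows "bO n (\<lambda>i. A (f i))"
proof -
  obtain K where "\<And>x. norm (A x) \<le> norm x * K" using bounded_linear.bounded[OF assms(1)] by blast
  then have "\<forall>\<^sub>F i in F. norm (A (f i)) \<le> K * norm (f i)"
    by (intro always_eventually allI) (simp add: mult.commute)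
  then show ?thesis using assms(2) by (rule bO_le)
qed

lemma bO_minus: "bO n f \<Longrightarrow> bO n (\<lambda>i. - f i)"
  by (rule bO_linear[OF bounded_linear_minus[OF bounded_linear_ident]])

lemma bO_diff: "bO n f \<Longrightarrow> bO n g \<Longrightarrow> bO n (\<lambda>i. f i - g i)"
  using bO_add[of n f "\<lambda>i. - g i"] bO_minus[of n g] by simp

lemma bO_cmult: "bO n f \<Longrightarrow> bO n (\<lambda>i. c *\<^sub>R f i)"
  by (rule bO_linear[OF bounded_linear_scaleR_right])

lemma bO_sum: "(\<And>k. k \<in> I \<Longrightarrow> bO n (f k)) \<Longrightarrow> bO n (\<lambda>i. \<Sum>k\<in>I. f k i)"
proof (induction I rule: infinite_finite_induct)
  case (insert x I)
  then show ?case using bO_add[of n "f x" "\<lambda>i. \<Sum>k\<in>I. f k i"] by simp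
qed (simp_all add: bO_I[of _ 0])

lemma bO_bilinear:
  assumes "bounded_bilinear p" "bO n f" "bO m g" shows "bO (n + m) (\<lambda>i. p (f i) (g i))"
proof -
  obtain K where K: "K > 0" "\<And>a b. norm (p a b) \<le> norm a * norm b * K"
    using bounded_bilinear.pos_bounded[OF assms(1)] by blast
  obtain C where C: "C \<ge> 0" "\<forall>\<^sub>F i in F. norm (f i) \<le> C * h i ^ n" using assms(2) by (rule bO_E)
  obtain D where D: "D \<ge> 0" "\<forall>\<^sub>F i in F. norm (g i) \<le> D * h i ^ m" using assms(3) by (rule bO_E)
  have "\<forall>\<^sub>F i in F. norm (p (f i) (g i)) \<le> (C * D * K) * h i ^ (n + m)"
    using C(2) D(2) small[OF zero_less_one]
  proof eventually_elim
    case (elim i)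
    have "norm (f i) * norm (g i) * K \<le> (C * h i ^ n) * (D * h i ^ m) * K"
      using elim C(1) D(1) K(1) by (intro mult_right_mono mult_mono) auto
    also have "\<dots> = (C * D * K) * h i ^ (n + m)" by (simp add: power_add)
    finally show ?case using K(2)[of "f i" "g i"] by linarith
  qed
  then show ?thesis by (rule bO_I)
qed

lemma bO_h: "bO 1 h"
  by (rule bO_I[of _ 1]) (use small[OF zero_less_one] in \<open>auto elim: eventually_mono\<close>)

lemma bO_const: "bO 0 (\<lambda>i. c)"
  by (rule bO_I[of _ "norm c"]) simp

lemma bO_h_scale: "bO n f \<Longrightarrow> bO (Suc n) (\<lambda>i. h i *\<^sub>R f i)"
  using bO_bilinear[OF bounded_bilinear_scaleR bO_h, of n f] by simp

lemma bO_h_power_scale: "bO n f \<Longrightarrow> bO (k + n) (\<lambda>i. h i ^ k *\<^sub>R f i)"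
proof -
  assume "bO n f"
  moreover have "bO k (\<lambda>i. h i ^ k)" by (rule bO_I[of _ 1]) (use small[OF zero_less_one] in \<open>auto elim: eventually_mono\<close>)
  ultimately show ?thesis by (intro bO_bilinear[OF bounded_bilinear_scaleR])
qed

lemma bO_apply: "bO n A \<Longrightarrow> bO m f \<Longrightarrow> bO (n + m) (\<lambda>i. blinfun_apply (A i) (f i))"
  by (rule bO_bilinear[OF bounded_bilinear_blinfun_apply])

text \<open>Serves to divide by h^2, the factor with which the velocities enter the implicit
  relations.\<close>

lemma bO_cancel:
  assumes "bO (k + n) (\<lambda>i. h i ^ k *\<^sub>R f i)" shows "bO n f"
proof -
  obtain C where C: "\<forall>\<^sub>F i in F. norm (h i ^ k *\<^sub>R f i) \<le> C * h i ^ (k + n)" using assms by (rule bO_E)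
  have "\<forall>\<^sub>F i in F. norm (f i) \<le> C * h i ^ n"
    using C small[OF zero_less_one]
  proof eventually_elim
    case (elim i)
    then have "h i ^ k * norm (f i) \<le> h i ^ k * (C * h i ^ n)" by (simp add: power_add mult_ac)
    then show ?case using elim by (simp add: mult_le_cancel_left_pos)
  qed
  then show ?thesis by (rule bO_I)
qed

lemma bO_small:
  assumes "bO (Suc n) f" "r > 0" shows "\<forall>\<^sub>F i in F. norm (f i) < r"
proof -
  obtain C where C: "C \<ge> 0" "\<forall>\<^sub>F i in F. norm (f i) \<le> C * h i ^ 1" using bO_mono[OF assms(1), of 1] by (auto elim: bO_E)
  have "\<forall>\<^sub>F i in F. 0 < h i \<and> h i < r / (C + 1)" using assms(2) C(1) by (intro small) auto
  with C(2) show ?thesis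
  proof eventually_elim
    case (elim i)
    then have "C * h i + h i < r" using C(1) by (simp add: field_simps)
    then show ?case using elim by simp
  qed
qed

lemma bO_continuous:
  assumes "compact K" "continuous_on K g" "\<forall>\<^sub>F i in F. x i \<in> K"
  shows "bO 0 (\<lambda>i. g (x i))"
proof -
  have "bounded (g ` K)" using assms by (intro compact_imp_bounded compact_continuous_image)
  then obtain C where "\<And>y. y \<in> K \<Longrightarrow> norm (g y) \<le> C" unfolding bounded_iff by blast
  then show ?thesis using assms(3) by (intro bO_I[of _ C]) (auto elim: eventually_mono)
qed

lemma bO_lipschitz:
  fixes g :: "'a::euclidean_space \<Rightarrow> 'b::real_normed_vector"
  assumes "smooth_on Q g" "open Q" "compact K" "K \<subseteq> Q" "\<forall>\<^sub>F i in F. x i \<in> K" "bO (Suc n) (\<lambda>i. y i - x i)"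
  shows "bO (Suc n) (\<lambda>i. g (y i) - g (x i))" and "\<forall>\<^sub>F i in F. y i \<in> Q" and "bO 0 (\<lambda>i. g (y i))"
proof -
  obtain C r where C: "C \<ge> 0" "0 < r" and C_all: "\<And>x \<zeta> Z \<rho>. x \<in> K \<Longrightarrow> norm \<zeta> \<le> \<rho> \<Longrightarrow> norm Z \<le> \<rho> \<Longrightarrow> \<rho> \<le> r \<Longrightarrow>
      x + \<zeta> \<in> Q \<and> norm (g (x + \<zeta>) - (\<Sum>i<1. (1 / fact i) *\<^sub>R taylor_term i g x Z)) \<le> C * (\<rho> ^ 1 + norm (\<zeta> - Z))"
    using taylor_approx[OF assms(1-4), of 1] by blast
  have C_bound: "x + \<zeta> \<in> Q \<and> norm (g (x + \<zeta>) - g x) \<le> C * norm \<zeta>" if "x \<in> K" "norm \<zeta> \<le> r" for x \<zeta>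
    using C_all[OF that(1) order_refl order_refl that(2)] by simp
  have ev: "\<forall>\<^sub>F i in F. y i \<in> Q \<and> norm (g (y i) - g (x i)) \<le> C * norm (y i - x i)"
    using bO_small[OF assms(6) C(2)] assms(5)
  proof eventually_elim
    case (elim i)
    then show ?case using C_bound[of "x i" "y i - x i"] by simp
  qed
  then show "\<forall>\<^sub>F i in F. y i \<in> Q" by (auto elim: eventually_mono)
  have "\<forall>\<^sub>F i in F. norm (g (y i) - g (x i)) \<le> C * norm (y i - x i)" using ev by (auto elim: eventually_mono)
  then show 1: "bO (Suc n) (\<lambda>i. g (y i) - g (x i))" using assms(6) by (rule bO_le)
  have "continuous_on K g" using smooth_on_continuous[OF assms(1)] assms(4) by (rule continuous_on_subset)
  then have "bO 0 (\<lambda>i. g (x i))" using assms(3,5) by (intro bO_continuous)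
  from bO_add[OF this bO_mono[OF 1, of 0]] show "bO 0 (\<lambda>i. g (y i))" by simp
qed

text \<open>The Taylor polynomial of degree 1 is integrated exactly against t^k; the two fractions
  are the integrals of t^k and of t^(k+1).\<close>

lemma bO_ray_int:
  fixes g :: "'a::euclidean_space \<Rightarrow> 'b::banach"
  assumes "smooth_on Q g" "open Q" "compact K" "K \<subseteq> Q" "\<forall>\<^sub>F i in F. x i \<in> K" "bO (Suc n) \<xi>"
  shows "bO (2 * Suc n) (\<lambda>i. ray_int k g (x i, \<xi> i) - (1 / real (Suc k)) *\<^sub>R g (x i)
      - (1 / real (Suc (Suc k))) *\<^sub>R blinfun_apply (total_deriv g (x i)) (\<xi> i))"
proof -
  obtain C r where C: "C \<ge> 0" "0 < r" and C_all: "\<And>x \<zeta> Z \<rho>. x \<in> K \<Longrightarrow> norm \<zeta> \<le> \<rho> \<Longrightarrow> norm Z \<le> \<rho> \<Longrightarrow> \<rho> \<le> r \<Longrightarrow>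
      x + \<zeta> \<in> Q \<and> norm (g (x + \<zeta>) - (\<Sum>i<2. (1 / fact i) *\<^sub>R taylor_term i g x Z)) \<le> C * (\<rho> ^ 2 + norm (\<zeta> - Z))"
    using taylor_approx[OF assms(1-4), of 2] by blast
  have C_bound: "x + \<zeta> \<in> Q \<and> norm (g (x + \<zeta>) - (\<Sum>i<2. (1 / fact i) *\<^sub>R taylor_term i g x \<zeta>)) \<le> C * \<rho> ^ 2"
    if "x \<in> K" "norm \<zeta> \<le> \<rho>" "\<rho> \<le> r" for x \<zeta> \<rho>
    using C_all[OF that(1,2,2,3)] by simp
  have bound: "norm (ray_int k g (x, \<xi>) - (1 / real (Suc k)) *\<^sub>R g x - (1 / real (Suc (Suc k))) *\<^sub>R total_deriv g x \<xi>)
      \<le> C * norm \<xi> ^ 2" if x: "x \<in> K" and \<xi>: "norm \<xi> \<le> r" for x \<xi>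
  proof -
    have xQ: "x \<in> Q" using x assms(4) by blast
    have T: "x + t *\<^sub>R \<xi> \<in> Q \<and> norm (g (x + t *\<^sub>R \<xi>) - (g x + t *\<^sub>R total_deriv g x \<xi>)) \<le> C * norm \<xi> ^ 2"
      if t: "t \<in> {0..1}" for t
    proof -
      have "norm (t *\<^sub>R \<xi>) \<le> 1 * norm \<xi>" unfolding norm_scaleR by (rule mult_right_mono) (use t in auto)
      moreover have "(\<Sum>i<2. (1 / fact i) *\<^sub>R taylor_term i g x (t *\<^sub>R \<xi>)) = g x + t *\<^sub>R total_deriv g x \<xi>"
        using taylor_term_1[OF assms(1) xQ, of "t *\<^sub>R \<xi>"]
        by (simp add: numeral_2_eq_2 smooth_on_total_deriv_apply[OF assms(1) xQ, symmetric] blinfun.scaleR_right del: taylor_term.simps(2))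
      ultimately show ?thesis using C_bound[OF x, of "t *\<^sub>R \<xi>" "norm \<xi>"] \<xi> by simp
    qed
    have dom: "(x, \<xi>) \<in> ray_dom Q" using T by (auto simp: ray_dom_def)
    note cg = smooth_on_continuous[OF assms(1)]
    have gc: "continuous_on {0..1} (\<lambda>t. g (x + t *\<^sub>R \<xi>))" using ray_continuous[OF cg dom] by simp
    have "ray_int k (\<lambda>y. c) (x, 0 :: 'a) = (1 / real (Suc k)) *\<^sub>R c" for k and c :: 'b
      by (rule ray_int_at_0)
    then have c: "integral {0..1} (\<lambda>t. t ^ k *\<^sub>R c) = (1 / real (Suc k)) *\<^sub>R c" for k and c :: 'b
      by (simp add: ray_int_def)
    have "integral {0..1} (\<lambda>t. t ^ k *\<^sub>R g (x + t *\<^sub>R \<xi>) - t ^ k *\<^sub>R g x - t ^ Suc k *\<^sub>R total_deriv g x \<xi>)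
        = ray_int k g (x, \<xi>) - (1 / real (Suc k)) *\<^sub>R g x - (1 / real (Suc (Suc k))) *\<^sub>R total_deriv g x \<xi>"
      unfolding c[symmetric] ray_int_def fst_conv snd_conv
      by (subst integral_diff integral_diff; (intro integrable_continuous_real continuous_intros gc)?)+ (rule refl)
    moreover have "norm (integral {0..1} (\<lambda>t. t ^ k *\<^sub>R g (x + t *\<^sub>R \<xi>) - t ^ k *\<^sub>R g x - t ^ Suc k *\<^sub>R total_deriv g x \<xi>))
        \<le> (C * norm \<xi> ^ 2) * (1 - 0)"
    proof (rule integral_bound)
      show "continuous_on {0..1} (\<lambda>t. t ^ k *\<^sub>R g (x + t *\<^sub>R \<xi>) - t ^ k *\<^sub>R g x - t ^ Suc k *\<^sub>R total_deriv g x \<xi>)"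
        by (intro continuous_intros gc)
      fix t :: real assume t: "t \<in> {0..1}"
      have "t ^ k *\<^sub>R g (x + t *\<^sub>R \<xi>) - t ^ k *\<^sub>R g x - t ^ Suc k *\<^sub>R total_deriv g x \<xi>
          = t ^ k *\<^sub>R (g (x + t *\<^sub>R \<xi>) - (g x + t *\<^sub>R total_deriv g x \<xi>))"
        by (simp add: algebra_simps)
      moreover have "norm (t ^ k *\<^sub>R (g (x + t *\<^sub>R \<xi>) - (g x + t *\<^sub>R total_deriv g x \<xi>))) \<le> 1 * (C * norm \<xi> ^ 2)"
        unfolding norm_scaleR using T[OF t] t by (intro mult_mono) (auto intro: power_le_one)
      ultimately show "norm (t ^ k *\<^sub>R g (x + t *\<^sub>R \<xi>) - t ^ k *\<^sub>R g x - t ^ Suc k *\<^sub>R total_deriv g x \<xi>) \<le> C * norm \<xi> ^ 2"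
        by simp
    qed simp
    ultimately show ?thesis by simp
  qed
  obtain D where D: "D \<ge> 0" "\<forall>\<^sub>F i in F. norm (\<xi> i) \<le> D * h i ^ Suc n" using assms(6) by (rule bO_E)
  have "\<forall>\<^sub>F i in F. norm (ray_int k g (x i, \<xi> i) - (1 / real (Suc k)) *\<^sub>R g (x i)
      - (1 / real (Suc (Suc k))) *\<^sub>R total_deriv g (x i) (\<xi> i)) \<le> (C * D ^ 2) * h i ^ (2 * Suc n)"
    using D(2) bO_small[OF assms(6) C(2)] assms(5)
  proof eventually_elim
    case (elim i)
    have "C * norm (\<xi> i) ^ 2 \<le> C * (D * h i ^ Suc n) ^ 2"
      using elim(1) C(1) by (intro mult_left_mono power_mono) auto
    also have "\<dots> = (C * D ^ 2) * h i ^ (2 * Suc n)"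
      by (simp add: power_mult_distrib power2_eq_square power_add[symmetric] mult_2)
    finally show ?case using bound[OF elim(3), of "\<xi> i"] elim(2) by (meson less_imp_le order_trans)
  qed
  then show ?thesis by (rule bO_I)
qed


lemma bO_taylor:
  fixes g :: "'a::euclidean_space \<Rightarrow> 'b::real_normed_vector"
  assumes "smooth_on Q g" "open Q" "compact K" "K \<subseteq> Q" "\<forall>\<^sub>F i in F. x i \<in> K" "bO (Suc n) (\<lambda>i. y i - x i)"
  shows "bO (2 * Suc n) (\<lambda>i. g (y i) - g (x i) - blinfun_apply (total_deriv g (x i)) (y i - x i))"
proof -
  obtain C r where C: "C \<ge> 0" "0 < r" and C_all: "\<And>x \<zeta> Z \<rho>. x \<in> K \<Longrightarrow> norm \<zeta> \<le> \<rho> \<Longrightarrow> norm Z \<le> \<rho> \<Longrightarrow> \<rho> \<le> r \<Longrightarrow>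
      x + \<zeta> \<in> Q \<and> norm (g (x + \<zeta>) - (\<Sum>i<2. (1 / fact i) *\<^sub>R taylor_term i g x Z)) \<le> C * (\<rho> ^ 2 + norm (\<zeta> - Z))"
    using taylor_approx[OF assms(1-4), of 2] by blast
  have C_bound: "norm (g (x + \<zeta>) - g x - total_deriv g x \<zeta>) \<le> C * norm \<zeta> ^ 2"
    if "x \<in> K" "norm \<zeta> \<le> r" for x \<zeta>
  proof -
    have xQ: "x \<in> Q" using that assms(4) by blast
    have "(\<Sum>i<2. (1 / fact i) *\<^sub>R taylor_term i g x \<zeta>) = g x + total_deriv g x \<zeta>"
      using taylor_term_1[OF assms(1) xQ, of \<zeta>]
      by (simp add: numeral_2_eq_2 smooth_on_total_deriv_apply[OF assms(1) xQ, symmetric] del: taylor_term.simps(2))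
    then show ?thesis using C_all[OF that(1) order_refl order_refl that(2)] by (simp add: diff_diff_eq)
  qed
  obtain D where D: "D \<ge> 0" "\<forall>\<^sub>F i in F. norm (y i - x i) \<le> D * h i ^ Suc n" using assms(6) by (rule bO_E)
  have "\<forall>\<^sub>F i in F. norm (g (y i) - g (x i) - total_deriv g (x i) (y i - x i)) \<le> (C * D ^ 2) * h i ^ (2 * Suc n)"
    using D(2) bO_small[OF assms(6) C(2)] assms(5)
  proof eventually_elim
    case (elim i)
    have "C * norm (y i - x i) ^ 2 \<le> C * (D * h i ^ Suc n) ^ 2"
      using elim(1) C(1) by (intro mult_left_mono power_mono) auto
    also have "\<dots> = (C * D ^ 2) * h i ^ (2 * Suc n)"
      by (simp add: power_mult_distrib power2_eq_square power_add[symmetric] mult_2)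
    finally show ?case using C_bound[OF elim(3), of "y i - x i"] elim(2) by simp
  qed
  then show ?thesis by (rule bO_I)
qed

end

section \<open>One step of the map\<close>

text \<open>Formulated for families of pairs satisfying the relations rather than for iterates of
  \<Psi>, so that it applies at every index of an orbit.\<close>

locale lorentz_step = lorentz Q \<theta> J H \<theta>0 + small_parameter F h
  for Q :: "'a::euclidean_space set" and \<theta> J H \<theta>0 and F :: "'i filter" and h :: "'i \<Rightarrow> real" +
  fixes K :: "'a set" and q v q' v' :: "'i \<Rightarrow> 'a"
  assumes K_compact: "compact K" and K_Q: "K \<subseteq> Q"
    and q_K: "\<forall>\<^sub>F i in F. q i \<in> K"
    and q'_q: "bO 1 (\<lambda>i. q' i - q i)"
    and v_bounded: "bO 0 v" and v'_bounded: "bO 0 v'"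
    and relations: "\<forall>\<^sub>F i in F. (q i, q' i, h i) \<in> \<Omega>S \<and>
      s1 (q i, q' i, h i) = - thv (q i) - (h i)\<^sup>2 *\<^sub>R G (q i) (v i) \<and>
      s2 (q i, q' i, h i) = thv (q' i) + (h i)\<^sup>2 *\<^sub>R G (q' i) (v' i)"
begin

definition \<xi> where "\<xi> i = q' i - q i"
definition m where "m i = (1/2) *\<^sub>R (q i + q' i)"
text \<open>The deviation of the step from the midpoint rule for X_H. It is O(h) a priori and is
  improved to O(h^2), the order at which the velocities become visible.\<close>

definition d where "d i = \<xi> i - h i *\<^sub>R X (m i)"
definition w where "w i = v i - X (q i)"
definition w' where "w' i = v' i - X (q' i)"

lemma m_q: "bO 1 (\<lambda>i. m i - q i)"
proof -
  have "m i - q i = (1/2) *\<^sub>R (q' i - q i)" for i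
  proof -
    have "q i = (1/2) *\<^sub>R q i + (1/2) *\<^sub>R q i" by (simp flip: scaleR_left_distrib)
    then show ?thesis unfolding m_def by (simp add: algebra_simps)
  qed
  then show ?thesis using bO_cmult[OF q'_q, of "1/2"] by simp
qed

lemma at_q: "smooth_on Q g \<Longrightarrow> bO 0 (\<lambda>i. g (q i))"
  using bO_continuous[OF K_compact _ q_K, of g] smooth_on_continuous[of Q g] K_Q continuous_on_subset by blast

lemma at_m:
  fixes g :: "'a \<Rightarrow> 'b::real_normed_vector" assumes "smooth_on Q g"
  shows "bO 1 (\<lambda>i. g (m i) - g (q i))" "bO 0 (\<lambda>i. g (m i))" 
  using bO_lipschitz[OF assms open_Q K_compact K_Q q_K, of 0 m] m_q by simp_all

lemma at_q':
  fixes g :: "'a \<Rightarrow> 'b::real_normed_vector" assumes "smooth_on Q g"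
  shows "bO 1 (\<lambda>i. g (q' i) - g (q i))" "bO 0 (\<lambda>i. g (q' i))" 
  using bO_lipschitz[OF assms open_Q K_compact K_Q q_K, of 0 q'] q'_q by simp_all

lemma q'_m: "smooth_on Q g \<Longrightarrow> bO 1 (\<lambda>i. g (q' i) - g (m i))"
  using bO_diff[OF at_q'(1) at_m(1), of g g] by simp

lemma in_Q: "\<forall>\<^sub>F i in F. q i \<in> Q \<and> m i \<in> Q"
  using q_K bO_lipschitz(2)[OF G_smooth open_Q K_compact K_Q q_K, of 0 m] m_q K_Q
  by (auto elim: eventually_elim2)

lemma \<xi>1: "bO 1 \<xi>"
  using q'_q unfolding \<xi>_def[abs_def] .

lemma d1: "bO 1 d"
  unfolding d_def[abs_def] using bO_diff[OF \<xi>1 bO_h_scale[OF at_m(2)[OF X_smooth], unfolded One_nat_def[symmetric]]] .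

definition E where "E i = sgx (m i, \<xi> i, h i) + h i *\<^sub>R gH (m i)"

text \<open>The terms of \<open>E\<close> are quadratic in d, of the form h d, or O(h^3), so any
  gain on \<open>d\<close> improves \<open>E\<close>. The case n = 1 leads to \<open>d2\<close>, and
  the case n = 2 then to \<open>E3\<close>.\<close>

lemma E_bound:
  assumes "bO n d" "n = 1 \<or> n = 2" shows "bO (Suc n) E"
proof -
  have t1: "bO (Suc n) (\<lambda>i. (h i)\<^sup>2 *\<^sub>R (total_deriv al (m i) u \<bullet> \<xi> i))" for u
  proof (rule bO_mono)
    show "bO (2 + (0 + 0 + 1)) (\<lambda>i. (h i)\<^sup>2 *\<^sub>R (total_deriv al (m i) u \<bullet> \<xi> i))"
      by (intro bO_h_power_scale bO_bilinear[OF bounded_bilinear_inner] bO_apply bO_const \<xi>1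
          at_m(2)[OF smooth_on_total_deriv[OF open_Q al_smooth]])
  qed (use assms(2) in auto)
  have t2: "bO (Suc n) (\<lambda>i. (\<kappa> / 4) *\<^sub>R (total_deriv G (m i) u (d i) \<bullet> d i))" for u
  proof (rule bO_mono)
    show "bO ((0 + 0 + n) + n) (\<lambda>i. (\<kappa> / 4) *\<^sub>R (total_deriv G (m i) u (d i) \<bullet> d i))"
      by (intro bO_cmult bO_bilinear[OF bounded_bilinear_inner] bO_apply bO_const assms(1)
          at_m(2)[OF smooth_on_total_deriv[OF open_Q G_smooth]])
  qed (use assms(2) in auto)
  have t3: "bO (Suc n) (\<lambda>i. (\<kappa> / 2) *\<^sub>R (h i *\<^sub>R (G (m i) (d i) \<bullet> total_deriv X (m i) u)))" for u
  proof -
    have "bO (Suc ((0 + n) + (0 + 0))) (\<lambda>i. (\<kappa> / 2) *\<^sub>R (h i *\<^sub>R (G (m i) (d i) \<bullet> total_deriv X (m i) u)))"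
      by (intro bO_cmult bO_h_scale bO_bilinear[OF bounded_bilinear_inner] bO_apply bO_const assms(1)
          at_m(2)[OF smooth_on_total_deriv[OF open_Q X_smooth]] at_m(2)[OF G_smooth])
    then show ?thesis by simp
  qed
  have "bO (Suc n) (\<lambda>i. (\<Sum>u\<in>Basis. ((h i)\<^sup>2 *\<^sub>R (total_deriv al (m i) u \<bullet> \<xi> i) - (\<kappa> / 4) *\<^sub>R (total_deriv G (m i) u (d i) \<bullet> d i)
      + (\<kappa> / 2) *\<^sub>R (h i *\<^sub>R (G (m i) (d i) \<bullet> total_deriv X (m i) u))) *\<^sub>R u))"
    by (intro bO_sum bO_linear[OF bounded_linear_scaleR_left] bO_add bO_diff t1 t2 t3)
  moreover have "E i = (\<Sum>u\<in>Basis. ((h i)\<^sup>2 *\<^sub>R (total_deriv al (m i) u \<bullet> \<xi> i) - (\<kappa> / 4) *\<^sub>R (total_deriv G (m i) u (d i) \<bullet> d i)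
      + (\<kappa> / 2) *\<^sub>R (h i *\<^sub>R (G (m i) (d i) \<bullet> total_deriv X (m i) u))) *\<^sub>R u)" (is "_ = ?R i") for i
  proof -
    have "E i \<bullet> u = ?R i \<bullet> u" if "u \<in> Basis" for u
      using that unfolding E_def d_def[symmetric] inner_add_left sgx_inner by (simp add: d_def[symmetric])
    then show ?thesis by (rule euclidean_eqI)
  qed
  ultimately show ?thesis by (simp add: bO_def)
qed

text \<open>The mean of B over the segment is its midpoint value up to second order. The weight 2 t
  - 1 has integral 0 and first moment 1/6, which is the coefficient that remains.\<close>

lemma ray_B:
  "bO 2 (\<lambda>i. ray_int 0 B (q i, \<xi> i) - B (m i))"
  "bO 2 (\<lambda>i. 2 *\<^sub>R ray_int 1 B (q i, \<xi> i) - ray_int 0 B (q i, \<xi> i) - (1/6) *\<^sub>R total_deriv B (q i) (\<xi> i))"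
proof -
  let ?D = "\<lambda>i. total_deriv B (q i) (\<xi> i)"
  have m: "m i - q i = (1/2) *\<^sub>R \<xi> i" for i
  proof -
    have "q i = (1/2) *\<^sub>R q i + (1/2) *\<^sub>R q i" by (simp flip: scaleR_left_distrib)
    then show ?thesis unfolding m_def \<xi>_def by (simp add: algebra_simps)
  qed
  have "bO (2 * Suc 0) (\<lambda>i. B (m i) - B (q i) - total_deriv B (q i) (m i - q i))"
    by (rule bO_taylor[OF B_smooth open_Q K_compact K_Q q_K]) (use m_q in simp)
  then have Bm: "bO 2 (\<lambda>i. B (m i) - B (q i) - (1/2) *\<^sub>R ?D i)"
    by (simp add: m blinfun.scaleR_right numeral_2_eq_2)
  have r: "bO 2 (\<lambda>i. ray_int k B (q i, \<xi> i) - (1 / real (Suc k)) *\<^sub>R B (q i) - (1 / real (Suc (Suc k))) *\<^sub>R ?D i)" for k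
    using bO_ray_int[OF B_smooth open_Q K_compact K_Q q_K, of 0 \<xi> k] \<xi>1 by simp
  have r0: "bO 2 (\<lambda>i. ray_int 0 B (q i, \<xi> i) - B (q i) - (1/2) *\<^sub>R ?D i)" using r[of 0] by simp
  have r1: "bO 2 (\<lambda>i. ray_int 1 B (q i, \<xi> i) - (1/2) *\<^sub>R B (q i) - (1/3) *\<^sub>R ?D i)" using r[of 1] by simp
  show "bO 2 (\<lambda>i. ray_int 0 B (q i, \<xi> i) - B (m i))" using bO_diff[OF r0 Bm] by simp
  have "2 *\<^sub>R (ray_int 1 B (q i, \<xi> i) - (1/2) *\<^sub>R B (q i) - (1/3) *\<^sub>R ?D i) - (ray_int 0 B (q i, \<xi> i) - B (q i) - (1/2) *\<^sub>R ?D i)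
      = 2 *\<^sub>R ray_int 1 B (q i, \<xi> i) - ray_int 0 B (q i, \<xi> i) - (1/6) *\<^sub>R ?D i" for i
    by (simp add: algebra_simps) (simp flip: scaleR_left_distrib)
  then show "bO 2 (\<lambda>i. 2 *\<^sub>R ray_int 1 B (q i, \<xi> i) - ray_int 0 B (q i, \<xi> i) - (1/6) *\<^sub>R ?D i)"
    by (intro bO_cong[OF always_eventually bO_diff[OF bO_cmult[OF r1, of 2] r0]] allI)
qed

definition e0 where "e0 i = (ray_int 0 B (q i, \<xi> i) - B (m i)) (\<xi> i)"

lemma e0: "bO 3 e0"
  unfolding e0_def[abs_def] using bO_apply[OF ray_B(1) \<xi>1] by (simp add: numeral_3_eq_3 numeral_2_eq_2)

lemma mid_eq: "mid (q i, q' i, h i) = (m i, \<xi> i, h i)"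
  by (simp add: mid_def m_def \<xi>_def)

text \<open>In the sum of the two implicit relations the contributions of \<open>sg\<xi>\<close>
  cancel, and gH = B X combines the force with the step to B d.\<close>

lemma sum_relation: "\<forall>\<^sub>F i in F. (h i)\<^sup>2 *\<^sub>R (G (q' i) (v' i) - G (q i) (v i)) = B (m i) (d i) + e0 i + E i"
  using relations in_Q
proof eventually_elim
  case (elim i)
  have "s1 (q i, q' i, h i) + s2 (q i, q' i, h i)
      = thv (q' i) - thv (q i) + ray_int 0 B (q i, \<xi> i) (\<xi> i) + sgx (m i, \<xi> i, h i)"
    unfolding s1_def s2_def mid_eq fst_conv snd_conv \<xi>_def[symmetric]
    by (simp add: blinfun.diff_left algebra_simps) (simp flip: scaleR_left_distrib)
  moreover have "s1 (q i, q' i, h i) + s2 (q i, q' i, h i) = thv (q' i) - thv (q i) + (h i)\<^sup>2 *\<^sub>R (G (q' i) (v' i) - G (q i) (v i))"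
    using elim(1) by (simp add: algebra_simps)
  moreover have "B (m i) (d i) = B (m i) (\<xi> i) - h i *\<^sub>R gH (m i)"
    using elim(2) by (simp add: d_def blinfun.diff_right blinfun.scaleR_right B_X)
  ultimately show ?case
    by (simp add: e0_def E_def blinfun.diff_left algebra_simps)
qed

lemma lhs_bound: "bO 2 (\<lambda>i. (h i)\<^sup>2 *\<^sub>R (G (q' i) (v' i) - G (q i) (v i)))"
proof -
  have "bO (2 + (0 + 0)) (\<lambda>i. (h i)\<^sup>2 *\<^sub>R (G (q' i) (v' i) - G (q i) (v i)))"
    by (intro bO_h_power_scale bO_diff bO_apply at_q'(2)[OF G_smooth] at_q[OF G_smooth] v_bounded v'_bounded)
  then show ?thesis by simp
qed

text \<open>In \<open>sum_relation\<close> everything except B d is O(h^2), and - J Ginv inverts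
  B.\<close>

lemma d2: "bO 2 d"
proof -
  have "bO 2 E" using E_bound[of 1] d1 by (simp add: numeral_2_eq_2)
  then have "bO 2 (\<lambda>i. (h i)\<^sup>2 *\<^sub>R (G (q' i) (v' i) - G (q i) (v i)) - e0 i - E i)"
    by (intro bO_diff lhs_bound bO_mono[OF e0]) auto
  then have "bO (0 + (0 + 2)) (\<lambda>i. J (m i) (Ginv (m i) ((h i)\<^sup>2 *\<^sub>R (G (q' i) (v' i) - G (q i) (v i)) - e0 i - E i)))"
    by (intro bO_apply at_m(2)[OF J_smooth] at_m(2)[OF Ginv_smooth]) simp
  then have "bO 2 (\<lambda>i. - J (m i) (Ginv (m i) ((h i)\<^sup>2 *\<^sub>R (G (q' i) (v' i) - G (q i) (v i)) - e0 i - E i)))"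
    unfolding add_0_left by (rule bO_minus)
  then show ?thesis
  proof (rule bO_cong[rotated])
    show "\<forall>\<^sub>F i in F. - J (m i) (Ginv (m i) ((h i)\<^sup>2 *\<^sub>R (G (q' i) (v' i) - G (q i) (v i)) - e0 i - E i)) = d i"
      using sum_relation in_Q
    proof eventually_elim
      case (elim i)
      then have "(h i)\<^sup>2 *\<^sub>R (G (q' i) (v' i) - G (q i) (v i)) - e0 i - E i = G (m i) (J (m i) (d i))"
        by (simp add: B_G)
      then show ?case using elim(2) by (simp add: Ginv_G J_J)
    qed
  qed
qed

lemma E3: "bO 3 E"
  using E_bound[OF d2] by (simp add: numeral_3_eq_3 numeral_2_eq_2)

text \<open>The velocities already carry h^2, so moving the base point of the metric by O(h) costs
  only O(h^3).\<close>

lemma G_shift: "bO 3 (\<lambda>i. (h i)\<^sup>2 *\<^sub>R (G (q' i) (v' i) - G (m i) (v' i)))" "bO 3 (\<lambda>i. (h i)\<^sup>2 *\<^sub>R (G (q i) (v i) - G (m i) (v i)))"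
proof -
  have "bO (2 + (1 + 0)) (\<lambda>i. (h i)\<^sup>2 *\<^sub>R ((G (q' i) - G (m i)) (v' i)))"
    by (intro bO_h_power_scale bO_apply q'_m[OF G_smooth] v'_bounded)
  then show "bO 3 (\<lambda>i. (h i)\<^sup>2 *\<^sub>R (G (q' i) (v' i) - G (m i) (v' i)))" by (simp add: blinfun.diff_left)
  have "bO (2 + (1 + 0)) (\<lambda>i. (h i)\<^sup>2 *\<^sub>R ((- (G (m i) - G (q i))) (v i)))"
    by (intro bO_h_power_scale bO_apply bO_minus at_m(1)[OF G_smooth] v_bounded)
  then show "bO 3 (\<lambda>i. (h i)\<^sup>2 *\<^sub>R (G (q i) (v i) - G (m i) (v i)))" by (simp add: blinfun.diff_left)
qed

lemma X_shift: "bO 3 (\<lambda>i. (h i)\<^sup>2 *\<^sub>R (X (q i) - X (m i)))" "bO 3 (\<lambda>i. (h i)\<^sup>2 *\<^sub>R (X (q' i) - X (m i)))"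
proof -
  have "bO (2 + 1) (\<lambda>i. (h i)\<^sup>2 *\<^sub>R (- (X (m i) - X (q i))))"
    by (intro bO_h_power_scale bO_minus at_m(1)[OF X_smooth])
  then show "bO 3 (\<lambda>i. (h i)\<^sup>2 *\<^sub>R (X (q i) - X (m i)))" by simp
  have "bO (2 + 1) (\<lambda>i. (h i)\<^sup>2 *\<^sub>R (X (q' i) - X (m i)))"
    by (intro bO_h_power_scale q'_m[OF X_smooth])
  then show "bO 3 (\<lambda>i. (h i)\<^sup>2 *\<^sub>R (X (q' i) - X (m i)))" by simp
qed

lemma Ginv_bound: "bO 3 y \<Longrightarrow> bO 3 (\<lambda>i. Ginv (m i) (y i))"
  using bO_apply[OF at_m(2)[OF Ginv_smooth], of 3 y] by simp

text \<open>The sum and the difference of the two implicit relations say that \<open>D1\<close> and \<open>D2\<close> are \<open>O(h\<^sup>3)\<close>; eliminating \<open>d\<close>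
  between them gives the rotation of \<open>w\<close>.\<close>

definition D1 where "D1 i = (h i)\<^sup>2 *\<^sub>R (w' i - w i) - J (q i) (d i)"
definition D2 where "D2 i = (h i)\<^sup>2 *\<^sub>R (w' i + w i) + \<kappa> *\<^sub>R d i"

lemma D1: "bO 3 D1"
proof -
  have "bO 3 (\<lambda>i. e0 i + E i - (h i)\<^sup>2 *\<^sub>R (G (q' i) (v' i) - G (m i) (v' i)) + (h i)\<^sup>2 *\<^sub>R (G (q i) (v i) - G (m i) (v i)))"
    by (intro bO_add bO_diff e0 E3 G_shift)
  from Ginv_bound[OF this]
  have 1: "bO 3 (\<lambda>i. Ginv (m i) (e0 i + E i - (h i)\<^sup>2 *\<^sub>R (G (q' i) (v' i) - G (m i) (v' i)) + (h i)\<^sup>2 *\<^sub>R (G (q i) (v i) - G (m i) (v i))))" .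
  have 2: "bO 3 (\<lambda>i. (J (m i) - J (q i)) (d i))"
    by (rule bO_mono[OF bO_apply[OF at_m(1)[OF J_smooth] d2]]) simp
  from bO_add[OF bO_add[OF 1 2] bO_diff[OF X_shift(1,2)]]
  show ?thesis
  proof (rule bO_cong[rotated])
    show "\<forall>\<^sub>F i in F. Ginv (m i) (e0 i + E i - (h i)\<^sup>2 *\<^sub>R (G (q' i) (v' i) - G (m i) (v' i)) + (h i)\<^sup>2 *\<^sub>R (G (q i) (v i) - G (m i) (v i)))
        + (J (m i) - J (q i)) (d i) + ((h i)\<^sup>2 *\<^sub>R (X (q i) - X (m i)) - (h i)\<^sup>2 *\<^sub>R (X (q' i) - X (m i))) = D1 i"
      using sum_relation in_Q
    proof eventually_elim
      case (elim i)
      have "e0 i + E i - (h i)\<^sup>2 *\<^sub>R (G (q' i) (v' i) - G (m i) (v' i)) + (h i)\<^sup>2 *\<^sub>R (G (q i) (v i) - G (m i) (v i))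
          = G (m i) ((h i)\<^sup>2 *\<^sub>R (v' i - v i) - J (m i) (d i))"
        using elim B_G[of "m i" "d i"] by (simp add: blinfun.add_right blinfun.diff_right blinfun.scaleR_right algebra_simps)
      then show ?case using elim(2)
        by (simp add: Ginv_G D1_def w_def w'_def blinfun.diff_left algebra_simps)
    qed
  qed
qed

lemma diff_relation: "\<forall>\<^sub>F i in F. (h i)\<^sup>2 *\<^sub>R (G (q' i) (v' i) + G (q i) (v i))
    = (2 *\<^sub>R ray_int 1 B (q i, \<xi> i) - ray_int 0 B (q i, \<xi> i)) (\<xi> i) + 2 *\<^sub>R sg\<xi> (m i, \<xi> i, h i)"
  using relations
proof eventually_elim
  case (elim i)
  have "s2 (q i, q' i, h i) - s1 (q i, q' i, h i)
      = thv (q' i) + thv (q i) + (2 *\<^sub>R ray_int 1 B (q i, \<xi> i) - ray_int 0 B (q i, \<xi> i)) (\<xi> i) + 2 *\<^sub>R sg\<xi> (m i, \<xi> i, h i)"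
    unfolding s1_def s2_def mid_eq fst_conv snd_conv \<xi>_def[symmetric]
    by (simp add: blinfun.diff_left blinfun.add_left blinfun.scaleR_left scaleR_2 algebra_simps)
  moreover have "s2 (q i, q' i, h i) - s1 (q i, q' i, h i)
      = thv (q' i) + thv (q i) + (h i)\<^sup>2 *\<^sub>R (G (q' i) (v' i) + G (q i) (v i))"
    using elim by (simp add: algebra_simps)
  ultimately show ?case by simp
qed

text \<open>Holds because \<xi> = h X + O(h^2). In \<open>D2\<close> the coefficient 1/6 from
  \<open>ray_B\<close> meets twice the coefficient 1/12 of \<Sigma>, and the terms of order h^2
  cancel. This cancellation is the purpose of the third term of \<Sigma>.\<close>

lemma curvature_term: "bO 3 (\<lambda>i. total_deriv B (q i) (\<xi> i) (\<xi> i) - (h i)\<^sup>2 *\<^sub>R cc (m i))"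
proof -
  define \<eta> where "\<eta> i = \<xi> i - h i *\<^sub>R X (q i)" for i
  have hX: "bO 1 (\<lambda>i. h i *\<^sub>R X (q i))" using bO_h_scale[OF at_q[OF X_smooth]] by simp
  have "bO 2 (\<lambda>i. d i + h i *\<^sub>R (X (m i) - X (q i)))"
    using bO_add[OF d2] bO_h_scale[OF at_m(1)[OF X_smooth]] by (simp add: numeral_2_eq_2)
  then have \<eta>: "bO 2 \<eta>" by (simp add: \<eta>_def[abs_def] d_def algebra_simps)
  note jB = at_q[OF total_deriv_B_smooth]
  have 1: "bO (0 + 2 + 1) (\<lambda>i. total_deriv B (q i) (\<eta> i) (\<xi> i))" by (intro bO_apply jB \<eta> \<xi>1)
  have 2: "bO (0 + 1 + 2) (\<lambda>i. total_deriv B (q i) (h i *\<^sub>R X (q i)) (\<eta> i))" by (intro bO_apply jB \<eta> hX)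
  have 3: "bO (2 + 1) (\<lambda>i. (h i)\<^sup>2 *\<^sub>R (cc (m i) - cc (q i)))" by (intro bO_h_power_scale at_m(1)[OF cc_smooth])
  have "bO 3 (\<lambda>i. total_deriv B (q i) (\<eta> i) (\<xi> i) + total_deriv B (q i) (h i *\<^sub>R X (q i)) (\<eta> i) - (h i)\<^sup>2 *\<^sub>R (cc (m i) - cc (q i)))"
    by (intro bO_diff bO_add bO_mono[OF 1] bO_mono[OF 2] bO_mono[OF 3]) simp_all
  moreover have "total_deriv B (q i) (\<eta> i) (\<xi> i) + total_deriv B (q i) (h i *\<^sub>R X (q i)) (\<eta> i) - (h i)\<^sup>2 *\<^sub>R (cc (m i) - cc (q i))
      = total_deriv B (q i) (\<xi> i) (\<xi> i) - (h i)\<^sup>2 *\<^sub>R cc (m i)" for i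
    by (simp add: \<eta>_def cc_def blinfun.diff_left blinfun.diff_right blinfun.scaleR_left blinfun.scaleR_right
        power2_eq_square algebra_simps)
  ultimately show ?thesis by simp
qed

lemma D2: "bO 3 D2"
proof -
  define r where "r i = (2 *\<^sub>R ray_int 1 B (q i, \<xi> i) - ray_int 0 B (q i, \<xi> i) - (1/6) *\<^sub>R total_deriv B (q i) (\<xi> i)) (\<xi> i)" for i
  define c where "c i = total_deriv B (q i) (\<xi> i) (\<xi> i) - (h i)\<^sup>2 *\<^sub>R cc (m i)" for i
  have r: "bO 3 r" unfolding r_def[abs_def] using bO_apply[OF ray_B(2) \<xi>1] by simp
  have c: "bO 3 c" unfolding c_def[abs_def] by (rule curvature_term)
  have "bO 3 (\<lambda>i. r i + (1/6) *\<^sub>R c i - (h i)\<^sup>2 *\<^sub>R (G (q' i) (v' i) - G (m i) (v' i)) - (h i)\<^sup>2 *\<^sub>R (G (q i) (v i) - G (m i) (v i)))"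
    by (intro bO_add bO_diff bO_cmult r c G_shift)
  from bO_diff[OF Ginv_bound[OF this] bO_add[OF X_shift]]
  show ?thesis
  proof (rule bO_cong[rotated])
    show "\<forall>\<^sub>F i in F. Ginv (m i) (r i + (1/6) *\<^sub>R c i - (h i)\<^sup>2 *\<^sub>R (G (q' i) (v' i) - G (m i) (v' i)) - (h i)\<^sup>2 *\<^sub>R (G (q i) (v i) - G (m i) (v i)))
        - ((h i)\<^sup>2 *\<^sub>R (X (q i) - X (m i)) + (h i)\<^sup>2 *\<^sub>R (X (q' i) - X (m i))) = D2 i"
      using diff_relation in_Q
    proof eventually_elim
      case (elim i)
      have sg: "2 *\<^sub>R sg\<xi> (m i, \<xi> i, h i) = (2 * (h i)\<^sup>2) *\<^sub>R G (m i) (X (m i)) - ((h i)\<^sup>2 / 6) *\<^sub>R cc (m i) - \<kappa> *\<^sub>R G (m i) (d i)"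
        by (simp add: sg\<xi>_def al_def d_def algebra_simps)
      have "r i + (1/6) *\<^sub>R c i - (h i)\<^sup>2 *\<^sub>R (G (q' i) (v' i) - G (m i) (v' i)) - (h i)\<^sup>2 *\<^sub>R (G (q i) (v i) - G (m i) (v i))
          = G (m i) ((h i)\<^sup>2 *\<^sub>R (v' i + v i) - (2 * (h i)\<^sup>2) *\<^sub>R X (m i) + \<kappa> *\<^sub>R d i)"
        using elim(1) unfolding sg
        by (simp add: r_def c_def blinfun.diff_left blinfun.add_left blinfun.scaleR_left blinfun.add_right blinfun.diff_right blinfun.scaleR_right
            algebra_simps)
      then show ?case using elim(2)
        by (simp add: Ginv_G D2_def w_def w'_def algebra_simps) (simp flip: scaleR_left_distrib)
    qed
  qed
qed

lemma velocity_step: "bO 1 (\<lambda>i. w' i - rot (J (q i)) \<theta>0 (w i))"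
proof (rule bO_cancel)
  define a where "a i = (1/2) *\<^sub>R (D1 i + D2 i)" for i
  define b where "b i = (1/2) *\<^sub>R (D2 i - D1 i)" for i
  have a: "bO 3 a" and b: "bO 3 b" unfolding a_def[abs_def] b_def[abs_def] by (intro bO_cmult bO_add bO_diff D1 D2)+
  have "bO (0 + 3) (\<lambda>i. J (q i) (b i))" by (intro bO_apply at_q[OF J_smooth] b)
  then have "bO 3 (\<lambda>i. a i - (cos \<theta>0 *\<^sub>R b i - sin \<theta>0 *\<^sub>R J (q i) (b i)))"
    by (intro bO_diff bO_cmult a b) simp
  then have "bO 3 (\<lambda>i. (h i)\<^sup>2 *\<^sub>R (w' i - rot (J (q i)) \<theta>0 (w i)))"
  proof (rule bO_cong[rotated])
    show "\<forall>\<^sub>F i in F. a i - (cos \<theta>0 *\<^sub>R b i - sin \<theta>0 *\<^sub>R J (q i) (b i)) = (h i)\<^sup>2 *\<^sub>R (w' i - rot (J (q i)) \<theta>0 (w i))"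
      using in_Q
    proof eventually_elim
      case (elim i)
      then have JJ: "J (q i) (J (q i) y) = - y" for y by (simp add: J_J)
      have half: "(1/2) *\<^sub>R y + (1/2) *\<^sub>R y = y" for y :: 'a by (simp flip: scaleR_left_distrib)
      have ai: "a i = (h i)\<^sup>2 *\<^sub>R w' i - (1/2) *\<^sub>R (J (q i) (d i) - \<kappa> *\<^sub>R d i)"
        using half[of "(h i)\<^sup>2 *\<^sub>R w' i"] by (simp add: a_def D1_def D2_def algebra_simps)
      have bi: "b i = (h i)\<^sup>2 *\<^sub>R w i + (1/2) *\<^sub>R (J (q i) (d i) + \<kappa> *\<^sub>R d i)"
        using half[of "(h i)\<^sup>2 *\<^sub>R w i"] by (simp add: b_def D1_def D2_def algebra_simps)
      \<comment> \<open>In terms of these identities the rotation by \<theta>0 maps (\<kappa> + J) d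
        to (\<kappa> - J) d, so \<open>d\<close> disappears from the difference of \<open>a\<close>
        and the rotated \<open>b\<close>.\<close>
      have k: "cos \<theta>0 * \<kappa> + sin \<theta>0 = \<kappa>" "sin \<theta>0 * \<kappa> - cos \<theta>0 = 1"
        using \<kappa>_trig(3,4) by (simp_all add: algebra_simps)
      have "cos \<theta>0 *\<^sub>R (J (q i) (d i) + \<kappa> *\<^sub>R d i) - sin \<theta>0 *\<^sub>R J (q i) (J (q i) (d i) + \<kappa> *\<^sub>R d i)
          = (cos \<theta>0 * \<kappa> + sin \<theta>0) *\<^sub>R d i - (sin \<theta>0 * \<kappa> - cos \<theta>0) *\<^sub>R J (q i) (d i)"
        by (simp add: blinfun.add_right blinfun.scaleR_right JJ algebra_simps)
      then have r: "cos \<theta>0 *\<^sub>R (J (q i) (d i) + \<kappa> *\<^sub>R d i) - sin \<theta>0 *\<^sub>R J (q i) (J (q i) (d i) + \<kappa> *\<^sub>R d i)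
          = \<kappa> *\<^sub>R d i - J (q i) (d i)" unfolding k by simp
      have "cos \<theta>0 *\<^sub>R b i - sin \<theta>0 *\<^sub>R J (q i) (b i)
          = (h i)\<^sup>2 *\<^sub>R rot (J (q i)) \<theta>0 (w i) + (1/2) *\<^sub>R (cos \<theta>0 *\<^sub>R (J (q i) (d i) + \<kappa> *\<^sub>R d i) - sin \<theta>0 *\<^sub>R J (q i) (J (q i) (d i) + \<kappa> *\<^sub>R d i))"
        unfolding bi rot_def
        by (simp only: blinfun.add_right blinfun.scaleR_right scaleR_add_right scaleR_diff_right scaleR_scaleR mult.commute)
          (simp add: algebra_simps)
      then show ?case unfolding r ai by (simp add: algebra_simps)
    qed
  qed
  then show "bO (2 + 1) (\<lambda>i. (h i) ^ 2 *\<^sub>R (w' i - rot (J (q i)) \<theta>0 (w i)))" by simp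
qed

text \<open>Applying J to \<open>D1\<close> identifies \<open>d\<close>, up to O(h^3), with the
  increment of - h^2 J w. Adding h^2 J w to the position thus removes the gyration from the step and
  leaves the midpoint rule for X_H.\<close>

lemma centre_step: "bO 3 (\<lambda>i. q' i + (h i)\<^sup>2 *\<^sub>R J (q' i) (w' i) - (q i + (h i)\<^sup>2 *\<^sub>R J (q i) (w i)) - h i *\<^sub>R X (m i))"
proof -
  have w': "bO 0 w'" unfolding w'_def[abs_def] by (intro bO_diff v'_bounded at_q'(2)[OF X_smooth])
  have 1: "bO (0 + 3) (\<lambda>i. J (q i) (D1 i))" by (intro bO_apply at_q[OF J_smooth] D1)
  have 2: "bO (2 + (1 + 0)) (\<lambda>i. (h i)\<^sup>2 *\<^sub>R ((J (q' i) - J (q i)) (w' i)))"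
    by (intro bO_h_power_scale bO_apply at_q'(1)[OF J_smooth] w')
  from bO_add[OF 1[simplified] 2[simplified]]
  show ?thesis
  proof (rule bO_cong[rotated])
    show "\<forall>\<^sub>F i in F. J (q i) (D1 i) + (h i)\<^sup>2 *\<^sub>R ((J (q' i) - J (q i)) (w' i))
       = q' i + (h i)\<^sup>2 *\<^sub>R J (q' i) (w' i) - (q i + (h i)\<^sup>2 *\<^sub>R J (q i) (w i)) - h i *\<^sub>R X (m i)"
      using in_Q
    proof eventually_elim
      case (elim i)
      then have "J (q i) (D1 i) = (h i)\<^sup>2 *\<^sub>R (J (q i) (w' i) - J (q i) (w i)) + d i"
        by (simp add: D1_def blinfun.diff_right blinfun.scaleR_right J_J)
      then show ?case
        by (simp add: blinfun.diff_left d_def \<xi>_def algebra_simps)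
    qed
  qed
qed

end

section \<open>Orbits of the map\<close>

locale lorentz_map = lorentz Q \<theta> J H \<theta>0
  for Q :: "'a::euclidean_space set" and \<theta> J H \<theta>0 +
  fixes U :: "('a \<times> 'a \<times> real) set" and \<Psi> :: "real \<Rightarrow> 'a \<times> 'a \<Rightarrow> 'a \<times> 'a" and C :: "('a \<times> 'a) set"
  assumes map: "symplectic_lorentz_map Q \<theta> J H \<theta>0 U \<Psi>"
    and C_compact: "compact C" and C_Q: "C \<subseteq> Q \<times> UNIV"
begin

definition K :: "'a set" where "K = fst ` C"

lemma K_compact: "compact K"
  unfolding K_def by (intro compact_continuous_image continuous_intros C_compact)

lemma K_Q: "K \<subseteq> Q"
  using C_Q by (auto simp: K_def)

text \<open>The map is smooth near C \<times> {0} and lies over the identity at h = 0; compactness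
  of C makes the resulting O(h) uniform.\<close>

lemma map_displacement:
  "\<exists>C0 h1. C0 \<ge> 0 \<and> h1 > 0 \<and> (\<forall>z\<in>C. \<forall>h. 0 < h \<longrightarrow> h < h1 \<longrightarrow>
     (fst z, snd z, h) \<in> U \<and> norm (fst (\<Psi> h z) - fst z) \<le> C0 * h)"
proof -
  let ?g = "\<lambda>P::'a \<times> 'a \<times> real. \<Psi> (snd (snd P)) (fst P, fst (snd P))"
  have U: "open U" "Q \<times> UNIV \<times> {0} \<subseteq> U" and g: "smooth_on U ?g" and \<Psi>0: "\<And>q v. q \<in> Q \<Longrightarrow> fst (\<Psi> 0 (q, v)) = q"
    using map unfolding symplectic_lorentz_map_def case_prod_beta by auto
  define C' where "C' = (\<lambda>z. (fst z, snd z, 0 :: real)) ` C"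
  have "C' \<subseteq> Q \<times> UNIV \<times> {0}" unfolding C'_def using C_Q by auto
  then have C': "compact C'" "C' \<subseteq> U"
    unfolding C'_def using U(2) by (auto intro!: compact_continuous_image continuous_intros C_compact)
  obtain D r where D: "D \<ge> 0" "0 < r" and all: "\<And>x \<zeta> Z \<rho>. x \<in> C' \<Longrightarrow> norm \<zeta> \<le> \<rho> \<Longrightarrow> norm Z \<le> \<rho> \<Longrightarrow> \<rho> \<le> r \<Longrightarrow>
      x + \<zeta> \<in> U \<and> norm (?g (x + \<zeta>) - (\<Sum>i<1. (1 / fact i) *\<^sub>R taylor_term i ?g x Z)) \<le> D * (\<rho> ^ 1 + norm (\<zeta> - Z))"
    using taylor_approx[OF g U(1) C', of 1] by blast
  show ?thesis
  proof (rule exI[of _ D], rule exI[of _ r], intro conjI ballI allI impI)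
    fix z h assume z: "z \<in> C" and h: "0 < h" "h < r"
    have zz: "(fst z, snd z, 0) \<in> C'" using z by (auto simp: C'_def)
    have n: "norm (0 :: 'a, 0 :: 'a, h) \<le> h" using h by (simp add: norm_Pair)
    from all[OF zz n n] h
    show "(fst z, snd z, h) \<in> U" by simp
    have "norm (\<Psi> h z - \<Psi> 0 z) \<le> D * h" using all[OF zz n n] h by simp
    moreover have "fst (\<Psi> 0 z) = fst z" using \<Psi>0[of "fst z" "snd z"] z C_Q by auto
    ultimately show "norm (fst (\<Psi> h z) - fst z) \<le> D * h"
      using norm_fst_le[of "fst (\<Psi> h z - \<Psi> 0 z)" "snd (\<Psi> h z - \<Psi> 0 z)"] unfolding prod.collapse by simp
  qed (use D in auto)
qed

lemma map_relations:
  assumes "(fst z, snd z, h) \<in> U"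
  defines "P \<equiv> (fst z, fst (\<Psi> h z), h)"
  shows "P \<in> \<Omega>S" "s1 P = - thv (fst z) - h\<^sup>2 *\<^sub>R G (fst z) (snd z)"
    "s2 P = thv (fst (\<Psi> h z)) + h\<^sup>2 *\<^sub>R G (fst (\<Psi> h z)) (snd (\<Psi> h z))"
proof -
  define q v q' v' where "q = fst z" and "v = snd z" and "q' = fst (\<Psi> h z)" and "v' = snd (\<Psi> h z)"
  have "\<forall>(q, v, h)\<in>U. lorentz_relations Q \<theta> J H \<theta>0 h (q, v) (\<Psi> h (q, v))"
    using map unfolding symplectic_lorentz_map_def by blast
  from bspec[OF this assms(1)] have "lorentz_relations Q \<theta> J H \<theta>0 h z (\<Psi> h z)" by simp
  then have rel: "closed_segment q q' \<subseteq> Q"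
    "((\<lambda>y. lorentz_S \<theta> J H \<theta>0 h q y) has_derivative (\<lambda>w. \<theta> q' w + h\<^sup>2 * compat_metric \<theta> J q' v' w)) (at q')"
    "((\<lambda>y. lorentz_S \<theta> J H \<theta>0 h y q') has_derivative (\<lambda>w. - (\<theta> q w + h\<^sup>2 * compat_metric \<theta> J q v w))) (at q)"
    unfolding lorentz_relations_def case_prod_beta q_def v_def q'_def v'_def by auto
  have P: "P = (q, q', h)" by (simp add: P_def q_def q'_def)
  show PS: "P \<in> \<Omega>S" unfolding P \<Omega>S_iff by (rule rel(1))
  have qQ: "q \<in> Q" "q' \<in> Q" using \<Omega>S_points(1,2)[OF PS] by (simp_all add: P)
  note D = S_has_derivative[OF PS, unfolded P]
  have "((\<lambda>y. (q, y, h)) has_derivative (\<lambda>w. (0, w, 0))) (at q')"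
    by (intro has_derivative_Pair has_derivative_const has_derivative_ident)
  from has_derivative_compose[OF this D]
  have "((\<lambda>y. lorentz_S \<theta> J H \<theta>0 h q y) has_derivative (\<lambda>w. s2 (q, q', h) \<bullet> w)) (at q')"
    by (simp add: S_def)
  from has_derivative_unique[OF this rel(2)]
  have "s2 (q, q', h) \<bullet> w = (thv q' + h\<^sup>2 *\<^sub>R G q' v') \<bullet> w" for w
    by (metis (no_types) G_inner[OF qQ(2)] inner_add_left inner_scaleR_left thv_inner)
  then show "s2 P = thv (fst (\<Psi> h z)) + h\<^sup>2 *\<^sub>R G (fst (\<Psi> h z)) (snd (\<Psi> h z))"
    unfolding P q'_def[symmetric] v'_def[symmetric] by (metis vector_eq_rdot)
  have "((\<lambda>y. (y, q', h)) has_derivative (\<lambda>w. (w, 0, 0))) (at q)"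
    by (intro has_derivative_Pair has_derivative_const has_derivative_ident)
  from has_derivative_compose[OF this D]
  have "((\<lambda>y. lorentz_S \<theta> J H \<theta>0 h y q') has_derivative (\<lambda>w. s1 (q, q', h) \<bullet> w)) (at q)"
    by (simp add: S_def)
  from has_derivative_unique[OF this rel(3)]
  have e: "s1 (q, q', h) \<bullet> w = - (\<theta> q w + h\<^sup>2 * compat_metric \<theta> J q v w)" for w by (rule fun_cong)
  have "s1 (q, q', h) \<bullet> w = (- thv q - h\<^sup>2 *\<^sub>R G q v) \<bullet> w" for w
    unfolding e by (simp add: G_inner[OF qQ(1)] inner_diff_left thv_inner)
  then show "s1 P = - thv (fst z) - h\<^sup>2 *\<^sub>R G (fst z) (snd z)"
    unfolding P q_def[symmetric] v_def[symmetric] by (metis vector_eq_rdot)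
qed

text \<open>The constants are fixed once, so that \<open>pos\<close> and \<open>orb\<close> can
  refer to \<open>h1\<close> and all orbit estimates share one bound for the step.\<close>

definition C0 :: real where
  "C0 = (SOME C0. \<exists>h1. C0 \<ge> 0 \<and> h1 > 0 \<and> (\<forall>z\<in>C. \<forall>h. 0 < h \<longrightarrow> h < h1 \<longrightarrow>
     (fst z, snd z, h) \<in> U \<and> norm (fst (\<Psi> h z) - fst z) \<le> C0 * h))"

definition h1 :: real where
  "h1 = (SOME h1. C0 \<ge> 0 \<and> h1 > 0 \<and> (\<forall>z\<in>C. \<forall>h. 0 < h \<longrightarrow> h < h1 \<longrightarrow>
     (fst z, snd z, h) \<in> U \<and> norm (fst (\<Psi> h z) - fst z) \<le> C0 * h))"

lemma C0_h1: "C0 \<ge> 0" "h1 > 0" "\<And>z h. z \<in> C \<Longrightarrow> 0 < h \<Longrightarrow> h < h1 \<Longrightarrow> (fst z, snd z, h) \<in> U"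
  "\<And>z h. z \<in> C \<Longrightarrow> 0 < h \<Longrightarrow> h < h1 \<Longrightarrow> norm (fst (\<Psi> h z) - fst z) \<le> C0 * h"
proof -
  have "\<exists>h1. C0 \<ge> 0 \<and> h1 > 0 \<and> (\<forall>z\<in>C. \<forall>h. 0 < h \<longrightarrow> h < h1 \<longrightarrow>
     (fst z, snd z, h) \<in> U \<and> norm (fst (\<Psi> h z) - fst z) \<le> C0 * h)"
    unfolding C0_def by (rule someI_ex[OF map_displacement])
  from someI_ex[OF this, folded h1_def]
  show "C0 \<ge> 0" "h1 > 0" "\<And>z h. z \<in> C \<Longrightarrow> 0 < h \<Longrightarrow> h < h1 \<Longrightarrow> (fst z, snd z, h) \<in> U"
    "\<And>z h. z \<in> C \<Longrightarrow> 0 < h \<Longrightarrow> h < h1 \<Longrightarrow> norm (fst (\<Psi> h z) - fst z) \<le> C0 * h" by blast+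
qed

text \<open>The bound h < h1 keeps all iterates in C inside the domain U, where the implicit
  relations hold; outside U the values of \<Psi> are arbitrary.\<close>

definition pos :: "real \<Rightarrow> 'a \<times> 'a \<Rightarrow> bool" where
  "pos h z \<longleftrightarrow> 0 < h \<and> h < h1 \<and> positively_contained (\<Psi> h) C z"

definition qs :: "real \<Rightarrow> 'a \<times> 'a \<Rightarrow> nat \<Rightarrow> 'a" where
  "qs h z n = fst ((\<Psi> h ^^ n) z)"

definition vs :: "real \<Rightarrow> 'a \<times> 'a \<Rightarrow> nat \<Rightarrow> 'a" where
  "vs h z n = snd ((\<Psi> h ^^ n) z)"

definition orb :: "real \<Rightarrow> (nat \<Rightarrow> 'a) \<Rightarrow> bool" where
  "orb h q \<longleftrightarrow> (\<exists>z. pos h z \<and> q = qs h z)"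

lemma pos_shift: "pos h z \<Longrightarrow> pos h ((\<Psi> h ^^ n) z)"
  unfolding pos_def positively_contained_def by (metis comp_apply funpow_add)

lemma qs_shift: "qs h ((\<Psi> h ^^ n) z) m = qs h z (n + m)" "vs h ((\<Psi> h ^^ n) z) m = vs h z (n + m)"
  unfolding qs_def vs_def by (simp_all add: funpow_add[symmetric, THEN fun_cong, unfolded comp_apply] add.commute)

lemma pos_C: "pos h z \<Longrightarrow> (\<Psi> h ^^ n) z \<in> C"
  by (simp add: pos_def positively_contained_def)

lemma orbit_relations:
  assumes "pos h z"
  shows "(qs h z n, qs h z (Suc n), h) \<in> \<Omega>S"
    and "s1 (qs h z n, qs h z (Suc n), h) = - thv (qs h z n) - h\<^sup>2 *\<^sub>R G (qs h z n) (vs h z n)"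
    and "s2 (qs h z n, qs h z (Suc n), h) = thv (qs h z (Suc n)) + h\<^sup>2 *\<^sub>R G (qs h z (Suc n)) (vs h z (Suc n))"
  using map_relations[OF C0_h1(3)[OF pos_C[OF assms, of n], of h]] assms
  unfolding qs_def vs_def pos_def by simp_all

lemma qs_step: "pos h z \<Longrightarrow> norm (qs h z (Suc n) - qs h z n) \<le> C0 * h"
  using C0_h1(4)[OF pos_C, of h z h n] unfolding qs_def pos_def by simp

lemma qs_K: "pos h z \<Longrightarrow> qs h z n \<in> K"
  using pos_C unfolding qs_def K_def by blast

lemma bounded_on_K:
  assumes "smooth_on Q g"
  obtains c where "c \<ge> 0" "\<And>x. x \<in> K \<Longrightarrow> norm (g x) \<le> c"
  using smooth_on_bounded[OF assms K_compact K_Q] by blast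

text \<open>The velocity at an interior point occurs in two relations, as final velocity of one step
  and as initial velocity of the next, with opposite signs. Adding them eliminates it and leaves f =
  0 for three consecutive positions.\<close>

lemma orbits: "\<exists>Cj CA. variational_orbits f \<Omega> K (\<lambda>x. blinfun_apply (J x)) \<theta>0 A bv orb C0 Cj CA S s1 s2 (\<lambda>P. sgh (mid P)) \<Omega>S"
proof -
  obtain cj where cj: "cj \<ge> 0" "\<And>x. x \<in> K \<Longrightarrow> norm (J x) \<le> cj" using bounded_on_K[OF J_smooth] by blast
  obtain cg where cg: "cg \<ge> 0" "\<And>x. x \<in> K \<Longrightarrow> norm (Ginv x) \<le> cg" using bounded_on_K[OF Ginv_smooth] by blast
  define CA where "CA = (2 / (\<kappa>\<^sup>2 + 1)) * (\<bar>\<kappa>\<bar> * cg + cj * cg)"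
  have CA: "CA \<ge> 0" using cj(1) cg(1) by (auto simp: CA_def intro!: mult_nonneg_nonneg add_nonneg_nonneg divide_nonneg_nonneg)
  have KQ: "x \<in> Q" if "x \<in> K" for x using that K_Q by blast
  have Jb: "norm (J x v) \<le> cj * norm v" if "x \<in> K" for x v
    using norm_blinfun[of "J x" v] mult_right_mono[OF cj(2)[OF that], of "norm v"] by simp
  have Gb: "norm (Ginv x v) \<le> cg * norm v" if "x \<in> K" for x v
    using norm_blinfun[of "Ginv x" v] mult_right_mono[OF cg(2)[OF that], of "norm v"] by simp
  have Ab: "norm (A x v) \<le> CA * norm v" if x: "x \<in> K" for x v
  proof -
    have "norm (\<kappa> *\<^sub>R Ginv x v - J x (Ginv x v)) \<le> \<bar>\<kappa>\<bar> * norm (Ginv x v) + norm (J x (Ginv x v))"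
      by (intro order_trans[OF norm_triangle_ineq4]) simp
    also have "\<dots> \<le> \<bar>\<kappa>\<bar> * (cg * norm v) + cj * (cg * norm v)"
      using Gb[OF x] Jb[OF x, of "Ginv x v"] cj(1) by (intro add_mono mult_left_mono order_trans[OF Jb[OF x]]) auto
    also have "\<dots> = (\<bar>\<kappa>\<bar> * cg + cj * cg) * norm v" by (simp add: algebra_simps)
    finally have "(2 / (\<kappa>\<^sup>2 + 1)) * norm (\<kappa> *\<^sub>R Ginv x v - J x (Ginv x v)) \<le> (2 / (\<kappa>\<^sup>2 + 1)) * ((\<bar>\<kappa>\<bar> * cg + cj * cg) * norm v)"
      by (intro mult_left_mono) auto
    moreover have "norm (A x v) = (2 / (\<kappa>\<^sup>2 + 1)) * norm (\<kappa> *\<^sub>R Ginv x v - J x (Ginv x v))"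
      unfolding A_def norm_scaleR by (simp add: abs_of_nonneg)
    ultimately show ?thesis by (simp only: CA_def mult.assoc)
  qed
  have Al: "bounded_linear (A x)" for x
    unfolding A_def[abs_def]
    by (intro bounded_linear_const_scaleR bounded_linear_sub blinfun.bounded_linear_right
        bounded_linear_compose[OF blinfun.bounded_linear_right blinfun.bounded_linear_right])
  have "variational_orbits f \<Omega> K (\<lambda>x. blinfun_apply (J x)) \<theta>0 A bv orb C0 cj CA S s1 s2 (\<lambda>P. sgh (mid P)) \<Omega>S"
  proof (intro variational_orbits.intro discrete_orbits.intro variational_orbits_axioms.intro)
    show "f (q n, q (Suc n), q (Suc (Suc n)), h) = 0" if o: "orb h q" for h q n
    proof -
      obtain z where z: "pos h z" "q = qs h z" using o unfolding orb_def by blast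
      show ?thesis unfolding z(2) f_def by (simp add: orbit_relations[OF z(1)])
    qed
    show "A x (frechet_derivative f (at (x, x, x, 0)) (p0, p1, p2, h)) = p2 - p1 - rot (blinfun_apply (J x)) \<theta>0 (p1 - p0) - h *\<^sub>R bv x"
      if "x \<in> K" for x p0 p1 p2 h by (rule f_linear[OF KQ[OF that]])
    show "f (x, y, z, h) = s2 (x, y, h) + s1 (y, z, h)" for x y z h by (simp add: f_def)
  qed (use KQ Ab Al Jb CA cj in \<open>auto simp: f_smooth open_\<Omega> K_compact diag_\<Omega> f_diag blinfun.bounded_linear_right J_J nonresonant orb_def
      pos_def qs_K[unfolded pos_def] qs_step[unfolded pos_def] C0_h1 open_\<Omega>S diag_\<Omega>S S_has_derivative s_smooth\<close>)
  then show ?thesis by blast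
qed

end

section \<open>Expansion of orbits up to third order in h\<close>

lemma (in small_parameter) bO_telescope:
  assumes "\<And>n. bO k (\<lambda>i. y (Suc n) i - y n i)"
  shows "bO k (\<lambda>i. y n i - y 0 i)"
proof (induction n)
  case 0
  show ?case by (rule bO_I[of _ 0]) simp
next
  case (Suc n)
  from bO_add[OF assms[of n] Suc] show ?case by simp
qed

lemma rot_has_vector_derivative:
  assumes "bounded_linear j" "\<And>u. j (j u) = - u"
  shows "((\<lambda>t. rot j (t + a) u) has_vector_derivative - j (rot j (t + a) u)) (at t within S)"
proof -
  have 1: "((\<lambda>t. cos (t + a)) has_real_derivative - sin (t + a)) (at t within S)"
    and 2: "((\<lambda>t. sin (t + a)) has_real_derivative cos (t + a)) (at t within S)"
    by (auto intro!: derivative_eq_intros)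
  have "((\<lambda>t. cos (t + a) *\<^sub>R u - sin (t + a) *\<^sub>R j u) has_vector_derivative
      (cos (t + a) *\<^sub>R 0 + (- sin (t + a)) *\<^sub>R u) - (sin (t + a) *\<^sub>R 0 + cos (t + a) *\<^sub>R j u)) (at t within S)"
    by (intro has_vector_derivative_diff has_vector_derivative_scaleR[OF 1 has_vector_derivative_const]
        has_vector_derivative_scaleR[OF 2 has_vector_derivative_const])
  moreover have "(cos (t + a) *\<^sub>R 0 + (- sin (t + a)) *\<^sub>R u) - (sin (t + a) *\<^sub>R 0 + cos (t + a) *\<^sub>R j u) = - j (rot j (t + a) u)"
    using assms(2)[of u] bounded_linear.linear[OF assms(1)]
    by (simp add: rot_def linear_diff linear_scale)
  ultimately show ?thesis by (simp add: rot_def)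
qed

text \<open>Both points are expanded at x with the same second-order term, which cancels in the
  difference. The remaining errors are \<rho>^3 and \<rho> |y - z| with \<rho> = O(h), hence O(h^3).
  Separate first-order expansions would leave O(h^2), the size of y - z itself.\<close>

lemma (in small_parameter) bO_two_point:
  fixes g :: "'a::euclidean_space \<Rightarrow> 'b::real_normed_vector"
  assumes "smooth_on Q g" "open Q" "compact K" "K \<subseteq> Q" "\<forall>\<^sub>F i in F. x i \<in> K"
    and "bO 1 (\<lambda>i. y i - x i)" "bO 1 (\<lambda>i. z i - x i)" "bO 2 (\<lambda>i. y i - z i)"
  shows "bO 3 (\<lambda>i. g (y i) - g (z i) - blinfun_apply (total_deriv g (x i)) (y i - z i))"
proof -
  obtain C r where C: "C \<ge> 0" "0 < r" and C_all: "\<And>x \<zeta> Z \<rho>. x \<in> K \<Longrightarrow> norm \<zeta> \<le> \<rho> \<Longrightarrow> norm Z \<le> \<rho> \<Longrightarrow> \<rho> \<le> r \<Longrightarrow>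
      norm (g (x + \<zeta>) - (\<Sum>i<3. (1 / fact i) *\<^sub>R taylor_term i g x (if i < 2 then \<zeta> else Z))) \<le> C * (\<rho> ^ 3 + \<rho> * norm (\<zeta> - Z))"
    using taylor_approx[OF assms(1-4), of 3] by blast
  have bound: "norm (g (x + \<zeta>) - g (x + Z) - total_deriv g x (\<zeta> - Z)) \<le> C * (\<rho> ^ 3 + \<rho> * norm (\<zeta> - Z)) + C * \<rho> ^ 3"
    if "x \<in> K" "norm \<zeta> \<le> \<rho>" "norm Z \<le> \<rho>" "\<rho> \<le> r" for x \<zeta> Z \<rho>
  proof -
    have xQ: "x \<in> Q" using that assms(4) by blast
    have T: "(\<Sum>i<3. (1 / fact i) *\<^sub>R taylor_term i g x (if i < 2 then \<zeta> else Z))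
        = g x + total_deriv g x \<zeta> + (1/2) *\<^sub>R taylor_term 2 g x Z" for \<zeta>
      using taylor_term_1[OF assms(1) xQ, of \<zeta>]
      by (simp add: eval_nat_numeral smooth_on_total_deriv_apply[OF assms(1) xQ, symmetric] del: taylor_term.simps(2))
    have eq: "g (x + \<zeta>) - g (x + Z) - total_deriv g x (\<zeta> - Z)
       = (g (x + \<zeta>) - (g x + total_deriv g x \<zeta> + (1/2) *\<^sub>R taylor_term 2 g x Z))
         - (g (x + Z) - (g x + total_deriv g x Z + (1/2) *\<^sub>R taylor_term 2 g x Z))"
      by (simp add: blinfun.diff_right)
    have a: "norm (g (x + \<zeta>) - (g x + total_deriv g x \<zeta> + (1/2) *\<^sub>R taylor_term 2 g x Z)) \<le> C * (\<rho> ^ 3 + \<rho> * norm (\<zeta> - Z))"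
      using C_all[OF that] unfolding T .
    have b: "norm (g (x + Z) - (g x + total_deriv g x Z + (1/2) *\<^sub>R taylor_term 2 g x Z)) \<le> C * \<rho> ^ 3"
      using C_all[OF that(1,3,3,4)] unfolding T by simp
    show ?thesis unfolding eq by (rule order_trans[OF norm_triangle_ineq4 add_mono[OF a b]])
  qed
  obtain D1 where D1: "D1 \<ge> 0" "\<forall>\<^sub>F i in F. norm (y i - x i) \<le> D1 * h i ^ 1" using assms(6) by (rule bO_E)
  obtain D2 where D2: "D2 \<ge> 0" "\<forall>\<^sub>F i in F. norm (z i - x i) \<le> D2 * h i ^ 1" using assms(7) by (rule bO_E)
  obtain D3 where D3: "D3 \<ge> 0" "\<forall>\<^sub>F i in F. norm (y i - z i) \<le> D3 * h i ^ 2" using assms(8) by (rule bO_E)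
  define D where "D = D1 + D2"
  have D: "D \<ge> 0" using D1(1) D2(1) by (simp add: D_def)
  have "bO (Suc 0) (\<lambda>i. D *\<^sub>R h i)" using bO_cmult[OF bO_h, of D] by simp
  note small' = bO_small[OF this C(2)]
  have "\<forall>\<^sub>F i in F. norm (g (y i) - g (z i) - total_deriv g (x i) (y i - z i)) \<le> (C * (D ^ 3 + D * D3) + C * D ^ 3) * h i ^ 3"
    using D1(2) D2(2) D3(2) small' small[OF zero_less_one] assms(5)
  proof eventually_elim
    case (elim i)
    have 1: "norm (y i - x i) \<le> D * h i" "norm (z i - x i) \<le> D * h i"
      using elim D1(1) D2(1) by (auto simp: D_def distrib_right intro: order_trans add_increasing add_increasing2)
    have "norm (g (x i + (y i - x i)) - g (x i + (z i - x i)) - total_deriv g (x i) ((y i - x i) - (z i - x i)))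
        \<le> C * ((D * h i) ^ 3 + D * h i * norm ((y i - x i) - (z i - x i))) + C * (D * h i) ^ 3"
      by (rule bound) (use elim 1 D in auto)
    also have "\<dots> \<le> C * ((D * h i) ^ 3 + D * h i * (D3 * h i ^ 2)) + C * (D * h i) ^ 3"
      using elim C(1) D by (intro add_mono mult_left_mono) auto
    also have "\<dots> = (C * (D ^ 3 + D * D3) + C * D ^ 3) * h i ^ 3"
      by (simp add: power_mult_distrib algebra_simps power2_eq_square power3_eq_cube)
    finally show ?case by simp
  qed
  then show ?thesis by (rule bO_I)
qed

context lorentz_map
begin

text \<open>The index \<open>(h, z, t)\<close> carries all the data in which the estimates are uniform.\<close>

definition flt :: "(real \<times> ('a \<times> 'a) \<times> real) filter" where
  "flt = inf (filtercomap fst (at_right 0)) (principal {i. pos (fst i) (fst (snd i)) \<and> snd (snd i) \<in> {0..2*pi}})"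

lemma eventually_flt:
  "eventually P flt \<longleftrightarrow> (\<exists>h0>0. \<forall>h z t. pos h z \<longrightarrow> h < h0 \<longrightarrow> t \<in> {0..2*pi} \<longrightarrow> P (h, z, t))"
proof
  assume "eventually P flt"
  then obtain R where R: "eventually R (at_right 0)"
    "\<And>i. R (fst i) \<Longrightarrow> pos (fst i) (fst (snd i)) \<and> snd (snd i) \<in> {0..2*pi} \<Longrightarrow> P i"
    unfolding flt_def eventually_inf_principal eventually_filtercomap mem_Collect_eq by blast
  obtain h0 where h0: "h0 > 0" "\<And>h. 0 < h \<Longrightarrow> h < h0 \<Longrightarrow> R h"
    using R(1) unfolding eventually_at_right_field by blast
  have "P (h, z, t)" if "pos h z" "h < h0" "t \<in> {0..2*pi}" for h z t
    by (rule R(2)) (use that h0(2)[of h] in \<open>simp_all add: pos_def\<close>)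
  then show "\<exists>h0>0. \<forall>h z t. pos h z \<longrightarrow> h < h0 \<longrightarrow> t \<in> {0..2*pi} \<longrightarrow> P (h, z, t)" using h0(1) by blast
next
  assume "\<exists>h0>0. \<forall>h z t. pos h z \<longrightarrow> h < h0 \<longrightarrow> t \<in> {0..2*pi} \<longrightarrow> P (h, z, t)"
  then obtain h0 where h0: "h0 > 0" "\<And>h z t. pos h z \<Longrightarrow> h < h0 \<Longrightarrow> t \<in> {0..2*pi} \<Longrightarrow> P (h, z, t)" by blast
  have "eventually (\<lambda>h. h < h0) (at_right 0)" unfolding eventually_at_right_field using h0(1) by blast
  moreover have "\<forall>i. fst i < h0 \<longrightarrow> pos (fst i) (fst (snd i)) \<and> snd (snd i) \<in> {0..2*pi} \<longrightarrow> P i"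
    using h0(2) by simp
  ultimately show "eventually P flt"
    unfolding flt_def eventually_inf_principal eventually_filtercomap mem_Collect_eq by blast
qed

sublocale sp: small_parameter flt fst
proof
  fix r :: real assume "r > 0"
  then show "\<forall>\<^sub>F i in flt. 0 < fst i \<and> fst i < r"
    unfolding eventually_flt by (intro exI[of _ r]) (auto simp: pos_def)
qed

lemma flt_pos: "\<forall>\<^sub>F i in flt. pos (fst i) (fst (snd i))"
  unfolding eventually_flt by (intro exI[of _ 1]) auto

abbreviation qn :: "nat \<Rightarrow> real \<times> ('a \<times> 'a) \<times> real \<Rightarrow> 'a" where "qn n i \<equiv> qs (fst i) (fst (snd i)) n"
abbreviation vn :: "nat \<Rightarrow> real \<times> ('a \<times> 'a) \<times> real \<Rightarrow> 'a" where "vn n i \<equiv> vs (fst i) (fst (snd i)) n"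

lemma step_locale: "lorentz_step Q \<theta> J H \<theta>0 flt fst K (qn n) (vn n) (qn (Suc n)) (vn (Suc n))"
proof -
  have vb: "sp.bO 0 (vn n)" for n
  proof -
    have "bounded (snd ` C)" by (intro compact_imp_bounded compact_continuous_image continuous_intros C_compact)
    then obtain b where b: "\<And>z. z \<in> C \<Longrightarrow> norm (snd z) \<le> b" unfolding bounded_iff by auto
    have "\<forall>\<^sub>F i in flt. norm (vn n i) \<le> b * fst i ^ 0"
      using flt_pos by eventually_elim (use b pos_C in \<open>auto simp: vs_def\<close>)
    then show ?thesis by (rule sp.bO_I)
  qed
  have qK: "\<forall>\<^sub>F i in flt. qn n i \<in> K" for n
    using flt_pos by eventually_elim (rule qs_K)
  show ?thesis
  proof
    show "sp.bO 1 (\<lambda>i. qn (Suc n) i - qn n i)"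
      by (rule sp.bO_I[of _ C0]) (use flt_pos in \<open>eventually_elim, simp add: qs_step\<close>)
    show "\<forall>\<^sub>F i in flt. (qn n i, qn (Suc n) i, fst i) \<in> \<Omega>S \<and>
         s1 (qn n i, qn (Suc n) i, fst i) = - thv (qn n i) - (fst i)\<^sup>2 *\<^sub>R G (qn n i) (vn n i) \<and>
         s2 (qn n i, qn (Suc n) i, fst i) = thv (qn (Suc n) i) + (fst i)\<^sup>2 *\<^sub>R G (qn (Suc n) i) (vn (Suc n) i)"
      using flt_pos by eventually_elim (simp add: orbit_relations)
  qed (use K_compact K_Q qK vb in auto)
qed

definition wn where "wn n i = vn n i - X (qn n i)"
abbreviation q0 where "q0 i \<equiv> qn 0 i"
abbreviation w0 where "w0 i \<equiv> wn 0 i"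

lemma qK: "\<forall>\<^sub>F i in flt. qn n i \<in> K"
  using flt_pos by eventually_elim (rule qs_K)

lemma q0_Q: "\<forall>\<^sub>F i in flt. q0 i \<in> Q"
  using qK[of 0] K_Q by (auto elim: eventually_mono)

lemma step:
  shows "sp.bO 1 (\<lambda>i. wn (Suc n) i - rot (J (qn n i)) \<theta>0 (wn n i))"
    and "sp.bO 3 (\<lambda>i. qn (Suc n) i + (fst i)\<^sup>2 *\<^sub>R J (qn (Suc n) i) (wn (Suc n) i) - (qn n i + (fst i)\<^sup>2 *\<^sub>R J (qn n i) (wn n i))
      - fst i *\<^sub>R X ((1/2) *\<^sub>R (qn n i + qn (Suc n) i)))"
    and "sp.bO 2 (\<lambda>i. qn (Suc n) i - qn n i - fst i *\<^sub>R X ((1/2) *\<^sub>R (qn n i + qn (Suc n) i)))"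
    and "sp.bO 1 (\<lambda>i. qn (Suc n) i - qn n i)" and "sp.bO 0 (wn n)"
proof -
  interpret st: lorentz_step Q \<theta> J H \<theta>0 flt fst K "qn n" "vn n" "qn (Suc n)" "vn (Suc n)" by (rule step_locale)
  have w: "st.w = wn n" "st.w' = wn (Suc n)" by (auto simp: st.w_def wn_def st.w'_def fun_eq_iff)
  show "sp.bO 1 (\<lambda>i. wn (Suc n) i - rot (J (qn n i)) \<theta>0 (wn n i))" using st.velocity_step unfolding w .
  show "sp.bO 3 (\<lambda>i. qn (Suc n) i + (fst i)\<^sup>2 *\<^sub>R J (qn (Suc n) i) (wn (Suc n) i) - (qn n i + (fst i)\<^sup>2 *\<^sub>R J (qn n i) (wn n i))
      - fst i *\<^sub>R X ((1/2) *\<^sub>R (qn n i + qn (Suc n) i)))" using st.centre_step unfolding w st.m_def .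
  show "sp.bO 2 (\<lambda>i. qn (Suc n) i - qn n i - fst i *\<^sub>R X ((1/2) *\<^sub>R (qn n i + qn (Suc n) i)))"
    using st.d2 unfolding st.d_def[abs_def] st.\<xi>_def st.m_def .
  show "sp.bO 1 (\<lambda>i. qn (Suc n) i - qn n i)" by (rule st.q'_q)
  show "sp.bO 0 (wn n)" unfolding wn_def[abs_def] by (intro sp.bO_diff st.v_bounded st.at_q X_smooth)
qed

lemma qn_q0: "sp.bO 1 (\<lambda>i. qn n i - q0 i)"
  by (rule sp.bO_telescope[where y = "\<lambda>n i. qn n i", OF step(4)])

lemma near_q0:
  fixes g :: "'a \<Rightarrow> 'b::real_normed_vector"
  assumes "smooth_on Q g"
  shows "sp.bO 0 (\<lambda>i. g (q0 i))" "sp.bO 1 (\<lambda>i. y i - q0 i) \<Longrightarrow> sp.bO 1 (\<lambda>i. g (y i) - g (q0 i))"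
proof -
  show "sp.bO 0 (\<lambda>i. g (q0 i))"
    using sp.bO_continuous[OF K_compact _ qK, of g] smooth_on_continuous[OF assms] K_Q continuous_on_subset by blast
  show "sp.bO 1 (\<lambda>i. g (y i) - g (q0 i))" if "sp.bO 1 (\<lambda>i. y i - q0 i)"
    using sp.bO_lipschitz(1)[OF assms open_Q K_compact K_Q qK, of 0 y] that by simp
qed

lemma bO_rot0:
  assumes "sp.bO k y" shows "sp.bO k (\<lambda>i. rot (J (q0 i)) \<phi> (y i))"
proof -
  have "sp.bO (0 + k) (\<lambda>i. J (q0 i) (y i))" by (intro sp.bO_apply near_q0(1)[OF J_smooth] assms)
  then show ?thesis unfolding rot_def using assms by (intro sp.bO_diff sp.bO_cmult) simp_all
qed

lemma Jlin: "linear (blinfun_apply (J x))"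
  by (rule blinfun_linear)

text \<open>J at the n-th position differs from J at the initial one by O(h). For fixed n all
  rotations may therefore be taken with the initial J, and they compose to a single angle.\<close>

lemma wn_rot: "sp.bO 1 (\<lambda>i. wn n i - rot (J (q0 i)) (real n * \<theta>0) (w0 i))"
proof (induction n)
  case 0
  show ?case by (rule sp.bO_I[of _ 0]) (simp add: rot_0)
next
  case (Suc n)
  have "sp.bO (1 + 0) (\<lambda>i. (J (qn n i) - J (q0 i)) (wn n i))"
    by (intro sp.bO_apply near_q0(2)[OF J_smooth] qn_q0 step(5))
  then have 1: "sp.bO 1 (\<lambda>i. sin \<theta>0 *\<^sub>R (J (qn n i) - J (q0 i)) (wn n i))"
    by (intro sp.bO_cmult) simp
  have 2: "sp.bO 1 (\<lambda>i. rot (J (q0 i)) \<theta>0 (wn n i - rot (J (q0 i)) (real n * \<theta>0) (w0 i)))"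
    by (rule bO_rot0[OF Suc])
  from sp.bO_add[OF sp.bO_diff[OF step(1)[of n] 1] 2]
  show ?case
  proof (rule sp.bO_cong[rotated])
    show "\<forall>\<^sub>F i in flt. wn (Suc n) i - rot (J (qn n i)) \<theta>0 (wn n i) - sin \<theta>0 *\<^sub>R (J (qn n i) - J (q0 i)) (wn n i)
       + rot (J (q0 i)) \<theta>0 (wn n i - rot (J (q0 i)) (real n * \<theta>0) (w0 i)) = wn (Suc n) i - rot (J (q0 i)) (real (Suc n) * \<theta>0) (w0 i)"
      using q0_Q
    proof eventually_elim
      case (elim i)
      have "rot (J (q0 i)) \<theta>0 (rot (J (q0 i)) (real n * \<theta>0) (w0 i)) = rot (J (q0 i)) (real (Suc n) * \<theta>0) (w0 i)"
        using rot_rot[OF Jlin J_J[OF elim]] by (simp add: algebra_simps)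
      then show ?case
        unfolding rot_diff[OF Jlin] by (simp add: rot_def[of _ _ "wn n i"] blinfun.diff_left algebra_simps)
    qed
  qed
qed

text \<open>The acceleration of the integral curves of X_H.\<close>

definition Y where "Y x = total_deriv X x (X x)"

lemma qn_linear: "sp.bO 2 (\<lambda>i. qn n i - q0 i - (real n * fst i) *\<^sub>R X (q0 i))"
proof (induction n)
  case 0
  show ?case by (rule sp.bO_I[of _ 0]) simp
next
  case (Suc n)
  have m: "sp.bO 1 (\<lambda>i. (1/2) *\<^sub>R (qn n i + qn (Suc n) i) - q0 i)"
  proof -
    have "(1/2) *\<^sub>R (qn n i - q0 i) + (1/2) *\<^sub>R (qn (Suc n) i - q0 i) = (1/2) *\<^sub>R (qn n i + qn (Suc n) i) - q0 i" for i
      by (simp add: algebra_simps) (simp flip: scaleR_left_distrib)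
    then show ?thesis using sp.bO_add[OF sp.bO_cmult[OF qn_q0] sp.bO_cmult[OF qn_q0], of "1/2" n "1/2" "Suc n"] by simp
  qed
  have "sp.bO (Suc 1) (\<lambda>i. fst i *\<^sub>R (X ((1/2) *\<^sub>R (qn n i + qn (Suc n) i)) - X (q0 i)))"
    by (intro sp.bO_h_scale near_q0(2)[OF X_smooth] m)
  then have "sp.bO 2 (\<lambda>i. fst i *\<^sub>R (X ((1/2) *\<^sub>R (qn n i + qn (Suc n) i)) - X (q0 i)))"
    by (rule sp.bO_mono) simp
  from sp.bO_add[OF sp.bO_add[OF step(3)[of n] this] Suc]
  show ?case by (rule sp.bO_cong[rotated]) (intro always_eventually allI, simp add: algebra_simps)
qed

text \<open>The guiding centre: it follows \<open>X\<^sub>H\<close> with one order more of accuracy than \<open>q\<^sub>n\<close>.\<close>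

definition centre where "centre n i = qn n i + (fst i)\<^sup>2 *\<^sub>R J (qn n i) (wn n i)"

text \<open>The increments agree with the second-order Taylor polynomial of the flow of X_H at time
  n h. The midpoint of a step belongs to the time (n + 1/2) h, and n^2 / 2 + (n + 1/2) = (n + 1)^2 /
  2.\<close>

lemma centre_quadratic:
  "sp.bO 3 (\<lambda>i. centre n i - centre 0 i - (real n * fst i) *\<^sub>R X (q0 i) - ((real n)\<^sup>2 / 2 * (fst i)\<^sup>2) *\<^sub>R Y (q0 i))"
proof (induction n)
  case 0
  show ?case by (rule sp.bO_I[of _ 0]) simp
next
  case (Suc n)
  define m where "m i = (1/2) *\<^sub>R (qn n i + qn (Suc n) i)" for i
  have m2: "sp.bO 2 (\<lambda>i. m i - q0 i - ((real n + 1/2) * fst i) *\<^sub>R X (q0 i))"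
  proof -
    have "(1/2) *\<^sub>R (qn n i - q0 i - (real n * fst i) *\<^sub>R X (q0 i)) + (1/2) *\<^sub>R (qn (Suc n) i - q0 i - (real (Suc n) * fst i) *\<^sub>R X (q0 i))
        = m i - q0 i - ((real n + 1/2) * fst i) *\<^sub>R X (q0 i)" for i
      by (simp add: m_def algebra_simps) (simp flip: scaleR_left_distrib add: field_simps)
    then show ?thesis
      using sp.bO_add[OF sp.bO_cmult[OF qn_linear] sp.bO_cmult[OF qn_linear], of "1/2" n "1/2" "Suc n"] by simp
  qed
  have hX: "sp.bO 1 (\<lambda>i. ((real n + 1/2) * fst i) *\<^sub>R X (q0 i))"
    using sp.bO_cmult[OF sp.bO_h_scale[OF near_q0(1)[OF X_smooth]], of "real n + 1/2"] by simp
  have m1: "sp.bO 1 (\<lambda>i. m i - q0 i)"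
    using sp.bO_add[OF sp.bO_mono[OF m2, of 1] hX] by simp
  have "sp.bO (2 * Suc 0) (\<lambda>i. X (m i) - X (q0 i) - total_deriv X (q0 i) (m i - q0 i))"
    by (rule sp.bO_taylor[OF X_smooth open_Q K_compact K_Q qK]) (use m1 in simp)
  then have t: "sp.bO 2 (\<lambda>i. X (m i) - X (q0 i) - total_deriv X (q0 i) (m i - q0 i))" by (rule sp.bO_mono) simp
  have u: "sp.bO 2 (\<lambda>i. total_deriv X (q0 i) (m i - q0 i - ((real n + 1/2) * fst i) *\<^sub>R X (q0 i)))"
    by (rule sp.bO_mono[OF sp.bO_apply[OF near_q0(1)[OF smooth_on_total_deriv[OF open_Q X_smooth]] m2]]) simp
  have "sp.bO 3 (\<lambda>i. fst i *\<^sub>R ((X (m i) - X (q0 i) - total_deriv X (q0 i) (m i - q0 i))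
      + total_deriv X (q0 i) (m i - q0 i - ((real n + 1/2) * fst i) *\<^sub>R X (q0 i))))"
    by (rule sp.bO_mono[OF sp.bO_h_scale[OF sp.bO_add[OF t u]]]) simp
  from sp.bO_add[OF sp.bO_add[OF step(2)[of n] this] Suc]
  show ?case
  proof (rule sp.bO_cong[rotated], intro always_eventually allI)
    fix i :: "real \<times> ('a \<times> 'a) \<times> real"
    have "fst i *\<^sub>R ((X (m i) - X (q0 i) - total_deriv X (q0 i) (m i - q0 i))
      + total_deriv X (q0 i) (m i - q0 i - ((real n + 1/2) * fst i) *\<^sub>R X (q0 i)))
      = fst i *\<^sub>R X (m i) - fst i *\<^sub>R X (q0 i) - ((real n + 1/2) * (fst i)\<^sup>2) *\<^sub>R Y (q0 i)"
      by (simp add: blinfun.diff_right blinfun.add_right blinfun.scaleR_right Y_def algebra_simps power2_eq_square)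
    moreover have "((real (Suc n))\<^sup>2 / 2 * (fst i)\<^sup>2) *\<^sub>R Y (q0 i)
        = ((real n)\<^sup>2 / 2 * (fst i)\<^sup>2) *\<^sub>R Y (q0 i) + ((real n + 1/2) * (fst i)\<^sup>2) *\<^sub>R Y (q0 i)"
      unfolding scaleR_left_distrib[symmetric] by (simp add: field_simps power2_eq_square)
    ultimately show "qn (Suc n) i + (fst i)\<^sup>2 *\<^sub>R J (qn (Suc n) i) (wn (Suc n) i) - (qn n i + (fst i)\<^sup>2 *\<^sub>R J (qn n i) (wn n i))
      - fst i *\<^sub>R X ((1/2) *\<^sub>R (qn n i + qn (Suc n) i)) +
      fst i *\<^sub>R ((X (m i) - X (q0 i) - total_deriv X (q0 i) (m i - q0 i)) + total_deriv X (q0 i) (m i - q0 i - ((real n + 1/2) * fst i) *\<^sub>R X (q0 i))) +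
      (centre n i - centre 0 i - (real n * fst i) *\<^sub>R X (q0 i) - ((real n)\<^sup>2 / 2 * (fst i)\<^sup>2) *\<^sub>R Y (q0 i)) =
      centre (Suc n) i - centre 0 i - (real (Suc n) * fst i) *\<^sub>R X (q0 i) - ((real (Suc n))\<^sup>2 / 2 * (fst i)\<^sup>2) *\<^sub>R Y (q0 i)"
      by (simp add: centre_def m_def[symmetric] distrib_right scaleR_left_distrib)
  qed
qed

text \<open>An explicit approximation of the orbit. \<open>orbit_trig_polynomial\<close> reaches
  every order but yields no coefficients, while the leading term of the action needs the coefficient
  of the rotating part.\<close>

definition Fx where
  "Fx i s \<phi> = centre 0 i + (s * fst i) *\<^sub>R X (q0 i) + (s\<^sup>2 / 2 * (fst i)\<^sup>2) *\<^sub>R Y (q0 i)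
     - (fst i)\<^sup>2 *\<^sub>R J (q0 i) (rot (J (q0 i)) \<phi> (w0 i))"

lemma qn_Fx: "sp.bO 3 (\<lambda>i. qn n i - Fx i (real n) (real n * \<theta>0))"
proof -
  have 1: "sp.bO (2 + (1 + 0)) (\<lambda>i. (fst i)\<^sup>2 *\<^sub>R ((J (qn n i) - J (q0 i)) (wn n i)))"
    by (intro sp.bO_h_power_scale sp.bO_apply near_q0(2)[OF J_smooth] qn_q0 step(5))
  have 2: "sp.bO (2 + (0 + 1)) (\<lambda>i. (fst i)\<^sup>2 *\<^sub>R (J (q0 i) (wn n i - rot (J (q0 i)) (real n * \<theta>0) (w0 i))))"
    by (intro sp.bO_h_power_scale sp.bO_apply near_q0(1)[OF J_smooth] wn_rot)
  have 3: "sp.bO 3 (\<lambda>i. (fst i)\<^sup>2 *\<^sub>R ((J (qn n i) - J (q0 i)) (wn n i)) + (fst i)\<^sup>2 *\<^sub>R (J (q0 i) (wn n i - rot (J (q0 i)) (real n * \<theta>0) (w0 i))))"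
    by (intro sp.bO_add sp.bO_mono[OF 1] sp.bO_mono[OF 2]) simp_all
  from sp.bO_diff[OF centre_quadratic[of n] 3]
  show ?thesis
    by (rule sp.bO_cong[rotated]) (intro always_eventually allI,
      simp add: Fx_def centre_def[of n] blinfun.diff_left blinfun.diff_right algebra_simps)
qed

lemma vtp_Fx: "vtp 2 (Fx i)"
proof -
  have s2: "vtp 2 (\<lambda>s \<phi>. s *\<^sub>R s)" using vtp_mono[OF vtp_scaleR[OF vtp_s vtp_s], of 2] by simp
  have "vtp (Suc 0) (\<lambda>s \<phi>. rot (J (q0 i)) (\<phi> + 0) (w0 i))"
    by (rule vtp_rot(1)[OF vtp_const blinfun.bounded_linear_right])
  from vtp_mono[OF this, of 2] have r: "vtp 2 (\<lambda>s \<phi>. rot (J (q0 i)) \<phi> (w0 i))" by simp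
  have 1: "vtp 2 (\<lambda>s \<phi>. (s * fst i) *\<^sub>R X (q0 i))"
    using vtp_mono[OF vtp_linear[OF bounded_linear_scaleR_left[of "fst i *\<^sub>R X (q0 i)"] vtp_s], of 2] by simp
  have 2: "vtp 2 (\<lambda>s \<phi>. (s\<^sup>2 / 2 * (fst i)\<^sup>2) *\<^sub>R Y (q0 i))"
    using vtp_linear[OF bounded_linear_scaleR_left[of "((fst i)\<^sup>2 / 2) *\<^sub>R Y (q0 i)"] s2]
    by (simp add: power2_eq_square)
  have 3: "vtp 2 (\<lambda>s \<phi>. (fst i)\<^sup>2 *\<^sub>R J (q0 i) (rot (J (q0 i)) \<phi> (w0 i)))"
    by (intro vtp_scaleR_const vtp_linear[OF blinfun.bounded_linear_right r])
  show ?thesis unfolding Fx_def[abs_def]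
    by (rule vtp_diff[OF vtp_add[OF vtp_add[OF vtp_const 1] 2] 3])
qed

end

section \<open>The leading term of the action\<close>

lemma (in small_parameter) bO_Pair:
  assumes "bO n f" "bO n g" shows "bO n (\<lambda>i. (f i, g i))"
proof -
  have "bO n (\<lambda>i. (f i, 0) + (0, g i))"
    by (intro bO_add bO_linear[OF _ assms(1)] bO_linear[OF _ assms(2)] bounded_linear_Pair
        bounded_linear_ident bounded_linear_zero)
  then show ?thesis by simp
qed

context lorentz
begin

definition Ls where
  "Ls x p0 p1 = T x p1 + (1/2) *\<^sub>R B x (p1 - p0) - (\<kappa> / 2) *\<^sub>R G x (p1 - p0)"

lemma Ls_s2: "x \<in> Q \<Longrightarrow> total_deriv s2 (x, x, 0) (p0, p1, 0) = Ls x p0 p1"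
  by (simp add: smooth_on_total_deriv_apply[OF s_smooth(2) diag_\<Omega>S]
      frechet_derivative_at[OF s_diag(2), symmetric] Ls_def)

lemma G_rot:
  assumes x: "x \<in> Q" shows "G x (rot (J x) \<phi> u) \<bullet> rot (J x) \<phi> u = G x u \<bullet> u"
proof -
  have 1: "G x u \<bullet> J x u = 0"
    using B_antisym[OF x, of u u] G_sym[OF x, of u "J x u"] by (simp add: B_G[OF x, symmetric])
  have 2: "G x (J x u) \<bullet> u = 0" using 1 G_sym[OF x, of u "J x u"] by simp
  have "G x (rot (J x) \<phi> u) \<bullet> rot (J x) \<phi> u = (cos \<phi>)\<^sup>2 * (G x u \<bullet> u) + (sin \<phi>)\<^sup>2 * (G x (J x u) \<bullet> J x u)"
    by (simp add: rot_def blinfun.diff_right blinfun.scaleR_right inner_diff_left inner_diff_right 1 2 power2_eq_square algebra_simps)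
  also have "\<dots> = ((cos \<phi>)\<^sup>2 + (sin \<phi>)\<^sup>2) * (G x u \<bullet> u)"
    unfolding G_J[OF x] by (rule distrib_right[symmetric])
  finally show ?thesis by (simp only: sin_cos_squared_add2 mult_1)
qed

text \<open>The symmetric part of the second-order coefficients contributes an exact derivative; only the
  mixed term survives the average over the circle.\<close>

lemma action_density:
  fixes x w :: 'a
  assumes x: "x \<in> Q"
  defines "l \<equiv> \<lambda>t. - J x (rot (J x) t w)"
  shows "((\<lambda>t. Ls x (l t - l 0) (l (t + \<theta>0) - l \<theta>0) \<bullet> (- rot (J x) (t + \<theta>0) w)) has_integral - pi * (G x w \<bullet> w)) {0..2*pi}"
proof -
  have JJ: "J x (J x u) = - u" for u by (rule J_J[OF x])
  define l1 where "l1 t = l (t + \<theta>0)" for t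
  define l1' where "l1' t = - rot (J x) (t + \<theta>0) w" for t
  have dl: "(l1 has_vector_derivative l1' t) (at t within S)" for t S
  proof -
    have "((\<lambda>t. - J x (rot (J x) (t + \<theta>0) w)) has_vector_derivative - J x (- J x (rot (J x) (t + \<theta>0) w))) (at t within S)"
      by (intro has_vector_derivative_minus bounded_linear.has_vector_derivative[OF blinfun.bounded_linear_right]
          rot_has_vector_derivative[OF blinfun.bounded_linear_right JJ])
    then show ?thesis by (simp add: l1_def[abs_def] l_def l1'_def blinfun.minus_right JJ)
  qed
  \<comment> \<open>\<open>Ls\<close> is split by its arguments. Half of \<open>B\<close> replaces
    \<open>T\<close> by its symmetric part, so \<open>A2\<close> is symmetric and its contribution
    along the loop is the derivative of a quadratic form.\<close>
  define A1 where "A1 p = (1/2) *\<^sub>R (\<kappa> *\<^sub>R G x p - B x p)" for p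
  define A2 where "A2 p = T x p + (1/2) *\<^sub>R B x p - (\<kappa> / 2) *\<^sub>R G x p" for p
  have A2_linear: "bounded_linear A2"
    unfolding A2_def[abs_def]
    by (intro bounded_linear_add bounded_linear_sub bounded_linear_const_scaleR blinfun.bounded_linear_right)
  have A2_sym: "A2 p \<bullet> r = A2 r \<bullet> p" for p r
    using B_T[OF x, of p r] B_T[OF x, of r p] G_sym[OF x, of p r]
    by (simp add: A2_def inner_diff_left inner_add_left field_simps)
  have Ls: "Ls x (p0 - a) (p1 - b) = A1 p0 + A2 p1 - (A1 a + A2 b)" for p0 p1 a b
    by (simp add: Ls_def A1_def A2_def blinfun.diff_right blinfun.add_right algebra_simps)
  \<comment> \<open>The factor cos \<theta>0 - \<kappa> sin \<theta>0 = -1 makes this pairing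
    independent of t; over the full circle it yields - pi (G w . w).\<close>
  have A1: "A1 (l t) \<bullet> l1' t = - (1/2) * (G x w \<bullet> w)" for t
  proof -
    define r where "r = rot (J x) t w"
    have rr: "rot (J x) (t + \<theta>0) w = cos \<theta>0 *\<^sub>R r - sin \<theta>0 *\<^sub>R J x r"
      using rot_rot[OF blinfun_linear JJ, of \<theta>0 t w] by (simp add: r_def rot_def[of _ \<theta>0] add.commute)
    have Gr: "G x r \<bullet> r = G x w \<bullet> w" unfolding r_def by (rule G_rot[OF x])
    have g1: "G x r \<bullet> J x r = 0"
      using B_antisym[OF x, of r r] G_sym[OF x, of r "J x r"] by (simp add: B_G[OF x, symmetric])
    have g2: "G x (J x r) \<bullet> r = 0" using g1 G_sym[OF x, of r "J x r"] by simp
    have BJ: "B x (J x r) = - G x r" by (simp add: B_G[OF x] JJ blinfun.minus_right)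
    have "A1 (l t) \<bullet> l1' t = (1/2) * (cos \<theta>0 - \<kappa> * sin \<theta>0) * (G x w \<bullet> w)"
      unfolding A1_def l_def l1'_def r_def[symmetric] rr
      by (simp add: blinfun.minus_right BJ inner_diff_left inner_diff_right inner_add_left g1 g2 G_J[OF x] Gr algebra_simps)
    also have "cos \<theta>0 - \<kappa> * sin \<theta>0 = -1" using \<kappa>_trig(3) by simp
    finally show ?thesis by simp
  qed
  define v0 where "v0 = A1 (l 0) + A2 (l \<theta>0)"
  define \<Phi> where "\<Phi> t = (1/2) * (A2 (l1 t) \<bullet> l1 t) - v0 \<bullet> l1 t - t * ((1/2) * (G x w \<bullet> w))" for t
  have "((\<lambda>t. A2 (l1 t) \<bullet> l1' t - v0 \<bullet> l1' t - (1/2) * (G x w \<bullet> w)) has_integral (\<Phi> (2*pi) - \<Phi> 0)) {0..2*pi}"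
  proof (rule fundamental_theorem_of_calculus)
    fix t
    have "((\<lambda>t. A2 (l1 t) \<bullet> l1 t) has_vector_derivative (A2 (l1 t) \<bullet> l1' t + A2 (l1' t) \<bullet> l1 t)) (at t within {0..2*pi})"
      by (rule bounded_bilinear.has_vector_derivative[OF bounded_bilinear_inner
          bounded_linear.has_vector_derivative[OF A2_linear dl] dl])
    moreover have "((\<lambda>t. v0 \<bullet> l1 t) has_vector_derivative v0 \<bullet> l1' t) (at t within {0..2*pi})"
      by (rule bounded_linear.has_vector_derivative[OF bounded_linear_inner_right dl])
    moreover have "((\<lambda>t. t * ((1/2) * (G x w \<bullet> w))) has_vector_derivative (1/2) * (G x w \<bullet> w)) (at t within {0..2*pi})"
      by (auto intro!: derivative_eq_intros simp: has_real_derivative_iff_has_vector_derivative[symmetric])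
    ultimately have "(\<Phi> has_vector_derivative (1/2) * (A2 (l1 t) \<bullet> l1' t + A2 (l1' t) \<bullet> l1 t) - v0 \<bullet> l1' t - (1/2) * (G x w \<bullet> w)) (at t within {0..2*pi})"
      unfolding \<Phi>_def[abs_def]
      by (intro has_vector_derivative_diff has_vector_derivative_mult_right)
    then show "(\<Phi> has_vector_derivative A2 (l1 t) \<bullet> l1' t - v0 \<bullet> l1' t - (1/2) * (G x w \<bullet> w)) (at t within {0..2*pi})"
      using A2_sym[of "l1' t" "l1 t"] by simp
  qed simp
  moreover have "l1 (2*pi) = l1 0"
    by (simp add: l1_def l_def rot_def cos_add sin_add)
  then have "\<Phi> (2*pi) - \<Phi> 0 = - pi * (G x w \<bullet> w)" by (simp add: \<Phi>_def)
  moreover have "Ls x (l t - l 0) (l (t + \<theta>0) - l \<theta>0) \<bullet> (- rot (J x) (t + \<theta>0) w)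
     = A2 (l1 t) \<bullet> l1' t - v0 \<bullet> l1' t - (1/2) * (G x w \<bullet> w)" for t
    using A1[of t] unfolding Ls l1'_def[symmetric] v0_def l1_def by (simp add: inner_diff_left inner_add_left)
  ultimately show ?thesis by simp
qed

end

context lorentz_map
begin

abbreviation av where "av c L k h z \<equiv> avg c L (qs h z) k"

abbreviation ava where
  "ava c L k \<tau> i \<equiv> av c L k (fst i) (fst (snd i)) (\<tau> i)"

definition lq where "lq i \<phi> = - J (q0 i) (rot (J (q0 i)) \<phi> (w0 i))"

context
  fixes D L and c c' :: "nat \<Rightarrow> real \<Rightarrow> real"
  assumes win: "window \<theta>0 D L c c'" and D2: "2 \<le> D"
begin

lemma vtp_FxD: "vtp D (Fx i)"
  by (rule vtp_mono[OF vtp_Fx D2])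

lemma window_coefficients:
  assumes "\<forall>\<^sub>F i in flt. \<tau> i \<in> {0..2*pi}" "m \<le> L"
  shows "sp.bO 0 (\<lambda>i. c m (\<tau> i))" "sp.bO 0 (\<lambda>i. c' m (\<tau> i))"
proof -
  obtain M where M: "\<And>m t. m \<le> L \<Longrightarrow> t \<in> {0..2*pi} \<Longrightarrow> \<bar>c m t\<bar> \<le> M \<and> \<bar>c' m t\<bar> \<le> M"
    using window_bounded[OF win] by metis
  show "sp.bO 0 (\<lambda>i. c m (\<tau> i))" "sp.bO 0 (\<lambda>i. c' m (\<tau> i))"
    by (rule sp.bO_I[of _ M], use assms M in \<open>auto elim!: eventually_mono\<close>)+
qed

text \<open>The window reproduces \<open>Fx\<close> exactly, its degree 2 being at most D, and each
  orbit point differs from \<open>Fx\<close> by O(h^3).\<close>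

lemma av_Fx:
  assumes "\<forall>\<^sub>F i in flt. \<tau> i \<in> {0..2*pi}"
  shows "sp.bO 3 (\<lambda>i. ava c L k \<tau> i - Fx i (real k) (\<tau> i + real k * \<theta>0))"
proof -
  have "sp.bO (0 + 3) (\<lambda>i. \<Sum>m\<le>L. c m (\<tau> i) *\<^sub>R (qn (k + m) i - Fx i (real (k + m)) (real (k + m) * \<theta>0)))"
    by (intro sp.bO_sum sp.bO_bilinear[OF bounded_bilinear_scaleR] window_coefficients(1) assms qn_Fx) simp
  moreover have "(\<Sum>m\<le>L. c m (\<tau> i) *\<^sub>R (qn (k + m) i - Fx i (real (k + m)) (real (k + m) * \<theta>0)))
      = ava c L k \<tau> i - Fx i (real k) (\<tau> i + real k * \<theta>0)" for i
    unfolding window_shift[OF win vtp_FxD] avg_def by (simp add: scaleR_diff_right sum_subtractf)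
  ultimately show ?thesis by simp
qed

text \<open>Closeness of two curves says nothing about their derivatives in general. Here the
  derivative is again a bounded combination of the same points, with weights c', and differentiating
  the window identity of \<open>Fx\<close> in t gives the value of this combination on
  \<open>Fx\<close>.\<close>

lemma av'_Fx:
  assumes "\<forall>\<^sub>F i in flt. \<tau> i \<in> {0..2*pi}"
  shows "sp.bO 3 (\<lambda>i. ava c' L k \<tau> i - (fst i)\<^sup>2 *\<^sub>R (- rot (J (q0 i)) (\<tau> i + real k * \<theta>0) (w0 i)))"
proof -
  have "sp.bO (0 + 3) (\<lambda>i. \<Sum>m\<le>L. c' m (\<tau> i) *\<^sub>R (qn (k + m) i - Fx i (real (k + m)) (real (k + m) * \<theta>0)))"
    by (intro sp.bO_sum sp.bO_bilinear[OF bounded_bilinear_scaleR] window_coefficients(2) assms qn_Fx) simp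
  then have "sp.bO 3 (\<lambda>i. \<Sum>m\<le>L. c' m (\<tau> i) *\<^sub>R (qn (k + m) i - Fx i (real (k + m)) (real (k + m) * \<theta>0)))" by simp
  then show ?thesis
  proof (rule sp.bO_cong[rotated])
    show "\<forall>\<^sub>F i in flt. (\<Sum>m\<le>L. c' m (\<tau> i) *\<^sub>R (qn (k + m) i - Fx i (real (k + m)) (real (k + m) * \<theta>0)))
        = ava c' L k \<tau> i - (fst i)\<^sup>2 *\<^sub>R (- rot (J (q0 i)) (\<tau> i + real k * \<theta>0) (w0 i))"
      using q0_Q
    proof eventually_elim
      case (elim i)
      let ?x = "q0 i"
      have JJ: "J ?x (J ?x u) = - u" for u by (rule J_J[OF elim])
      have cm: "((\<lambda>t. c m t *\<^sub>R u) has_vector_derivative c' m t *\<^sub>R u) (at t)" for m t and u :: 'a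
      proof -
        have "(c m has_real_derivative c' m t) (at t)" using win unfolding window_def by blast
        then show ?thesis by (auto intro!: derivative_eq_intros simp: has_real_derivative_iff_has_vector_derivative)
      qed
      have "((\<lambda>t. \<Sum>m\<le>L. c m t *\<^sub>R Fx i (real (k + m)) (real (k + m) * \<theta>0)) has_vector_derivative
          (\<Sum>m\<le>L. c' m (\<tau> i) *\<^sub>R Fx i (real (k + m)) (real (k + m) * \<theta>0))) (at (\<tau> i))"
        by (intro has_vector_derivative_sum cm)
      then have 1: "((\<lambda>t. Fx i (real k) (t + real k * \<theta>0)) has_vector_derivative
          (\<Sum>m\<le>L. c' m (\<tau> i) *\<^sub>R Fx i (real (k + m)) (real (k + m) * \<theta>0))) (at (\<tau> i))"
        unfolding window_shift[OF win vtp_FxD] .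
      have "((\<lambda>t. (fst i)\<^sup>2 *\<^sub>R J ?x (rot (J ?x) (t + real k * \<theta>0) (w0 i))) has_vector_derivative
          (fst i)\<^sup>2 *\<^sub>R J ?x (- J ?x (rot (J ?x) (\<tau> i + real k * \<theta>0) (w0 i)))) (at (\<tau> i))"
        by (intro bounded_linear.has_vector_derivative[OF bounded_linear_scaleR_right]
            bounded_linear.has_vector_derivative[OF blinfun.bounded_linear_right]
            rot_has_vector_derivative[OF blinfun.bounded_linear_right JJ])
      then have 2: "((\<lambda>t. Fx i (real k) (t + real k * \<theta>0)) has_vector_derivative
          (0 - (fst i)\<^sup>2 *\<^sub>R J ?x (- J ?x (rot (J ?x) (\<tau> i + real k * \<theta>0) (w0 i))))) (at (\<tau> i))"
        unfolding Fx_def by (intro has_vector_derivative_diff has_vector_derivative_const)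
      have "(\<Sum>m\<le>L. c' m (\<tau> i) *\<^sub>R Fx i (real (k + m)) (real (k + m) * \<theta>0))
          = (fst i)\<^sup>2 *\<^sub>R (- rot (J ?x) (\<tau> i + real k * \<theta>0) (w0 i))"
        using vector_derivative_unique_at[OF 1 2] by (simp add: blinfun.minus_right JJ)
      then show ?case unfolding avg_def by (simp add: scaleR_diff_right sum_subtractf)
    qed
  qed
qed

text \<open>Only the rotating term depends on the phase. Moving along the loop thus changes
  positions by O(h^2), although its points are in general O(h) away from q 0.\<close>

lemma Fx_diff: "Fx i s \<phi> - Fx i s \<psi> = (fst i)\<^sup>2 *\<^sub>R (lq i \<phi> - lq i \<psi>)"
  by (simp add: Fx_def lq_def algebra_simps)

lemma bO_rot_var:
  assumes "sp.bO k y" shows "sp.bO k (\<lambda>i. rot (J (q0 i)) (\<phi> i) (y i))"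
proof -
  have "sp.bO (0 + k) (\<lambda>i. J (q0 i) (y i))" by (intro sp.bO_apply near_q0(1)[OF J_smooth] assms)
  then have J: "sp.bO k (\<lambda>i. J (q0 i) (y i))" by simp
  have "sp.bO 0 (\<lambda>i. cos (\<phi> i))" "sp.bO 0 (\<lambda>i. sin (\<phi> i))" by (rule sp.bO_I[of _ 1], simp)+
  then have "sp.bO (0 + k) (\<lambda>i. cos (\<phi> i) *\<^sub>R y i)" "sp.bO (0 + k) (\<lambda>i. sin (\<phi> i) *\<^sub>R J (q0 i) (y i))"
    by (intro sp.bO_bilinear[OF bounded_bilinear_scaleR] assms J; simp)+
  then show ?thesis unfolding rot_def using sp.bO_diff by fastforce
qed

lemma lq_bound: "sp.bO 0 (\<lambda>i. lq i (\<phi> i))"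
proof -
  have "sp.bO (0 + 0) (\<lambda>i. J (q0 i) (rot (J (q0 i)) (\<phi> i) (w0 i)))"
    by (intro sp.bO_apply near_q0(1)[OF J_smooth] bO_rot_var step(5))
  then show ?thesis unfolding lq_def by (intro sp.bO_minus) simp
qed

lemma tt_range: "\<forall>\<^sub>F i in flt. snd (snd i) \<in> {0..2*pi}" "\<forall>\<^sub>F i in flt. (0::real) \<in> {0..2*pi}"
  unfolding eventually_flt by (auto intro: exI[of _ 1])

lemma av_near:
  assumes "\<forall>\<^sub>F i in flt. \<tau> i \<in> {0..2*pi}"
  shows "sp.bO 1 (\<lambda>i. ava c L k \<tau> i - q0 i)"
proof -
  let ?\<phi> = "\<lambda>i. \<tau> i + real k * \<theta>0"
  have a: "sp.bO 1 (\<lambda>i. (fst i)\<^sup>2 *\<^sub>R J (q0 i) (w0 i))"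
  proof (rule sp.bO_mono)
    show "sp.bO (2 + (0 + 0)) (\<lambda>i. (fst i)\<^sup>2 *\<^sub>R J (q0 i) (w0 i))"
      by (intro sp.bO_h_power_scale sp.bO_apply near_q0(1)[OF J_smooth] step(5))
  qed simp
  have b: "sp.bO 1 (\<lambda>i. (real k * fst i) *\<^sub>R X (q0 i))"
    using sp.bO_cmult[OF sp.bO_h_scale[OF near_q0(1)[OF X_smooth]], of "real k"] by simp
  have Ys: "smooth_on Q Y"
    unfolding Y_def[abs_def] by (intro smooth_on_blinfun_apply open_Q smooth_on_total_deriv X_smooth)
  have e: "sp.bO 1 (\<lambda>i. ((real k)\<^sup>2 / 2) *\<^sub>R ((fst i)\<^sup>2 *\<^sub>R Y (q0 i)))"
    by (intro sp.bO_cmult sp.bO_mono[OF sp.bO_h_power_scale[OF near_q0(1)[OF Ys], of 2]]) simp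
  have g: "sp.bO 1 (\<lambda>i. (fst i)\<^sup>2 *\<^sub>R lq i (?\<phi> i))"
    by (rule sp.bO_mono[OF sp.bO_h_power_scale[OF lq_bound, of 2]]) simp
  from sp.bO_add[OF sp.bO_mono[OF av_Fx[OF assms, of k], of 1] sp.bO_add[OF sp.bO_add[OF a b] sp.bO_add[OF e g]]]
  have "sp.bO 1 (\<lambda>i. ava c L k \<tau> i - Fx i (real k) (?\<phi> i) + ((fst i)\<^sup>2 *\<^sub>R J (q0 i) (w0 i) + (real k * fst i) *\<^sub>R X (q0 i)
     + (((real k)\<^sup>2 / 2) *\<^sub>R ((fst i)\<^sup>2 *\<^sub>R Y (q0 i)) + (fst i)\<^sup>2 *\<^sub>R lq i (?\<phi> i))))" by simp
  then show ?thesis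
    by (rule sp.bO_cong[rotated]) (intro always_eventually allI, simp add: Fx_def centre_def lq_def)
qed

definition dens where
  "dens i = Ls (q0 i) (lq i (snd (snd i)) - lq i 0) (lq i (snd (snd i) + \<theta>0) - lq i \<theta>0)
     \<bullet> (- rot (J (q0 i)) (snd (snd i) + \<theta>0) (w0 i))"

text \<open>The integrand of the action minus its density of order h^4. Subtracting the value of
  \<open>s2\<close> at t = 0 makes the first factor O(h^2). The integral is not affected, because a
  constant covector integrates to 0 along a closed loop.\<close>

definition err where
  "err i = s2 (ava c L 0 (\<lambda>i. snd (snd i)) i, ava c L 1 (\<lambda>i. snd (snd i)) i, fst i) \<bullet> ava c' L 1 (\<lambda>i. snd (snd i)) i
    - s2 (ava c L 0 (\<lambda>i. 0) i, ava c L 1 (\<lambda>i. 0) i, fst i) \<bullet> ava c' L 1 (\<lambda>i. snd (snd i)) i - (fst i) ^ 4 * dens i"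

lemma base_K: "compact ((\<lambda>x. (x, x, 0::real)) ` K)" "(\<lambda>x. (x, x, 0::real)) ` K \<subseteq> \<Omega>S"
  using K_Q diag_\<Omega>S by (auto intro!: compact_continuous_image continuous_intros K_compact)

text \<open>Relative to t = 0, \<open>s2\<close> changes by h^2 times its linearisation at the
  diagonal plus O(h^3), by \<open>bO_two_point\<close>. The velocity of the loop is h^2 times a
  rotated w plus O(h^3). The product is h^4 times the density plus O(h^5).\<close>

lemma err_bound: "sp.bO 5 err" and av_\<Omega>S: "\<forall>\<^sub>F i in flt. (ava c L 0 (\<lambda>i. snd (snd i)) i, ava c L 1 (\<lambda>i. snd (snd i)) i, fst i) \<in> \<Omega>S"
proof -
  let ?t = "\<lambda>i :: real \<times> ('a \<times> 'a) \<times> real. snd (snd i)" and ?o = "\<lambda>i :: real \<times> ('a \<times> 'a) \<times> real. 0 :: real"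
  define y where "y \<tau> i = (ava c L 0 \<tau> i, ava c L 1 \<tau> i, fst i)" for \<tau> and i :: "real \<times> ('a \<times> 'a) \<times> real"
  define b where "b i = (q0 i, q0 i, 0 :: real)" for i
  define \<Delta> where "\<Delta> k i = ava c L k ?t i - ava c L k ?o i" for k and i :: "real \<times> ('a \<times> 'a) \<times> real"
  define \<delta> where "\<delta> k i = lq i (snd (snd i) + real k * \<theta>0) - lq i (real k * \<theta>0)" for k i
  have bK: "\<forall>\<^sub>F i in flt. b i \<in> (\<lambda>x. (x, x, 0::real)) ` K" using qK[of 0] by (auto simp: b_def elim: eventually_mono)
  have yb: "sp.bO 1 (\<lambda>i. y \<tau> i - b i)" if "\<forall>\<^sub>F i in flt. \<tau> i \<in> {0..2*pi}" for \<tau>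
    unfolding y_def b_def diff_Pair by (intro sp.bO_Pair av_near that) (use sp.bO_h in simp)
  have \<Delta>3: "sp.bO 3 (\<lambda>i. \<Delta> k i - (fst i)\<^sup>2 *\<^sub>R \<delta> k i)" for k
  proof -
    have eq: "(fst i)\<^sup>2 *\<^sub>R \<delta> k i = Fx i (real k) (snd (snd i) + real k * \<theta>0) - Fx i (real k) (0 + real k * \<theta>0)" for i
      unfolding \<delta>_def Fx_diff by simp
    from sp.bO_diff[OF av_Fx[OF tt_range(1), of k] av_Fx[OF tt_range(2), of k]]
    show ?thesis unfolding eq
      by (rule sp.bO_cong[rotated]) (intro always_eventually allI, simp add: \<Delta>_def)
  qed
  have \<delta>0: "sp.bO 0 (\<delta> k)" for k unfolding \<delta>_def[abs_def] by (intro sp.bO_diff lq_bound)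
  have \<Delta>2: "sp.bO 2 (\<Delta> k)" for k
  proof -
    have "sp.bO 2 (\<lambda>i. (fst i)\<^sup>2 *\<^sub>R \<delta> k i)" by (rule sp.bO_mono[OF sp.bO_h_power_scale[OF \<delta>0, of 2]]) simp
    from sp.bO_add[OF sp.bO_mono[OF \<Delta>3[of k], of 2] this] show ?thesis by simp
  qed
  have yy: "y ?t i - y ?o i = (\<Delta> 0 i, \<Delta> 1 i, 0)" for i by (simp add: y_def \<Delta>_def)
  have "sp.bO 2 (\<lambda>i. y ?t i - y ?o i)"
    unfolding yy by (intro sp.bO_Pair \<Delta>2) (rule sp.bO_I[of _ 0], simp)
  from sp.bO_two_point[OF s_smooth(2) open_\<Omega>S base_K bK yb[OF tt_range(1)] yb[OF tt_range(2)] this]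
  have tp: "sp.bO 3 (\<lambda>i. s2 (y ?t i) - s2 (y ?o i) - total_deriv s2 (b i) (\<Delta> 0 i, \<Delta> 1 i, 0))"
    unfolding yy .
  have "sp.bO 0 (\<lambda>i. total_deriv s2 (b i))"
    by (rule sp.bO_continuous[OF base_K(1) _ bK])
      (rule continuous_on_subset[OF smooth_on_continuous[OF smooth_on_total_deriv[OF open_\<Omega>S s_smooth(2)]] base_K(2)])
  from sp.bO_apply[OF this sp.bO_Pair[OF \<Delta>3[of 0] sp.bO_Pair[OF \<Delta>3[of 1] sp.bO_I[of "\<lambda>_. 0::real" 0]]]]
  have j3: "sp.bO 3 (\<lambda>i. total_deriv s2 (b i) (\<Delta> 0 i - (fst i)\<^sup>2 *\<^sub>R \<delta> 0 i, \<Delta> 1 i - (fst i)\<^sup>2 *\<^sub>R \<delta> 1 i, 0))" by simp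
  have Ls0: "sp.bO 0 (\<lambda>i. total_deriv s2 (b i) (\<delta> 0 i, \<delta> 1 i, 0))"
    using sp.bO_apply[OF \<open>sp.bO 0 (\<lambda>i. total_deriv s2 (b i))\<close> sp.bO_Pair[OF \<delta>0[of 0] sp.bO_Pair[OF \<delta>0[of 1] sp.bO_I[of "\<lambda>_. 0::real" 0]]]] by simp
  define R where "R i = s2 (y ?t i) - s2 (y ?o i) - (fst i)\<^sup>2 *\<^sub>R total_deriv s2 (b i) (\<delta> 0 i, \<delta> 1 i, 0)" for i
  have R3: "sp.bO 3 R"
  proof -
    from sp.bO_add[OF tp j3] show ?thesis
    proof (rule sp.bO_cong[rotated], intro always_eventually allI)
      fix i
      have "total_deriv s2 (b i) (\<Delta> 0 i, \<Delta> 1 i, 0) = total_deriv s2 (b i) (\<Delta> 0 i - (fst i)\<^sup>2 *\<^sub>R \<delta> 0 i, \<Delta> 1 i - (fst i)\<^sup>2 *\<^sub>R \<delta> 1 i, 0)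
          + (fst i)\<^sup>2 *\<^sub>R total_deriv s2 (b i) (\<delta> 0 i, \<delta> 1 i, 0)"
        by (simp add: blinfun.add_right[symmetric] blinfun.scaleR_right[symmetric])
      then show "s2 (y ?t i) - s2 (y ?o i) - total_deriv s2 (b i) (\<Delta> 0 i, \<Delta> 1 i, 0)
          + total_deriv s2 (b i) (\<Delta> 0 i - (fst i)\<^sup>2 *\<^sub>R \<delta> 0 i, \<Delta> 1 i - (fst i)\<^sup>2 *\<^sub>R \<delta> 1 i, 0) = R i"
        by (simp add: R_def)
    qed
  qed
  define \<rho> where "\<rho> i = - rot (J (q0 i)) (snd (snd i) + \<theta>0) (w0 i)" for i
  define R' where "R' i = ava c' L 1 ?t i - (fst i)\<^sup>2 *\<^sub>R \<rho> i" for i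
  have R'3: "sp.bO 3 R'" using av'_Fx[OF tt_range(1), of 1] by (simp add: R'_def[abs_def] \<rho>_def)
  have \<rho>0: "sp.bO 0 \<rho>" unfolding \<rho>_def[abs_def] by (intro sp.bO_minus bO_rot_var step(5))
  have a2: "sp.bO 2 (\<lambda>i. ava c' L 1 ?t i)"
  proof -
    have "sp.bO 2 (\<lambda>i. (fst i)\<^sup>2 *\<^sub>R \<rho> i)" by (rule sp.bO_mono[OF sp.bO_h_power_scale[OF \<rho>0, of 2]]) simp
    from sp.bO_add[OF sp.bO_mono[OF R'3, of 2] this] show ?thesis by (simp add: R'_def)
  qed
  have e1: "sp.bO 5 (\<lambda>i. (fst i)\<^sup>2 *\<^sub>R (total_deriv s2 (b i) (\<delta> 0 i, \<delta> 1 i, 0) \<bullet> R' i))"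
    by (rule sp.bO_mono[OF sp.bO_h_power_scale[OF sp.bO_bilinear[OF bounded_bilinear_inner Ls0 R'3], of 2]]) simp
  have e2: "sp.bO 5 (\<lambda>i. R i \<bullet> ava c' L 1 ?t i)"
    by (rule sp.bO_mono[OF sp.bO_bilinear[OF bounded_bilinear_inner R3 a2]]) simp
  from sp.bO_add[OF e1 e2]
  show "sp.bO 5 err"
  proof (rule sp.bO_cong[rotated])
    show "\<forall>\<^sub>F i in flt. (fst i)\<^sup>2 *\<^sub>R (total_deriv s2 (b i) (\<delta> 0 i, \<delta> 1 i, 0) \<bullet> R' i) + R i \<bullet> ava c' L 1 ?t i = err i"
      using q0_Q
    proof eventually_elim
      case (elim i)
      have "dens i = total_deriv s2 (b i) (\<delta> 0 i, \<delta> 1 i, 0) \<bullet> \<rho> i"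
        by (simp add: dens_def Ls_s2[OF elim] b_def \<delta>_def \<rho>_def)
      then show ?case
        by (simp add: err_def y_def R_def R'_def inner_diff_left inner_diff_right algebra_simps)
    qed
  qed
  show "\<forall>\<^sub>F i in flt. (ava c L 0 ?t i, ava c L 1 ?t i, fst i) \<in> \<Omega>S"
    using sp.bO_lipschitz(2)[OF s_smooth(2) open_\<Omega>S base_K bK, of 0 "y ?t"] yb[OF tt_range(1)] by (simp add: y_def)
qed

end


lemma action_leading:
  assumes win: "window \<theta>0 D L c c'" and D2: "2 \<le> D"
  shows "\<exists>M h0. M \<ge> 0 \<and> h0 > 0 \<and> (\<forall>h z. pos h z \<longrightarrow> h < h0 \<longrightarrow>
    \<bar>integral {0..2*pi} (\<lambda>t. s2 (av c L 0 h z t, av c L 1 h z t, h) \<bullet> av c' L 1 h z t)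
      + pi * h ^ 4 * (G (qs h z 0) (vs h z 0 - X (qs h z 0)) \<bullet> (vs h z 0 - X (qs h z 0)))\<bar> \<le> M * h ^ 5)"
proof -
  obtain M where M: "M \<ge> 0" "\<forall>\<^sub>F i in flt. norm (err L c c' i) \<le> M * fst i ^ 5"
    using err_bound[OF win D2] by (rule sp.bO_E)
  from eventually_conj[OF M(2) av_\<Omega>S[OF win D2]] obtain h0 where h0: "h0 > 0"
    "\<And>h z t. pos h z \<Longrightarrow> h < h0 \<Longrightarrow> t \<in> {0..2*pi} \<Longrightarrow> norm (err L c c' (h, z, t)) \<le> M * h ^ 5 \<and>
       (av c L 0 h z t, av c L 1 h z t, h) \<in> \<Omega>S"
    unfolding eventually_flt by auto
  show ?thesis
  proof (rule exI[of _ "M * (2 * pi)"], rule exI[of _ h0], intro conjI allI impI)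
    fix h z assume p: "pos h z" and h: "h < h0"
    define a where "a k t = av c L k h z t" for k t
    define a' where "a' t = av c' L 1 h z t" for t
    define w where "w = vs h z 0 - X (qs h z 0)"
    have xQ: "qs h z 0 \<in> Q" using qs_K[OF p] K_Q by blast
    have dom: "(a 0 t, a 1 t, h) \<in> \<Omega>S" if "t \<in> {0..2*pi}" for t using h0(2)[OF p h that] by (simp add: a_def)
    have ac: "continuous_on {0..2*pi} (\<lambda>t. a k t)" "continuous_on {0..2*pi} (\<lambda>t. a' t)" for k
      using avg_continuous[OF win] by (simp_all add: a_def[abs_def] a'_def[abs_def])
    have "continuous_on {0..2*pi} (\<lambda>t. s2 (a 0 t, a 1 t, h) \<bullet> a' t)"
      by (intro continuous_intros ac continuous_on_compose2[OF smooth_on_continuous[OF s_smooth(2)]])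
        (use dom in auto)
    then have 1: "((\<lambda>t. s2 (a 0 t, a 1 t, h) \<bullet> a' t) has_integral integral {0..2*pi} (\<lambda>t. s2 (a 0 t, a 1 t, h) \<bullet> a' t)) {0..2*pi}"
      by (intro integrable_integral integrable_continuous_real)
    have "((\<lambda>t. s2 (a 0 0, a 1 0, h) \<bullet> a' t) has_integral (s2 (a 0 0, a 1 0, h) \<bullet> a 1 (2*pi) - s2 (a 0 0, a 1 0, h) \<bullet> a 1 0)) {0..2*pi}"
      by (intro fundamental_theorem_of_calculus bounded_linear.has_vector_derivative[OF bounded_linear_inner_right])
        (use avg_has_vector_derivative[OF win] in \<open>auto simp: a_def[abs_def] a'_def\<close>)
    moreover have "a 1 (2*pi) = a 1 0"
    proof -
      have "c m (0 + 2 * pi) = c m 0" for m using win unfolding window_def by blast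
      then show ?thesis by (simp add: a_def avg_def)
    qed
    ultimately have 2: "((\<lambda>t. s2 (a 0 0, a 1 0, h) \<bullet> a' t) has_integral 0) {0..2*pi}" by simp
    have 3: "((\<lambda>t. dens (h, z, t)) has_integral - pi * (G (qs h z 0) w \<bullet> w)) {0..2*pi}"
      using action_density[OF xQ, of w] unfolding dens_def[OF win D2] lq_def wn_def w_def by simp
    have "((\<lambda>t. err L c c' (h, z, t)) has_integral
       (integral {0..2*pi} (\<lambda>t. s2 (a 0 t, a 1 t, h) \<bullet> a' t) - 0 - h ^ 4 * (- pi * (G (qs h z 0) w \<bullet> w)))) {0..2*pi}"
      using has_integral_diff[OF has_integral_diff[OF 1 2] has_integral_mult_right[OF 3, of "h ^ 4"]]
      by (simp add: err_def[OF win D2] a_def a'_def)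
    then have "norm (integral {0..2*pi} (\<lambda>t. s2 (a 0 t, a 1 t, h) \<bullet> a' t) - 0 - h ^ 4 * (- pi * (G (qs h z 0) w \<bullet> w)))
        \<le> (M * h ^ 5) * measure lborel {0..2*pi}"
    proof (rule has_integral_bound_real[OF _ finite.emptyI, rotated])
      show "norm (err L c c' (h, z, t)) \<le> M * h ^ 5" if "t \<in> {0..2*pi} - {}" for t
        using h0(2)[OF p h] that by simp
      show "0 \<le> M * h ^ 5" using M(1) p by (simp add: pos_def)
    qed
    then show "\<bar>integral {0..2*pi} (\<lambda>t. s2 (av c L 0 h z t, av c L 1 h z t, h) \<bullet> av c' L 1 h z t)
      + pi * h ^ 4 * (G (qs h z 0) (vs h z 0 - X (qs h z 0)) \<bullet> (vs h z 0 - X (qs h z 0)))\<bar> \<le> M * (2 * pi) * h ^ 5"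
      by (simp add: a_def a'_def w_def mult_ac)
  qed (use M h0 in auto)
qed

section \<open>Long-time control of the deviation from X_H\<close>

definition kin :: "real \<Rightarrow> 'a \<times> 'a \<Rightarrow> nat \<Rightarrow> real" where
  "kin h z n = G (qs h z n) (vs h z n - X (qs h z n)) \<bullet> (vs h z n - X (qs h z n))"

text \<open>The drift of the action accumulates over n steps, whereas replacing the action by its
  leading term is done only at the two ends. The error O(h^5) therefore does not grow with n, and k
  is free to be taken large.\<close>

lemma kin_almost_conserved:
  "\<exists>M1 M2 h0. M1 \<ge> 0 \<and> M2 \<ge> 0 \<and> h0 > 0 \<and> (\<forall>h z n. pos h z \<longrightarrow> h < h0 \<longrightarrow>
    pi * h ^ 4 * kin h z n \<le> pi * h ^ 4 * kin h z 0 + M1 * h ^ 5 + real n * (M2 * h ^ Suc k))"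
proof -
  obtain Cj CA where vo: "variational_orbits f \<Omega> K (\<lambda>x. blinfun_apply (J x)) \<theta>0 A bv orb C0 Cj CA S s1 s2 (\<lambda>P. sgh (mid P)) \<Omega>S"
    using orbits by blast
  interpret vo: variational_orbits f \<Omega> K "\<lambda>x. blinfun_apply (J x)" \<theta>0 A bv orb C0 Cj CA S s1 s2 "\<lambda>P. sgh (mid P)" \<Omega>S
    by (rule vo)
  obtain D where D: "\<And>L c c'. window \<theta>0 D L c c' \<Longrightarrow> (\<exists>C h0. C \<ge> 0 \<and> h0 > 0 \<and> (\<forall>h q. orb h q \<longrightarrow> h < h0 \<longrightarrow>
    \<bar>vo.action c c' L h (\<lambda>n. q (Suc n)) - vo.action c c' L h q\<bar> \<le> C * h ^ Suc k))"
    using vo.action_step[of k] by blast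
  \<comment> \<open>One window serves two purposes: degree D for the conservation of the action,
    degree 2 for \<open>Fx\<close> in its leading term.\<close>
  obtain L c c' where win: "window \<theta>0 (max D 2) L c c'" using window_exists[OF nonresonant] by blast
  obtain M2 h2 where M2: "M2 \<ge> 0" "h2 > 0" "\<And>h q. orb h q \<Longrightarrow> h < h2 \<Longrightarrow>
    \<bar>vo.action c c' L h (\<lambda>n. q (Suc n)) - vo.action c c' L h q\<bar> \<le> M2 * h ^ Suc k"
    using D[OF window_mono[OF win max.cobounded1]] by blast
  obtain M h0 where M: "M \<ge> 0" "h0 > 0" "\<And>h z. pos h z \<Longrightarrow> h < h0 \<Longrightarrow>
    \<bar>integral {0..2*pi} (\<lambda>t. s2 (av c L 0 h z t, av c L 1 h z t, h) \<bullet> av c' L 1 h z t) + pi * h ^ 4 * kin h z 0\<bar> \<le> M * h ^ 5"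
    using action_leading[OF win max.cobounded2] unfolding kin_def by blast
  have act: "\<bar>vo.action c c' L h (qs h z) + pi * h ^ 4 * kin h z 0\<bar> \<le> M * h ^ 5" if "pos h z" "h < h0" for h z
    using M(3)[OF that] by (simp add: vo.action_def)
  show ?thesis
  proof (rule exI[of _ "2 * M"], rule exI[of _ M2], rule exI[of _ "min h0 h2"], intro conjI allI impI)
    fix h z n assume p: "pos h z" and "h < min h0 h2"
    then have h: "h < h0" "h < h2" by auto
    have sh: "qs h z = (\<lambda>n. qs h z n)" "qs h ((\<Psi> h ^^ n) z) = (\<lambda>m. qs h z (n + m))" for n
      by (simp_all add: fun_eq_iff qs_shift)
    have drift: "\<bar>vo.action c c' L h (qs h ((\<Psi> h ^^ n) z)) - vo.action c c' L h (qs h z)\<bar> \<le> real n * (M2 * h ^ Suc k)" for n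
    proof (induction n)
      case (Suc n)
      have "orb h (qs h ((\<Psi> h ^^ n) z))" using pos_shift[OF p] unfolding orb_def by blast
      from M2(3)[OF this h(2)]
      have "\<bar>vo.action c c' L h (qs h ((\<Psi> h ^^ Suc n) z)) - vo.action c c' L h (qs h ((\<Psi> h ^^ n) z))\<bar> \<le> M2 * h ^ Suc k"
        unfolding sh(2) by simp
      with Suc show ?case by (simp add: distrib_right)
    qed simp
    have k0: "kin h ((\<Psi> h ^^ n) z) 0 = kin h z n" by (simp add: kin_def qs_shift)
    have "\<bar>vo.action c c' L h (qs h ((\<Psi> h ^^ n) z)) + pi * h ^ 4 * kin h z n\<bar> \<le> M * h ^ 5"
      using act[OF pos_shift[OF p, of n] h(1)] unfolding k0 .
    with act[OF p h(1)] drift[of n]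
    show "pi * h ^ 4 * kin h z n \<le> pi * h ^ 4 * kin h z 0 + 2 * M * h ^ 5 + real n * (M2 * h ^ Suc k)"
      by linarith
  qed (use M M2 in auto)
qed

lemma metric_norm_kin:
  assumes "pos h z"
  shows "metric_norm (compat_metric \<theta> J) (qs h z n) (vs h z n - X (qs h z n)) = sqrt (kin h z n)"
  using qs_K[OF assms, of n] K_Q by (simp add: metric_norm_def kin_def G_inner subset_iff)

text \<open>V1 is fixed before kstar; the constant in the bound for kstar only decides how small h
  has to be.\<close>

lemma long_time_bound:
  assumes "N > 0" "V0 > 0"
  shows "\<exists>V1>0. \<forall>kstar :: real \<Rightarrow> nat.
       (\<lambda>h. real (kstar h)) \<in> O[at_right 0](\<lambda>h. h powr (- N)) \<longrightarrow>
       (\<forall>\<^sub>F h in at_right 0. \<forall>z. pos h z \<longrightarrow> sqrt (kin h z 0) < V0 * sqrt h \<longrightarrow>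
          (\<forall>k \<le> kstar h. sqrt (kin h z k) \<le> V1 * sqrt h))"
proof -
  \<comment> \<open>Over O(h^-N) steps the drift is O(h^(k+1-N)), hence O(h^6). This is one power of
    h better than the error of the leading term, and the spare power absorbs the constants.\<close>
  define k where "k = nat \<lceil>N\<rceil> + 5"
  obtain M1 M2 h0 where M: "M1 \<ge> 0" "M2 \<ge> 0" "h0 > 0" "\<And>h z n. pos h z \<Longrightarrow> h < h0 \<Longrightarrow>
    pi * h ^ 4 * kin h z n \<le> pi * h ^ 4 * kin h z 0 + M1 * h ^ 5 + real n * (M2 * h ^ Suc k)"
    using kin_almost_conserved[of k] by blast
  \<comment> \<open>A bound for kin / h: V0^2 comes from the initial point, M1 from the error of the
    leading term at both ends, and 1 from the accumulated drift.\<close>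
  define V where "V = V0\<^sup>2 + (M1 + 1) / pi"
  have V: "V > 0" using assms(2) M(1) by (simp add: V_def add_pos_nonneg)
  show ?thesis
  proof (rule exI[of _ "sqrt V"], intro conjI allI impI)
    show "0 < sqrt V" using V by simp
    fix kstar :: "real \<Rightarrow> nat"
    assume "(\<lambda>h. real (kstar h)) \<in> O[at_right 0](\<lambda>h. h powr (- N))"
    then obtain c where c: "c > 0" "\<forall>\<^sub>F h in at_right 0. norm (real (kstar h)) \<le> c * norm (h powr (- N))"
      by (elim landau_o.bigE)
    have "\<forall>\<^sub>F h in at_right 0. h < min (min h0 1) (1 / (c * M2 + 1))"
      using M(2,3) c(1) by (intro eventually_at_right_less[THEN eventually_mono] order_tendstoD(2)[OF tendsto_ident_at])
        (auto intro!: add_nonneg_pos)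
    with c(2) show "\<forall>\<^sub>F h in at_right 0. \<forall>z. pos h z \<longrightarrow> sqrt (kin h z 0) < V0 * sqrt h \<longrightarrow>
          (\<forall>k \<le> kstar h. sqrt (kin h z k) \<le> sqrt V * sqrt h)"
    proof eventually_elim
      case (elim h)
      show ?case
      proof (intro allI impI)
        fix z n assume p: "pos h z" and init: "sqrt (kin h z 0) < V0 * sqrt h" and n: "n \<le> kstar h"
        have h: "h > 0" "h < h0" "h < 1" "h < 1 / (c * M2 + 1)" using p elim by (auto simp: pos_def)
        have cM: "c * M2 + 1 > 0" using c(1) M(2) by (auto intro!: add_nonneg_pos)
        have "kin h z 0 < V0\<^sup>2 * h"
        proof -
          have "kin h z 0 \<ge> 0" unfolding kin_def using qs_K[OF p, of 0] K_Q by (intro G_nonneg) auto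
          then have "kin h z 0 = (sqrt (kin h z 0))\<^sup>2" by simp
          also have "\<dots> < (V0 * sqrt h)\<^sup>2" using init \<open>kin h z 0 \<ge> 0\<close> by (intro power_strict_mono) auto
          also have "\<dots> = V0\<^sup>2 * h" using h(1) by (simp add: power_mult_distrib)
          finally show ?thesis .
        qed
        then have k0: "pi * h ^ 4 * kin h z 0 \<le> pi * h ^ 4 * (V0\<^sup>2 * h)"
          using h(1) by (intro mult_left_mono) auto
        have "real n * h ^ Suc k \<le> c * h ^ 6"
        proof -
          have "real n \<le> c * h powr (- N)" using elim(1) n h(1) by simp
          then have "real n * h ^ Suc k \<le> c * h powr (- N) * h ^ Suc k" using h(1) by (intro mult_right_mono) auto
          also have "c * h powr (- N) * h ^ Suc k = c * h powr (- N) * (h powr real (nat \<lceil>N\<rceil>) * h ^ 6)"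
            using h(1) by (simp add: powr_realpow k_def power_add eval_nat_numeral mult_ac)
          also have "c * h powr (- N) * (h powr real (nat \<lceil>N\<rceil>) * h ^ 6) = c * h powr (real (nat \<lceil>N\<rceil>) - N) * h ^ 6"
            using h(1) by (simp add: powr_diff powr_minus field_simps)
          also have "\<dots> \<le> c * 1 * h ^ 6"
          proof (intro mult_right_mono mult_left_mono)
            have "real (nat \<lceil>N\<rceil>) - N \<ge> 0" using real_nat_ceiling_ge[of N] by simp
            then have "h powr (real (nat \<lceil>N\<rceil>) - N) \<le> 1 powr (real (nat \<lceil>N\<rceil>) - N)" using h by (intro powr_mono2) auto
            then show "h powr (real (nat \<lceil>N\<rceil>) - N) \<le> 1" by simp
          qed (use c h in auto)
          finally show ?thesis by (simp only: mult_1_right)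
        qed
        then have "M2 * (real n * h ^ Suc k) \<le> M2 * (c * h ^ 6)" using M(2) by (rule mult_left_mono)
        also have "\<dots> = (c * M2 * h) * h ^ 5" by (simp add: eval_nat_numeral)
        also have "\<dots> \<le> 1 * h ^ 5"
        proof (rule mult_right_mono)
          have "c * M2 * h \<le> (c * M2 + 1) * h" using h(1) by (intro mult_right_mono) auto
          also have "\<dots> \<le> 1" using h(4) cM by (simp add: field_simps)
          finally show "c * M2 * h \<le> 1" .
        qed (use h in simp)
        finally have drift: "real n * (M2 * h ^ Suc k) \<le> h ^ 5" by (simp add: mult_ac)
        have "pi * h ^ 4 * kin h z n \<le> pi * h ^ 4 * (V0\<^sup>2 * h) + M1 * h ^ 5 + h ^ 5"
          using M(4)[OF p h(2), of n] k0 drift by linarith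
        also have "\<dots> = pi * h ^ 4 * (V * h)"
          by (simp add: V_def field_simps eval_nat_numeral)
        finally have "kin h z n \<le> V * h" using h(1) by (simp add: mult_le_cancel_left_pos)
        then have "sqrt (kin h z n) \<le> sqrt (V * h)" by (rule real_sqrt_le_mono)
        then show "sqrt (kin h z n) \<le> sqrt V * sqrt h" by (simp add: real_sqrt_mult)
      qed
    qed
  qed
qed

end

theorem proposition8:
  fixes Q :: "'a::euclidean_space set"
    and \<theta> :: "'a \<Rightarrow> ('a \<Rightarrow>\<^sub>L real)"
    and J :: "'a \<Rightarrow> ('a \<Rightarrow>\<^sub>L 'a)"
    and H :: "'a \<Rightarrow> real"
    and \<theta>0 :: real
    and U :: "('a \<times> 'a \<times> real) set"
    and \<Psi> :: "real \<Rightarrow> 'a \<times> 'a \<Rightarrow> 'a \<times> 'a"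
    and C :: "('a \<times> 'a) set"
  assumes "open Q" and "connected Q"
    and "smooth_on Q \<theta>" and "symplectic_on Q (symp_form \<theta>)"
    and "smooth_on Q H"
    and "almost_complex_on Q J" and "riemannian_on Q (compat_metric \<theta> J)"
    and "\<theta>0 / (2 * pi) \<notin> \<rat>"
    and "symplectic_lorentz_map Q \<theta> J H \<theta>0 U \<Psi>"
    and "compact C" and "C \<subseteq> Q \<times> UNIV"
  shows "\<forall>N::real. \<forall>V0::real. N > 0 \<longrightarrow> V0 > 0 \<longrightarrow>
    (\<exists>V1>0. \<forall>kstar :: real \<Rightarrow> nat.
       (\<lambda>h. real (kstar h)) \<in> \<Theta>[at_right 0](\<lambda>h. h powr (- N)) \<longrightarrow>
       (\<forall>\<^sub>F h in at_right 0. \<forall>(q, v) \<in> C.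
          positively_contained (\<Psi> h) C (q, v) \<longrightarrow>
          metric_norm (compat_metric \<theta> J) q (v - ham_vec \<theta> H q) < V0 * sqrt h \<longrightarrow>
          (\<forall>k \<le> kstar h. \<forall>qk vk. (qk, vk) = (\<Psi> h ^^ k) (q, v) \<longrightarrow>
             metric_norm (compat_metric \<theta> J) qk (vk - ham_vec \<theta> H qk) \<le> V1 * sqrt h)))"
proof (intro allI impI)
  interpret lorentz_map Q \<theta> J H \<theta>0 U \<Psi> C
    by unfold_locales (use assms nonres_irrational in auto)
  fix N V0 :: real assume "N > 0" "V0 > 0"
  then obtain V1 where V1: "V1 > 0" "\<And>kstar :: real \<Rightarrow> nat.
       (\<lambda>h. real (kstar h)) \<in> O[at_right 0](\<lambda>h. h powr (- N)) \<Longrightarrow>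
       (\<forall>\<^sub>F h in at_right 0. \<forall>z. pos h z \<longrightarrow> sqrt (kin h z 0) < V0 * sqrt h \<longrightarrow>
          (\<forall>k \<le> kstar h. sqrt (kin h z k) \<le> V1 * sqrt h))"
    using long_time_bound by blast
  show "\<exists>V1>0. \<forall>kstar :: real \<Rightarrow> nat.
       (\<lambda>h. real (kstar h)) \<in> \<Theta>[at_right 0](\<lambda>h. h powr (- N)) \<longrightarrow>
       (\<forall>\<^sub>F h in at_right 0. \<forall>(q, v) \<in> C.
          positively_contained (\<Psi> h) C (q, v) \<longrightarrow>
          metric_norm (compat_metric \<theta> J) q (v - ham_vec \<theta> H q) < V0 * sqrt h \<longrightarrow>
          (\<forall>k \<le> kstar h. \<forall>qk vk. (qk, vk) = (\<Psi> h ^^ k) (q, v) \<longrightarrow>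
             metric_norm (compat_metric \<theta> J) qk (vk - ham_vec \<theta> H qk) \<le> V1 * sqrt h))"
  proof (rule exI[of _ V1], intro conjI allI impI V1(1))
    fix kstar :: "real \<Rightarrow> nat"
    assume "(\<lambda>h. real (kstar h)) \<in> \<Theta>[at_right 0](\<lambda>h. h powr (- N))"
    then have "(\<lambda>h. real (kstar h)) \<in> O[at_right 0](\<lambda>h. h powr (- N))" by (rule bigthetaD1)
    from V1(2)[OF this] have bound: "\<forall>\<^sub>F h in at_right 0. \<forall>z. pos h z \<longrightarrow> sqrt (kin h z 0) < V0 * sqrt h \<longrightarrow>
        (\<forall>k \<le> kstar h. sqrt (kin h z k) \<le> V1 * sqrt h)" .
    have "\<forall>\<^sub>F h in at_right 0. 0 < h \<and> h < h1"
      unfolding eventually_at_right_field using C0_h1(2) by blast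
    with bound show "\<forall>\<^sub>F h in at_right 0. \<forall>(q, v) \<in> C.
          positively_contained (\<Psi> h) C (q, v) \<longrightarrow>
          metric_norm (compat_metric \<theta> J) q (v - ham_vec \<theta> H q) < V0 * sqrt h \<longrightarrow>
          (\<forall>k \<le> kstar h. \<forall>qk vk. (qk, vk) = (\<Psi> h ^^ k) (q, v) \<longrightarrow>
             metric_norm (compat_metric \<theta> J) qk (vk - ham_vec \<theta> H qk) \<le> V1 * sqrt h)"
    proof eventually_elim
      case (elim h)
      have "metric_norm (compat_metric \<theta> J) qk (vk - ham_vec \<theta> H qk) \<le> V1 * sqrt h"
        if pc: "positively_contained (\<Psi> h) C (q, v)"
          and init: "metric_norm (compat_metric \<theta> J) q (v - ham_vec \<theta> H q) < V0 * sqrt h"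
          and k: "k \<le> kstar h" and qk: "(qk, vk) = (\<Psi> h ^^ k) (q, v)" for q v k qk vk
      proof -
        have p: "pos h (q, v)" using elim(2) pc by (simp add: pos_def)
        have "sqrt (kin h (q, v) 0) < V0 * sqrt h"
          using init metric_norm_kin[OF p, of 0] by (simp add: qs_def vs_def)
        then have "sqrt (kin h (q, v) k) \<le> V1 * sqrt h" using elim(1) p k by blast
        then show "metric_norm (compat_metric \<theta> J) qk (vk - ham_vec \<theta> H qk) \<le> V1 * sqrt h"
          using metric_norm_kin[OF p, of k] by (simp add: qs_def vs_def qk[symmetric])
      qed
      then show ?case by blast
    qed
  qed
qed

end
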